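(* Let $\mathcal{E}\xrightarrow{\gamma}\mathrm{Set}$ be a Grothendieck topos. Given a cover $U\to\gamma^*I$ in $\mathcal{E}$ and a self-dual simplicial hypercover refinement $H_\bullet\to\gamma^*(S_\bullet)$ of its Čech simplicial family satisfying condition G, the category of covering projections trivialized by a consistent $S_\bullet$-descent datum $\{s_\ell\}_{\ell\in S_1}$ on a family of sets $R\to I$ is isomorphic to the category (topos) of left actions of the G-fundamental groupoid of the family $H_\bullet\to\gamma^*(S_\bullet)$.
   Context: $\gamma^*:\mathrm{Set}\to\mathcal{E}$ is the inverse image functor. A family $U\xrightarrow{\zeta}\gamma^*I$ is the same as $\{U_i\}_{i\in I}$, $U=\sum_iU_i$, with all $U_i$ non-empty (not initial); it is a cover if $U\to1$ is epimorphic. Simplicial families. A simplicial family $H_\bullet\to\gamma^*(S_\bullet)$ consists of a simplicial object $H_\bullet$ in $\mathcal{E}$ (faces $d_i$, degeneracies $s_i$), a simplicial set $S_\bullet$ (faces $\partial_i$, degeneracies $\sigma_i$) and a morphism of simplicial objects $H_\bullet\to\gamma^*(S_\bullet)$; $H_n=\sum_{w\in S_n}(H_n)_w$ with $(d_i)_w:(H_n)_w\to(H_{n-1})_{\partial_i(w)}$, $(s_i)_w:(H_{n-1})_w\to(H_n)_{\sigma_i(w)}$, all components non-empty. For $\ell\in S_1$, $i\xrightarrow{\ell}j$ means $i=\partial_1(\ell)$, $j=\partial_0(\ell)$. A strict duality on a simplicial object is a family of isomorphisms $\tau_n$ with $\tau_0=\mathrm{id}$, $d_i\tau_n=\tau_{n-1}d_{n-i}$,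 $s_i\tau_{n-1}=\tau_ns_{n-1-i}$; a simplicial family is self-dual if $H_\bullet$ and $S_\bullet$ carry strict dualities $\tau$ compatible with $H_\bullet\to\gamma^*S_\bullet$; write $w^{op}=\tau_n(w)$, so $(\tau_n)_w:(H_n)_w\to(H_n)_{w^{op}}$. Čech family: $N_n=\{(i_0,\dots,i_n)\in I^{n+1}\mid U_{i_0}\times\cdots\times U_{i_n}\ne\emptyset\}$, $U_n=U^{n+1}$, with projections as faces ($\partial_1(i,j)=i$, $\partial_0(i,j)=j$), diagonals as degeneracies, and duality reversing the order. A simplicial family with $S_0=I$, $H_0=U$ (same structure map $\zeta$) has a canonical morphism $(h_\bullet,\alpha_\bullet)$ to the Čech family given by the vertices, e.g. $(h_1)_\ell=((d_1)_\ell,(d_0)_\ell)$; it is a hypercover refinement if the maps $H_k\to(\mathrm{cosk}_{k-1}H_\bullet)_k$ are epimorphisms for all $k\ge1$. Condition G: for every $\ell\in S_1$, with $i=\partial_1(\ell)$, there exists $w\in S_2$ with $\partial_2(w)=\ell$, $\partial_0(w)=\ell^{op}$ and $(d_1)_{\partial_1(w)}=(d_0)_{\partial_1(w)}$. A morphism of spans from $i\xrightarrow{\ell}j$ to $i\xrightarrow{t}j$ is an arrow $f:(H_1)_\ell\to(H_1)_t$ with $(d_1)_tf=(d_1)_\ell$ and $(d_0)_tf=(d_0)_\ell$. G-fundamental groupoid: objects are the elements of $S_0$; premorphisms $i\to j$ are sequences $(\ell_n\cdots\ell_1)$, $n\ge1$, $\ell_k\in S_1$, with $\partial_1(\ell_1)=i$,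 $\partial_1(\ell_{k+1})=\partial_0(\ell_k)$, $\partial_0(\ell_n)=j$, composed by concatenation; morphisms are classes of premorphisms under the smallest equivalence relation compatible with composition such that $\partial_1(w)\sim(\partial_0(w)\,\partial_2(w))$ for all $w\in S_2$, and $\ell\sim t$ whenever there is a morphism of spans from $\ell$ to $t$; the class of $\sigma_0(i)$ is the identity of $i$. (Under condition G this is a groupoid.) Its left actions are the covariant set-valued functors on it, with natural transformations as morphisms. $S_\bullet$-descent datum on a family of sets $R\to I=S_0$: bijections $s_\ell:R_i\to R_j$ for each $i\xrightarrow{\ell}j$ in $S_1$, with $s_{\sigma_0(i)}=\mathrm{id}_{R_i}$ and $s_{\partial_1(w)}=s_{\partial_0(w)}\circ s_{\partial_2(w)}$ for $w\in S_2$. It is consistent if $s_\ell=s_t$ whenever there is a morphism of spans from $\ell$ to $t$. Covering projection determined by $\{s_\ell\}$: a locally constant object trivialized by $U\to\gamma^*I$ is an object $X$ with sets $\{R_i\}_{i\in I}$ and isomorphisms $\theta_i:\gamma^*R_i\times U_i\to X\times U_i$ over $U_i$; it is equivalently given, by descent, by isomorphisms $\sigma_{j,i}:\gamma^*R_i\times U_i\times U_j\to\gamma^*R_j\times U_j\times U_i$, $(i,j)\in N_1$, over the symmetry $\tau$, satisfying the usual identity and cocycle conditions, via $(\theta_j\times U_i)\circ\sigma_{j,i}=(X\times\tau)\circ(\theta_i\times U_j)$. It is a covering projection if for each $(i,j)\in N_1$ the maps $(u,v):V\to U_i\times U_j$ form an epimorphic family, where $V\neq\emptyset$ and $(V,u,v)$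 ranges over the action spans, i.e. those for which there is a bijection $s:R_i\to R_j$ with $\sigma_{j,i}\circ(\gamma^*R_i\times(u,v))=(\gamma^*R_j\times(v,u))\circ(\gamma^*s\times V)$. A consistent $S_\bullet$-descent datum $\{s_\ell\}$ determines the covering projection $X$ whose datum $\sigma_{j,i}$ is the unique one with $\sigma_{j,i}\circ(\gamma^*R_i\times(h_1)_\ell)=(\gamma^*R_j\times(h_1)_{\ell^{op}})\circ(\gamma^*(s_\ell)\times(\tau_1)_\ell)$ for all $i\xrightarrow{\ell}j$. The category of covering projections trivialized by a consistent $S_\bullet$-descent datum has as objects the covering projections so constructed together with their datum $(R\to I,\{s_\ell\})$, and as morphisms $(R,s)\to(R',s')$ the families of functions $f_i:R_i\to R'_i$, $i\in I$, with $f_j\circ s_\ell=s'_\ell\circ f_i$ for all $i\xrightarrow{\ell}j$ in $S_1$. *)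

theory Defs
  imports "HOL-Library.FuncSet"
begin

section \<open>Categories, functors, limits\<close>

record ('o, 'a) cat =
  Obj :: "'o set"
  Arr :: "'a set"
  Dom :: "'a \<Rightarrow> 'o"
  Cod :: "'a \<Rightarrow> 'o"
  Id :: "'o \<Rightarrow> 'a"
  Comp :: "'a \<Rightarrow> 'a \<Rightarrow> 'a"  (infixl "\<cdot>\<index>" 70)

definition hom :: "('o, 'a) cat \<Rightarrow> 'o \<Rightarrow> 'o \<Rightarrow> 'a set" where
  "hom C A B = {f \<in> Arr C. Dom C f = A \<and> Cod C f = B}"

definition category :: "('o, 'a) cat \<Rightarrow> bool" where
  "category C \<longleftrightarrow>
     (\<forall>f\<in>Arr C. Dom C f \<in> Obj C \<and> Cod C f \<in> Obj C) \<and>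
     (\<forall>A\<in>Obj C. Id C A \<in> hom C A A) \<and>
     (\<forall>f\<in>Arr C. \<forall>g\<in>Arr C. Dom C g = Cod C f \<longrightarrow> g \<cdot>\<^bsub>C\<^esub> f \<in> hom C (Dom C f) (Cod C g)) \<and>
     (\<forall>f\<in>Arr C. f \<cdot>\<^bsub>C\<^esub> Id C (Dom C f) = f \<and> Id C (Cod C f) \<cdot>\<^bsub>C\<^esub> f = f) \<and>
     (\<forall>f\<in>Arr C. \<forall>g\<in>Arr C. \<forall>h\<in>Arr C. Dom C g = Cod C f \<longrightarrow> Dom C h = Cod C g \<longrightarrow>
        h \<cdot>\<^bsub>C\<^esub> (g \<cdot>\<^bsub>C\<^esub> f) = (h \<cdot>\<^bsub>C\<^esub> g) \<cdot>\<^bsub>C\<^esub> f)"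

definition op_cat :: "('o, 'a) cat \<Rightarrow> ('o, 'a) cat" where
  "op_cat C = \<lparr>Obj = Obj C, Arr = Arr C, Dom = Cod C, Cod = Dom C, Id = Id C,
               Comp = (\<lambda>g f. f \<cdot>\<^bsub>C\<^esub> g)\<rparr>"

definition full_subcat :: "('o, 'a) cat \<Rightarrow> 'o set \<Rightarrow> ('o, 'a) cat" where
  "full_subcat C P = C\<lparr>Obj := Obj C \<inter> P, Arr := {f \<in> Arr C. Dom C f \<in> P \<and> Cod C f \<in> P}\<rparr>"

definition is_iso :: "('o, 'a) cat \<Rightarrow> 'a \<Rightarrow> bool" where
  "is_iso C f \<longleftrightarrow> f \<in> Arr C \<and>
     (\<exists>g\<in>hom C (Cod C f) (Dom C f). g \<cdot>\<^bsub>C\<^esub> f = Id C (Dom C f) \<and> f \<cdot>\<^bsub>C\<^esub> g = Id C (Cod C f))"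

definition is_epi :: "('o, 'a) cat \<Rightarrow> 'a \<Rightarrow> bool" where
  "is_epi C e \<longleftrightarrow> e \<in> Arr C \<and>
     (\<forall>Z. \<forall>f\<in>hom C (Cod C e) Z. \<forall>g\<in>hom C (Cod C e) Z. f \<cdot>\<^bsub>C\<^esub> e = g \<cdot>\<^bsub>C\<^esub> e \<longrightarrow> f = g)"

definition epimorphic_family :: "('o, 'a) cat \<Rightarrow> 'o \<Rightarrow> 'a set \<Rightarrow> bool" where
  "epimorphic_family C B K \<longleftrightarrow> (\<forall>k\<in>K. k \<in> Arr C \<and> Cod C k = B) \<and>
     (\<forall>Z. \<forall>f\<in>hom C B Z. \<forall>g\<in>hom C B Z. (\<forall>k\<in>K. f \<cdot>\<^bsub>C\<^esub> k = g \<cdot>\<^bsub>C\<^esub> k) \<longrightarrow> f = g)"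

definition is_terminal :: "('o, 'a) cat \<Rightarrow> 'o \<Rightarrow> bool" where
  "is_terminal C T \<longleftrightarrow> T \<in> Obj C \<and> (\<forall>A\<in>Obj C. \<exists>!f. f \<in> hom C A T)"

definition is_initial :: "('o, 'a) cat \<Rightarrow> 'o \<Rightarrow> bool" where
  "is_initial C Z \<longleftrightarrow> Z \<in> Obj C \<and> (\<forall>A\<in>Obj C. \<exists>!f. f \<in> hom C Z A)"

definition is_product :: "('o, 'a) cat \<Rightarrow> 'o \<Rightarrow> 'o \<Rightarrow> 'a \<Rightarrow> 'a \<Rightarrow> bool" where
  "is_product C A B p q \<longleftrightarrow>
     p \<in> hom C (Dom C p) A \<and> q \<in> hom C (Dom C p) B \<and>
     (\<forall>T. \<forall>f\<in>hom C T A. \<forall>g\<in>hom C T B.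
        \<exists>!h. h \<in> hom C T (Dom C p) \<and> p \<cdot>\<^bsub>C\<^esub> h = f \<and> q \<cdot>\<^bsub>C\<^esub> h = g)"

definition is_pullback :: "('o, 'a) cat \<Rightarrow> 'a \<Rightarrow> 'a \<Rightarrow> 'a \<Rightarrow> 'a \<Rightarrow> bool" where
  "is_pullback C p q f g \<longleftrightarrow>
     f \<in> Arr C \<and> g \<in> Arr C \<and> Cod C f = Cod C g \<and>
     p \<in> hom C (Dom C p) (Dom C f) \<and> q \<in> hom C (Dom C p) (Dom C g) \<and> f \<cdot>\<^bsub>C\<^esub> p = g \<cdot>\<^bsub>C\<^esub> q \<and>
     (\<forall>T. \<forall>a\<in>hom C T (Dom C f). \<forall>b\<in>hom C T (Dom C g). f \<cdot>\<^bsub>C\<^esub> a = g \<cdot>\<^bsub>C\<^esub> b \<longrightarrow>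
        (\<exists>!h. h \<in> hom C T (Dom C p) \<and> p \<cdot>\<^bsub>C\<^esub> h = a \<and> q \<cdot>\<^bsub>C\<^esub> h = b))"

text \<open>Chosen limits. They are only applied in categories where these limits exist.\<close>

definition one :: "('o, 'a) cat \<Rightarrow> 'o" where
  "one C = (SOME T. is_terminal C T)"

definition bang :: "('o, 'a) cat \<Rightarrow> 'o \<Rightarrow> 'a" where
  "bang C A = (THE f. f \<in> hom C A (one C))"

definition projs :: "('o, 'a) cat \<Rightarrow> 'o \<Rightarrow> 'o \<Rightarrow> 'a \<times> 'a" where
  "projs C A B = (SOME pq. is_product C A B (fst pq) (snd pq))"

definition pr1 :: "('o, 'a) cat \<Rightarrow> 'o \<Rightarrow> 'o \<Rightarrow> 'a" where
  "pr1 C A B = fst (projs C A B)"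

definition pr2 :: "('o, 'a) cat \<Rightarrow> 'o \<Rightarrow> 'o \<Rightarrow> 'a" where
  "pr2 C A B = snd (projs C A B)"

definition Prod :: "('o, 'a) cat \<Rightarrow> 'o \<Rightarrow> 'o \<Rightarrow> 'o" where
  "Prod C A B = Dom C (pr1 C A B)"

definition pairing :: "('o, 'a) cat \<Rightarrow> 'a \<Rightarrow> 'a \<Rightarrow> 'a" where
  "pairing C f g = (THE h. h \<in> hom C (Dom C f) (Prod C (Cod C f) (Cod C g)) \<and>
      pr1 C (Cod C f) (Cod C g) \<cdot>\<^bsub>C\<^esub> h = f \<and> pr2 C (Cod C f) (Cod C g) \<cdot>\<^bsub>C\<^esub> h = g)"

definition prod_map :: "('o, 'a) cat \<Rightarrow> 'a \<Rightarrow> 'a \<Rightarrow> 'a" where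
  "prod_map C f g = pairing C (f \<cdot>\<^bsub>C\<^esub> pr1 C (Dom C f) (Dom C g)) (g \<cdot>\<^bsub>C\<^esub> pr2 C (Dom C f) (Dom C g))"

definition symm :: "('o, 'a) cat \<Rightarrow> 'o \<Rightarrow> 'o \<Rightarrow> 'a" where
  "symm C A B = pairing C (pr2 C A B) (pr1 C A B)"

definition assoc_right :: "('o, 'a) cat \<Rightarrow> 'o \<Rightarrow> 'o \<Rightarrow> 'o \<Rightarrow> 'a" where
  \<comment> \<open>the canonical isomorphism from (A x B) x D to A x (B x D)\<close>
  "assoc_right C A B D =
     pairing C (pr1 C A B \<cdot>\<^bsub>C\<^esub> pr1 C (Prod C A B) D)
               (pairing C (pr2 C A B \<cdot>\<^bsub>C\<^esub> pr1 C (Prod C A B) D) (pr2 C (Prod C A B) D))"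

definition assoc_left :: "('o, 'a) cat \<Rightarrow> 'o \<Rightarrow> 'o \<Rightarrow> 'o \<Rightarrow> 'a" where
  "assoc_left C A B D =
     pairing C (pairing C (pr1 C A (Prod C B D)) (pr1 C B D \<cdot>\<^bsub>C\<^esub> pr2 C A (Prod C B D)))
               (pr2 C B D \<cdot>\<^bsub>C\<^esub> pr2 C A (Prod C B D))"

record ('o, 'a, 'p, 'b) fctr =
  FO :: "'o \<Rightarrow> 'p"
  FA :: "'a \<Rightarrow> 'b"

definition is_functor :: "('o, 'a) cat \<Rightarrow> ('p, 'b) cat \<Rightarrow> ('o, 'a, 'p, 'b) fctr \<Rightarrow> bool" where
  "is_functor C D F \<longleftrightarrow> category C \<and> category D \<and>
     (\<forall>A\<in>Obj C. FO F A \<in> Obj D \<and> FA F (Id C A) = Id D (FO F A)) \<and>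
     (\<forall>f\<in>Arr C. FA F f \<in> hom D (FO F (Dom C f)) (FO F (Cod C f))) \<and>
     (\<forall>f\<in>Arr C. \<forall>g\<in>Arr C. Dom C g = Cod C f \<longrightarrow> FA F (g \<cdot>\<^bsub>C\<^esub> f) = FA F g \<cdot>\<^bsub>D\<^esub> FA F f)"

definition isomorphic_categories :: "('o, 'a) cat \<Rightarrow> ('p, 'b) cat \<Rightarrow> bool" where
  "isomorphic_categories C D \<longleftrightarrow>
     (\<exists>F. is_functor C D F \<and> bij_betw (FO F) (Obj C) (Obj D) \<and> bij_betw (FA F) (Arr C) (Arr D))"

definition equivalent_categories :: "('o, 'a) cat \<Rightarrow> ('p, 'b) cat \<Rightarrow> bool" where
  "equivalent_categories C D \<longleftrightarrow>
     (\<exists>F. is_functor C D F \<and>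
        (\<forall>A\<in>Obj C. \<forall>B\<in>Obj C. bij_betw (FA F) (hom C A B) (hom D (FO F A) (FO F B))) \<and>
        (\<forall>Y\<in>Obj D. \<exists>A\<in>Obj C. \<exists>f\<in>hom D (FO F A) Y. is_iso D f))"

text \<open>Objects of the functor category are required to be undefined outside the domain category,
  so that equality of objects is equality of functors.\<close>

definition functor_cat ::
  "('o, 'a) cat \<Rightarrow> ('p, 'b) cat \<Rightarrow>
   (('o, 'a, 'p, 'b) fctr, ('o, 'a, 'p, 'b) fctr \<times> ('o \<Rightarrow> 'b) \<times> ('o, 'a, 'p, 'b) fctr) cat" where
  "functor_cat C D = (let Fun = {F. is_functor C D F \<and> FO F \<in> extensional (Obj C) \<and> FA F \<in> extensional (Arr C)} in
     \<lparr>Obj = Fun,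
      Arr = {(F, t, G). F \<in> Fun \<and> G \<in> Fun \<and> t \<in> extensional (Obj C) \<and>
               (\<forall>A\<in>Obj C. t A \<in> hom D (FO F A) (FO G A)) \<and>
               (\<forall>f\<in>Arr C. t (Cod C f) \<cdot>\<^bsub>D\<^esub> FA F f = FA G f \<cdot>\<^bsub>D\<^esub> t (Dom C f))},
      Dom = (\<lambda>(F, t, G). F),
      Cod = (\<lambda>(F, t, G). G),
      Id = (\<lambda>F. (F, (\<lambda>A\<in>Obj C. Id D (FO F A)), F)),
      Comp = (\<lambda>(G, u, K) (F, t, G'). (F, (\<lambda>A\<in>Obj C. u A \<cdot>\<^bsub>D\<^esub> t A), K))\<rparr>)"

section \<open>The category of sets\<close>

text \<open>A Grothendieck universe, presented as a type whose elements are the (small) sets, with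
  extension map el. The axiom of infinity is not imposed; a universe
  with infinite sets is a special case.\<close>

definition universe :: "('v \<Rightarrow> 'v set) \<Rightarrow> bool" where
  "universe el \<longleftrightarrow> inj el \<and>
     (\<forall>x A. A \<subseteq> el x \<longrightarrow> A \<in> range el) \<and>
     (\<forall>x y. {x, y} \<in> range el) \<and>
     (\<forall>x. {z. el z \<subseteq> el x} \<in> range el) \<and>
     (\<forall>x f. (\<Union>z\<in>el x. el (f z)) \<in> range el)"

type_synonym 'v sarr = "'v \<times> ('v \<Rightarrow> 'v) \<times> 'v"

definition app :: "'v sarr \<Rightarrow> 'v \<Rightarrow> 'v" where
  "app a = fst (snd a)"

definition set_cat :: "('v \<Rightarrow> 'v set) \<Rightarrow> ('v, 'v sarr) cat" where
  "set_cat el =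
     \<lparr>Obj = UNIV,
      Arr = {(A, f, B). f \<in> el A \<rightarrow>\<^sub>E el B},
      Dom = (\<lambda>(A, f, B). A),
      Cod = (\<lambda>(A, f, B). B),
      Id = (\<lambda>A. (A, (\<lambda>x\<in>el A. x), A)),
      Comp = (\<lambda>(B, g, D) (A, f, B'). (A, compose (el A) g f, D))\<rparr>"

section \<open>Grothendieck topoi and geometric morphisms\<close>

definition sieve :: "('o, 'a) cat \<Rightarrow> 'o \<Rightarrow> 'a set \<Rightarrow> bool" where
  "sieve C c S \<longleftrightarrow> S \<subseteq> {f \<in> Arr C. Cod C f = c} \<and>
     (\<forall>f\<in>S. \<forall>g\<in>Arr C. Cod C g = Dom C f \<longrightarrow> f \<cdot>\<^bsub>C\<^esub> g \<in> S)"

definition pull_sieve :: "('o, 'a) cat \<Rightarrow> 'a \<Rightarrow> 'a set \<Rightarrow> 'a set" where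
  "pull_sieve C h S = {g \<in> Arr C. Cod C g = Dom C h \<and> h \<cdot>\<^bsub>C\<^esub> g \<in> S}"

definition grothendieck_topology :: "('o, 'a) cat \<Rightarrow> ('o \<Rightarrow> 'a set set) \<Rightarrow> bool" where
  "grothendieck_topology C J \<longleftrightarrow>
     (\<forall>c\<in>Obj C. \<forall>S\<in>J c. sieve C c S) \<and>
     (\<forall>c\<in>Obj C. {f \<in> Arr C. Cod C f = c} \<in> J c) \<and>
     (\<forall>h\<in>Arr C. \<forall>S\<in>J (Cod C h). pull_sieve C h S \<in> J (Dom C h)) \<and>
     (\<forall>c\<in>Obj C. \<forall>S\<in>J c. \<forall>R. sieve C c R \<longrightarrow> (\<forall>h\<in>S. pull_sieve C h R \<in> J (Dom C h)) \<longrightarrow> R \<in> J c)"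

definition is_sheaf ::
  "('v \<Rightarrow> 'v set) \<Rightarrow> ('o, 'a) cat \<Rightarrow> ('o \<Rightarrow> 'a set set) \<Rightarrow> ('o, 'a, 'v, 'v sarr) fctr \<Rightarrow> bool" where
  "is_sheaf el C J P \<longleftrightarrow>
     (\<forall>c\<in>Obj C. \<forall>S\<in>J c. \<forall>x.
        (\<forall>f\<in>S. x f \<in> el (FO P (Dom C f))) \<and>
        (\<forall>f\<in>S. \<forall>g\<in>Arr C. Cod C g = Dom C f \<longrightarrow> app (FA P g) (x f) = x (f \<cdot>\<^bsub>C\<^esub> g)) \<longrightarrow>
        (\<exists>!y. y \<in> el (FO P c) \<and> (\<forall>f\<in>S. app (FA P f) y = x f)))"

definition sheaf_cat where
  "sheaf_cat el C J = full_subcat (functor_cat (op_cat C) (set_cat el)) {P. is_sheaf el C J P}"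

definition grothendieck_topos :: "('v \<Rightarrow> 'v set) \<Rightarrow> ('o, 'a) cat \<Rightarrow> bool" where
  "grothendieck_topos el E \<longleftrightarrow>
     (\<exists>(C :: ('v, 'v) cat) J. category C \<and> Obj C \<in> range el \<and> Arr C \<in> range el \<and>
        grothendieck_topology C J \<and> equivalent_categories E (sheaf_cat el C J))"

definition left_adjoint ::
  "('o, 'a) cat \<Rightarrow> ('p, 'b) cat \<Rightarrow> ('o, 'a, 'p, 'b) fctr \<Rightarrow> ('p, 'b, 'o, 'a) fctr \<Rightarrow> bool" where
  "left_adjoint C D L R \<longleftrightarrow> is_functor C D L \<and> is_functor D C R \<and>
     (\<exists>\<phi>. (\<forall>A\<in>Obj C. \<forall>X\<in>Obj D. bij_betw (\<phi> A X) (hom D (FO L A) X) (hom C A (FO R X))) \<and>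
          (\<forall>a\<in>Arr C. \<forall>b\<in>Arr D. \<forall>f\<in>hom D (FO L (Cod C a)) (Dom D b).
             \<phi> (Dom C a) (Cod D b) (b \<cdot>\<^bsub>D\<^esub> (f \<cdot>\<^bsub>D\<^esub> FA L a)) = FA R b \<cdot>\<^bsub>C\<^esub> (\<phi> (Cod C a) (Dom D b) f \<cdot>\<^bsub>C\<^esub> a)))"

definition left_exact :: "('o, 'a) cat \<Rightarrow> ('p, 'b) cat \<Rightarrow> ('o, 'a, 'p, 'b) fctr \<Rightarrow> bool" where
  "left_exact C D F \<longleftrightarrow> is_functor C D F \<and>
     (\<forall>T. is_terminal C T \<longrightarrow> is_terminal D (FO F T)) \<and>
     (\<forall>p q f g. is_pullback C p q f g \<longrightarrow> is_pullback D (FA F p) (FA F q) (FA F f) (FA F g))"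

definition geometric_morphism ::
  "('o, 'a) cat \<Rightarrow> ('p, 'b) cat \<Rightarrow> ('p, 'b, 'o, 'a) fctr \<Rightarrow> ('o, 'a, 'p, 'b) fctr \<Rightarrow> bool" where
  \<comment> \<open>a geometric morphism from E to B with inverse image gs and direct image gl\<close>
  "geometric_morphism E B gs gl \<longleftrightarrow> left_adjoint B E gs gl \<and> left_exact B E gs"

section \<open>Simplicial objects\<close>

text \<open>Indices are those of the lower degree: dd X n i goes from Ob X (n+1) to Ob X n, and
  ss X n i from Ob X n to Ob X (n+1).\<close>

record ('o, 'a) simp_obj =
  Ob :: "nat \<Rightarrow> 'o"
  dd :: "nat \<Rightarrow> nat \<Rightarrow> 'a"
  ss :: "nat \<Rightarrow> nat \<Rightarrow> 'a"

definition simplicial_object :: "('o, 'a) cat \<Rightarrow> ('o, 'a) simp_obj \<Rightarrow> bool" where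
  "simplicial_object C X \<longleftrightarrow>
     (\<forall>n. Ob X n \<in> Obj C) \<and>
     (\<forall>n i. i \<le> n + 1 \<longrightarrow> dd X n i \<in> hom C (Ob X (n + 1)) (Ob X n)) \<and>
     (\<forall>n i. i \<le> n \<longrightarrow> ss X n i \<in> hom C (Ob X n) (Ob X (n + 1))) \<and>
     (\<forall>n i j. i < j \<and> j \<le> n + 2 \<longrightarrow>
        dd X n i \<cdot>\<^bsub>C\<^esub> dd X (n + 1) j = dd X n (j - 1) \<cdot>\<^bsub>C\<^esub> dd X (n + 1) i) \<and>
     (\<forall>n i j. i < j \<and> j \<le> n + 1 \<longrightarrow>
        dd X (n + 1) i \<cdot>\<^bsub>C\<^esub> ss X (n + 1) j = ss X n (j - 1) \<cdot>\<^bsub>C\<^esub> dd X n i) \<and>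
     (\<forall>n i j. j \<le> n \<and> (i = j \<or> i = j + 1) \<longrightarrow> dd X n i \<cdot>\<^bsub>C\<^esub> ss X n j = Id C (Ob X n)) \<and>
     (\<forall>n i j. j + 1 < i \<and> i \<le> n + 2 \<longrightarrow>
        dd X (n + 1) i \<cdot>\<^bsub>C\<^esub> ss X (n + 1) j = ss X n j \<cdot>\<^bsub>C\<^esub> dd X n (i - 1)) \<and>
     (\<forall>n i j. i \<le> j \<and> j \<le> n \<longrightarrow>
        ss X (n + 1) i \<cdot>\<^bsub>C\<^esub> ss X n j = ss X (n + 1) (j + 1) \<cdot>\<^bsub>C\<^esub> ss X n i)"

definition simplicial_map ::
  "('o, 'a) cat \<Rightarrow> ('o, 'a) simp_obj \<Rightarrow> ('o, 'a) simp_obj \<Rightarrow> (nat \<Rightarrow> 'a) \<Rightarrow> bool" where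
  "simplicial_map C X Y h \<longleftrightarrow>
     (\<forall>n. h n \<in> hom C (Ob X n) (Ob Y n)) \<and>
     (\<forall>n i. i \<le> n + 1 \<longrightarrow> h n \<cdot>\<^bsub>C\<^esub> dd X n i = dd Y n i \<cdot>\<^bsub>C\<^esub> h (n + 1)) \<and>
     (\<forall>n i. i \<le> n \<longrightarrow> h (n + 1) \<cdot>\<^bsub>C\<^esub> ss X n i = ss Y n i \<cdot>\<^bsub>C\<^esub> h n)"

definition map_simp :: "('o, 'a, 'p, 'b) fctr \<Rightarrow> ('o, 'a) simp_obj \<Rightarrow> ('p, 'b) simp_obj" where
  "map_simp F X = \<lparr>Ob = (\<lambda>n. FO F (Ob X n)), dd = (\<lambda>n i. FA F (dd X n i)), ss = (\<lambda>n i. FA F (ss X n i))\<rparr>"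

definition strict_duality :: "('o, 'a) cat \<Rightarrow> ('o, 'a) simp_obj \<Rightarrow> (nat \<Rightarrow> 'a) \<Rightarrow> bool" where
  "strict_duality C X \<tau> \<longleftrightarrow>
     (\<forall>n. \<tau> n \<in> hom C (Ob X n) (Ob X n) \<and> is_iso C (\<tau> n)) \<and>
     \<tau> 0 = Id C (Ob X 0) \<and>
     (\<forall>n i. i \<le> n + 1 \<longrightarrow> dd X n i \<cdot>\<^bsub>C\<^esub> \<tau> (n + 1) = \<tau> n \<cdot>\<^bsub>C\<^esub> dd X n (n + 1 - i)) \<and>
     (\<forall>n i. i \<le> n \<longrightarrow> ss X n i \<cdot>\<^bsub>C\<^esub> \<tau> n = \<tau> (n + 1) \<cdot>\<^bsub>C\<^esub> ss X n (n - i))"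

text \<open>The object of (k+1)-simplices of the k-coskeleton of X, with its faces p 0, ..., p (k+1):
  the simplicial kernel, i.e. the universal (k+2)-tuple of k-simplices with matching faces
  (for k = 0 there is no matching condition and this is the product of two copies of Ob X 0).\<close>

definition is_cosk ::
  "('o, 'a) cat \<Rightarrow> ('o, 'a) simp_obj \<Rightarrow> nat \<Rightarrow> 'o \<Rightarrow> (nat \<Rightarrow> 'a) \<Rightarrow> bool" where
  "is_cosk C X k M p \<longleftrightarrow> (let matching = (\<lambda>T q.
       (\<forall>i\<le>k + 1. q i \<in> hom C T (Ob X k)) \<and>
       (\<forall>m i j. k = m + 1 \<and> i < j \<and> j \<le> k + 1 \<longrightarrow>
          dd X m i \<cdot>\<^bsub>C\<^esub> q j = dd X m (j - 1) \<cdot>\<^bsub>C\<^esub> q i)) in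
     M \<in> Obj C \<and> matching M p \<and>
     (\<forall>T\<in>Obj C. \<forall>q. matching T q \<longrightarrow> (\<exists>!h. h \<in> hom C T M \<and> (\<forall>i\<le>k + 1. p i \<cdot>\<^bsub>C\<^esub> h = q i))))"

section \<open>Families and covers\<close>

text \<open>For a family \<open>\<zeta> : U \<rightarrow> \<gamma>\<^sup>* I\<close>, its component at \<open>i \<in> I\<close> is the pullback of \<open>\<zeta>\<close>
  along the value of \<open>\<gamma>\<^sup>*\<close> at the point \<open>i : 1 \<rightarrow> I\<close>.\<close>

context
  fixes el :: "'v \<Rightarrow> 'v set"
    and E :: "('o, 'a) cat"
    and gs :: "('v, 'v sarr, 'o, 'a) fctr"
begin

definition point :: "'v \<Rightarrow> 'v \<Rightarrow> 'v sarr" where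
  "point I i = (one (set_cat el), (\<lambda>x\<in>el (one (set_cat el)). i), I)"

definition comp_in :: "'v \<Rightarrow> 'a \<Rightarrow> 'v \<Rightarrow> 'a" where
  "comp_in I \<zeta> i = (SOME p. \<exists>q. is_pullback E p q \<zeta> (FA gs (point I i)))"

definition component :: "'v \<Rightarrow> 'a \<Rightarrow> 'v \<Rightarrow> 'o" where
  "component I \<zeta> i = Dom E (comp_in I \<zeta> i)"

text \<open>The arrow from component i of one family to component j of another induced by an arrow f
  between the total objects.\<close>

definition comp_map :: "'v \<Rightarrow> 'a \<Rightarrow> 'v \<Rightarrow> 'v \<Rightarrow> 'a \<Rightarrow> 'v \<Rightarrow> 'a \<Rightarrow> 'a" where
  "comp_map I \<zeta> i J \<xi> j f =
     (THE g. g \<in> hom E (component I \<zeta> i) (component J \<xi> j) \<and>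
             comp_in J \<xi> j \<cdot>\<^bsub>E\<^esub> g = f \<cdot>\<^bsub>E\<^esub> comp_in I \<zeta> i)"

definition family :: "'v \<Rightarrow> 'o \<Rightarrow> 'a \<Rightarrow> bool" where
  "family I U \<zeta> \<longleftrightarrow> \<zeta> \<in> hom E U (FO gs I) \<and> (\<forall>i\<in>el I. \<not> is_initial E (component I \<zeta> i))"

definition cover :: "'v \<Rightarrow> 'o \<Rightarrow> 'a \<Rightarrow> bool" where
  "cover I U \<zeta> \<longleftrightarrow> family I U \<zeta> \<and> is_epi E (bang E U)"

end

section \<open>Self-dual simplicial families\<close>

record ('v, 'o, 'a) sd_family =
  tot :: "('o, 'a) simp_obj"
  idx :: "('v, 'v sarr) simp_obj"
  str :: "nat \<Rightarrow> 'a"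
  tot_dual :: "nat \<Rightarrow> 'a"
  idx_dual :: "nat \<Rightarrow> 'v sarr"

context
  fixes el :: "'v \<Rightarrow> 'v set"
    and E :: "('o, 'a) cat"
    and gs :: "('v, 'v sarr, 'o, 'a) fctr"
    and F :: "('v, 'o, 'a) sd_family"
begin

definition simplicial_family :: bool where
  "simplicial_family \<longleftrightarrow>
     simplicial_object E (tot F) \<and> simplicial_object (set_cat el) (idx F) \<and>
     simplicial_map E (tot F) (map_simp gs (idx F)) (str F) \<and>
     (\<forall>n. family el E gs (Ob (idx F) n) (Ob (tot F) n) (str F n))"

definition self_dual :: bool where
  "self_dual \<longleftrightarrow>
     strict_duality E (tot F) (tot_dual F) \<and> strict_duality (set_cat el) (idx F) (idx_dual F) \<and>
     (\<forall>n. str F n \<cdot>\<^bsub>E\<^esub> tot_dual F n = FA gs (idx_dual F n) \<cdot>\<^bsub>E\<^esub> str F n)"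

text \<open>The canonical morphism from a simplicial family with the required degree 0 part to the Cech
  family exists automatically, so refining the Cech family is no further condition.\<close>

definition hypercover_refinement :: "'v \<Rightarrow> 'o \<Rightarrow> 'a \<Rightarrow> bool" where
  "hypercover_refinement I U \<zeta> \<longleftrightarrow> simplicial_family \<and>
     Ob (idx F) 0 = I \<and> Ob (tot F) 0 = U \<and> str F 0 = \<zeta> \<and>
     (\<forall>k. \<exists>M p e. is_cosk E (tot F) k M p \<and> e \<in> hom E (Ob (tot F) (k + 1)) M \<and>
        (\<forall>i\<le>k + 1. p i \<cdot>\<^bsub>E\<^esub> e = dd (tot F) k i) \<and> is_epi E e)"

definition simplices :: "nat \<Rightarrow> 'v set" where
  "simplices n = el (Ob (idx F) n)"

text \<open>\<open>bd n i w\<close> is \<open>\<partial>\<^sub>i w\<close> for \<open>w\<close> of dimension n+1.\<close>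

definition bd :: "nat \<Rightarrow> nat \<Rightarrow> 'v \<Rightarrow> 'v" where
  "bd n i w = app (dd (idx F) n i) w"

definition opp :: "nat \<Rightarrow> 'v \<Rightarrow> 'v" where
  "opp n w = app (idx_dual F n) w"

abbreviation src :: "'v \<Rightarrow> 'v" where "src \<equiv> bd 0 1"
abbreviation tgt :: "'v \<Rightarrow> 'v" where "tgt \<equiv> bd 0 0"

text \<open>\<open>(H\<^sub>n)\<^sub>w\<close> for \<open>w\<close> of dimension n, \<open>(d\<^sub>i)\<^sub>w\<close> for \<open>w\<close> of dimension n+1, \<open>(\<tau>\<^sub>n)\<^sub>w\<close> for \<open>w\<close> of
  dimension n.\<close>

definition Hc :: "nat \<Rightarrow> 'v \<Rightarrow> 'o" where
  "Hc n w = component el E gs (Ob (idx F) n) (str F n) w"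

definition dc :: "nat \<Rightarrow> nat \<Rightarrow> 'v \<Rightarrow> 'a" where
  "dc n i w = comp_map el E gs (Ob (idx F) (n + 1)) (str F (n + 1)) w
                               (Ob (idx F) n) (str F n) (bd n i w) (dd (tot F) n i)"

definition tauc :: "nat \<Rightarrow> 'v \<Rightarrow> 'a" where
  "tauc n w = comp_map el E gs (Ob (idx F) n) (str F n) w
                               (Ob (idx F) n) (str F n) (opp n w) (tot_dual F n)"

definition condition_G :: bool where
  "condition_G \<longleftrightarrow> (\<forall>l\<in>simplices 1. \<exists>w\<in>simplices 2.
     bd 1 2 w = l \<and> bd 1 0 w = opp 1 l \<and> dc 0 1 (bd 1 1 w) = dc 0 0 (bd 1 1 w))"

definition span_morphism :: "'v \<Rightarrow> 'v \<Rightarrow> 'a \<Rightarrow> bool" where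
  "span_morphism l t f \<longleftrightarrow> l \<in> simplices 1 \<and> t \<in> simplices 1 \<and> src l = src t \<and> tgt l = tgt t \<and>
     f \<in> hom E (Hc 1 l) (Hc 1 t) \<and>
     dc 0 1 t \<cdot>\<^bsub>E\<^esub> f = dc 0 1 l \<and> dc 0 0 t \<cdot>\<^bsub>E\<^esub> f = dc 0 0 l"

section \<open>The G-fundamental groupoid\<close>

text \<open>A premorphism \<open>(\<ell>\<^sub>n \<cdots> \<ell>\<^sub>1)\<close> is the list with head \<open>\<ell>\<^sub>n\<close> and last element \<open>\<ell>\<^sub>1\<close>.\<close>

definition premorphism :: "'v \<Rightarrow> 'v list \<Rightarrow> 'v \<Rightarrow> bool" where
  "premorphism i p j \<longleftrightarrow> p \<noteq> [] \<and> set p \<subseteq> simplices 1 \<and> src (last p) = i \<and> tgt (hd p) = j \<and>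
     (\<forall>k. Suc k < length p \<longrightarrow> src (p ! k) = tgt (p ! Suc k))"

inductive equiv_pre :: "'v list \<Rightarrow> 'v list \<Rightarrow> bool" where
  refl: "premorphism i p j \<Longrightarrow> equiv_pre p p"
| sym: "equiv_pre p q \<Longrightarrow> equiv_pre q p"
| trans: "equiv_pre p q \<Longrightarrow> equiv_pre q r \<Longrightarrow> equiv_pre p r"
| comp: "premorphism i p j \<Longrightarrow> premorphism j p' k \<Longrightarrow> equiv_pre p q \<Longrightarrow> equiv_pre p' q' \<Longrightarrow>
           equiv_pre (p' @ p) (q' @ q)"
| triangle: "w \<in> simplices 2 \<Longrightarrow> equiv_pre [bd 1 1 w] [bd 1 0 w, bd 1 2 w]"
| spans: "span_morphism l t f \<Longrightarrow> equiv_pre [l] [t]"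

definition pclass :: "'v list \<Rightarrow> 'v list set" where
  "pclass p = {q. equiv_pre p q}"

definition fundamental_groupoid :: "('v, 'v \<times> 'v list set \<times> 'v) cat" where
  "fundamental_groupoid =
     \<lparr>Obj = simplices 0,
      Arr = {(i, pclass p, j) | i p j. i \<in> simplices 0 \<and> j \<in> simplices 0 \<and> premorphism i p j},
      Dom = (\<lambda>(i, c, j). i),
      Cod = (\<lambda>(i, c, j). j),
      Id = (\<lambda>i. (i, pclass [app (ss (idx F) 0 0) i], i)),
      Comp = (\<lambda>(j, d, k) (i, c, j'). (i, (\<Union>q\<in>d. \<Union>p\<in>c. pclass (q @ p)), k))\<rparr>"

section \<open>Descent data\<close>

type_synonym 'w descent_datum = "('w \<Rightarrow> 'w) \<times> ('w \<Rightarrow> 'w sarr)"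

definition descent_datum :: "'v descent_datum \<Rightarrow> bool" where
  "descent_datum = (\<lambda>(R, s).
     R \<in> extensional (simplices 0) \<and> s \<in> extensional (simplices 1) \<and>
     (\<forall>l\<in>simplices 1. s l \<in> hom (set_cat el) (R (src l)) (R (tgt l)) \<and>
        bij_betw (app (s l)) (el (R (src l))) (el (R (tgt l)))) \<and>
     (\<forall>i\<in>simplices 0. s (app (ss (idx F) 0 0) i) = Id (set_cat el) (R i)) \<and>
     (\<forall>w\<in>simplices 2. s (bd 1 1 w) = s (bd 1 0 w) \<cdot>\<^bsub>set_cat el\<^esub> s (bd 1 2 w)))"

definition consistent :: "'v descent_datum \<Rightarrow> bool" where
  "consistent = (\<lambda>(R, s). \<forall>l t f. span_morphism l t f \<longrightarrow> s l = s t)"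

section \<open>Covering projections\<close>

text \<open>The cover is the degree 0 part of the family, so \<open>U\<^sub>i\<close> is \<open>Hc 0 i\<close>.\<close>

definition locally_constant :: "('v \<Rightarrow> 'v) \<Rightarrow> 'o \<times> ('v \<Rightarrow> 'a) \<Rightarrow> bool" where
  "locally_constant R = (\<lambda>(X, \<theta>). X \<in> Obj E \<and> \<theta> \<in> extensional (simplices 0) \<and>
     (\<forall>i\<in>simplices 0.
        \<theta> i \<in> hom E (Prod E (FO gs (R i)) (Hc 0 i)) (Prod E X (Hc 0 i)) \<and> is_iso E (\<theta> i) \<and>
        pr2 E X (Hc 0 i) \<cdot>\<^bsub>E\<^esub> \<theta> i = pr2 E (FO gs (R i)) (Hc 0 i)))"

definition theta_times :: "('v \<Rightarrow> 'v) \<Rightarrow> 'o \<times> ('v \<Rightarrow> 'a) \<Rightarrow> 'v \<Rightarrow> 'v \<Rightarrow> 'a" where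
  \<comment> \<open>\<open>\<theta>\<^sub>i \<times> U\<^sub>j : \<gamma>\<^sup>* R\<^sub>i \<times> (U\<^sub>i \<times> U\<^sub>j) \<rightarrow> X \<times> (U\<^sub>i \<times> U\<^sub>j)\<close>\<close>
  "theta_times R = (\<lambda>(X, \<theta>) i j.
     assoc_right E X (Hc 0 i) (Hc 0 j) \<cdot>\<^bsub>E\<^esub>
       (prod_map E (\<theta> i) (Id E (Hc 0 j)) \<cdot>\<^bsub>E\<^esub> assoc_left E (FO gs (R i)) (Hc 0 i) (Hc 0 j)))"

definition transition :: "('v \<Rightarrow> 'v) \<Rightarrow> 'o \<times> ('v \<Rightarrow> 'a) \<Rightarrow> 'v \<Rightarrow> 'v \<Rightarrow> 'a" where
  \<comment> \<open>\<open>\<sigma>\<^sub>j\<^sub>,\<^sub>i\<close>, with the arguments in the order j, i\<close>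
  "transition R X\<theta> j i =
     (THE g. g \<in> hom E (Prod E (FO gs (R i)) (Prod E (Hc 0 i) (Hc 0 j)))
                       (Prod E (FO gs (R j)) (Prod E (Hc 0 j) (Hc 0 i))) \<and>
        theta_times R X\<theta> j i \<cdot>\<^bsub>E\<^esub> g =
        prod_map E (Id E (fst X\<theta>)) (symm E (Hc 0 i) (Hc 0 j)) \<cdot>\<^bsub>E\<^esub> theta_times R X\<theta> i j)"

definition cech1 :: "('v \<times> 'v) set" where
  \<comment> \<open>\<open>N\<^sub>1\<close>\<close>
  "cech1 = {(i, j). i \<in> simplices 0 \<and> j \<in> simplices 0 \<and> \<not> is_initial E (Prod E (Hc 0 i) (Hc 0 j))}"

definition action_span :: "('v \<Rightarrow> 'v) \<Rightarrow> 'o \<times> ('v \<Rightarrow> 'a) \<Rightarrow> 'v \<Rightarrow> 'v \<Rightarrow> 'o \<Rightarrow> 'a \<Rightarrow> 'a \<Rightarrow> bool" where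
  "action_span R X\<theta> i j V u v \<longleftrightarrow>
     u \<in> hom E V (Hc 0 i) \<and> v \<in> hom E V (Hc 0 j) \<and>
     (\<exists>s\<in>hom (set_cat el) (R i) (R j). bij_betw (app s) (el (R i)) (el (R j)) \<and>
        transition R X\<theta> j i \<cdot>\<^bsub>E\<^esub> prod_map E (Id E (FO gs (R i))) (pairing E u v) =
        prod_map E (Id E (FO gs (R j))) (pairing E v u) \<cdot>\<^bsub>E\<^esub> prod_map E (FA gs s) (Id E V))"

definition covering_projection :: "('v \<Rightarrow> 'v) \<Rightarrow> 'o \<times> ('v \<Rightarrow> 'a) \<Rightarrow> bool" where
  "covering_projection R X\<theta> \<longleftrightarrow> locally_constant R X\<theta> \<and>
     (\<forall>(i, j)\<in>cech1. epimorphic_family E (Prod E (Hc 0 i) (Hc 0 j))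
        {pairing E u v | V u v. V \<in> Obj E \<and> \<not> is_initial E V \<and> action_span R X\<theta> i j V u v})"

definition h1c :: "'v \<Rightarrow> 'a" where
  "h1c l = pairing E (dc 0 1 l) (dc 0 0 l)"

definition determined_by :: "'v descent_datum \<Rightarrow> 'o \<times> ('v \<Rightarrow> 'a) \<Rightarrow> bool" where
  "determined_by = (\<lambda>(R, s) X\<theta>. covering_projection R X\<theta> \<and>
     (\<forall>l\<in>simplices 1.
        transition R X\<theta> (tgt l) (src l) \<cdot>\<^bsub>E\<^esub> prod_map E (Id E (FO gs (R (src l)))) (h1c l) =
        prod_map E (Id E (FO gs (R (tgt l)))) (h1c (opp 1 l)) \<cdot>\<^bsub>E\<^esub> prod_map E (FA gs (s l)) (tauc 1 l)))"

text \<open>The covering projection is determined by the datum only up to a unique compatible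
  isomorphism; the construction picks one. An object of the category below is moreover required
  to be a covering projection determined by its datum, so that the choice is never vacuous.\<close>

definition the_covering_projection :: "'v descent_datum \<Rightarrow> 'o \<times> ('v \<Rightarrow> 'a)" where
  "the_covering_projection Rs = (SOME X\<theta>. determined_by Rs X\<theta>)"

type_synonym ('w, 'p, 'b) cov_obj = "('p \<times> ('w \<Rightarrow> 'b)) \<times> 'w descent_datum"

definition covering_objects :: "('v, 'o, 'a) cov_obj set" where
  "covering_objects = {(X\<theta>, Rs). descent_datum Rs \<and> consistent Rs \<and>
     determined_by Rs X\<theta> \<and> X\<theta> = the_covering_projection Rs}"

definition covering_cat ::
  "(('v, 'o, 'a) cov_obj, ('v, 'o, 'a) cov_obj \<times> ('v \<Rightarrow> 'v sarr) \<times> ('v, 'o, 'a) cov_obj) cat" where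
  "covering_cat =
     \<lparr>Obj = covering_objects,
      Arr = {(P, f, P'). P \<in> covering_objects \<and> P' \<in> covering_objects \<and>
              f \<in> extensional (simplices 0) \<and>
              (\<forall>i\<in>simplices 0. f i \<in> hom (set_cat el) (fst (snd P) i) (fst (snd P') i)) \<and>
              (\<forall>l\<in>simplices 1. f (tgt l) \<cdot>\<^bsub>set_cat el\<^esub> snd (snd P) l =
                               snd (snd P') l \<cdot>\<^bsub>set_cat el\<^esub> f (src l))},
      Dom = (\<lambda>(P, f, P'). P),
      Cod = (\<lambda>(P, f, P'). P'),
      Id = (\<lambda>P. (P, (\<lambda>i\<in>simplices 0. Id (set_cat el) (fst (snd P) i)), P)),
      Comp = (\<lambda>(P', g, P'') (P, f, Q). (P, (\<lambda>i\<in>simplices 0. g i \<cdot>\<^bsub>set_cat el\<^esub> f i), P''))\<rparr>"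

end

end

theory Submission
  imports Defs
begin

text \<open>
  A functor on the fundamental groupoid is the same thing as a consistent descent datum. Morphisms of
  the groupoid are classes of paths of edges, so a functor is determined by its values on single edges,
  and the relations generating the classes are exactly the cocycle condition for the triangles in
  \<open>S\<^sub>2\<close> and consistency (\<open>act_of_functor\<close>, \<open>act_of_inj\<close>, \<open>act_of_surj\<close>). That the value on an edge
  is a bijection is where condition G enters: it makes the opposite of an edge a left inverse of it
  (\<open>inverse_edge\<close>). Natural transformations of functors are the families that commute with the
  edges (\<open>natural_iff\<close>). Since an object of the category of covering projections is a datum
  together with the covering projection chosen for it, what remains is that every descent datum
  does determine a covering projection (\<open>covering_projection_exists\<close>).

  For that existence the topos is described by sections over a small site (\<open>sheaf_topos\<close>): an object
  is a sheaf of sets of sections, an arrow is a natural family of maps, and every small sheaf occurs.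
  Finite limits are then computed on sections (\<open>lim_sec\<close>), and a jointly epimorphic family is
  jointly surjective locally (\<open>epi_locally\<close>, by means of the sheaf of closed sieves). The two lowest
  hypercover conditions become statements about sections: any \<open>u\<close> in \<open>U\<^sub>i\<close> and \<open>v\<close> in \<open>U\<^sub>j\<close> are
  locally joined by a section of some \<open>(H\<^sub>1)\<^sub>\<ell>\<close> (\<open>edges\<close>), and three edges with matching ends bound a
  triangle of \<open>S\<^sub>2\<close> unless the empty sieve covers (\<open>triangles\<close>). Hence \<open>s\<^sub>\<ell>\<close> depends, locally, only on
  the ends of the edge, and the maps \<open>s\<^sub>\<ell>\<close> glue to a transport of sections of \<open>\<gamma>\<^sup>* R\<^sub>i\<close> over \<open>u\<close>
  to sections of \<open>\<gamma>\<^sup>* R\<^sub>j\<close> over \<open>v\<close>.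

  The object \<open>X\<close> is built as a limit, so that no sheafification is needed: a section of \<open>X\<close> over \<open>c\<close>
  assigns to each section \<open>u\<close> of \<open>U\<^sub>k\<close> over an arrow into \<open>c\<close> a section of \<open>\<gamma>\<^sup>* R\<^sub>k\<close>, naturally and
  compatibly with the datum (\<open>glued\<close>). Over \<open>U\<^sub>i\<close> such a section is determined by a single value,
  all others being transports of it; this is the isomorphism \<open>\<theta>\<^sub>i\<close>. Its transition maps are computed
  on sections along an edge (\<open>tn_edge\<close>).
\<close>

section \<open>Categories, sets and functor categories\<close>

lemma homD: "f \<in> hom C A B \<Longrightarrow> f \<in> Arr C" "f \<in> hom C A B \<Longrightarrow> Dom C f = A"
  "f \<in> hom C A B \<Longrightarrow> Cod C f = B"
  by (simp_all add: hom_def)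

lemma cat_obj:
  assumes "category C" "f \<in> hom C A B"
  shows "A \<in> Obj C" "B \<in> Obj C"
  using assms unfolding category_def hom_def by blast+

lemma cat_dom_obj: "category C \<Longrightarrow> f \<in> Arr C \<Longrightarrow> Dom C f \<in> Obj C"
  and cat_cod_obj: "category C \<Longrightarrow> f \<in> Arr C \<Longrightarrow> Cod C f \<in> Obj C"
  unfolding category_def by blast+

lemma cat_id: "category C \<Longrightarrow> A \<in> Obj C \<Longrightarrow> Id C A \<in> hom C A A"
  unfolding category_def by blast+

lemma cat_comp:
  assumes "category C" "f \<in> hom C A B" "g \<in> hom C B D"
  shows "g \<cdot>\<^bsub>C\<^esub> f \<in> hom C A D"
  using assms unfolding category_def hom_def by auto

lemma cat_unit:
  assumes "category C" "f \<in> hom C A B"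
  shows "f \<cdot>\<^bsub>C\<^esub> Id C A = f" "Id C B \<cdot>\<^bsub>C\<^esub> f = f"
  using assms unfolding category_def hom_def by blast+

lemma cat_assoc:
  assumes "category C" "f \<in> hom C A B" "g \<in> hom C B D" "h \<in> hom C D G"
  shows "h \<cdot>\<^bsub>C\<^esub> (g \<cdot>\<^bsub>C\<^esub> f) = (h \<cdot>\<^bsub>C\<^esub> g) \<cdot>\<^bsub>C\<^esub> f"
  using assms unfolding category_def hom_def by blast+

lemma categoryI:
  assumes "\<And>f. f \<in> Arr C \<Longrightarrow> Dom C f \<in> Obj C \<and> Cod C f \<in> Obj C"
    and "\<And>A. A \<in> Obj C \<Longrightarrow> Id C A \<in> hom C A A"
    and "\<And>f g. f \<in> Arr C \<Longrightarrow> g \<in> Arr C \<Longrightarrow> Dom C g = Cod C f \<Longrightarrow> g \<cdot>\<^bsub>C\<^esub> f \<in> hom C (Dom C f) (Cod C g)"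
    and "\<And>f. f \<in> Arr C \<Longrightarrow> f \<cdot>\<^bsub>C\<^esub> Id C (Dom C f) = f"
    and "\<And>f. f \<in> Arr C \<Longrightarrow> Id C (Cod C f) \<cdot>\<^bsub>C\<^esub> f = f"
    and "\<And>f g h. f \<in> Arr C \<Longrightarrow> g \<in> Arr C \<Longrightarrow> h \<in> Arr C \<Longrightarrow> Dom C g = Cod C f \<Longrightarrow> Dom C h = Cod C g
           \<Longrightarrow> h \<cdot>\<^bsub>C\<^esub> (g \<cdot>\<^bsub>C\<^esub> f) = (h \<cdot>\<^bsub>C\<^esub> g) \<cdot>\<^bsub>C\<^esub> f"
  shows "category C"
  unfolding category_def using assms by blast

lemma Obj_set_cat [simp]: "Obj (set_cat el) = UNIV"
  by (simp add: set_cat_def)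

lemma hom_set_cat: "a \<in> hom (set_cat el) A B \<longleftrightarrow> fst a = A \<and> snd (snd a) = B \<and> app a \<in> el A \<rightarrow>\<^sub>E el B"
  by (cases a) (auto simp: hom_def set_cat_def app_def)

lemma hom_set_catI: "f \<in> el A \<rightarrow>\<^sub>E el B \<Longrightarrow> (A, f, B) \<in> hom (set_cat el) A B"
  by (simp add: hom_set_cat app_def)

lemma app_comp: "app (g \<cdot>\<^bsub>set_cat el\<^esub> f) = compose (el (fst f)) (app g) (app f)"
  by (cases f; cases g) (simp add: set_cat_def app_def)

lemma comp_set_cat: "g \<cdot>\<^bsub>set_cat el\<^esub> f = (fst f, compose (el (fst f)) (app g) (app f), snd (snd g))"
  by (cases f; cases g) (simp add: set_cat_def app_def)

lemma app_comp_apply: "f \<in> hom (set_cat el) A B \<Longrightarrow> x \<in> el A \<Longrightarrow> app (g \<cdot>\<^bsub>set_cat el\<^esub> f) x = app g (app f x)"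
  by (simp add: app_comp hom_set_cat compose_def)

lemma Id_set_cat: "Id (set_cat el) A = (A, (\<lambda>x\<in>el A. x), A)"
  by (simp add: set_cat_def)

lemma app_Id: "app (Id (set_cat el) A) = (\<lambda>x\<in>el A. x)"
  by (simp add: set_cat_def app_def)

lemma app_in: "f \<in> hom (set_cat el) A B \<Longrightarrow> x \<in> el A \<Longrightarrow> app f x \<in> el B"
  by (auto simp: hom_set_cat)

lemma set_cat_ext:
  assumes "f \<in> hom (set_cat el) A B" "g \<in> hom (set_cat el) A B" "\<And>x. x \<in> el A \<Longrightarrow> app f x = app g x"
  shows "f = g"
proof -
  have "app f = app g"
    by (rule PiE_ext[of _ "el A" "\<lambda>_. el B"]) (use assms in \<open>auto simp: hom_set_cat\<close>)
  then show ?thesis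
    using assms by (cases f; cases g) (auto simp: hom_set_cat app_def)
qed

lemma set_cat_comp:
  assumes "f \<in> hom (set_cat el) A B" "g \<in> hom (set_cat el) B D"
  shows "g \<cdot>\<^bsub>set_cat el\<^esub> f \<in> hom (set_cat el) A D"
proof -
  have "compose (el A) (app g) (app f) \<in> el A \<rightarrow>\<^sub>E el D"
    using assms by (auto simp: compose_def dest: app_in)
  then show ?thesis
    using assms by (simp add: comp_set_cat hom_set_cat) (simp add: app_def)
qed

lemma set_cat_id: "Id (set_cat el) A \<in> hom (set_cat el) A A"
  by (simp add: hom_set_cat app_Id) (simp add: Id_set_cat)

lemma category_set_cat: "category (set_cat el)"
proof (rule categoryI)
  fix f assume "f \<in> Arr (set_cat el)"
  then have f: "f \<in> hom (set_cat el) (Dom (set_cat el) f) (Cod (set_cat el) f)" by (simp add: hom_def)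
  show "f \<cdot>\<^bsub>set_cat el\<^esub> Id (set_cat el) (Dom (set_cat el) f) = f"
    by (rule set_cat_ext[OF set_cat_comp[OF set_cat_id f] f]) (simp add: app_comp_apply[OF set_cat_id] app_Id)
  show "Id (set_cat el) (Cod (set_cat el) f) \<cdot>\<^bsub>set_cat el\<^esub> f = f"
    by (rule set_cat_ext[OF set_cat_comp[OF f set_cat_id] f]) (simp add: app_comp_apply[OF f] app_Id app_in[OF f])
next
  fix f g assume "f \<in> Arr (set_cat el)" "g \<in> Arr (set_cat el)" "Dom (set_cat el) g = Cod (set_cat el) f"
  then show "g \<cdot>\<^bsub>set_cat el\<^esub> f \<in> hom (set_cat el) (Dom (set_cat el) f) (Cod (set_cat el) g)"
    by (intro set_cat_comp) (auto simp: hom_def)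
next
  fix f g h assume a: "f \<in> Arr (set_cat el)" "g \<in> Arr (set_cat el)" "h \<in> Arr (set_cat el)"
    "Dom (set_cat el) g = Cod (set_cat el) f" "Dom (set_cat el) h = Cod (set_cat el) g"
  have f: "f \<in> hom (set_cat el) (Dom (set_cat el) f) (Cod (set_cat el) f)"
    and g: "g \<in> hom (set_cat el) (Cod (set_cat el) f) (Cod (set_cat el) g)"
    and h: "h \<in> hom (set_cat el) (Cod (set_cat el) g) (Cod (set_cat el) h)"
    using a by (simp_all add: hom_def)
  show "h \<cdot>\<^bsub>set_cat el\<^esub> (g \<cdot>\<^bsub>set_cat el\<^esub> f) = (h \<cdot>\<^bsub>set_cat el\<^esub> g) \<cdot>\<^bsub>set_cat el\<^esub> f"
    by (rule set_cat_ext[OF set_cat_comp[OF set_cat_comp[OF f g] h] set_cat_comp[OF f set_cat_comp[OF g h]]])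
      (simp add: app_comp_apply[OF f] app_comp_apply[OF g] app_comp_apply[OF set_cat_comp[OF f g]] app_in[OF f])
qed (simp_all add: set_cat_id)

lemma functor_cats: "is_functor C D F \<Longrightarrow> category C" "is_functor C D F \<Longrightarrow> category D"
  by (simp_all add: is_functor_def)

lemma functor_obj: "is_functor C D F \<Longrightarrow> A \<in> Obj C \<Longrightarrow> FO F A \<in> Obj D"
  and functor_id: "is_functor C D F \<Longrightarrow> A \<in> Obj C \<Longrightarrow> FA F (Id C A) = Id D (FO F A)"
  and functor_arr: "is_functor C D F \<Longrightarrow> f \<in> hom C A B \<Longrightarrow> FA F f \<in> hom D (FO F A) (FO F B)"
  and functor_comp: "is_functor C D F \<Longrightarrow> f \<in> hom C A B \<Longrightarrow> g \<in> hom C B G \<Longrightarrow>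
    FA F (g \<cdot>\<^bsub>C\<^esub> f) = FA F g \<cdot>\<^bsub>D\<^esub> FA F f"
  unfolding is_functor_def hom_def by blast+

text \<open>The objects of \<open>functor_cat C D\<close>: functors that are undefined off \<open>C\<close>.\<close>

definition functors :: "('o, 'a) cat \<Rightarrow> ('p, 'b) cat \<Rightarrow> ('o, 'a, 'p, 'b) fctr set" where
  "functors C D = {F. is_functor C D F \<and> FO F \<in> extensional (Obj C) \<and> FA F \<in> extensional (Arr C)}"

lemma functor_cat_simps:
  "Obj (functor_cat C D) = functors C D"
  "(F, t, G) \<in> Arr (functor_cat C D) \<longleftrightarrow> F \<in> functors C D \<and> G \<in> functors C D \<and> t \<in> extensional (Obj C) \<and>
               (\<forall>A\<in>Obj C. t A \<in> hom D (FO F A) (FO G A)) \<and>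
               (\<forall>f\<in>Arr C. t (Cod C f) \<cdot>\<^bsub>D\<^esub> FA F f = FA G f \<cdot>\<^bsub>D\<^esub> t (Dom C f))"
  "Dom (functor_cat C D) (F, t, G) = F" "Cod (functor_cat C D) (F, t, G) = G"
  "Id (functor_cat C D) F = (F, (\<lambda>A\<in>Obj C. Id D (FO F A)), F)"
  "(G, u, K) \<cdot>\<^bsub>functor_cat C D\<^esub> (F, t, G') = (F, (\<lambda>A\<in>Obj C. u A \<cdot>\<^bsub>D\<^esub> t A), K)"
  by (simp_all add: functor_cat_def Let_def functors_def)

lemma category_functor_cat:
  assumes C: "category C" and D: "category D"
  shows "category (functor_cat C D)"
proof (rule categoryI)
  fix f assume f: "f \<in> Arr (functor_cat C D)"
  obtain F t G where ft: "f = (F, t, G)" by (cases f)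
  note a = f[unfolded ft functor_cat_simps]
  show "Dom (functor_cat C D) f \<in> Obj (functor_cat C D) \<and> Cod (functor_cat C D) f \<in> Obj (functor_cat C D)"
    using a by (simp add: ft functor_cat_simps)
  show "f \<cdot>\<^bsub>functor_cat C D\<^esub> Id (functor_cat C D) (Dom (functor_cat C D) f) = f"
    using a cat_unit(1)[OF D] by (auto simp: ft functor_cat_simps fun_eq_iff extensional_def)
  show "Id (functor_cat C D) (Cod (functor_cat C D) f) \<cdot>\<^bsub>functor_cat C D\<^esub> f = f"
    using a cat_unit(2)[OF D] by (auto simp: ft functor_cat_simps fun_eq_iff extensional_def)
next
  fix F assume "F \<in> Obj (functor_cat C D)"
  then have F: "F \<in> functors C D" by (simp add: functor_cat_simps)
  then have FF: "is_functor C D F" by (simp add: functors_def)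
  have "Id D (FO F (Cod C f)) \<cdot>\<^bsub>D\<^esub> FA F f = FA F f \<cdot>\<^bsub>D\<^esub> Id D (FO F (Dom C f))" if "f \<in> Arr C" for f
    using cat_unit[OF D functor_arr[OF FF, of f "Dom C f" "Cod C f"]] that by (simp add: hom_def)
  then have "(F, (\<lambda>A\<in>Obj C. Id D (FO F A)), F) \<in> Arr (functor_cat C D)"
    using F cat_id[OF D functor_obj[OF FF]] cat_dom_obj[OF C] cat_cod_obj[OF C]
    by (auto simp: functor_cat_simps)
  then show "Id (functor_cat C D) F \<in> hom (functor_cat C D) F F"
    by (simp add: hom_def functor_cat_simps)
next
  fix f g assume fg: "f \<in> Arr (functor_cat C D)" "g \<in> Arr (functor_cat C D)"
    "Dom (functor_cat C D) g = Cod (functor_cat C D) f"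
  obtain F t G u K where ft: "f = (F, t, G)" "g = (G, u, K)"
    using fg(3) by (cases f; cases g) (auto simp: functor_cat_simps)
  note a = fg(1)[unfolded ft functor_cat_simps] and b = fg(2)[unfolded ft functor_cat_simps]
  have F: "is_functor C D F" "is_functor C D G" "is_functor C D K"
    using a b by (auto simp: functors_def)
  have "(u (Cod C h) \<cdot>\<^bsub>D\<^esub> t (Cod C h)) \<cdot>\<^bsub>D\<^esub> FA F h = FA K h \<cdot>\<^bsub>D\<^esub> (u (Dom C h) \<cdot>\<^bsub>D\<^esub> t (Dom C h))"
    if h: "h \<in> Arr C" for h
  proof -
    have o: "Dom C h \<in> Obj C" "Cod C h \<in> Obj C" using h C by (auto simp: cat_dom_obj cat_cod_obj)
    have hh: "h \<in> hom C (Dom C h) (Cod C h)" using h by (simp add: hom_def)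
    note m = functor_arr[OF F(1) hh] functor_arr[OF F(2) hh] functor_arr[OF F(3) hh]
    have ta: "t (Dom C h) \<in> hom D (FO F (Dom C h)) (FO G (Dom C h))"
       "t (Cod C h) \<in> hom D (FO F (Cod C h)) (FO G (Cod C h))"
       "u (Dom C h) \<in> hom D (FO G (Dom C h)) (FO K (Dom C h))"
       "u (Cod C h) \<in> hom D (FO G (Cod C h)) (FO K (Cod C h))"
       "t (Cod C h) \<cdot>\<^bsub>D\<^esub> FA F h = FA G h \<cdot>\<^bsub>D\<^esub> t (Dom C h)"
       "u (Cod C h) \<cdot>\<^bsub>D\<^esub> FA G h = FA K h \<cdot>\<^bsub>D\<^esub> u (Dom C h)"
      using a b o h by auto
    show ?thesis
      using cat_assoc[OF D m(1) ta(2) ta(4)] cat_assoc[OF D ta(1) m(2) ta(4)] cat_assoc[OF D ta(1) ta(3) m(3)] ta(5,6)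
      by simp
  qed
  moreover have "u A \<cdot>\<^bsub>D\<^esub> t A \<in> hom D (FO F A) (FO K A)" if "A \<in> Obj C" for A
    using a b that cat_comp[OF D, of "t A" "FO F A" "FO G A" "u A" "FO K A"] by blast
  ultimately have "(F, (\<lambda>A\<in>Obj C. u A \<cdot>\<^bsub>D\<^esub> t A), K) \<in> Arr (functor_cat C D)"
    using a b C by (simp add: functor_cat_simps cat_dom_obj cat_cod_obj)
  then show "g \<cdot>\<^bsub>functor_cat C D\<^esub> f \<in> hom (functor_cat C D) (Dom (functor_cat C D) f) (Cod (functor_cat C D) g)"
    by (simp add: ft hom_def functor_cat_simps)
next
  fix f g h assume fg: "f \<in> Arr (functor_cat C D)" "g \<in> Arr (functor_cat C D)" "h \<in> Arr (functor_cat C D)"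
    "Dom (functor_cat C D) g = Cod (functor_cat C D) f" "Dom (functor_cat C D) h = Cod (functor_cat C D) g"
  obtain F t G u K v L where ft: "f = (F, t, G)" "g = (G, u, K)" "h = (K, v, L)"
    using fg(4,5) by (cases f; cases g; cases h) (auto simp: functor_cat_simps)
  note a = fg(1)[unfolded ft functor_cat_simps] and b = fg(2)[unfolded ft functor_cat_simps]
    and c = fg(3)[unfolded ft functor_cat_simps]
  have "v A \<cdot>\<^bsub>D\<^esub> (u A \<cdot>\<^bsub>D\<^esub> t A) = (v A \<cdot>\<^bsub>D\<^esub> u A) \<cdot>\<^bsub>D\<^esub> t A" if "A \<in> Obj C" for A
    using a b c that cat_assoc[OF D, of "t A" "FO F A" "FO G A" "u A" "FO K A" "v A" "FO L A"] by blast
  then show "h \<cdot>\<^bsub>functor_cat C D\<^esub> (g \<cdot>\<^bsub>functor_cat C D\<^esub> f) = (h \<cdot>\<^bsub>functor_cat C D\<^esub> g) \<cdot>\<^bsub>functor_cat C D\<^esub> f"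
    by (simp add: ft functor_cat_simps restrict_def fun_eq_iff)
qed

section \<open>Small sets\<close>

text \<open>A set of any type is small if it injects into an element of the universe.\<close>

definition small :: "('v \<Rightarrow> 'v set) \<Rightarrow> 's set \<Rightarrow> bool" where
  "small el A \<longleftrightarrow> (\<exists>v f. inj_on f A \<and> f ` A \<subseteq> el v)"

context
  fixes el :: "'v \<Rightarrow> 'v set"
  assumes univ: "universe el"
begin

lemma el_sub: "A \<subseteq> el x \<Longrightarrow> A \<in> range el"
  and el_pair: "{x, y} \<in> range el"
  and el_Pow: "{z. el z \<subseteq> el x} \<in> range el"
  and el_Union: "(\<Union>z\<in>el x. el (f z)) \<in> range el"
proof -
  have "\<forall>x A. A \<subseteq> el x \<longrightarrow> A \<in> range el" using univ unfolding universe_def by simp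
  then show "A \<subseteq> el x \<Longrightarrow> A \<in> range el" by blast
  show "{x, y} \<in> range el" using univ unfolding universe_def by simp
  show "{z. el z \<subseteq> el x} \<in> range el" using univ unfolding universe_def by simp
  show "(\<Union>z\<in>el x. el (f z)) \<in> range el" using univ unfolding universe_def by simp
qed

lemma small_bij:
  assumes "small el A"
  obtains v f where "bij_betw f A (el v)"
proof -
  obtain v f where "inj_on f A" "f ` A \<subseteq> el v" using assms by (auto simp: small_def)
  moreover from el_sub[OF this(2)] obtain w where "f ` A = el w" by auto
  ultimately show thesis using that by (auto simp: bij_betw_def)
qed

lemma small_el: "small el (el x)"
  unfolding small_def by (rule exI[of _ x], rule exI[of _ id]) auto

lemma small_range: "A \<in> range el \<Longrightarrow> small el A"
  using small_el by auto

lemma small_sub: "small el A \<Longrightarrow> B \<subseteq> A \<Longrightarrow> small el B"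
  unfolding small_def by (meson image_mono inj_on_subset order_trans)

lemma small_inj: "inj_on f A \<Longrightarrow> f ` A \<subseteq> B \<Longrightarrow> small el B \<Longrightarrow> small el A"
  unfolding small_def by (metis comp_inj_on image_comp image_mono inj_on_subset order_trans)

lemma small_Pow:
  assumes "small el A"
  shows "small el (Pow A)"
proof -
  obtain v f where f: "inj_on f A" "f ` A \<subseteq> el v" using assms by (auto simp: small_def)
  obtain w where w: "{z. el z \<subseteq> el v} = el w" using el_Pow[of v] by auto
  have ex: "el (inv el (f ` X)) = f ` X" if "X \<subseteq> A" for X
    using el_sub[of "f ` X" v] that f(2) by (meson f_inv_into_f image_mono order_trans)
  have "inj_on (\<lambda>X. inv el (f ` X)) (Pow A)"
    by (rule inj_onI) (metis PowD ex f(1) inj_on_image_eq_iff)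
  moreover have "(\<lambda>X. inv el (f ` X)) ` Pow A \<subseteq> el w"
    using ex f(2) unfolding w[symmetric] by (simp add: image_subset_iff) blast
  ultimately show ?thesis unfolding small_def by blast
qed

text \<open>Kuratowski pairs inside the universe.\<close>

definition kpair :: "'v \<Rightarrow> 'v \<Rightarrow> 'v" where
  "kpair x y = inv el {inv el {x}, inv el {x, y}}"

lemma kpair_inj: "kpair x y = kpair x' y' \<longleftrightarrow> x = x' \<and> y = y'"
proof
  assume a: "kpair x y = kpair x' y'"
  have e: "el (inv el {a, b}) = {a, b}" for a b
    using el_pair[of a b] by (rule f_inv_into_f)
  have e1: "el (inv el {a}) = {a}" for a using e[of a a] by simp
  have "{inv el {x}, inv el {x, y}} = {inv el {x'}, inv el {x', y'}}"
    using arg_cong[OF a, of el] unfolding kpair_def e .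
  then have "el ` {inv el {x}, inv el {x, y}} = el ` {inv el {x'}, inv el {x', y'}}" by simp
  then have "{{x}, {x, y}} = {{x'}, {x', y'}}" by (simp only: image_insert image_empty e e1)
  then show "x = x' \<and> y = y'" by (metis doubleton_eq_iff singleton_insert_inj_eq)
qed simp

lemma el_image: "f ` el x \<in> range el"
proof -
  have e1: "el (inv el {a}) = {a}" for a
    using el_pair[of a a] by (simp add: f_inv_into_f)
  have "(\<Union>z\<in>el x. el (inv el {f z})) = f ` el x" by (auto simp: e1)
  then show ?thesis using el_Union[where x = x and f = "\<lambda>z. inv el {f z}"] by simp
qed

lemma small_Sigma:
  assumes A: "small el A" and B: "\<And>a. a \<in> A \<Longrightarrow> small el (B a)"
  shows "small el (Sigma A B)"
proof -
  obtain v f where f: "bij_betw f A (el v)" using small_bij[OF A] .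
  have "\<forall>a\<in>A. \<exists>g w. inj_on g (B a) \<and> g ` B a \<subseteq> el w"
    using B unfolding small_def by blast
  then obtain g w where g: "\<And>a. a \<in> A \<Longrightarrow> inj_on (g a) (B a)" "\<And>a. a \<in> A \<Longrightarrow> g a ` B a \<subseteq> el (w a)"
    by metis
  define h where "h = (\<lambda>(a, b). kpair (f a) (g a b))"
  have i: "inj_on h (Sigma A B)"
    using f g(1) by (auto simp: h_def inj_on_def kpair_inj bij_betw_def)
  define u where "u = (\<lambda>z. inv el (kpair z ` el (w (inv_into A f z))))"
  have u: "el (u z) = kpair z ` el (w (inv_into A f z))" for z
    unfolding u_def by (rule f_inv_into_f) (rule el_image)
  obtain x where x: "(\<Union>z\<in>el v. el (u z)) = el x" using el_Union[where x = v and f = u] by auto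
  have "h ` Sigma A B \<subseteq> el x"
  proof
    fix y assume "y \<in> h ` Sigma A B"
    then obtain a b where ab: "a \<in> A" "b \<in> B a" "y = kpair (f a) (g a b)" by (auto simp: h_def)
    have "f a \<in> el v" "inv_into A f (f a) = a"
      using f ab(1) by (auto simp: bij_betw_def)
    then have "y \<in> el (u (f a))" using ab g(2)[OF ab(1)] by (auto simp: u)
    then show "y \<in> el x" using \<open>f a \<in> el v\<close> x by blast
  qed
  with i show ?thesis by (auto simp: small_def)
qed

text \<open>A function is recovered from its graph, so a dependent product embeds into the power set of the sum.\<close>

lemma small_PiE:
  assumes A: "small el A" and B: "\<And>a. a \<in> A \<Longrightarrow> small el (B a)"
  shows "small el (PiE A B)"
proof (rule small_inj[where f = "\<lambda>f. (\<lambda>a. (a, f a)) ` A" and B = "Pow (Sigma A B)"])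
  show "inj_on (\<lambda>f. (\<lambda>a. (a, f a)) ` A) (PiE A B)"
  proof (rule inj_onI)
    fix f g assume fg: "f \<in> PiE A B" "g \<in> PiE A B" "(\<lambda>a. (a, f a)) ` A = (\<lambda>a. (a, g a)) ` A"
    show "f = g"
    proof (rule PiE_ext[OF fg(1,2)])
      fix a assume "a \<in> A"
      then have "(a, f a) \<in> (\<lambda>a. (a, g a)) ` A" using fg(3) by blast
      then show "f a = g a" by auto
    qed
  qed
qed (use small_Pow[OF small_Sigma[OF A B]] in auto)

end

lemma small_empty: "small el {}"
  by (simp add: small_def)

lemma small_insert:
  assumes u: "universe el" and A: "small el A"
  shows "small el (insert a A)"
proof (rule small_inj[OF u _ _ small_Pow[OF u A]])
  show "inj_on (\<lambda>x. if x \<in> A then {x} else {}) (insert a A)" by (auto simp: inj_on_def)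
qed auto

lemma small_finite:
  assumes u: "universe el" and A: "finite A"
  shows "small el A"
  using A by induction (auto intro: small_empty small_insert[OF u])

section \<open>Sections over a site\<close>

text \<open>A sheaf of sets on a site, presented by its sets of sections \<open>S c\<close> and its restriction maps
  \<open>\<rho> f\<close>, without reference to a universe.\<close>

definition set_sheaf ::
  "('c, 'm) cat \<Rightarrow> ('c \<Rightarrow> 'm set set) \<Rightarrow> ('c \<Rightarrow> 's set) \<Rightarrow> ('m \<Rightarrow> 's \<Rightarrow> 's) \<Rightarrow> bool" where
  "set_sheaf C J S \<rho> \<longleftrightarrow>
     (\<forall>f\<in>Arr C. \<forall>x\<in>S (Cod C f). \<rho> f x \<in> S (Dom C f)) \<and>
     (\<forall>c\<in>Obj C. \<forall>x\<in>S c. \<rho> (Id C c) x = x) \<and>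
     (\<forall>f\<in>Arr C. \<forall>g\<in>Arr C. Dom C g = Cod C f \<longrightarrow> (\<forall>x\<in>S (Cod C g). \<rho> (g \<cdot>\<^bsub>C\<^esub> f) x = \<rho> f (\<rho> g x))) \<and>
     (\<forall>c\<in>Obj C. \<forall>A\<in>J c. \<forall>x. (\<forall>f\<in>A. x f \<in> S (Dom C f)) \<and>
         (\<forall>f\<in>A. \<forall>g\<in>Arr C. Cod C g = Dom C f \<longrightarrow> \<rho> g (x f) = x (f \<cdot>\<^bsub>C\<^esub> g)) \<longrightarrow>
         (\<exists>!y. y \<in> S c \<and> (\<forall>f\<in>A. \<rho> f y = x f)))"

lemma set_sheafI:
  assumes "\<And>f d c x. f \<in> hom C d c \<Longrightarrow> x \<in> S c \<Longrightarrow> \<rho> f x \<in> S d"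
    and "\<And>c x. c \<in> Obj C \<Longrightarrow> x \<in> S c \<Longrightarrow> \<rho> (Id C c) x = x"
    and "\<And>f g b c d x. f \<in> hom C b c \<Longrightarrow> g \<in> hom C c d \<Longrightarrow> x \<in> S d \<Longrightarrow> \<rho> (g \<cdot>\<^bsub>C\<^esub> f) x = \<rho> f (\<rho> g x)"
    and "\<And>c A x. c \<in> Obj C \<Longrightarrow> A \<in> J c \<Longrightarrow> (\<And>f. f \<in> A \<Longrightarrow> x f \<in> S (Dom C f)) \<Longrightarrow>
        (\<And>f g d. f \<in> A \<Longrightarrow> g \<in> hom C d (Dom C f) \<Longrightarrow> \<rho> g (x f) = x (f \<cdot>\<^bsub>C\<^esub> g)) \<Longrightarrow>
         \<exists>!y. y \<in> S c \<and> (\<forall>f\<in>A. \<rho> f y = x f)"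
  shows "set_sheaf C J S \<rho>"
  unfolding set_sheaf_def
proof (intro conjI ballI allI impI)
  fix c A x assume "c \<in> Obj C" "A \<in> J c" "(\<forall>f\<in>A. x f \<in> S (Dom C f)) \<and>
         (\<forall>f\<in>A. \<forall>g\<in>Arr C. Cod C g = Dom C f \<longrightarrow> \<rho> g (x f) = x (f \<cdot>\<^bsub>C\<^esub> g))"
  then show "\<exists>!y. y \<in> S c \<and> (\<forall>f\<in>A. \<rho> f y = x f)"
    by (intro assms(4)) (auto simp: hom_def)
qed (auto intro: assms(1,2) assms(3) simp: hom_def)

lemma set_sheafD:
  assumes "set_sheaf C J S \<rho>"
  shows "f \<in> hom C d c \<Longrightarrow> x \<in> S c \<Longrightarrow> \<rho> f x \<in> S d"
    and "c \<in> Obj C \<Longrightarrow> x \<in> S c \<Longrightarrow> \<rho> (Id C c) x = x"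
    and "f \<in> hom C b c \<Longrightarrow> g \<in> hom C c d \<Longrightarrow> x \<in> S d \<Longrightarrow> \<rho> (g \<cdot>\<^bsub>C\<^esub> f) x = \<rho> f (\<rho> g x)"
    and "c \<in> Obj C \<Longrightarrow> A \<in> J c \<Longrightarrow> (\<And>f. f \<in> A \<Longrightarrow> y f \<in> S (Dom C f)) \<Longrightarrow>
        (\<And>f g d. f \<in> A \<Longrightarrow> g \<in> hom C d (Dom C f) \<Longrightarrow> \<rho> g (y f) = y (f \<cdot>\<^bsub>C\<^esub> g)) \<Longrightarrow>
         \<exists>!x. x \<in> S c \<and> (\<forall>f\<in>A. \<rho> f x = y f)"
proof -
  note a = assms[unfolded set_sheaf_def]
  show "f \<in> hom C d c \<Longrightarrow> x \<in> S c \<Longrightarrow> \<rho> f x \<in> S d"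
    using conjunct1[OF a] by (auto simp: hom_def)
  show "c \<in> Obj C \<Longrightarrow> x \<in> S c \<Longrightarrow> \<rho> (Id C c) x = x"
    using conjunct1[OF conjunct2[OF a]] by simp
  show "f \<in> hom C b c \<Longrightarrow> g \<in> hom C c d \<Longrightarrow> x \<in> S d \<Longrightarrow> \<rho> (g \<cdot>\<^bsub>C\<^esub> f) x = \<rho> f (\<rho> g x)"
    using conjunct1[OF conjunct2[OF conjunct2[OF a]]] by (simp add: hom_def)
  assume c: "c \<in> Obj C" "A \<in> J c" and y: "\<And>f. f \<in> A \<Longrightarrow> y f \<in> S (Dom C f)"
    "\<And>f g d. f \<in> A \<Longrightarrow> g \<in> hom C d (Dom C f) \<Longrightarrow> \<rho> g (y f) = y (f \<cdot>\<^bsub>C\<^esub> g)"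
  show "\<exists>!x. x \<in> S c \<and> (\<forall>f\<in>A. \<rho> f x = y f)"
    by (rule conjunct2[OF conjunct2[OF conjunct2[OF a]], rule_format, OF c]) (use y in \<open>auto simp: hom_def\<close>)
qed

text \<open>A Grothendieck topos seen through the sections of its objects over a small site: every object
  has a sheaf of sections, arrows are the natural maps of sections, and every small sheaf is
  isomorphic to the sheaf of sections of an object.\<close>

locale sheaf_topos =
  fixes el :: "'v \<Rightarrow> 'v set" and C :: "('v, 'v) cat" and J :: "'v \<Rightarrow> 'v set set"
    and E :: "('o, 'a) cat"
    and sec :: "'o \<Rightarrow> 'v \<Rightarrow> 'v set" and res :: "'o \<Rightarrow> 'v \<Rightarrow> 'v \<Rightarrow> 'v"
    and act :: "'a \<Rightarrow> 'v \<Rightarrow> 'v \<Rightarrow> 'v"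
  assumes univ: "universe el"
    and catC: "category C" and small_Obj: "Obj C \<in> range el" and small_Arr: "Arr C \<in> range el"
    and top: "grothendieck_topology C J"
    and catE: "category E"
    and sec_range: "X \<in> Obj E \<Longrightarrow> c \<in> Obj C \<Longrightarrow> sec X c \<in> range el"
    and sec_sheaf: "X \<in> Obj E \<Longrightarrow> set_sheaf C J (sec X) (res X)"
    and act_in: "a \<in> hom E X Y \<Longrightarrow> c \<in> Obj C \<Longrightarrow> x \<in> sec X c \<Longrightarrow> act a c x \<in> sec Y c"
    and act_nat: "a \<in> hom E X Y \<Longrightarrow> f \<in> hom C d c \<Longrightarrow> x \<in> sec X c \<Longrightarrow>
      act a d (res X f x) = res Y f (act a c x)"
    and act_id: "X \<in> Obj E \<Longrightarrow> c \<in> Obj C \<Longrightarrow> x \<in> sec X c \<Longrightarrow> act (Id E X) c x = x"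
    and act_comp: "a \<in> hom E X Y \<Longrightarrow> b \<in> hom E Y Z \<Longrightarrow> c \<in> Obj C \<Longrightarrow> x \<in> sec X c \<Longrightarrow>
      act (b \<cdot>\<^bsub>E\<^esub> a) c x = act b c (act a c x)"
    and full: "X \<in> Obj E \<Longrightarrow> Y \<in> Obj E \<Longrightarrow>
      (\<And>c x. c \<in> Obj C \<Longrightarrow> x \<in> sec X c \<Longrightarrow> \<phi> c x \<in> sec Y c) \<Longrightarrow>
      (\<And>f d c x. f \<in> hom C d c \<Longrightarrow> x \<in> sec X c \<Longrightarrow> \<phi> d (res X f x) = res Y f (\<phi> c x)) \<Longrightarrow>
      \<exists>a\<in>hom E X Y. \<forall>c\<in>Obj C. \<forall>x\<in>sec X c. act a c x = \<phi> c x"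
    and faithful: "a \<in> hom E X Y \<Longrightarrow> b \<in> hom E X Y \<Longrightarrow>
      (\<And>c x. c \<in> Obj C \<Longrightarrow> x \<in> sec X c \<Longrightarrow> act a c x = act b c x) \<Longrightarrow> a = b"
    and represent: "set_sheaf C J S \<rho> \<Longrightarrow> (\<And>c. c \<in> Obj C \<Longrightarrow> S c \<in> range el) \<Longrightarrow>
      \<exists>X\<in>Obj E. \<exists>\<beta>. (\<forall>c\<in>Obj C. bij_betw (\<beta> c) (sec X c) (S c)) \<and>
        (\<forall>f d c x. f \<in> hom C d c \<longrightarrow> x \<in> sec X c \<longrightarrow> \<beta> d (res X f x) = \<rho> f (\<beta> c x))"

lemma op_cat_simps:
  "Obj (op_cat C) = Obj C" "Arr (op_cat C) = Arr C" "Dom (op_cat C) = Cod C" "Cod (op_cat C) = Dom C"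
  "Id (op_cat C) = Id C" "g \<cdot>\<^bsub>op_cat C\<^esub> f = f \<cdot>\<^bsub>C\<^esub> g" "hom (op_cat C) c d = hom C d c"
  by (auto simp: op_cat_def hom_def)

lemma category_op_cat: "category C \<Longrightarrow> category (op_cat C)"
  by (rule categoryI) (auto simp: op_cat_simps hom_def category_def)

lemma full_subcat_simps:
  "Obj (full_subcat D P) = Obj D \<inter> P"
  "Arr (full_subcat D P) = {f \<in> Arr D. Dom D f \<in> P \<and> Cod D f \<in> P}"
  "Dom (full_subcat D P) = Dom D" "Cod (full_subcat D P) = Cod D" "Id (full_subcat D P) = Id D"
  "g \<cdot>\<^bsub>full_subcat D P\<^esub> f = g \<cdot>\<^bsub>D\<^esub> f"
  by (simp_all add: full_subcat_def)

text \<open>Sheaves valued in the universe and their natural transformations, spelled out.\<close>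

lemma sheaf_cat_Obj:
  "P \<in> Obj (sheaf_cat el C J) \<longleftrightarrow> P \<in> functors (op_cat C) (set_cat el) \<and> is_sheaf el C J P"
  by (simp add: sheaf_cat_def full_subcat_simps functor_cat_simps)

lemma sheaf_cat_hom:
  "a \<in> hom (sheaf_cat el C J) P Q \<longleftrightarrow> P \<in> Obj (sheaf_cat el C J) \<and> Q \<in> Obj (sheaf_cat el C J) \<and>
     (\<exists>t. a = (P, t, Q) \<and> t \<in> extensional (Obj C) \<and>
        (\<forall>c\<in>Obj C. t c \<in> hom (set_cat el) (FO P c) (FO Q c)) \<and>
        (\<forall>f\<in>Arr C. t (Dom C f) \<cdot>\<^bsub>set_cat el\<^esub> FA P f = FA Q f \<cdot>\<^bsub>set_cat el\<^esub> t (Cod C f)))"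
  unfolding hom_def[of "sheaf_cat el C J"] mem_Collect_eq sheaf_cat_Obj
  by (cases a) (auto simp: sheaf_cat_def full_subcat_simps functor_cat_simps op_cat_simps)

lemma sheaf_cat_comp: "(Q, u, R) \<cdot>\<^bsub>sheaf_cat el C J\<^esub> (P, t, Q') = (P, (\<lambda>c\<in>Obj C. u c \<cdot>\<^bsub>set_cat el\<^esub> t c), R)"
  and sheaf_cat_Id: "Id (sheaf_cat el C J) P = (P, (\<lambda>c\<in>Obj C. Id (set_cat el) (FO P c)), P)"
  by (simp_all add: sheaf_cat_def full_subcat_simps functor_cat_simps op_cat_simps)

text \<open>The two presentations of a sheaf agree: a functor to the category of sets with the sheaf property
  has a sheaf of sections, and conversely a sheaf of sets whose values are elements of the universe
  comes from such a functor.\<close>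

lemma set_sheaf_of_sheaf:
  assumes P: "P \<in> Obj (sheaf_cat el C J)"
  shows "set_sheaf C J (\<lambda>c. el (FO P c)) (\<lambda>f. app (FA P f))"
proof -
  have F: "is_functor (op_cat C) (set_cat el) P" and S: "is_sheaf el C J P"
    using P by (auto simp: sheaf_cat_Obj functors_def)
  have h: "FA P f \<in> hom (set_cat el) (FO P (Cod C f)) (FO P (Dom C f))" if "f \<in> Arr C" for f
    by (rule functor_arr[OF F]) (use that in \<open>auto simp: op_cat_simps hom_def\<close>)
  have "app (FA P (g \<cdot>\<^bsub>C\<^esub> f)) x = app (FA P f) (app (FA P g) x)"
    if "f \<in> Arr C" "g \<in> Arr C" "Dom C g = Cod C f" "x \<in> el (FO P (Cod C g))" for f g x
  proof -
    have "FA P (g \<cdot>\<^bsub>C\<^esub> f) = FA P f \<cdot>\<^bsub>set_cat el\<^esub> FA P g"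
      using functor_comp[OF F, of g "Cod C g" "Dom C g" f "Dom C f"] that by (simp add: op_cat_simps hom_def)
    then show ?thesis using app_comp_apply[OF h[OF that(2)] that(4)] by simp
  qed
  moreover have "app (FA P (Id C c)) x = x" if "c \<in> Obj C" "x \<in> el (FO P c)" for c x
    using functor_id[OF F, of c] that by (simp add: op_cat_simps app_Id)
  ultimately show ?thesis
    using S app_in[OF h] unfolding set_sheaf_def is_sheaf_def by simp
qed

lemma sheaf_of_set_sheaf:
  assumes C: "category C" and S: "set_sheaf C J S \<rho>" and r: "\<And>c. c \<in> Obj C \<Longrightarrow> S c \<in> range el"
    and J: "\<And>c A f. c \<in> Obj C \<Longrightarrow> A \<in> J c \<Longrightarrow> f \<in> A \<Longrightarrow> f \<in> Arr C \<and> Cod C f = c"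
  obtains P where "P \<in> Obj (sheaf_cat el C J)" "\<And>c. c \<in> Obj C \<Longrightarrow> el (FO P c) = S c"
    "\<And>f x. f \<in> Arr C \<Longrightarrow> x \<in> S (Cod C f) \<Longrightarrow> app (FA P f) x = \<rho> f x"
proof -
  define P where "P = \<lparr>FO = (\<lambda>c\<in>Obj C. inv el (S c)),
    FA = (\<lambda>f\<in>Arr C. (inv el (S (Cod C f)), restrict (\<rho> f) (S (Cod C f)), inv el (S (Dom C f))))\<rparr>"
  have e: "el (inv el (S c)) = S c" if "c \<in> Obj C" for c using r[OF that] by (simp add: f_inv_into_f)
  have FO: "el (FO P c) = S c" if "c \<in> Obj C" for c using that e by (simp add: P_def)
  have FA: "app (FA P f) = restrict (\<rho> f) (S (Cod C f))" if "f \<in> Arr C" for f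
    using that by (simp add: P_def app_def)
  have S1: "\<rho> f x \<in> S (Dom C f)" if "f \<in> Arr C" "x \<in> S (Cod C f)" for f x
    using S that by (simp add: set_sheaf_def)
  have S2: "\<rho> (Id C c) x = x" if "c \<in> Obj C" "x \<in> S c" for c x
    using S that by (simp add: set_sheaf_def)
  have S3: "\<rho> (g \<cdot>\<^bsub>C\<^esub> f) x = \<rho> f (\<rho> g x)" if "f \<in> Arr C" "g \<in> Arr C" "Dom C g = Cod C f" "x \<in> S (Cod C g)" for f g x
    using S that by (simp add: set_sheaf_def)
  have h: "FA P f \<in> hom (set_cat el) (FO P (Cod C f)) (FO P (Dom C f))" if "f \<in> Arr C" for f
  proof -
    have "Dom C f \<in> Obj C" "Cod C f \<in> Obj C" using C that by (auto simp: cat_dom_obj cat_cod_obj)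
    then show ?thesis using that S1[OF that] FO FA[OF that] by (auto simp: hom_set_cat) (auto simp: P_def)
  qed
  have F: "is_functor (op_cat C) (set_cat el) P"
    unfolding is_functor_def op_cat_simps
  proof (intro conjI ballI impI)
    fix c assume c: "c \<in> Obj C"
    then have i: "Id C c \<in> hom C c c" using cat_id[OF C] by simp
    show "FA P (Id C c) = Id (set_cat el) (FO P c)"
      by (rule set_cat_ext[of _ el "FO P c" "FO P c"])
        (use h[of "Id C c"] i FA[of "Id C c"] S2[OF c] FO[OF c] in \<open>auto simp: hom_def[of C] set_cat_id app_Id\<close>)
  next
    fix f g assume f: "f \<in> Arr C" "g \<in> Arr C" "Cod C g = Dom C f"
    have fg: "f \<cdot>\<^bsub>C\<^esub> g \<in> Arr C" "Dom C (f \<cdot>\<^bsub>C\<^esub> g) = Dom C g" "Cod C (f \<cdot>\<^bsub>C\<^esub> g) = Cod C f"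
      using cat_comp[OF C, of g "Dom C g" "Cod C g" f "Cod C f"] f by (auto simp: hom_def)
    have hg: "FA P g \<in> hom (set_cat el) (FO P (Dom C f)) (FO P (Dom C g))" using h[OF f(2)] f(3) by simp
    have o: "Dom C f \<in> Obj C" "Cod C f \<in> Obj C" using C f by (auto simp: cat_dom_obj cat_cod_obj)
    show "FA P (f \<cdot>\<^bsub>C\<^esub> g) = FA P g \<cdot>\<^bsub>set_cat el\<^esub> FA P f"
      by (rule set_cat_ext[OF h[OF fg(1), unfolded fg] set_cat_comp[OF h[OF f(1)] hg]])
        (use f fg o S3[OF f(2,1)] S1 in \<open>simp add: app_comp_apply[OF h[OF f(1)]] FA FO\<close>)
  qed (use C h in \<open>auto simp: category_op_cat category_set_cat\<close>)
  have "is_sheaf el C J P"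
    unfolding is_sheaf_def
  proof (intro ballI allI impI)
    fix c A x
    assume c: "c \<in> Obj C" and A: "A \<in> J c"
      and x: "(\<forall>f\<in>A. x f \<in> el (FO P (Dom C f))) \<and> (\<forall>f\<in>A. \<forall>g\<in>Arr C. Cod C g = Dom C f \<longrightarrow> app (FA P g) (x f) = x (f \<cdot>\<^bsub>C\<^esub> g))"
    show "\<exists>!y. y \<in> el (FO P c) \<and> (\<forall>f\<in>A. app (FA P f) y = x f)"
    proof -
      have T: "f \<in> Arr C" "Cod C f = c" "Dom C f \<in> Obj C" if "f \<in> A" for f
        using J[OF c A that] C by (auto simp: cat_dom_obj)
      have "\<rho> g (x f) = x (f \<cdot>\<^bsub>C\<^esub> g)" if "f \<in> A" "g \<in> Arr C" "Cod C g = Dom C f" for f g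
      proof -
        have "x f \<in> S (Cod C g)" using x that FO[OF T(3)[OF that(1)]] by auto
        moreover have "app (FA P g) (x f) = x (f \<cdot>\<^bsub>C\<^esub> g)" using x that by blast
        ultimately show ?thesis using FA[OF that(2)] by simp
      qed
      then have "(\<forall>f\<in>A. x f \<in> S (Dom C f)) \<and> (\<forall>f\<in>A. \<forall>g\<in>Arr C. Cod C g = Dom C f \<longrightarrow> \<rho> g (x f) = x (f \<cdot>\<^bsub>C\<^esub> g))"
        using x FO T(3) by simp
      then have "\<exists>!y. y \<in> S c \<and> (\<forall>f\<in>A. \<rho> f y = x f)"
        by (intro set_sheafD(4)[OF S c A]) (auto simp: hom_def)
      moreover have "(y \<in> el (FO P c) \<and> (\<forall>f\<in>A. app (FA P f) y = x f)) = (y \<in> S c \<and> (\<forall>f\<in>A. \<rho> f y = x f))" for y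
        using T FA FO[OF c] by auto
      ultimately show ?thesis by simp
    qed
  qed
  moreover have "P \<in> functors (op_cat C) (set_cat el)"
  proof -
    have "FO P \<in> extensional (Obj C)" "FA P \<in> extensional (Arr C)" by (simp_all add: P_def)
    with F show ?thesis by (simp add: functors_def op_cat_simps)
  qed
  ultimately show thesis
    using that[of P] FO FA by (simp add: sheaf_cat_Obj)
qed

text \<open>Sections are those of the sheaf that corresponds to an object under the equivalence with a category
  of sheaves; the clauses of the locale hold because the equivalence is full, faithful and essentially
  surjective.\<close>

theorem sheaf_topos_of_grothendieck_topos:
  fixes el :: "'v \<Rightarrow> 'v set" and E :: "('o, 'a) cat"
  assumes univ: "universe el" and E: "grothendieck_topos el E"
  obtains C J sec res act where "sheaf_topos el C J E sec res act"
proof -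
  obtain C :: "('v, 'v) cat" and J where C: "category C" "Obj C \<in> range el" "Arr C \<in> range el"
    and J: "grothendieck_topology C J" and eq: "equivalent_categories E (sheaf_cat el C J)"
    using E by (auto simp: grothendieck_topos_def)
  obtain F where F: "is_functor E (sheaf_cat el C J) F"
    and ff: "\<And>A B. A \<in> Obj E \<Longrightarrow> B \<in> Obj E \<Longrightarrow> bij_betw (FA F) (hom E A B) (hom (sheaf_cat el C J) (FO F A) (FO F B))"
    and es: "\<And>Y. Y \<in> Obj (sheaf_cat el C J) \<Longrightarrow> \<exists>A\<in>Obj E. \<exists>f\<in>hom (sheaf_cat el C J) (FO F A) Y. is_iso (sheaf_cat el C J) f"
    using eq unfolding equivalent_categories_def by blast
  note catE = functor_cats(1)[OF F]
  define sec where "sec X c = el (FO (FO F X) c)" for X c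
  define res where "res X f = app (FA (FO F X) f)" for X f
  define act where "act a c = app (fst (snd (FA F a)) c)" for a c
  note o = functor_obj[OF F]
  have arr: "\<exists>t. FA F a = (FO F X, t, FO F Y) \<and> t \<in> extensional (Obj C) \<and>
        (\<forall>c\<in>Obj C. t c \<in> hom (set_cat el) (FO (FO F X) c) (FO (FO F Y) c)) \<and>
        (\<forall>f\<in>Arr C. t (Dom C f) \<cdot>\<^bsub>set_cat el\<^esub> FA (FO F X) f = FA (FO F Y) f \<cdot>\<^bsub>set_cat el\<^esub> t (Cod C f))"
    if "a \<in> hom E X Y" for a X Y
    using functor_arr[OF F that] unfolding sheaf_cat_hom by blast
  have resh: "FA P f \<in> hom (set_cat el) (FO P c) (FO P d)"
    if "P \<in> Obj (sheaf_cat el C J)" "f \<in> hom C d c" for P f c d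
    using functor_arr[of "op_cat C" "set_cat el" P f c d] that by (simp add: sheaf_cat_Obj functors_def op_cat_simps)
  have JA: "f \<in> Arr C \<and> Cod C f = c" if "c \<in> Obj C" "A \<in> J c" "f \<in> A" for c A f
  proof -
    have "\<forall>c\<in>Obj C. \<forall>A\<in>J c. sieve C c A" using J unfolding grothendieck_topology_def by (rule conjunct1)
    then have "sieve C c A" using that by simp
    then show ?thesis using that unfolding sieve_def by auto
  qed
  have "sheaf_topos el C J E sec res act"
  proof
    show "universe el" "category C" "Obj C \<in> range el" "Arr C \<in> range el" "grothendieck_topology C J" "category E"
      by fact+
    show "sec X c \<in> range el" for X c by (simp add: sec_def)
    show "set_sheaf C J (sec X) (res X)" if "X \<in> Obj E" for X
      using set_sheaf_of_sheaf[OF o[OF that]] by (simp add: sec_def[abs_def] res_def[abs_def])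
  next
    fix a X Y c x assume a: "a \<in> hom E X Y" "c \<in> Obj C" "x \<in> sec X c"
    obtain t where "FA F a = (FO F X, t, FO F Y)" "t c \<in> hom (set_cat el) (FO (FO F X) c) (FO (FO F Y) c)"
      using arr[OF a(1)] a(2) by blast
    then show "act a c x \<in> sec Y c" using a(3) app_in[of "t c"] by (simp add: act_def sec_def)
  next
    fix a X Y f d c x assume a: "a \<in> hom E X Y" "f \<in> hom C d c" "x \<in> sec X c"
    obtain t where t: "FA F a = (FO F X, t, FO F Y)"
      "t c \<in> hom (set_cat el) (FO (FO F X) c) (FO (FO F Y) c)"
      "t d \<cdot>\<^bsub>set_cat el\<^esub> FA (FO F X) f = FA (FO F Y) f \<cdot>\<^bsub>set_cat el\<^esub> t c"
      using arr[OF a(1)] a(2) cat_obj[OF C(1) a(2)] by (auto simp: hom_def[of C])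
    have "app (t d \<cdot>\<^bsub>set_cat el\<^esub> FA (FO F X) f) x = app (t d) (app (FA (FO F X) f) x)"
      by (rule app_comp_apply[OF resh[OF o[OF cat_obj(1)[OF catE a(1)]] a(2)]]) (use a(3) in \<open>simp add: sec_def\<close>)
    moreover have "app (FA (FO F Y) f \<cdot>\<^bsub>set_cat el\<^esub> t c) x = app (FA (FO F Y) f) (app (t c) x)"
      by (rule app_comp_apply[OF t(2)]) (use a(3) in \<open>simp add: sec_def\<close>)
    ultimately show "act a d (res X f x) = res Y f (act a c x)"
      using t by (simp add: act_def res_def)
  next
    fix X c x assume a: "X \<in> Obj E" "c \<in> Obj C" "x \<in> sec X c"
    then show "act (Id E X) c x = x"
      using functor_id[OF F a(1)] by (simp add: act_def sheaf_cat_Id app_Id sec_def)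
  next
    fix a b X Y Z c x assume a: "a \<in> hom E X Y" "b \<in> hom E Y Z" "c \<in> Obj C" "x \<in> sec X c"
    obtain t where t: "FA F a = (FO F X, t, FO F Y)"
      "t c \<in> hom (set_cat el) (FO (FO F X) c) (FO (FO F Y) c)"
      using arr[OF a(1)] a(3) by blast
    obtain u where u: "FA F b = (FO F Y, u, FO F Z)" using arr[OF a(2)] by blast
    show "act (b \<cdot>\<^bsub>E\<^esub> a) c x = act b c (act a c x)"
      using functor_comp[OF F a(1,2)] app_comp_apply[OF t(2), of x "u c"] a(3,4)
      by (simp add: act_def t u sheaf_cat_comp sec_def)
  next
    fix X Y \<phi>
    assume XY: "X \<in> Obj E" "Y \<in> Obj E"
      and in1: "\<And>c x. c \<in> Obj C \<Longrightarrow> x \<in> sec X c \<Longrightarrow> \<phi> c x \<in> sec Y c"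
      and nat: "\<And>f d c x. f \<in> hom C d c \<Longrightarrow> x \<in> sec X c \<Longrightarrow> \<phi> d (res X f x) = res Y f (\<phi> c x)"
    define t where "t = (\<lambda>c\<in>Obj C. (FO (FO F X) c, restrict (\<phi> c) (sec X c), FO (FO F Y) c))"
    have t: "t c \<in> hom (set_cat el) (FO (FO F X) c) (FO (FO F Y) c)" if "c \<in> Obj C" for c
      using in1[OF that] that by (auto simp: t_def sec_def intro!: hom_set_catI)
    have at: "app (t c) x = \<phi> c x" if "c \<in> Obj C" "x \<in> sec X c" for c x
      using that by (simp add: t_def app_def)
    have "t (Dom C f) \<cdot>\<^bsub>set_cat el\<^esub> FA (FO F X) f = FA (FO F Y) f \<cdot>\<^bsub>set_cat el\<^esub> t (Cod C f)"
      if f: "f \<in> Arr C" for f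
    proof -
      have fh: "f \<in> hom C (Dom C f) (Cod C f)" using f by (simp add: hom_def)
      note oc = cat_obj[OF C(1) fh]
      note r1 = resh[OF o[OF XY(1)] fh] and r2 = resh[OF o[OF XY(2)] fh]
      show ?thesis
      proof (rule set_cat_ext[OF set_cat_comp[OF r1 t[OF oc(1)]] set_cat_comp[OF t[OF oc(2)] r2]])
        fix x assume x: "x \<in> el (FO (FO F X) (Cod C f))"
        have "app (FA (FO F X) f) x \<in> sec X (Dom C f)" using app_in[OF r1 x] by (simp add: sec_def)
        then show "app (t (Dom C f) \<cdot>\<^bsub>set_cat el\<^esub> FA (FO F X) f) x = app (FA (FO F Y) f \<cdot>\<^bsub>set_cat el\<^esub> t (Cod C f)) x"
          using nat[OF fh, of x] x at oc
          by (simp add: app_comp_apply[OF r1 x] app_comp_apply[OF t[OF oc(2)] x] sec_def[symmetric] res_def)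
      qed
    qed
    then have "(FO F X, t, FO F Y) \<in> hom (sheaf_cat el C J) (FO F X) (FO F Y)"
      using t o XY by (auto simp: sheaf_cat_hom t_def)
    then have "(FO F X, t, FO F Y) \<in> FA F ` hom E X Y"
      using bij_betw_imp_surj_on[OF ff[OF XY]] by simp
    then obtain a where "a \<in> hom E X Y" "FA F a = (FO F X, t, FO F Y)" by auto
    then show "\<exists>a\<in>hom E X Y. \<forall>c\<in>Obj C. \<forall>x\<in>sec X c. act a c x = \<phi> c x"
      using at by (auto simp: act_def intro!: bexI[of _ a])
  next
    fix a b X Y assume a: "a \<in> hom E X Y" and b: "b \<in> hom E X Y"
      and ab: "\<And>c x. c \<in> Obj C \<Longrightarrow> x \<in> sec X c \<Longrightarrow> act a c x = act b c x"
    obtain t where t: "FA F a = (FO F X, t, FO F Y)" "t \<in> extensional (Obj C)"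
      "\<And>c. c \<in> Obj C \<Longrightarrow> t c \<in> hom (set_cat el) (FO (FO F X) c) (FO (FO F Y) c)"
      using arr[OF a] by blast
    obtain u where u: "FA F b = (FO F X, u, FO F Y)" "u \<in> extensional (Obj C)"
      "\<And>c. c \<in> Obj C \<Longrightarrow> u c \<in> hom (set_cat el) (FO (FO F X) c) (FO (FO F Y) c)"
      using arr[OF b] by blast
    have "t = u"
    proof (rule extensionalityI[OF t(2) u(2)])
      fix c assume c: "c \<in> Obj C"
      show "t c = u c"
        by (rule set_cat_ext[OF t(3)[OF c] u(3)[OF c]]) (use ab[OF c] in \<open>simp add: sec_def act_def t u\<close>)
    qed
    then have "FA F a = FA F b" using t u by simp
    then show "a = b" using ff[OF cat_obj[OF catE a]] a b by (auto simp: bij_betw_def inj_on_def)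
  next
    fix S :: "'v \<Rightarrow> 'v set" and \<rho> assume S: "set_sheaf C J S \<rho>" and r: "\<And>c. c \<in> Obj C \<Longrightarrow> S c \<in> range el"
    obtain P where P: "P \<in> Obj (sheaf_cat el C J)" "\<And>c. c \<in> Obj C \<Longrightarrow> el (FO P c) = S c"
      "\<And>f x. f \<in> Arr C \<Longrightarrow> x \<in> S (Cod C f) \<Longrightarrow> app (FA P f) x = \<rho> f x"
      by (rule sheaf_of_set_sheaf[OF C(1) S r]) (use JA in blast)+
    obtain X f where X: "X \<in> Obj E" and f: "f \<in> hom (sheaf_cat el C J) (FO F X) P"
      and iso: "is_iso (sheaf_cat el C J) f"
      using es[OF P(1)] by blast
    obtain g where g: "g \<in> hom (sheaf_cat el C J) P (FO F X)"
      "g \<cdot>\<^bsub>sheaf_cat el C J\<^esub> f = Id (sheaf_cat el C J) (FO F X)"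
      "f \<cdot>\<^bsub>sheaf_cat el C J\<^esub> g = Id (sheaf_cat el C J) P"
      using iso f by (auto simp: is_iso_def hom_def)
    obtain t where t: "f = (FO F X, t, P)"
      "\<And>c. c \<in> Obj C \<Longrightarrow> t c \<in> hom (set_cat el) (FO (FO F X) c) (FO P c)"
      "\<And>h. h \<in> Arr C \<Longrightarrow> t (Dom C h) \<cdot>\<^bsub>set_cat el\<^esub> FA (FO F X) h = FA P h \<cdot>\<^bsub>set_cat el\<^esub> t (Cod C h)"
      using f unfolding sheaf_cat_hom by blast
    obtain u where u: "g = (P, u, FO F X)"
      "\<And>c. c \<in> Obj C \<Longrightarrow> u c \<in> hom (set_cat el) (FO P c) (FO (FO F X) c)"
      using g(1) unfolding sheaf_cat_hom by blast
    have b: "bij_betw (app (t c)) (sec X c) (S c)" if c: "c \<in> Obj C" for c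
    proof (rule bij_betwI[where g = "app (u c)"])
      show "app (t c) \<in> sec X c \<rightarrow> S c" "app (u c) \<in> S c \<rightarrow> sec X c"
        using app_in[OF t(2)[OF c]] app_in[OF u(2)[OF c]] P(2)[OF c] by (auto simp: sec_def)
      have "(\<lambda>c\<in>Obj C. u c \<cdot>\<^bsub>set_cat el\<^esub> t c) = (\<lambda>c\<in>Obj C. Id (set_cat el) (FO (FO F X) c))"
        using g(2) by (simp add: t u sheaf_cat_comp sheaf_cat_Id)
      from fun_cong[OF this, of c] have "u c \<cdot>\<^bsub>set_cat el\<^esub> t c = Id (set_cat el) (FO (FO F X) c)"
        using c by simp
      then show "app (u c) (app (t c) x) = x" if "x \<in> sec X c" for x
        using app_comp_apply[OF t(2)[OF c], of x "u c"] that by (simp add: sec_def app_Id)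
      have "(\<lambda>c\<in>Obj C. t c \<cdot>\<^bsub>set_cat el\<^esub> u c) = (\<lambda>c\<in>Obj C. Id (set_cat el) (FO P c))"
        using g(3) by (simp add: t u sheaf_cat_comp sheaf_cat_Id)
      from fun_cong[OF this, of c] have "t c \<cdot>\<^bsub>set_cat el\<^esub> u c = Id (set_cat el) (FO P c)"
        using c by simp
      then show "app (t c) (app (u c) x) = x" if "x \<in> S c" for x
        using app_comp_apply[OF u(2)[OF c], of x "t c"] that P(2)[OF c] by (simp add: app_Id)
    qed
    have "app (t d) (res X h x) = \<rho> h (app (t c) x)" if h: "h \<in> hom C d c" and x: "x \<in> sec X c" for h d c x
    proof -
      note oc = cat_obj[OF C(1) h]
      have x': "x \<in> el (FO (FO F X) c)" using x by (simp add: sec_def)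
      have "app (t d) (res X h x) = app (t d \<cdot>\<^bsub>set_cat el\<^esub> FA (FO F X) h) x"
        by (simp add: app_comp_apply[OF resh[OF o[OF X] h] x'] res_def)
      also have "\<dots> = app (FA P h \<cdot>\<^bsub>set_cat el\<^esub> t c) x"
        using t(3)[of h] h by (simp add: hom_def[of C])
      also have "\<dots> = app (FA P h) (app (t c) x)" by (rule app_comp_apply[OF t(2)[OF oc(2)] x'])
      also have "\<dots> = \<rho> h (app (t c) x)"
        using P(3)[of h "app (t c) x"] h app_in[OF t(2)[OF oc(2)] x'] P(2)[OF oc(2)] by (simp add: hom_def[of C])
      finally show ?thesis .
    qed
    then show "\<exists>X\<in>Obj E. \<exists>\<beta>. (\<forall>c\<in>Obj C. bij_betw (\<beta> c) (sec X c) (S c)) \<and>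
        (\<forall>f d c x. f \<in> hom C d c \<longrightarrow> x \<in> sec X c \<longrightarrow> \<beta> d (res X f x) = \<rho> f (\<beta> c x))"
      using b X by (intro bexI[of _ X] exI[of _ "\<lambda>c. app (t c)"]) auto
  qed
  then show thesis by (rule that)
qed

section \<open>Local reasoning in a topos of sheaves\<close>

context sheaf_topos
begin

lemma J_sieve: "c \<in> Obj C \<Longrightarrow> A \<in> J c \<Longrightarrow> sieve C c A"
  using conjunct1[OF top[unfolded grothendieck_topology_def]] by simp

lemma J_max: "c \<in> Obj C \<Longrightarrow> {f \<in> Arr C. Cod C f = c} \<in> J c"
  using conjunct1[OF conjunct2[OF top[unfolded grothendieck_topology_def]]] by simp

lemma J_pull: "h \<in> hom C d c \<Longrightarrow> A \<in> J c \<Longrightarrow> pull_sieve C h A \<in> J d"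
  using conjunct1[OF conjunct2[OF conjunct2[OF top[unfolded grothendieck_topology_def]]]] by (auto simp: hom_def)

lemma J_trans: "c \<in> Obj C \<Longrightarrow> A \<in> J c \<Longrightarrow> sieve C c R \<Longrightarrow>
  (\<And>h. h \<in> A \<Longrightarrow> pull_sieve C h R \<in> J (Dom C h)) \<Longrightarrow> R \<in> J c"
  using conjunct2[OF conjunct2[OF conjunct2[OF top[unfolded grothendieck_topology_def]]]] by simp

lemma J_hom: "c \<in> Obj C \<Longrightarrow> A \<in> J c \<Longrightarrow> f \<in> A \<Longrightarrow> f \<in> hom C (Dom C f) c"
  using J_sieve by (auto simp: sieve_def hom_def)

lemmas compC = cat_comp[OF catC] and idC = cat_id[OF catC] and unitC = cat_unit[OF catC]
  and assocC = cat_assoc[OF catC] and objC = cat_obj[OF catC]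
lemmas compE = cat_comp[OF catE] and idE = cat_id[OF catE] and unitE = cat_unit[OF catE]
  and assocE = cat_assoc[OF catE] and objE = cat_obj[OF catE]

text \<open>The property \<open>P\<close> of arrows into \<open>c\<close> holds locally on \<open>c\<close>: the arrows satisfying it form a
  covering sieve. In particular \<open>P\<close> is then inherited by composites.\<close>

definition locally :: "'v \<Rightarrow> ('v \<Rightarrow> bool) \<Rightarrow> bool" where
  "locally c P \<longleftrightarrow> {f \<in> Arr C. Cod C f = c \<and> P f} \<in> J c"

text \<open>Being inherited by composites, i.e. defining a sieve.\<close>

definition stable :: "'v \<Rightarrow> ('v \<Rightarrow> bool) \<Rightarrow> bool" where
  "stable c P \<longleftrightarrow> (\<forall>f g d e. f \<in> hom C d c \<longrightarrow> P f \<longrightarrow> g \<in> hom C e d \<longrightarrow> P (f \<cdot>\<^bsub>C\<^esub> g))"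

lemma stableI: "(\<And>f g d e. f \<in> hom C d c \<Longrightarrow> P f \<Longrightarrow> g \<in> hom C e d \<Longrightarrow> P (f \<cdot>\<^bsub>C\<^esub> g)) \<Longrightarrow> stable c P"
  by (auto simp: stable_def)

lemma stableD: "stable c P \<Longrightarrow> f \<in> hom C d c \<Longrightarrow> P f \<Longrightarrow> g \<in> hom C e d \<Longrightarrow> P (f \<cdot>\<^bsub>C\<^esub> g)"
  by (auto simp: stable_def)

lemma stable_sieve: "stable c P \<longleftrightarrow> sieve C c {f \<in> Arr C. Cod C f = c \<and> P f}"
proof
  assume s: "stable c P"
  show "sieve C c {f \<in> Arr C. Cod C f = c \<and> P f}"
    unfolding sieve_def
  proof (intro conjI ballI impI)
    fix f g assume f: "f \<in> {f \<in> Arr C. Cod C f = c \<and> P f}" and g: "g \<in> Arr C" "Cod C g = Dom C f"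
    have "f \<cdot>\<^bsub>C\<^esub> g \<in> hom C (Dom C g) c" by (rule compC[of _ _ "Dom C f"]) (use f g in \<open>auto simp: hom_def\<close>)
    moreover have "P (f \<cdot>\<^bsub>C\<^esub> g)"
      using f g by (intro stableD[OF s, of f "Dom C f" g "Dom C g"]) (auto simp: hom_def)
    ultimately show "f \<cdot>\<^bsub>C\<^esub> g \<in> {f \<in> Arr C. Cod C f = c \<and> P f}" by (auto simp: hom_def)
  qed auto
qed (auto simp: stable_def sieve_def hom_def)

lemma locally_stable: "c \<in> Obj C \<Longrightarrow> locally c P \<Longrightarrow> stable c P"
  using J_sieve by (auto simp: stable_sieve locally_def)

lemma locally_always: "c \<in> Obj C \<Longrightarrow> (\<And>f d. f \<in> hom C d c \<Longrightarrow> P f) \<Longrightarrow> locally c P"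
  using J_max[of c] unfolding locally_def by (auto simp: hom_def elim!: back_subst[of "\<lambda>X. X \<in> J c"])

lemma locally_pull:
  assumes "h \<in> hom C d c" "locally c P"
  shows "locally d (\<lambda>g. P (h \<cdot>\<^bsub>C\<^esub> g))"
proof -
  have "pull_sieve C h {f \<in> Arr C. Cod C f = c \<and> P f} = {g \<in> Arr C. Cod C g = d \<and> P (h \<cdot>\<^bsub>C\<^esub> g)}"
    using assms(1) compC[of _ _ d h c] by (auto simp: pull_sieve_def hom_def)
  then show ?thesis using J_pull[OF assms(1), of "{f \<in> Arr C. Cod C f = c \<and> P f}"] assms(2)
    by (simp add: locally_def)
qed

text \<open>The local character of the topology: what holds locally on each member of a cover holds locally.\<close>

lemma locally_bind:
  assumes c: "c \<in> Obj C" and P: "locally c P" and Q: "stable c Q"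
    and PQ: "\<And>d f. f \<in> hom C d c \<Longrightarrow> P f \<Longrightarrow> locally d (\<lambda>g. Q (f \<cdot>\<^bsub>C\<^esub> g))"
  shows "locally c Q"
  unfolding locally_def
proof (rule J_trans[OF c P[unfolded locally_def] Q[unfolded stable_sieve]])
  fix h assume "h \<in> {f \<in> Arr C. Cod C f = c \<and> P f}"
  then have h: "h \<in> hom C (Dom C h) c" "P h" by (auto simp: hom_def)
  have "pull_sieve C h {f \<in> Arr C. Cod C f = c \<and> Q f} = {g \<in> Arr C. Cod C g = Dom C h \<and> Q (h \<cdot>\<^bsub>C\<^esub> g)}"
    using h(1) compC[of _ _ "Dom C h" h c] by (auto simp: pull_sieve_def hom_def)
  then show "pull_sieve C h {f \<in> Arr C. Cod C f = c \<and> Q f} \<in> J (Dom C h)"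
    using PQ[OF h] by (simp add: locally_def)
qed

lemma locally_mono:
  assumes c: "c \<in> Obj C" and P: "locally c P" and Q: "stable c Q"
    and PQ: "\<And>d f. f \<in> hom C d c \<Longrightarrow> P f \<Longrightarrow> Q f"
  shows "locally c Q"
proof (rule locally_bind[OF c P Q])
  fix d f assume f: "f \<in> hom C d c" "P f"
  show "locally d (\<lambda>g. Q (f \<cdot>\<^bsub>C\<^esub> g))"
    by (rule locally_always[OF objC(1)[OF f(1)]]) (rule stableD[OF Q f(1) PQ[OF f]])
qed

lemma locally_conj:
  assumes c: "c \<in> Obj C" and P: "locally c P" and Q: "locally c Q"
  shows "locally c (\<lambda>f. P f \<and> Q f)"
proof (rule locally_bind[OF c P])
  note s = locally_stable[OF c P] locally_stable[OF c Q]
  show "stable c (\<lambda>f. P f \<and> Q f)" using s unfolding stable_def by blast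
  fix d f assume f: "f \<in> hom C d c" "P f"
  show "locally d (\<lambda>g. P (f \<cdot>\<^bsub>C\<^esub> g) \<and> Q (f \<cdot>\<^bsub>C\<^esub> g))"
  proof (rule locally_mono[OF objC(1)[OF f(1)] locally_pull[OF f(1) Q]])
    show "stable d (\<lambda>g. P (f \<cdot>\<^bsub>C\<^esub> g) \<and> Q (f \<cdot>\<^bsub>C\<^esub> g))"
    proof (rule stableI)
      fix g h a b assume g: "g \<in> hom C a d" "P (f \<cdot>\<^bsub>C\<^esub> g) \<and> Q (f \<cdot>\<^bsub>C\<^esub> g)" "h \<in> hom C b a"
      show "P (f \<cdot>\<^bsub>C\<^esub> (g \<cdot>\<^bsub>C\<^esub> h)) \<and> Q (f \<cdot>\<^bsub>C\<^esub> (g \<cdot>\<^bsub>C\<^esub> h))"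
        using stableD[OF s(1) compC[OF g(1) f(1)] _ g(3)] stableD[OF s(2) compC[OF g(1) f(1)] _ g(3)] g(2)
          assocC[OF g(3) g(1) f(1)] by simp
    qed
    show "P (f \<cdot>\<^bsub>C\<^esub> g) \<and> Q (f \<cdot>\<^bsub>C\<^esub> g)" if "g \<in> hom C e d" "Q (f \<cdot>\<^bsub>C\<^esub> g)" for e g
      using stableD[OF s(1) f that(1)] that(2) by simp
  qed
qed

lemma locally_empty:
  assumes "c \<in> Obj C" "{} \<in> J c" "stable c P"
  shows "locally c P"
  by (rule locally_mono[of c "\<lambda>_. False"]) (use assms in \<open>auto simp: locally_def\<close>)

lemma locally_False: "locally c (\<lambda>f. False) \<longleftrightarrow> {} \<in> J c"
  by (simp add: locally_def)

text \<open>Sections of objects are separated and glue.\<close>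

lemma res_in: "X \<in> Obj E \<Longrightarrow> f \<in> hom C d c \<Longrightarrow> x \<in> sec X c \<Longrightarrow> res X f x \<in> sec X d"
  and res_id: "X \<in> Obj E \<Longrightarrow> c \<in> Obj C \<Longrightarrow> x \<in> sec X c \<Longrightarrow> res X (Id C c) x = x"
  and res_comp: "X \<in> Obj E \<Longrightarrow> f \<in> hom C b c \<Longrightarrow> g \<in> hom C c d \<Longrightarrow> x \<in> sec X d \<Longrightarrow>
     res X (g \<cdot>\<^bsub>C\<^esub> f) x = res X f (res X g x)"
  using set_sheafD[OF sec_sheaf] by blast+

lemma set_sheaf_separated:
  assumes S: "set_sheaf C J S \<rho>" and c: "c \<in> Obj C" and P: "locally c P" and x: "x \<in> S c" and y: "y \<in> S c"
    and e: "\<And>d f. f \<in> hom C d c \<Longrightarrow> P f \<Longrightarrow> \<rho> f x = \<rho> f y"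
  shows "x = y"
proof -
  let ?A = "{f \<in> Arr C. Cod C f = c \<and> P f}"
  have A: "?A \<in> J c" using P by (simp add: locally_def)
  note h = J_hom[OF c A]
  have "\<exists>!z. z \<in> S c \<and> (\<forall>f\<in>?A. \<rho> f z = \<rho> f x)"
  proof (rule set_sheafD(4)[OF S c A])
    fix f assume "f \<in> ?A"
    then show "\<rho> f x \<in> S (Dom C f)" using set_sheafD(1)[OF S h x] by simp
    fix g d assume "g \<in> hom C d (Dom C f)"
    then show "\<rho> g (\<rho> f x) = \<rho> (f \<cdot>\<^bsub>C\<^esub> g) x" using set_sheafD(3)[OF S _ h x] \<open>f \<in> ?A\<close> by simp
  qed
  moreover have "\<rho> f y = \<rho> f x" if "f \<in> ?A" for f using e[OF h[OF that]] that by simp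
  ultimately show ?thesis using x y by metis
qed

lemmas separated = set_sheaf_separated[OF sec_sheaf]

lemma set_sheaf_glue:
  assumes S: "set_sheaf C J S \<rho>" and c: "c \<in> Obj C" and P: "locally c P"
    and x: "\<And>d f. f \<in> hom C d c \<Longrightarrow> P f \<Longrightarrow> x f \<in> S d"
    and m: "\<And>d e f g. f \<in> hom C d c \<Longrightarrow> P f \<Longrightarrow> g \<in> hom C e d \<Longrightarrow> \<rho> g (x f) = x (f \<cdot>\<^bsub>C\<^esub> g)"
  shows "\<exists>y\<in>S c. \<forall>d f. f \<in> hom C d c \<longrightarrow> P f \<longrightarrow> \<rho> f y = x f"
proof -
  let ?A = "{f \<in> Arr C. Cod C f = c \<and> P f}"
  have A: "?A \<in> J c" using P by (simp add: locally_def)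
  note h = J_hom[OF c A]
  have "\<exists>!z. z \<in> S c \<and> (\<forall>f\<in>?A. \<rho> f z = x f)"
    by (rule set_sheafD(4)[OF S c A]) (use x[OF h] m[OF h] in auto)
  then show ?thesis by (auto simp: hom_def)
qed

lemmas glue = set_sheaf_glue[OF sec_sheaf]

text \<open>A criterion for sheaves in terms of local properties.\<close>

lemma set_sheaf_localI:
  assumes 1: "\<And>f d c x. f \<in> hom C d c \<Longrightarrow> x \<in> S c \<Longrightarrow> \<rho> f x \<in> S d"
    and 2: "\<And>c x. c \<in> Obj C \<Longrightarrow> x \<in> S c \<Longrightarrow> \<rho> (Id C c) x = x"
    and 3: "\<And>f g b c d x. f \<in> hom C b c \<Longrightarrow> g \<in> hom C c d \<Longrightarrow> x \<in> S d \<Longrightarrow> \<rho> (g \<cdot>\<^bsub>C\<^esub> f) x = \<rho> f (\<rho> g x)"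
    and sep: "\<And>c P x y. c \<in> Obj C \<Longrightarrow> locally c P \<Longrightarrow> x \<in> S c \<Longrightarrow> y \<in> S c \<Longrightarrow>
       (\<And>d f. f \<in> hom C d c \<Longrightarrow> P f \<Longrightarrow> \<rho> f x = \<rho> f y) \<Longrightarrow> x = y"
    and glue: "\<And>c P x. c \<in> Obj C \<Longrightarrow> locally c P \<Longrightarrow> (\<And>d f. f \<in> hom C d c \<Longrightarrow> P f \<Longrightarrow> x f \<in> S d) \<Longrightarrow>
       (\<And>d e f g. f \<in> hom C d c \<Longrightarrow> P f \<Longrightarrow> g \<in> hom C e d \<Longrightarrow> \<rho> g (x f) = x (f \<cdot>\<^bsub>C\<^esub> g)) \<Longrightarrow>
       \<exists>y\<in>S c. \<forall>d f. f \<in> hom C d c \<longrightarrow> P f \<longrightarrow> \<rho> f y = x f"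
  shows "set_sheaf C J S \<rho>"
proof (rule set_sheafI)
  fix c A x assume c: "c \<in> Obj C" and A: "A \<in> J c" and x: "\<And>f. f \<in> A \<Longrightarrow> x f \<in> S (Dom C f)"
    and m: "\<And>f g d. f \<in> A \<Longrightarrow> g \<in> hom C d (Dom C f) \<Longrightarrow> \<rho> g (x f) = x (f \<cdot>\<^bsub>C\<^esub> g)"
  note h = J_hom[OF c A]
  have "{f \<in> Arr C. Cod C f = c \<and> f \<in> A} = A" using h by (auto simp: hom_def)
  then have l: "locally c (\<lambda>f. f \<in> A)" using A by (simp add: locally_def)
  have "\<exists>y\<in>S c. \<forall>d f. f \<in> hom C d c \<longrightarrow> f \<in> A \<longrightarrow> \<rho> f y = x f"
    by (rule glue[OF c l]) (use x m in \<open>auto simp: hom_def\<close>)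
  then obtain y where y: "y \<in> S c" "\<And>f. f \<in> A \<Longrightarrow> \<rho> f y = x f" using h by blast
  show "\<exists>!y. y \<in> S c \<and> (\<forall>f\<in>A. \<rho> f y = x f)"
  proof (rule ex1I[of _ y])
    show "y \<in> S c \<and> (\<forall>f\<in>A. \<rho> f y = x f)" using y by blast
    show "z = y" if "z \<in> S c \<and> (\<forall>f\<in>A. \<rho> f z = x f)" for z
      by (rule sep[OF c l]) (use that y in auto)
  qed
qed (fact 1 2 3)+

lemma set_sheaf_transfer:
  assumes S: "set_sheaf C J S \<rho>"
    and b: "\<And>c. c \<in> Obj C \<Longrightarrow> bij_betw (b c) (S c) (S' c)"
    and n: "\<And>f d c x. f \<in> hom C d c \<Longrightarrow> x \<in> S c \<Longrightarrow> b d (\<rho> f x) = \<rho>' f (b c x)"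
  shows "set_sheaf C J S' \<rho>'"
proof (rule set_sheaf_localI)
  have surj: "\<exists>y\<in>S c. x = b c y" if "c \<in> Obj C" "x \<in> S' c" for c x
    using b[OF that(1)] that(2) by (auto simp: bij_betw_def)
  have bin: "b c y \<in> S' c" if "c \<in> Obj C" "y \<in> S c" for c y
    using b[OF that(1)] that(2) by (auto simp: bij_betw_def)
  have inj: "y = z" if "c \<in> Obj C" "y \<in> S c" "z \<in> S c" "b c y = b c z" for c y z
    using b[OF that(1)] that(2-) by (auto simp: bij_betw_def inj_on_def)
  note sh = set_sheafD[OF S]
  {
    fix f d c x assume f: "f \<in> hom C d c" and "x \<in> S' c"
    then obtain y where y: "y \<in> S c" "x = b c y" using surj objC[OF f] by blast
    show "\<rho>' f x \<in> S' d" using n[OF f y(1)] bin[OF objC(1)[OF f] sh(1)[OF f y(1)]] y by simp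
  }
  {
    fix c x assume c: "c \<in> Obj C" and "x \<in> S' c"
    then obtain y where y: "y \<in> S c" "x = b c y" using surj by blast
    show "\<rho>' (Id C c) x = x" using n[OF idC[OF c] y(1)] sh(2)[OF c y(1)] y by simp
  }
  {
    fix f g a c d x assume f: "f \<in> hom C a c" and g: "g \<in> hom C c d" and "x \<in> S' d"
    then obtain y where y: "y \<in> S d" "x = b d y" using surj objC[OF g] by blast
    show "\<rho>' (g \<cdot>\<^bsub>C\<^esub> f) x = \<rho>' f (\<rho>' g x)"
      using n[OF compC[OF f g] y(1)] sh(3)[OF f g y(1)] n[OF f sh(1)[OF g y(1)]] n[OF g y(1)] y(2) by simp
  }
  {
    fix c P x x' assume c: "c \<in> Obj C" and P: "locally c P" and xx: "x \<in> S' c" "x' \<in> S' c"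
      and e: "\<And>d f. f \<in> hom C d c \<Longrightarrow> P f \<Longrightarrow> \<rho>' f x = \<rho>' f x'"
    obtain y y' where y: "y \<in> S c" "x = b c y" "y' \<in> S c" "x' = b c y'" using surj[OF c] xx by blast
    have "y = y'"
    proof (rule set_sheaf_separated[OF S c P y(1,3)])
      fix d f assume f: "f \<in> hom C d c" "P f"
      show "\<rho> f y = \<rho> f y'"
        by (rule inj[OF objC(1)[OF f(1)] sh(1)[OF f(1) y(1)] sh(1)[OF f(1) y(3)]])
          (use e[OF f] y n[OF f(1)] in simp)
    qed
    then show "x = x'" using y by simp
  }
  fix c P x assume c: "c \<in> Obj C" and P: "locally c P" and x: "\<And>d f. f \<in> hom C d c \<Longrightarrow> P f \<Longrightarrow> x f \<in> S' d"
    and m: "\<And>d e f g. f \<in> hom C d c \<Longrightarrow> P f \<Longrightarrow> g \<in> hom C e d \<Longrightarrow> \<rho>' g (x f) = x (f \<cdot>\<^bsub>C\<^esub> g)"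
  have "\<exists>y. \<forall>d. f \<in> hom C d c \<and> P f \<longrightarrow> y \<in> S d \<and> x f = b d y" for f
  proof (cases "f \<in> hom C (Dom C f) c \<and> P f")
    case True
    then show ?thesis using surj[OF objC(1) x] by (metis homD(2))
  qed (metis homD(2))
  then obtain y where "\<And>f d. f \<in> hom C d c \<Longrightarrow> P f \<Longrightarrow> y f \<in> S d \<and> x f = b d (y f)" by metis
  then have y: "\<And>f d. f \<in> hom C d c \<Longrightarrow> P f \<Longrightarrow> y f \<in> S d" "\<And>f d. f \<in> hom C d c \<Longrightarrow> P f \<Longrightarrow> x f = b d (y f)"
    by blast+
  note st = stableD[OF locally_stable[OF c P]]
  have "\<exists>z\<in>S c. \<forall>d f. f \<in> hom C d c \<longrightarrow> P f \<longrightarrow> \<rho> f z = y f"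
  proof (rule set_sheaf_glue[OF S c P])
    fix d e f g assume f: "f \<in> hom C d c" "P f" and g: "g \<in> hom C e d"
    note fg = compC[OF g f(1)] st[OF f g]
    show "\<rho> g (y f) = y (f \<cdot>\<^bsub>C\<^esub> g)"
      by (rule inj[OF objC(1)[OF g] sh(1)[OF g y(1)[OF f]] y(1)[OF fg]])
        (use n[OF g y(1)[OF f]] m[OF f g] y(2)[OF f] y(2)[OF fg] in simp)
  qed (rule y(1))
  then obtain z where z: "z \<in> S c" "\<And>d f. f \<in> hom C d c \<Longrightarrow> P f \<Longrightarrow> \<rho> f z = y f" by blast
  show "\<exists>y\<in>S' c. \<forall>d f. f \<in> hom C d c \<longrightarrow> P f \<longrightarrow> \<rho>' f y = x f"
  proof (intro bexI[of _ "b c z"] allI impI)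
    show "b c z \<in> S' c" using bin[OF c z(1)] .
    show "\<rho>' f (b c z) = x f" if "f \<in> hom C d c" "P f" for d f
      using n[OF that(1) z(1)] z(2)[OF that] y(2)[OF that] by simp
  qed
qed

text \<open>Representability of small sheaves with values in any type, by transport to the universe.\<close>

lemma represent_small:
  assumes S: "set_sheaf C J S \<rho>" and sm: "\<And>c. c \<in> Obj C \<Longrightarrow> small el (S c)"
  obtains X \<beta> where "X \<in> Obj E" "\<And>c. c \<in> Obj C \<Longrightarrow> bij_betw (\<beta> c) (sec X c) (S c)"
    "\<And>f d c x. f \<in> hom C d c \<Longrightarrow> x \<in> sec X c \<Longrightarrow> \<beta> d (res X f x) = \<rho> f (\<beta> c x)"
proof -
  have "\<exists>b v. bij_betw b (S c) (el v)" if "c \<in> Obj C" for c using small_bij[OF univ sm[OF that]] by metis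
  then obtain b v where b: "\<And>c. c \<in> Obj C \<Longrightarrow> bij_betw (b c) (S c) (el (v c))" by metis
  define \<rho>' where "\<rho>' f x = b (Dom C f) (\<rho> f (inv_into (S (Cod C f)) (b (Cod C f)) x))" for f x
  have n: "b d (\<rho> f x) = \<rho>' f (b c x)" if "f \<in> hom C d c" "x \<in> S c" for f d c x
    using that b[OF objC(2)[OF that(1)]] by (simp add: \<rho>'_def hom_def bij_betw_def inv_into_f_f)
  obtain X \<beta> where X: "X \<in> Obj E" and \<beta>: "\<And>c. c \<in> Obj C \<Longrightarrow> bij_betw (\<beta> c) (sec X c) (el (v c))"
    "\<And>f d c x. f \<in> hom C d c \<Longrightarrow> x \<in> sec X c \<Longrightarrow> \<beta> d (res X f x) = \<rho>' f (\<beta> c x)"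
    using represent[OF set_sheaf_transfer[OF S b n]] by blast
  define \<gamma> where "\<gamma> c = inv_into (S c) (b c) \<circ> \<beta> c" for c
  have g: "bij_betw (\<gamma> c) (sec X c) (S c)" if "c \<in> Obj C" for c
    unfolding \<gamma>_def by (rule bij_betw_trans[OF \<beta>(1)[OF that] bij_betw_inv_into[OF b[OF that]]])
  have bg: "b c (\<gamma> c x) = \<beta> c x" if "c \<in> Obj C" "x \<in> sec X c" for c x
  proof -
    have "\<beta> c x \<in> b c ` S c"
      using \<beta>(1)[OF that(1)] b[OF that(1)] that(2) by (auto simp: bij_betw_def)
    then show ?thesis by (simp add: \<gamma>_def f_inv_into_f)
  qed
  have "\<gamma> d (res X f x) = \<rho> f (\<gamma> c x)" if f: "f \<in> hom C d c" and x: "x \<in> sec X c" for f d c x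
  proof -
    note o = objC[OF f]
    have gx: "\<gamma> c x \<in> S c" using g[OF o(2)] x by (auto simp: bij_betw_def)
    have r: "\<gamma> d (res X f x) \<in> S d" using g[OF o(1)] res_in[OF X f x] by (auto simp: bij_betw_def)
    have "b d (\<gamma> d (res X f x)) = b d (\<rho> f (\<gamma> c x))"
      using bg[OF o(1) res_in[OF X f x]] bg[OF o(2) x] n[OF f gx] \<beta>(2)[OF f x] by simp
    then show ?thesis using b[OF o(1)] r set_sheafD(1)[OF S f gx] by (auto simp: bij_betw_def inj_on_def)
  qed
  then show thesis using that[OF X g] by blast
qed

lemma iso_of_bij:
  assumes a: "a \<in> hom E X Y" and b: "\<And>c. c \<in> Obj C \<Longrightarrow> bij_betw (act a c) (sec X c) (sec Y c)"
  shows "is_iso E a"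
proof -
  note o = objE[OF a]
  let ?i = "\<lambda>c. inv_into (sec X c) (act a c)"
  have i: "?i c y \<in> sec X c" "act a c (?i c y) = y" if "c \<in> Obj C" "y \<in> sec Y c" for c y
    using b[OF that(1)] that(2) by (auto simp: bij_betw_def f_inv_into_f inv_into_into)
  have l: "?i c (act a c x) = x" if "c \<in> Obj C" "x \<in> sec X c" for c x
    using b[OF that(1)] that(2) by (auto simp: bij_betw_def)
  have "\<exists>g\<in>hom E Y X. \<forall>c\<in>Obj C. \<forall>y\<in>sec Y c. act g c y = ?i c y"
  proof (rule full[OF o(2,1) i(1)])
    fix f d c y assume f: "f \<in> hom C d c" and y: "y \<in> sec Y c"
    note oc = objC[OF f]
    have "act a d (res X f (?i c y)) = res Y f y" using act_nat[OF a f i(1)[OF oc(2) y]] i(2)[OF oc(2) y] by simp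
    then show "?i d (res Y f y) = res X f (?i c y)" using l[OF oc(1) res_in[OF o(1) f i(1)[OF oc(2) y]]] by simp
  qed
  then obtain g where g: "g \<in> hom E Y X" "\<And>c y. c \<in> Obj C \<Longrightarrow> y \<in> sec Y c \<Longrightarrow> act g c y = ?i c y" by blast
  have "g \<cdot>\<^bsub>E\<^esub> a = Id E X"
    by (rule faithful[OF compE[OF a g(1)] idE[OF o(1)]]) (simp add: act_comp[OF a g(1)] g(2) act_in[OF a] l act_id o)
  moreover have "a \<cdot>\<^bsub>E\<^esub> g = Id E Y"
    by (rule faithful[OF compE[OF g(1) a] idE[OF o(2)]]) (simp add: act_comp[OF g(1) a] g(2) act_in i act_id o)
  ultimately show ?thesis using a g(1) unfolding is_iso_def by (auto simp: hom_def)
qed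

end

section \<open>Finite limits and epimorphic families\<close>

context sheaf_topos
begin

subsection \<open>Finite limits are computed on sections\<close>

text \<open>A finite diagram of objects \<open>Y k\<close> with equations: \<open>(k, b, k', b')\<close> stands for the
  condition that \<open>b\<close> at \<open>k\<close> agrees with \<open>b'\<close> at \<open>k'\<close>.\<close>

definition diagram :: "nat set \<Rightarrow> (nat \<Rightarrow> 'o) \<Rightarrow> (nat \<times> 'a \<times> nat \<times> 'a) set \<Rightarrow> bool" where
  "diagram K Y Q \<longleftrightarrow> finite K \<and> (\<forall>k\<in>K. Y k \<in> Obj E) \<and>
     (\<forall>(k, b, k', b')\<in>Q. k \<in> K \<and> k' \<in> K \<and> (\<exists>Z. b \<in> hom E (Y k) Z \<and> b' \<in> hom E (Y k') Z))"

text \<open>Cones over such a diagram with apex \<open>T\<close>, the same for sections over \<open>c\<close>, and limit cones.\<close>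

definition cone :: "'o \<Rightarrow> (nat \<Rightarrow> 'a) \<Rightarrow> nat set \<Rightarrow> (nat \<Rightarrow> 'o) \<Rightarrow> (nat \<times> 'a \<times> nat \<times> 'a) set \<Rightarrow> bool" where
  "cone T a K Y Q \<longleftrightarrow> (\<forall>k\<in>K. a k \<in> hom E T (Y k)) \<and>
     (\<forall>(k, b, k', b')\<in>Q. b \<cdot>\<^bsub>E\<^esub> a k = b' \<cdot>\<^bsub>E\<^esub> a k')"

definition sec_cone :: "'v \<Rightarrow> (nat \<Rightarrow> 'v) \<Rightarrow> nat set \<Rightarrow> (nat \<Rightarrow> 'o) \<Rightarrow> (nat \<times> 'a \<times> nat \<times> 'a) set \<Rightarrow> bool" where
  "sec_cone c x K Y Q \<longleftrightarrow> (\<forall>k\<in>K. x k \<in> sec (Y k) c) \<and>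
     (\<forall>(k, b, k', b')\<in>Q. act b c (x k) = act b' c (x k'))"

definition is_lim :: "'o \<Rightarrow> (nat \<Rightarrow> 'a) \<Rightarrow> nat set \<Rightarrow> (nat \<Rightarrow> 'o) \<Rightarrow> (nat \<times> 'a \<times> nat \<times> 'a) set \<Rightarrow> bool" where
  "is_lim P p K Y Q \<longleftrightarrow> P \<in> Obj E \<and> cone P p K Y Q \<and>
     (\<forall>T\<in>Obj E. \<forall>a. cone T a K Y Q \<longrightarrow> (\<exists>!h. h \<in> hom E T P \<and> (\<forall>k\<in>K. p k \<cdot>\<^bsub>E\<^esub> h = a k)))"

lemma diagramD:
  assumes "diagram K Y Q"
  shows "k \<in> K \<Longrightarrow> Y k \<in> Obj E"
    "(k, b, k', b') \<in> Q \<Longrightarrow> k \<in> K \<and> k' \<in> K \<and> (\<exists>Z. b \<in> hom E (Y k) Z \<and> b' \<in> hom E (Y k') Z)"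
  using assms by (auto simp: diagram_def)

lemma sec_cone_act:
  assumes Q: "diagram K Y Q" and a: "cone T a K Y Q" and c: "c \<in> Obj C" and t: "t \<in> sec T c"
  shows "sec_cone c (\<lambda>k. act (a k) c t) K Y Q"
proof -
  have ak: "a k \<in> hom E T (Y k)" if "k \<in> K" for k using a that by (simp add: cone_def)
  have "act b c (act (a k) c t) = act b' c (act (a k') c t)" if q: "(k, b, k', b') \<in> Q" for k b k' b'
  proof -
    from diagramD(2)[OF Q q] obtain Z where Z: "k \<in> K" "k' \<in> K" "b \<in> hom E (Y k) Z" "b' \<in> hom E (Y k') Z"
      by blast
    have "b \<cdot>\<^bsub>E\<^esub> a k = b' \<cdot>\<^bsub>E\<^esub> a k'" using a q by (auto simp: cone_def)
    then show ?thesis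
      using act_comp[OF ak[OF Z(1)] Z(3) c t] act_comp[OF ak[OF Z(2)] Z(4) c t] by simp
  qed
  then show ?thesis using act_in[OF ak c t] by (auto simp: sec_cone_def)
qed

text \<open>The compatible families of sections form a sheaf, and the object representing it is a limit.\<close>

lemma lim_exists:
  assumes Q: "diagram K Y Q"
  obtains P p where "is_lim P p K Y Q"
    "\<And>c x. c \<in> Obj C \<Longrightarrow> sec_cone c x K Y Q \<Longrightarrow> \<exists>!z. z \<in> sec P c \<and> (\<forall>k\<in>K. act (p k) c z = x k)"
proof -
  define S where "S c = {x \<in> PiE K (\<lambda>k. sec (Y k) c). sec_cone c x K Y Q}" for c
  define \<rho> where "\<rho> f x = (\<lambda>k\<in>K. res (Y k) f (x k))" for f and x :: "nat \<Rightarrow> 'v"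
  note Y = diagramD(1)[OF Q]
  have Sk: "x k \<in> sec (Y k) c" if "x \<in> S c" "k \<in> K" for x k c
    using that by (auto simp: S_def sec_cone_def)
  have Sext: "x = y" if "x \<in> S c" "y \<in> S c" "\<And>k. k \<in> K \<Longrightarrow> x k = y k" for x y c
    by (rule PiE_ext[of x K "\<lambda>k. sec (Y k) c"]) (use that in \<open>auto simp: S_def\<close>)
  have SI: "x \<in> S c" if "x \<in> extensional K" "sec_cone c x K Y Q" for x c
    using that by (auto simp: S_def sec_cone_def PiE_def)
  have Q': "act b c (x k) = act b' c (x k')" if "x \<in> S c" "(k, b, k', b') \<in> Q" for x c k b k' b'
    using that by (auto simp: S_def sec_cone_def)
  have r1: "\<rho> f x \<in> S d" if f: "f \<in> hom C d c" and x: "x \<in> S c" for f d c x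
  proof (rule SI)
    show "sec_cone d (\<rho> f x) K Y Q"
      unfolding sec_cone_def
    proof (intro conjI ballI, goal_cases)
      case (1 k) then show ?case using res_in[OF Y f Sk[OF x]] by (simp add: \<rho>_def)
    next
      case (2 q)
      obtain k b k' b' where q: "q = (k, b, k', b')" by (cases q)
      obtain Z where Z: "k \<in> K" "k' \<in> K" "b \<in> hom E (Y k) Z" "b' \<in> hom E (Y k') Z"
        using diagramD(2)[OF Q, of k b k' b'] 2 q by blast
      show ?case using Z(1,2) act_nat[OF Z(3) f Sk[OF x Z(1)]] act_nat[OF Z(4) f Sk[OF x Z(2)]] Q'[OF x] 2
        by (simp add: q \<rho>_def)
    qed
  qed (simp add: \<rho>_def)
  have sh: "set_sheaf C J S \<rho>"
  proof (rule set_sheaf_localI)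
    fix f d c x assume "f \<in> hom C d c" "x \<in> S c"
    then show "\<rho> f x \<in> S d" by (rule r1)
  next
    fix c x assume c: "c \<in> Obj C" and x: "x \<in> S c"
    show "\<rho> (Id C c) x = x"
      by (rule Sext[OF r1[OF idC[OF c] x] x]) (simp add: \<rho>_def res_id[OF Y c Sk[OF x]])
  next
    fix f g b c d x assume f: "f \<in> hom C b c" and g: "g \<in> hom C c d" and x: "x \<in> S d"
    show "\<rho> (g \<cdot>\<^bsub>C\<^esub> f) x = \<rho> f (\<rho> g x)"
      by (rule Sext[OF r1[OF compC[OF f g] x] r1[OF f r1[OF g x]]])
        (simp add: \<rho>_def res_comp[OF Y f g Sk[OF x]])
  next
    fix c P x y assume c: "c \<in> Obj C" and P: "locally c P" and x: "x \<in> S c" and y: "y \<in> S c"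
      and e: "\<And>d f. f \<in> hom C d c \<Longrightarrow> P f \<Longrightarrow> \<rho> f x = \<rho> f y"
    show "x = y"
    proof (rule Sext[OF x y], rule separated[OF Y c P Sk[OF x] Sk[OF y]])
      fix k d f assume "k \<in> K" "f \<in> hom C d c" "P f"
      then show "res (Y k) f (x k) = res (Y k) f (y k)" using fun_cong[OF e, of f d k] by (simp add: \<rho>_def)
    qed
  next
    fix c P x assume c: "c \<in> Obj C" and P: "locally c P" and x: "\<And>d f. f \<in> hom C d c \<Longrightarrow> P f \<Longrightarrow> x f \<in> S d"
      and m: "\<And>d e f g. f \<in> hom C d c \<Longrightarrow> P f \<Longrightarrow> g \<in> hom C e d \<Longrightarrow> \<rho> g (x f) = x (f \<cdot>\<^bsub>C\<^esub> g)"
    have "\<exists>y\<in>sec (Y k) c. \<forall>d f. f \<in> hom C d c \<longrightarrow> P f \<longrightarrow> res (Y k) f y = x f k" if k: "k \<in> K" for k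
    proof (rule glue[OF Y[OF k] c P Sk[OF x k]])
      fix d e f g assume "f \<in> hom C d c" "P f" "g \<in> hom C e d"
      from fun_cong[OF m[OF this], of k] show "res (Y k) g (x f k) = x (f \<cdot>\<^bsub>C\<^esub> g) k"
        using k by (simp add: \<rho>_def)
    qed
    then obtain y where y: "\<And>k. k \<in> K \<Longrightarrow> y k \<in> sec (Y k) c"
      "\<And>k d f. k \<in> K \<Longrightarrow> f \<in> hom C d c \<Longrightarrow> P f \<Longrightarrow> res (Y k) f (y k) = x f k" by metis
    have yS: "restrict y K \<in> S c"
    proof (rule SI)
      show "sec_cone c (restrict y K) K Y Q"
        unfolding sec_cone_def
      proof (intro conjI ballI, goal_cases)
        case (2 q)
        obtain k b k' b' where q: "q = (k, b, k', b')" by (cases q)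
        obtain Z where Z: "k \<in> K" "k' \<in> K" "b \<in> hom E (Y k) Z" "b' \<in> hom E (Y k') Z"
          using diagramD(2)[OF Q, of k b k' b'] 2 q by blast
        have "act b c (y k) = act b' c (y k')"
        proof (rule separated[OF objE(2)[OF Z(3)] c P act_in[OF Z(3) c y(1)[OF Z(1)]] act_in[OF Z(4) c y(1)[OF Z(2)]]])
          fix d f assume f: "f \<in> hom C d c" "P f"
          show "res Z f (act b c (y k)) = res Z f (act b' c (y k'))"
            using act_nat[OF Z(3) f(1) y(1)[OF Z(1)]] act_nat[OF Z(4) f(1) y(1)[OF Z(2)]]
              y(2)[OF Z(1) f] y(2)[OF Z(2) f] Q'[OF x[OF f]] 2 by (simp add: q)
        qed
        then show ?case using Z by (simp add: q)
      qed (simp add: y)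
    qed simp
    moreover have "\<rho> f (restrict y K) = x f" if f: "f \<in> hom C d c" "P f" for d f
      by (rule Sext[OF r1[OF f(1) yS] x[OF f]]) (simp add: \<rho>_def y(2)[OF _ f])
    ultimately show "\<exists>y\<in>S c. \<forall>d f. f \<in> hom C d c \<longrightarrow> P f \<longrightarrow> \<rho> f y = x f" by blast
  qed
  have sm: "small el (S c)" if "c \<in> Obj C" for c
  proof (rule small_sub[where A = "PiE K (\<lambda>k. sec (Y k) c)"])
    show "small el (PiE K (\<lambda>k. sec (Y k) c))"
    proof (rule small_PiE[OF univ])
      show "small el K" using Q by (intro small_finite[OF univ]) (simp add: diagram_def)
      show "small el (sec (Y k) c)" if "k \<in> K" for k
        by (rule small_range[OF univ sec_range[OF Y[OF that] \<open>c \<in> Obj C\<close>]])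
    qed
  qed (use univ in \<open>auto simp: S_def\<close>)
  obtain P \<beta> where P: "P \<in> Obj E" and b: "\<And>c. c \<in> Obj C \<Longrightarrow> bij_betw (\<beta> c) (sec P c) (S c)"
    and bn: "\<And>f d c x. f \<in> hom C d c \<Longrightarrow> x \<in> sec P c \<Longrightarrow> \<beta> d (res P f x) = \<rho> f (\<beta> c x)"
    using represent_small[OF sh sm] by blast
  have bS: "\<beta> c z \<in> S c" if "c \<in> Obj C" "z \<in> sec P c" for c z
    using b[OF that(1)] that(2) by (auto simp: bij_betw_def)
  have "\<exists>p\<in>hom E P (Y k). \<forall>c\<in>Obj C. \<forall>z\<in>sec P c. act p c z = \<beta> c z k" if k: "k \<in> K" for k
  proof (rule full[OF P Y[OF k] Sk[OF bS k]])
    fix f d c z assume f: "f \<in> hom C d c" and "z \<in> sec P c"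
    then show "\<beta> d (res P f z) k = res (Y k) f (\<beta> c z k)" using bn k by (simp add: \<rho>_def)
  qed
  then obtain p where p: "\<And>k. k \<in> K \<Longrightarrow> p k \<in> hom E P (Y k)"
    "\<And>k c z. k \<in> K \<Longrightarrow> c \<in> Obj C \<Longrightarrow> z \<in> sec P c \<Longrightarrow> act (p k) c z = \<beta> c z k" by metis
  have u: "\<exists>!z. z \<in> sec P c \<and> (\<forall>k\<in>K. act (p k) c z = x k)" if c: "c \<in> Obj C" and x: "sec_cone c x K Y Q" for c x
  proof -
    have "restrict x K \<in> S c"
      using x diagramD(2)[OF Q] by (intro SI) (auto simp: sec_cone_def Ball_def)
    then have "restrict x K \<in> \<beta> c ` sec P c" using b[OF c] by (simp add: bij_betw_def)
    then obtain z where z: "z \<in> sec P c" "\<beta> c z = restrict x K" by (metis imageE)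
    show ?thesis
    proof (rule ex1I[of _ z])
      show "z \<in> sec P c \<and> (\<forall>k\<in>K. act (p k) c z = x k)" using z p(2)[OF _ c z(1)] by simp
      fix w assume w: "w \<in> sec P c \<and> (\<forall>k\<in>K. act (p k) c w = x k)"
      have "\<beta> c w = \<beta> c z"
        by (rule Sext[OF bS[OF c] bS[OF c z(1)]]) (use w z p(2)[OF _ c] in auto)
      then show "w = z" using b[OF c] w z(1) by (auto simp: bij_betw_def inj_on_def)
    qed
  qed
  have cp: "cone P p K Y Q"
    unfolding cone_def
  proof (intro conjI ballI, goal_cases)
    case (2 q)
    obtain k b k' b' where q: "q = (k, b, k', b')" by (cases q)
    obtain Z where Z: "k \<in> K" "k' \<in> K" "b \<in> hom E (Y k) Z" "b' \<in> hom E (Y k') Z"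
      using diagramD(2)[OF Q, of k b k' b'] 2 q by blast
    have "b \<cdot>\<^bsub>E\<^esub> p k = b' \<cdot>\<^bsub>E\<^esub> p k'"
    proof (rule faithful[OF compE[OF p(1)[OF Z(1)] Z(3)] compE[OF p(1)[OF Z(2)] Z(4)]])
      fix c x assume cx: "c \<in> Obj C" "x \<in> sec P c"
      show "act (b \<cdot>\<^bsub>E\<^esub> p k) c x = act (b' \<cdot>\<^bsub>E\<^esub> p k') c x"
        using act_comp[OF p(1)[OF Z(1)] Z(3) cx] act_comp[OF p(1)[OF Z(2)] Z(4) cx] p(2) Z cx Q'[OF bS[OF cx]] 2
        by (simp add: q)
    qed
    then show ?case by (simp add: q)
  qed (rule p(1))
  have "is_lim P p K Y Q"
    unfolding is_lim_def
  proof (intro conjI ballI allI impI P cp)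
    fix T a assume T: "T \<in> Obj E" and a: "cone T a K Y Q"
    have ak: "a k \<in> hom E T (Y k)" if "k \<in> K" for k using a that by (simp add: cone_def)
    define \<phi> where "\<phi> c t = (THE z. z \<in> sec P c \<and> (\<forall>k\<in>K. act (p k) c z = act (a k) c t))" for c t
    have \<phi>: "\<phi> c t \<in> sec P c" "\<And>k. k \<in> K \<Longrightarrow> act (p k) c (\<phi> c t) = act (a k) c t"
      if "c \<in> Obj C" "t \<in> sec T c" for c t
      using theI'[OF u[OF that(1) sec_cone_act[OF Q a that]]] by (auto simp: \<phi>_def)
    have "\<exists>h\<in>hom E T P. \<forall>c\<in>Obj C. \<forall>t\<in>sec T c. act h c t = \<phi> c t"
    proof (rule full[OF T P \<phi>(1)])
      fix f d c t assume f: "f \<in> hom C d c" and t: "t \<in> sec T c"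
      note oc = objC[OF f]
      note r = res_in[OF T f t]
      have "act (p k) d (res P f (\<phi> c t)) = act (a k) d (res T f t)" if "k \<in> K" for k
        using act_nat[OF p(1)[OF that] f \<phi>(1)[OF oc(2) t]] act_nat[OF ak[OF that] f t] \<phi>(2)[OF oc(2) t that] by simp
      then show "\<phi> d (res T f t) = res P f (\<phi> c t)"
        using u[OF oc(1) sec_cone_act[OF Q a oc(1) r]] \<phi>[OF oc(1) r] res_in[OF P f \<phi>(1)[OF oc(2) t]] by metis
    qed
    then obtain h where h: "h \<in> hom E T P" "\<And>c t. c \<in> Obj C \<Longrightarrow> t \<in> sec T c \<Longrightarrow> act h c t = \<phi> c t" by blast
    show "\<exists>!h. h \<in> hom E T P \<and> (\<forall>k\<in>K. p k \<cdot>\<^bsub>E\<^esub> h = a k)"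
    proof (rule ex1I[of _ h])
      have "p k \<cdot>\<^bsub>E\<^esub> h = a k" if "k \<in> K" for k
        by (rule faithful[OF compE[OF h(1) p(1)[OF that]] ak[OF that]])
          (simp add: act_comp[OF h(1) p(1)[OF that]] h(2) \<phi>(2) that)
      then show "h \<in> hom E T P \<and> (\<forall>k\<in>K. p k \<cdot>\<^bsub>E\<^esub> h = a k)" using h(1) by blast
      fix g assume g: "g \<in> hom E T P \<and> (\<forall>k\<in>K. p k \<cdot>\<^bsub>E\<^esub> g = a k)"
      show "g = h"
      proof (rule faithful[OF conjunct1[OF g] h(1)])
        fix c t assume ct: "c \<in> Obj C" "t \<in> sec T c"
        have "act (p k) c (act g c t) = act (a k) c t" if "k \<in> K" for k
          using act_comp[OF conjunct1[OF g] p(1)[OF that] ct] g that by simp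
        moreover have "act (p k) c (act h c t) = act (a k) c t" if "k \<in> K" for k
          using h(2)[OF ct] \<phi>(2)[OF ct that] by simp
        ultimately show "act g c t = act h c t"
          using u[OF ct(1) sec_cone_act[OF Q a ct]] act_in[OF conjunct1[OF g] ct] act_in[OF h(1) ct] by metis
      qed
    qed
  qed
  then show thesis using that u by blast
qed

text \<open>Sections of any limit are the compatible families, since it is isomorphic to the one just
  constructed.\<close>

lemma lim_sec:
  assumes Q: "diagram K Y Q" and L: "is_lim P p K Y Q" and c: "c \<in> Obj C" and x: "sec_cone c x K Y Q"
  shows "\<exists>!z. z \<in> sec P c \<and> (\<forall>k\<in>K. act (p k) c z = x k)"
proof -
  obtain P' p' where L': "is_lim P' p' K Y Q"
    and u: "\<And>c x. c \<in> Obj C \<Longrightarrow> sec_cone c x K Y Q \<Longrightarrow> \<exists>!z. z \<in> sec P' c \<and> (\<forall>k\<in>K. act (p' k) c z = x k)"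
    using lim_exists[OF Q] by metis
  have P: "P \<in> Obj E" "cone P p K Y Q" "P' \<in> Obj E" "cone P' p' K Y Q"
    using L L' by (auto simp: is_lim_def)
  have pk: "p k \<in> hom E P (Y k)" "p' k \<in> hom E P' (Y k)" if "k \<in> K" for k using P that by (simp_all add: cone_def)
  obtain h where h: "h \<in> hom E P' P" "\<And>k. k \<in> K \<Longrightarrow> p k \<cdot>\<^bsub>E\<^esub> h = p' k"
    using L P(3,4) unfolding is_lim_def by blast
  obtain g where g: "g \<in> hom E P P'" "\<And>k. k \<in> K \<Longrightarrow> p' k \<cdot>\<^bsub>E\<^esub> g = p k"
    using L' P(1,2) unfolding is_lim_def by blast
  have "p k \<cdot>\<^bsub>E\<^esub> (h \<cdot>\<^bsub>E\<^esub> g) = p k" if "k \<in> K" for k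
    using assocE[OF g(1) h(1) pk(1)[OF that]] h(2) g(2) that by simp
  moreover have "\<exists>!e. e \<in> hom E P P \<and> (\<forall>k\<in>K. p k \<cdot>\<^bsub>E\<^esub> e = p k)"
    using L P(1,2) unfolding is_lim_def by blast
  moreover have "p k \<cdot>\<^bsub>E\<^esub> Id E P = p k" if "k \<in> K" for k using unitE(1)[OF pk(1)[OF that]] .
  ultimately have hg: "h \<cdot>\<^bsub>E\<^esub> g = Id E P" using compE[OF g(1) h(1)] idE[OF P(1)] by blast
  obtain z where z: "z \<in> sec P' c" "\<And>k. k \<in> K \<Longrightarrow> act (p' k) c z = x k" using u[OF c x] by blast
  show ?thesis
  proof (rule ex1I[of _ "act h c z"])
    have "act (p k) c (act h c z) = x k" if "k \<in> K" for k
      using act_comp[OF h(1) pk(1)[OF that] c z(1)] h(2)[OF that] z(2)[OF that] by simp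
    then show "act h c z \<in> sec P c \<and> (\<forall>k\<in>K. act (p k) c (act h c z) = x k)"
      using act_in[OF h(1) c z(1)] by blast
    fix w assume w: "w \<in> sec P c \<and> (\<forall>k\<in>K. act (p k) c w = x k)"
    have "act (p' k) c (act g c w) = x k" if "k \<in> K" for k
      using act_comp[OF g(1) pk(2)[OF that] c conjunct1[OF w]] g(2)[OF that] w that by simp
    then have "act g c w = z" using u[OF c x] z act_in[OF g(1) c conjunct1[OF w]] by blast
    then show "w = act h c z"
      using act_comp[OF g(1) h(1) c conjunct1[OF w]] hg act_id[OF P(1) c conjunct1[OF w]] by simp
  qed
qed

text \<open>Terminal objects, binary products and pullbacks are such limits.\<close>

lemma is_terminal_lim: "is_terminal E T \<longleftrightarrow> is_lim T p {} Y {}"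
  by (auto simp: is_terminal_def is_lim_def cone_def)

lemma terminal_sec: "is_terminal E T \<Longrightarrow> c \<in> Obj C \<Longrightarrow> \<exists>!z. z \<in> sec T c"
  using lim_sec[of "{}" undefined "{}" T undefined c undefined]
  by (simp add: is_terminal_lim[of _ undefined undefined] diagram_def sec_cone_def)

text \<open>Families indexed by \<open>{0, 1}\<close>.\<close>

abbreviation two :: "'x \<Rightarrow> 'x \<Rightarrow> nat \<Rightarrow> 'x" where
  "two x y \<equiv> (\<lambda>k. if k = 0 then x else y)"

lemma diagram_product: "A \<in> Obj E \<Longrightarrow> B \<in> Obj E \<Longrightarrow> diagram {0, 1} (two A B) {}"
  by (simp add: diagram_def)

lemma is_product_lim:
  assumes "A \<in> Obj E" "B \<in> Obj E"
  shows "is_product E A B p q \<longleftrightarrow> Dom E q = Dom E p \<and> is_lim (Dom E p) (two p q) {0, 1} (two A B) {}"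
proof
  assume a: "is_product E A B p q"
  have h: "p \<in> hom E (Dom E p) A" "q \<in> hom E (Dom E p) B" using a by (simp_all add: is_product_def)
  show "Dom E q = Dom E p \<and> is_lim (Dom E p) (two p q) {0, 1} (two A B) {}"
    unfolding is_lim_def
  proof (intro conjI ballI allI impI)
    show "Dom E q = Dom E p" "Dom E p \<in> Obj E" "cone (Dom E p) (two p q) {0, 1} (two A B) {}"
      using h objE(1)[OF h(1)] by (simp_all add: cone_def homD(2)[OF h(2)])
    fix T x assume "cone T x {0, 1} (two A B) {}"
    then have "x 0 \<in> hom E T A" "x 1 \<in> hom E T B" by (auto simp: cone_def)
    then have "\<exists>!h. h \<in> hom E T (Dom E p) \<and> p \<cdot>\<^bsub>E\<^esub> h = x 0 \<and> q \<cdot>\<^bsub>E\<^esub> h = x 1"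
      using conjunct2[OF conjunct2[OF a[unfolded is_product_def]]] by simp
    then show "\<exists>!h. h \<in> hom E T (Dom E p) \<and> (\<forall>k\<in>{0, 1}. two p q k \<cdot>\<^bsub>E\<^esub> h = x k)"
      by simp
  qed
next
  assume a: "Dom E q = Dom E p \<and> is_lim (Dom E p) (two p q) {0, 1} (two A B) {}"
  show "is_product E A B p q"
    unfolding is_product_def
  proof (intro conjI allI ballI)
    show "p \<in> hom E (Dom E p) A" "q \<in> hom E (Dom E p) B" using a by (auto simp: is_lim_def cone_def)
    fix T f g assume f: "f \<in> hom E T A" "g \<in> hom E T B"
    then have "cone T (two f g) {0, 1} (two A B) {}" by (simp add: cone_def)
    then have "\<exists>!h. h \<in> hom E T (Dom E p) \<and> (\<forall>k\<in>{0, 1}. two p q k \<cdot>\<^bsub>E\<^esub> h = two f g k)"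
      using a objE(1)[OF f(1)] by (simp only: is_lim_def)
    then show "\<exists>!h. h \<in> hom E T (Dom E p) \<and> p \<cdot>\<^bsub>E\<^esub> h = f \<and> q \<cdot>\<^bsub>E\<^esub> h = g" by simp
  qed
qed

lemma product_sec:
  assumes "A \<in> Obj E" "B \<in> Obj E" "is_product E A B p q" "c \<in> Obj C" "x \<in> sec A c" "y \<in> sec B c"
  shows "\<exists>!z. z \<in> sec (Dom E p) c \<and> act p c z = x \<and> act q c z = y"
  using lim_sec[OF diagram_product[OF assms(1,2)], of "Dom E p" "two p q" c "two x y"] assms
  by (simp add: is_product_lim sec_cone_def)

lemma projs_product:
  assumes AB: "A \<in> Obj E" "B \<in> Obj E"
  shows "is_product E A B (pr1 E A B) (pr2 E A B)"
proof -
  obtain P p where L: "is_lim P p {0, 1} (two A B) {}" using lim_exists[OF diagram_product[OF AB]] by metis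
  have h: "p 0 \<in> hom E P A" "p 1 \<in> hom E P B" using L by (auto simp: is_lim_def cone_def)
  have "is_lim P (two (p 0) (p (Suc 0))) {0, 1} (two A B) {}"
    using L by (simp add: is_lim_def cone_def)
  then have "is_product E A B (fst (p 0, p (Suc 0))) (snd (p 0, p (Suc 0)))"
    using h by (simp add: is_product_lim[OF AB] homD(2))
  then show ?thesis unfolding pr1_def pr2_def projs_def by (rule someI)
qed

lemma is_pullback_lim:
  assumes "f \<in> hom E A D" "g \<in> hom E B D"
  shows "is_pullback E p q f g \<longleftrightarrow> Dom E q = Dom E p \<and> is_lim (Dom E p) (two p q) {0, 1} (two A B) {(0, f, 1, g)}"
proof -
  have d: "Dom E f = A" "Dom E g = B" "f \<in> Arr E" "g \<in> Arr E" "Cod E f = D" "Cod E g = D"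
    using assms by (auto simp: hom_def)
  show ?thesis
  proof
    assume a: "is_pullback E p q f g"
    have h: "p \<in> hom E (Dom E p) A" "q \<in> hom E (Dom E p) B" "f \<cdot>\<^bsub>E\<^esub> p = g \<cdot>\<^bsub>E\<^esub> q"
      using a by (simp_all add: is_pullback_def d)
    show "Dom E q = Dom E p \<and> is_lim (Dom E p) (two p q) {0, 1} (two A B) {(0, f, 1, g)}"
      unfolding is_lim_def
    proof (intro conjI ballI allI impI)
      show "Dom E q = Dom E p" "Dom E p \<in> Obj E" "cone (Dom E p) (two p q) {0, 1} (two A B) {(0, f, 1, g)}"
        using h objE(1)[OF h(1)] by (simp_all add: cone_def homD(2)[OF h(2)])
      fix T x assume "cone T x {0, 1} (two A B) {(0, f, 1, g)}"
      then have "x 0 \<in> hom E T A" "x 1 \<in> hom E T B" "f \<cdot>\<^bsub>E\<^esub> x 0 = g \<cdot>\<^bsub>E\<^esub> x 1" by (auto simp: cone_def)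
      then have "\<exists>!h. h \<in> hom E T (Dom E p) \<and> p \<cdot>\<^bsub>E\<^esub> h = x 0 \<and> q \<cdot>\<^bsub>E\<^esub> h = x 1"
        using conjunct2[OF conjunct2[OF conjunct2[OF conjunct2[OF conjunct2[OF conjunct2[OF a[unfolded is_pullback_def d]]]]]]]
        by simp
      then show "\<exists>!h. h \<in> hom E T (Dom E p) \<and> (\<forall>k\<in>{0, 1}. two p q k \<cdot>\<^bsub>E\<^esub> h = x k)"
        by simp
    qed
  next
    assume a: "Dom E q = Dom E p \<and> is_lim (Dom E p) (two p q) {0, 1} (two A B) {(0, f, 1, g)}"
    show "is_pullback E p q f g"
      unfolding is_pullback_def d
    proof (intro conjI allI ballI impI)
      show "p \<in> hom E (Dom E p) A" "q \<in> hom E (Dom E p) B" "f \<cdot>\<^bsub>E\<^esub> p = g \<cdot>\<^bsub>E\<^esub> q"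
        using a by (auto simp: is_lim_def cone_def)
      fix T x y assume f: "x \<in> hom E T A" "y \<in> hom E T B" "f \<cdot>\<^bsub>E\<^esub> x = g \<cdot>\<^bsub>E\<^esub> y"
      then have "cone T (two x y) {0, 1} (two A B) {(0, f, 1, g)}" by (simp add: cone_def)
      then have "\<exists>!h. h \<in> hom E T (Dom E p) \<and> (\<forall>k\<in>{0, 1}. two p q k \<cdot>\<^bsub>E\<^esub> h = two x y k)"
        using a objE(1)[OF f(1)] by (simp only: is_lim_def)
      then show "\<exists>!h. h \<in> hom E T (Dom E p) \<and> p \<cdot>\<^bsub>E\<^esub> h = x \<and> q \<cdot>\<^bsub>E\<^esub> h = y" by simp
    qed (use d in auto)
  qed
qed

lemma diagram_pullback: "f \<in> hom E A D \<Longrightarrow> g \<in> hom E B D \<Longrightarrow> diagram {0, 1} (two A B) {(0, f, 1, g)}"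
  by (auto simp: diagram_def objE)

lemma pullback_sec:
  assumes "f \<in> hom E A D" "g \<in> hom E B D" "is_pullback E p q f g" "c \<in> Obj C" "x \<in> sec A c" "y \<in> sec B c"
    "act f c x = act g c y"
  shows "\<exists>!z. z \<in> sec (Dom E p) c \<and> act p c z = x \<and> act q c z = y"
  using lim_sec[OF diagram_pullback[OF assms(1,2)], of "Dom E p" "two p q" c "two x y"] assms
  by (simp add: is_pullback_lim sec_cone_def)

lemma pullback_exists:
  assumes fg: "f \<in> hom E A D" "g \<in> hom E B D"
  obtains p q where "is_pullback E p q f g"
proof -
  obtain P p where L: "is_lim P p {0, 1} (two A B) {(0, f, 1, g)}"
    using lim_exists[OF diagram_pullback[OF fg]] by metis
  have h: "p 0 \<in> hom E P A" "p 1 \<in> hom E P B" using L by (auto simp: is_lim_def cone_def)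
  have "is_lim P (two (p 0) (p (Suc 0))) {0, 1} (two A B) {(0, f, 1, g)}"
    using L by (simp add: is_lim_def cone_def)
  then show thesis using h that[of "p 0" "p (Suc 0)"] by (simp add: is_pullback_lim[OF fg] homD(2))
qed

subsection \<open>Products\<close>

lemma pr_hom:
  assumes "A \<in> Obj E" "B \<in> Obj E"
  shows "pr1 E A B \<in> hom E (Prod E A B) A" "pr2 E A B \<in> hom E (Prod E A B) B"
  using projs_product[OF assms] by (auto simp: is_product_def Prod_def)

lemma Prod_obj: "A \<in> Obj E \<Longrightarrow> B \<in> Obj E \<Longrightarrow> Prod E A B \<in> Obj E"
  using pr_hom(1) objE(1) by blast

lemma Prod_sec:
  assumes "A \<in> Obj E" "B \<in> Obj E" "c \<in> Obj C" "x \<in> sec A c" "y \<in> sec B c"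
  obtains z where "z \<in> sec (Prod E A B) c" "act (pr1 E A B) c z = x" "act (pr2 E A B) c z = y"
  using product_sec[OF assms(1,2) projs_product[OF assms(1,2)] assms(3-5)] by (auto simp: Prod_def)

lemma Prod_ext:
  assumes AB: "A \<in> Obj E" "B \<in> Obj E" and c: "c \<in> Obj C" and z: "z \<in> sec (Prod E A B) c" "z' \<in> sec (Prod E A B) c"
    and e: "act (pr1 E A B) c z = act (pr1 E A B) c z'" "act (pr2 E A B) c z = act (pr2 E A B) c z'"
  shows "z = z'"
  using product_sec[OF AB projs_product[OF AB] c act_in[OF pr_hom(1)[OF AB] c z(1)] act_in[OF pr_hom(2)[OF AB] c z(1)]] z e
  by (auto simp: Prod_def)

lemma pairing_prop:
  assumes f: "f \<in> hom E T A" and g: "g \<in> hom E T B"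
  shows "pairing E f g \<in> hom E T (Prod E A B)" "pr1 E A B \<cdot>\<^bsub>E\<^esub> pairing E f g = f" "pr2 E A B \<cdot>\<^bsub>E\<^esub> pairing E f g = g"
proof -
  have "\<exists>!h. h \<in> hom E T (Prod E A B) \<and> pr1 E A B \<cdot>\<^bsub>E\<^esub> h = f \<and> pr2 E A B \<cdot>\<^bsub>E\<^esub> h = g"
    using projs_product[OF objE(2)[OF f] objE(2)[OF g]] f g by (simp add: is_product_def Prod_def)
  from theI'[OF this] show "pairing E f g \<in> hom E T (Prod E A B)"
    "pr1 E A B \<cdot>\<^bsub>E\<^esub> pairing E f g = f" "pr2 E A B \<cdot>\<^bsub>E\<^esub> pairing E f g = g"
    using f g by (simp_all add: pairing_def hom_def)
qed

lemmas pairing_hom = pairing_prop(1)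

lemma pairing_act:
  assumes f: "f \<in> hom E T A" and g: "g \<in> hom E T B" and c: "c \<in> Obj C" "x \<in> sec T c"
  shows "act (pr1 E A B) c (act (pairing E f g) c x) = act f c x"
    "act (pr2 E A B) c (act (pairing E f g) c x) = act g c x"
  using act_comp[OF pairing_hom[OF f g] pr_hom(1)[OF objE(2)[OF f] objE(2)[OF g]] c]
    act_comp[OF pairing_hom[OF f g] pr_hom(2)[OF objE(2)[OF f] objE(2)[OF g]] c] pairing_prop[OF f g] by simp_all

lemma prod_map_hom:
  assumes f: "f \<in> hom E A A'" and g: "g \<in> hom E B B'"
  shows "prod_map E f g \<in> hom E (Prod E A B) (Prod E A' B')"
proof -
  note p = pr_hom[OF objE(1)[OF f] objE(1)[OF g]]
  show ?thesis using pairing_hom[OF compE[OF p(1) f] compE[OF p(2) g]] f g by (simp add: prod_map_def hom_def)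
qed

lemma prod_map_act:
  assumes f: "f \<in> hom E A A'" and g: "g \<in> hom E B B'" and c: "c \<in> Obj C" and z: "z \<in> sec (Prod E A B) c"
  shows "act (pr1 E A' B') c (act (prod_map E f g) c z) = act f c (act (pr1 E A B) c z)"
    "act (pr2 E A' B') c (act (prod_map E f g) c z) = act g c (act (pr2 E A B) c z)"
proof -
  note p = pr_hom[OF objE(1)[OF f] objE(1)[OF g]]
  show "act (pr1 E A' B') c (act (prod_map E f g) c z) = act f c (act (pr1 E A B) c z)"
    "act (pr2 E A' B') c (act (prod_map E f g) c z) = act g c (act (pr2 E A B) c z)"
    using pairing_act[OF compE[OF p(1) f] compE[OF p(2) g] c z] act_comp[OF p(1) f c z] act_comp[OF p(2) g c z] f g
    by (simp_all add: prod_map_def homD(2))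
qed

subsection \<open>Epimorphic families are locally surjective\<close>

lemma locally_cong: "(\<And>d f. f \<in> hom C d c \<Longrightarrow> P f = Q f) \<Longrightarrow> locally c P = locally c Q"
  unfolding locally_def by (rule arg_cong[of _ _ "\<lambda>A. A \<in> J c"]) (auto simp: hom_def)

text \<open>Closed sieves: they contain every arrow that belongs to them locally. They are the sections of the
  subobject classifier.\<close>

definition closed_sieve :: "'v \<Rightarrow> 'v set \<Rightarrow> bool" where
  "closed_sieve c R \<longleftrightarrow> (\<forall>h\<in>R. h \<in> hom C (Dom C h) c) \<and> stable c (\<lambda>h. h \<in> R) \<and>
     (\<forall>d h. h \<in> hom C d c \<longrightarrow> locally d (\<lambda>g. h \<cdot>\<^bsub>C\<^esub> g \<in> R) \<longrightarrow> h \<in> R)"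

lemma closed_sieveD:
  assumes "closed_sieve c R"
  shows "h \<in> R \<Longrightarrow> h \<in> hom C (Dom C h) c"
    "h \<in> R \<Longrightarrow> g \<in> hom C e (Dom C h) \<Longrightarrow> h \<cdot>\<^bsub>C\<^esub> g \<in> R"
    "h \<in> hom C d c \<Longrightarrow> locally d (\<lambda>g. h \<cdot>\<^bsub>C\<^esub> g \<in> R) \<Longrightarrow> h \<in> R"
  using assms unfolding closed_sieve_def stable_def by blast+

lemma pull_sieve_iff: "f \<in> hom C d c \<Longrightarrow> g \<in> pull_sieve C f R \<longleftrightarrow> (g \<in> hom C (Dom C g) d \<and> f \<cdot>\<^bsub>C\<^esub> g \<in> R)"
  by (auto simp: pull_sieve_def hom_def)

lemma closed_sieve_pull:
  assumes f: "f \<in> hom C d c" and R: "closed_sieve c R"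
  shows "closed_sieve d (pull_sieve C f R)"
  unfolding closed_sieve_def
proof (intro conjI ballI allI impI stableI)
  note R = closed_sieveD[OF R]
  fix g h a b assume g: "g \<in> hom C a d" "g \<in> pull_sieve C f R" and h: "h \<in> hom C b a"
  have "(f \<cdot>\<^bsub>C\<^esub> g) \<cdot>\<^bsub>C\<^esub> h \<in> R"
    by (rule R(2)) (use g h compC[OF g(1) f] in \<open>auto simp: pull_sieve_iff[OF f] homD(2)\<close>)
  then show "g \<cdot>\<^bsub>C\<^esub> h \<in> pull_sieve C f R"
    using assocC[OF h g(1) f] compC[OF h g(1)] by (auto simp: pull_sieve_iff[OF f] hom_def)
next
  note R = closed_sieveD[OF R]
  fix e h assume h: "h \<in> hom C e d" and l: "locally e (\<lambda>g. h \<cdot>\<^bsub>C\<^esub> g \<in> pull_sieve C f R)"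
  have "locally e (\<lambda>g. (f \<cdot>\<^bsub>C\<^esub> h) \<cdot>\<^bsub>C\<^esub> g \<in> R)"
    using l
  proof (rule iffD1[OF locally_cong, rotated])
    fix a g assume g: "g \<in> hom C a e"
    show "(h \<cdot>\<^bsub>C\<^esub> g \<in> pull_sieve C f R) = ((f \<cdot>\<^bsub>C\<^esub> h) \<cdot>\<^bsub>C\<^esub> g \<in> R)"
      using compC[OF g h] assocC[OF g h f] by (auto simp: pull_sieve_iff[OF f] hom_def)
  qed
  then show "h \<in> pull_sieve C f R"
    using R(3)[OF compC[OF h f]] h by (auto simp: pull_sieve_iff[OF f] hom_def)
qed (auto simp: pull_sieve_iff[OF f])

lemma closed_sieves_sheaf: "set_sheaf C J (\<lambda>c. {R. closed_sieve c R}) (pull_sieve C)"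
proof (rule set_sheaf_localI)
  show "pull_sieve C f R \<in> {R. closed_sieve d R}" if "f \<in> hom C d c" "R \<in> {R. closed_sieve c R}" for f d c R
    using that closed_sieve_pull by blast
next
  fix c R assume c: "c \<in> Obj C" and R: "R \<in> {R. closed_sieve c R}"
  show "pull_sieve C (Id C c) R = R"
    using closed_sieveD(1)[of c R] R unitC(2)[of _ _ c] by (auto simp: pull_sieve_iff[OF idC[OF c]]) metis+
next
  fix f g b c d R assume f: "f \<in> hom C b c" and g: "g \<in> hom C c d" and R: "R \<in> {R. closed_sieve d R}"
  show "pull_sieve C (g \<cdot>\<^bsub>C\<^esub> f) R = pull_sieve C f (pull_sieve C g R)"
  proof (rule set_eqI)
    fix h
    show "h \<in> pull_sieve C (g \<cdot>\<^bsub>C\<^esub> f) R \<longleftrightarrow> h \<in> pull_sieve C f (pull_sieve C g R)"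
    proof (cases "h \<in> hom C (Dom C h) b")
      case True
      note fh = compC[OF True f]
      have "Dom C (f \<cdot>\<^bsub>C\<^esub> h) = Dom C h" using fh by (simp add: hom_def)
      then show ?thesis using True fh assocC[OF True f g]
        by (simp add: pull_sieve_iff[OF f] pull_sieve_iff[OF g] pull_sieve_iff[OF compC[OF f g]])
    qed (simp add: pull_sieve_iff[OF f] pull_sieve_iff[OF compC[OF f g]])
  qed
next
  have *: "R \<subseteq> R'" if c: "c \<in> Obj C" and P: "locally c P" and R: "closed_sieve c R" and R': "closed_sieve c R'"
    and e: "\<And>d f. f \<in> hom C d c \<Longrightarrow> P f \<Longrightarrow> pull_sieve C f R = pull_sieve C f R'" for c P R R'
  proof
    fix h assume h: "h \<in> R"
    note hh = closed_sieveD(1)[OF R h]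
    show "h \<in> R'"
    proof (rule closed_sieveD(3)[OF R' hh], rule locally_mono[OF objC(1)[OF hh] locally_pull[OF hh P]])
      show "stable (Dom C h) (\<lambda>g. h \<cdot>\<^bsub>C\<^esub> g \<in> R')"
      proof (rule stableI)
        fix f g d e assume a: "f \<in> hom C d (Dom C h)" "h \<cdot>\<^bsub>C\<^esub> f \<in> R'" "g \<in> hom C e d"
        show "h \<cdot>\<^bsub>C\<^esub> (f \<cdot>\<^bsub>C\<^esub> g) \<in> R'"
          using closed_sieveD(2)[OF R' a(2), of g e] a(3) compC[OF a(1) hh] assocC[OF a(3,1) hh] by (simp add: homD(2))
      qed
      fix d g assume g: "g \<in> hom C d (Dom C h)" "P (h \<cdot>\<^bsub>C\<^esub> g)"
      note hg = compC[OF g(1) hh]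
      have i: "Id C d \<in> hom C d d" by (rule idC[OF objC(1)[OF g(1)]])
      have "Id C d \<in> pull_sieve C (h \<cdot>\<^bsub>C\<^esub> g) R"
        using closed_sieveD(2)[OF R h g(1)] i unitC(1)[OF hg] by (simp add: pull_sieve_iff[OF hg] homD(2))
      then show "h \<cdot>\<^bsub>C\<^esub> g \<in> R'" using e[OF hg g(2)] unitC(1)[OF hg] by (simp add: pull_sieve_iff[OF hg])
    qed
  qed
  fix c P x y
  assume "c \<in> Obj C" "locally c P" "x \<in> {R. closed_sieve c R}" "y \<in> {R. closed_sieve c R}"
    "\<And>d f. f \<in> hom C d c \<Longrightarrow> P f \<Longrightarrow> pull_sieve C f x = pull_sieve C f y"
  then show "x = y" by (intro subset_antisym) (rule *[of c P]; simp)+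
next
  fix c P x assume c: "c \<in> Obj C" and P: "locally c P"
    and x0: "\<And>d f. f \<in> hom C d c \<Longrightarrow> P f \<Longrightarrow> x f \<in> {R. closed_sieve d R}"
    and m: "\<And>d e f g. f \<in> hom C d c \<Longrightarrow> P f \<Longrightarrow> g \<in> hom C e d \<Longrightarrow> pull_sieve C g (x f) = x (f \<cdot>\<^bsub>C\<^esub> g)"
  have x: "closed_sieve d (x f)" if "f \<in> hom C d c" "P f" for d f using x0[OF that] by simp
  note st = stableD[OF locally_stable[OF c P]]
  \<comment> \<open>the amalgamation: \<open>h\<close> belongs to it when its composites into the cover belong to the given sieves\<close>
  define R where "R = {h \<in> Arr C. Cod C h = c \<and> (\<forall>e g. g \<in> hom C e (Dom C h) \<longrightarrow> P (h \<cdot>\<^bsub>C\<^esub> g) \<longrightarrow> Id C e \<in> x (h \<cdot>\<^bsub>C\<^esub> g))}"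
  have Riff: "h \<in> R \<longleftrightarrow> (\<forall>e g. g \<in> hom C e d \<longrightarrow> P (h \<cdot>\<^bsub>C\<^esub> g) \<longrightarrow> Id C e \<in> x (h \<cdot>\<^bsub>C\<^esub> g))" if "h \<in> hom C d c" for h d
    using that by (auto simp: R_def hom_def)
  have key: "Id C e \<in> x (f \<cdot>\<^bsub>C\<^esub> h) \<longleftrightarrow> h \<in> x f" if f: "f \<in> hom C d c" "P f" and h: "h \<in> hom C e d" for f d h e
  proof -
    have "Id C e \<in> pull_sieve C h (x f) \<longleftrightarrow> h \<in> x f"
      using idC[OF objC(1)[OF h]] unitC(1)[OF h] by (simp add: pull_sieve_iff[OF h] homD(2))
    then show ?thesis using m[OF f h] by simp
  qed
  have "closed_sieve c R"
    unfolding closed_sieve_def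
  proof (intro conjI ballI allI impI stableI)
    show "h \<in> hom C (Dom C h) c" if "h \<in> R" for h using that by (auto simp: R_def hom_def)
    fix f g d e assume f: "f \<in> hom C d c" "f \<in> R" and g: "g \<in> hom C e d"
    show "f \<cdot>\<^bsub>C\<^esub> g \<in> R"
      unfolding Riff[OF compC[OF g f(1)]]
      using f(2)[unfolded Riff[OF f(1)]] assocC[OF _ g f(1)] compC[OF _ g] by metis
  next
    fix d h assume h: "h \<in> hom C d c" and l: "locally d (\<lambda>g. h \<cdot>\<^bsub>C\<^esub> g \<in> R)"
    show "h \<in> R"
      unfolding Riff[OF h]
    proof (intro allI impI)
      fix e g assume g: "g \<in> hom C e d" and Pg: "P (h \<cdot>\<^bsub>C\<^esub> g)"
      note hg = compC[OF g h]
      have i: "Id C e \<in> hom C e e" by (rule idC[OF objC(1)[OF g]])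
      show "Id C e \<in> x (h \<cdot>\<^bsub>C\<^esub> g)"
      proof (rule closed_sieveD(3)[OF x[OF hg Pg] i], rule locally_mono[OF objC(1)[OF g] locally_pull[OF g l]])
        show "stable e (\<lambda>k. Id C e \<cdot>\<^bsub>C\<^esub> k \<in> x (h \<cdot>\<^bsub>C\<^esub> g))"
        proof (rule stableI)
          fix k k' a b assume k: "k \<in> hom C a e" "Id C e \<cdot>\<^bsub>C\<^esub> k \<in> x (h \<cdot>\<^bsub>C\<^esub> g)" "k' \<in> hom C b a"
          show "Id C e \<cdot>\<^bsub>C\<^esub> (k \<cdot>\<^bsub>C\<^esub> k') \<in> x (h \<cdot>\<^bsub>C\<^esub> g)"
            using closed_sieveD(2)[OF x[OF hg Pg], of k k' b] k unitC(2)[OF k(1)] unitC(2)[OF compC[OF k(3,1)]]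
            by (simp add: homD(2))
        qed
        fix a k assume k: "k \<in> hom C a e" and hgk: "h \<cdot>\<^bsub>C\<^esub> (g \<cdot>\<^bsub>C\<^esub> k) \<in> R"
        have e: "h \<cdot>\<^bsub>C\<^esub> (g \<cdot>\<^bsub>C\<^esub> k) = (h \<cdot>\<^bsub>C\<^esub> g) \<cdot>\<^bsub>C\<^esub> k" using assocC[OF k g h] .
        have "P ((h \<cdot>\<^bsub>C\<^esub> g) \<cdot>\<^bsub>C\<^esub> k)" using st[OF hg Pg k] .
        then have "Id C a \<in> x ((h \<cdot>\<^bsub>C\<^esub> g) \<cdot>\<^bsub>C\<^esub> k)"
          using hgk[unfolded e Riff[OF compC[OF k hg]]] idC[OF objC(1)[OF k]] unitC(1)[OF compC[OF k hg]] by metis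
        then show "Id C e \<cdot>\<^bsub>C\<^esub> k \<in> x (h \<cdot>\<^bsub>C\<^esub> g)" using key[OF hg Pg k] unitC(2)[OF k] by simp
      qed
    qed
  qed
  moreover have "pull_sieve C f R = x f" if f: "f \<in> hom C d c" "P f" for d f
  proof (rule set_eqI)
    fix h
    show "h \<in> pull_sieve C f R \<longleftrightarrow> h \<in> x f"
    proof (cases "h \<in> hom C (Dom C h) d")
      case True
      note fh = compC[OF True f(1)]
      have "f \<cdot>\<^bsub>C\<^esub> h \<in> R \<longleftrightarrow> (\<forall>e g. g \<in> hom C e (Dom C h) \<longrightarrow> h \<cdot>\<^bsub>C\<^esub> g \<in> x f)"
        unfolding Riff[OF fh]
        using key[OF f] compC[OF _ True] assocC[OF _ True f(1)] st[OF f] by metis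
      also have "\<dots> \<longleftrightarrow> h \<in> x f"
        using closed_sieveD(2)[OF x[OF f]] idC[OF objC(1)[OF True]] unitC(1)[OF True] by metis
      finally show ?thesis using True by (simp add: pull_sieve_iff[OF f(1)])
    qed (use closed_sieveD(1)[OF x[OF f], of h] in \<open>auto simp: pull_sieve_iff[OF f(1)]\<close>)
  qed
  ultimately show "\<exists>y\<in>{R. closed_sieve c R}. \<forall>d f. f \<in> hom C d c \<longrightarrow> P f \<longrightarrow> pull_sieve C f y = x f" by blast
qed

text \<open>The section \<open>b\<close> over \<open>c\<close> lies in the image of some member of the family \<open>K\<close>.\<close>

definition in_image :: "'a set \<Rightarrow> 'v \<Rightarrow> 'v \<Rightarrow> bool" where
  "in_image K c b \<longleftrightarrow> (\<exists>k\<in>K. \<exists>v\<in>sec (Dom E k) c. act k c v = b)"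

lemma in_image_res:
  assumes K: "\<And>k. k \<in> K \<Longrightarrow> k \<in> Arr E \<and> Cod E k = B" and f: "f \<in> hom C d c" and b: "in_image K c b"
  shows "in_image K d (res B f b)"
proof -
  obtain k v where k: "k \<in> K" "v \<in> sec (Dom E k) c" "act k c v = b" using b by (auto simp: in_image_def)
  have h: "k \<in> hom E (Dom E k) B" using K[OF k(1)] by (simp add: hom_def)
  show ?thesis
    unfolding in_image_def
    using k act_nat[OF h f k(2)] res_in[OF objE(1)[OF h] f k(2)] by (intro bexI[of _ k] bexI[of _ "res (Dom E k) f v"]) auto
qed

text \<open>The maps into the sheaf of closed sieves classifying the whole of \<open>B\<close> and the local image of \<open>K\<close>
  agree on every member of \<open>K\<close>. If \<open>K\<close> is epimorphic they are equal, so the local image is all of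
  \<open>B\<close>.\<close>

lemma epi_locally:
  assumes epi: "epimorphic_family E B K" and B: "B \<in> Obj E" and c0: "c0 \<in> Obj C" and b0: "b0 \<in> sec B c0"
  shows "locally c0 (\<lambda>f. in_image K (Dom C f) (res B f b0))"
proof -
  have K: "k \<in> Arr E \<and> Cod E k = B" if "k \<in> K" for k using epi that by (simp add: epimorphic_family_def)
  define M where "M c b = (\<lambda>f. in_image K (Dom C f) (res B f b))" for c :: 'v and b
  have Mst: "stable c (M c b)" if b: "b \<in> sec B c" for c b
  proof (rule stableI)
    fix f g d e assume f: "f \<in> hom C d c" "M c b f" and g: "g \<in> hom C e d"
    show "M c b (f \<cdot>\<^bsub>C\<^esub> g)"
      using in_image_res[OF K g, where b = "res B f b"] f compC[OF g f(1)] res_comp[OF B g f(1) b]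
      by (auto simp: M_def homD(2))
  qed
  define R where "R c b = {f \<in> Arr C. Cod C f = c \<and> locally (Dom C f) (\<lambda>g. M c b (f \<cdot>\<^bsub>C\<^esub> g))}" for c b
  have Riff: "f \<in> R c b \<longleftrightarrow> locally d (\<lambda>g. M c b (f \<cdot>\<^bsub>C\<^esub> g))" if "f \<in> hom C d c" for f c d b
    using that by (auto simp: R_def hom_def)
  have Rcl: "closed_sieve c (R c b)" if b: "b \<in> sec B c" for c b
    unfolding closed_sieve_def
  proof (intro conjI ballI allI impI stableI)
    show "h \<in> hom C (Dom C h) c" if "h \<in> R c b" for h using that by (auto simp: R_def hom_def)
  next
    fix f g d e assume f: "f \<in> hom C d c" "f \<in> R c b" and g: "g \<in> hom C e d"
    have "locally e (\<lambda>h. M c b (f \<cdot>\<^bsub>C\<^esub> (g \<cdot>\<^bsub>C\<^esub> h)))"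
      using locally_pull[OF g] f(2)[unfolded Riff[OF f(1)]] by blast
    then show "f \<cdot>\<^bsub>C\<^esub> g \<in> R c b"
      unfolding Riff[OF compC[OF g f(1)]] by (rule iffD1[OF locally_cong, rotated]) (simp add: assocC[OF _ g f(1)])
  next
    fix d h assume h: "h \<in> hom C d c" and l: "locally d (\<lambda>g. h \<cdot>\<^bsub>C\<^esub> g \<in> R c b)"
    show "h \<in> R c b"
      unfolding Riff[OF h]
    proof (rule locally_bind[OF objC(1)[OF h] l])
      show "stable d (\<lambda>g. M c b (h \<cdot>\<^bsub>C\<^esub> g))"
      proof (rule stableI)
        fix f g a e assume f: "f \<in> hom C a d" "M c b (h \<cdot>\<^bsub>C\<^esub> f)" and g: "g \<in> hom C e a"
        show "M c b (h \<cdot>\<^bsub>C\<^esub> (f \<cdot>\<^bsub>C\<^esub> g))"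
          using stableD[OF Mst[OF b] compC[OF f(1) h] f(2) g] assocC[OF g f(1) h] by simp
      qed
      fix e f assume f: "f \<in> hom C e d" "h \<cdot>\<^bsub>C\<^esub> f \<in> R c b"
      from f(2)[unfolded Riff[OF compC[OF f(1) h]]]
      show "locally e (\<lambda>g. M c b (h \<cdot>\<^bsub>C\<^esub> (f \<cdot>\<^bsub>C\<^esub> g)))"
        by (rule iffD1[OF locally_cong, rotated]) (simp add: assocC[OF _ f(1) h])
    qed
  qed
  have sm: "small el {R. closed_sieve c R}" if "c \<in> Obj C" for c
  proof (rule small_sub[OF univ small_Pow[OF univ small_range[OF univ small_Arr]]])
    show "{R. closed_sieve c R} \<subseteq> Pow (Arr C)" using closed_sieveD(1) by (auto simp: hom_def)
  qed
  obtain W \<beta> where W: "W \<in> Obj E" and bb: "\<And>c. c \<in> Obj C \<Longrightarrow> bij_betw (\<beta> c) (sec W c) {R. closed_sieve c R}"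
    and bn: "\<And>f d c x. f \<in> hom C d c \<Longrightarrow> x \<in> sec W c \<Longrightarrow> \<beta> d (res W f x) = pull_sieve C f (\<beta> c x)"
    using represent_small[OF closed_sieves_sheaf sm] by blast
  define \<gamma> where "\<gamma> c R = inv_into (sec W c) (\<beta> c) R" for c R
  have g1: "\<gamma> c R \<in> sec W c" "\<beta> c (\<gamma> c R) = R" if "c \<in> Obj C" "closed_sieve c R" for c R
    using bb[OF that(1)] that(2) inv_into_into[of R "\<beta> c" "sec W c"] f_inv_into_f[of R "\<beta> c" "sec W c"]
    by (simp_all add: \<gamma>_def bij_betw_def)
  have g2: "\<gamma> d (pull_sieve C f R) = res W f (\<gamma> c R)" if f: "f \<in> hom C d c" and R: "closed_sieve c R" for f d c R
  proof -
    note oc = objC[OF f]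
    have r: "res W f (\<gamma> c R) \<in> sec W d" by (rule res_in[OF W f g1(1)[OF oc(2) R]])
    have "\<beta> d (res W f (\<gamma> c R)) = pull_sieve C f R" using bn[OF f g1(1)[OF oc(2) R]] g1(2)[OF oc(2) R] by simp
    then show ?thesis using bb[OF oc(1)] r by (simp add: \<gamma>_def bij_betw_def inv_into_f_eq)
  qed
  define Mx where "Mx c = {f \<in> Arr C. Cod C f = c}" for c
  have Mxc: "closed_sieve c (Mx c)" if "c \<in> Obj C" for c
    using compC by (auto simp: closed_sieve_def Mx_def hom_def intro!: stableI)
  have "\<exists>t\<in>hom E B W. \<forall>c\<in>Obj C. \<forall>b\<in>sec B c. act t c b = \<gamma> c (Mx c)"
  proof (rule full[OF B W])
    fix f d c b assume f: "f \<in> hom C d c"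
    have "pull_sieve C f (Mx c) = Mx d"
      using f compC[OF _ f] by (auto simp: pull_sieve_def Mx_def hom_def)
    then show "\<gamma> d (Mx d) = res W f (\<gamma> c (Mx c))" using g2[OF f Mxc[OF objC(2)[OF f]]] by simp
  qed (use g1(1) Mxc in auto)
  then obtain t where t: "t \<in> hom E B W" "\<And>c b. c \<in> Obj C \<Longrightarrow> b \<in> sec B c \<Longrightarrow> act t c b = \<gamma> c (Mx c)" by blast
  have "\<exists>u\<in>hom E B W. \<forall>c\<in>Obj C. \<forall>b\<in>sec B c. act u c b = \<gamma> c (R c b)"
  proof (rule full[OF B W g1(1)[OF _ Rcl]])
    fix f d c b assume f: "f \<in> hom C d c" and b: "b \<in> sec B c"
    have "pull_sieve C f (R c b) = R d (res B f b)"
    proof (rule set_eqI)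
      fix h
      show "h \<in> pull_sieve C f (R c b) \<longleftrightarrow> h \<in> R d (res B f b)"
      proof (cases "h \<in> hom C (Dom C h) d")
        case True
        have "locally (Dom C h) (\<lambda>g. M c b ((f \<cdot>\<^bsub>C\<^esub> h) \<cdot>\<^bsub>C\<^esub> g)) \<longleftrightarrow> locally (Dom C h) (\<lambda>g. M d (res B f b) (h \<cdot>\<^bsub>C\<^esub> g))"
        proof (rule locally_cong)
          fix e g assume g: "g \<in> hom C e (Dom C h)"
          show "M c b ((f \<cdot>\<^bsub>C\<^esub> h) \<cdot>\<^bsub>C\<^esub> g) = M d (res B f b) (h \<cdot>\<^bsub>C\<^esub> g)"
            using res_comp[OF B compC[OF g True] f b] assocC[OF g True f] homD(2)[OF compC[OF g True]]
              homD(2)[OF compC[OF compC[OF g True] f]] by (simp add: M_def)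
        qed
        then show ?thesis using True by (simp add: pull_sieve_iff[OF f] Riff[OF compC[OF True f]] Riff[OF True])
      qed (auto simp: pull_sieve_iff[OF f] R_def hom_def)
    qed
    then show "\<gamma> d (R d (res B f b)) = res W f (\<gamma> c (R c b))" using g2[OF f Rcl[OF b]] by simp
  qed
  then obtain u where u: "u \<in> hom E B W" "\<And>c b. c \<in> Obj C \<Longrightarrow> b \<in> sec B c \<Longrightarrow> act u c b = \<gamma> c (R c b)" by blast
  have "t = u"
  proof -
    have "t \<cdot>\<^bsub>E\<^esub> k = u \<cdot>\<^bsub>E\<^esub> k" if k: "k \<in> K" for k
    proof -
      have h: "k \<in> hom E (Dom E k) B" using K[OF k] by (simp add: hom_def)
      show ?thesis
      proof (rule faithful[OF compE[OF h t(1)] compE[OF h u(1)]])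
        fix c v assume c: "c \<in> Obj C" and v: "v \<in> sec (Dom E k) c"
        note kv = act_in[OF h c v]
        have M: "M c (act k c v) f" if f: "f \<in> hom C d c" for f d
          unfolding M_def homD(2)[OF f] in_image_def
          using act_nat[OF h f v] res_in[OF objE(1)[OF h] f v]
          by (intro bexI[OF _ k] bexI[of _ "res (Dom E k) f v"]) auto
        have "R c (act k c v) = Mx c"
        proof (intro set_eqI)
          fix f
          show "f \<in> R c (act k c v) \<longleftrightarrow> f \<in> Mx c"
          proof (cases "f \<in> hom C (Dom C f) c")
            case True
            have "locally (Dom C f) (\<lambda>g. M c (act k c v) (f \<cdot>\<^bsub>C\<^esub> g))"
              by (rule locally_always[OF objC(1)[OF True]]) (rule M[OF compC[OF _ True]])
            then show ?thesis using True by (simp add: Riff[OF True]) (simp add: Mx_def hom_def)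
          qed (auto simp: R_def Mx_def hom_def)
        qed
        then show "act (t \<cdot>\<^bsub>E\<^esub> k) c v = act (u \<cdot>\<^bsub>E\<^esub> k) c v"
          using act_comp[OF h t(1) c v] act_comp[OF h u(1) c v] t(2)[OF c kv] u(2)[OF c kv] by simp
      qed
    qed
    then show ?thesis
      using conjunct2[OF epi[unfolded epimorphic_family_def], rule_format, OF t(1) u(1)] by blast
  qed
  then have "\<gamma> c0 (R c0 b0) = \<gamma> c0 (Mx c0)" using t(2)[OF c0 b0] u(2)[OF c0 b0] by simp
  then have "R c0 b0 = Mx c0"
    using arg_cong[of "\<gamma> c0 (R c0 b0)" "\<gamma> c0 (Mx c0)" "\<beta> c0"]
    unfolding g1(2)[OF c0 Rcl[OF b0]] g1(2)[OF c0 Mxc[OF c0]] by blast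
  then have "Id C c0 \<in> R c0 b0" using idC[OF c0] by (simp add: Mx_def hom_def)
  then have "locally c0 (\<lambda>g. M c0 b0 (Id C c0 \<cdot>\<^bsub>C\<^esub> g))" unfolding Riff[OF idC[OF c0]] .
  then show ?thesis
  proof (rule iffD1[OF locally_cong, rotated])
    fix d f assume f: "f \<in> hom C d c0"
    show "M c0 b0 (Id C c0 \<cdot>\<^bsub>C\<^esub> f) = in_image K (Dom C f) (res B f b0)"
      by (simp add: M_def unitC(2)[OF f])
  qed
qed

lemma epi_of_locally:
  assumes K: "\<And>k. k \<in> K \<Longrightarrow> k \<in> Arr E \<and> Cod E k = B"
    and l: "\<And>c b. c \<in> Obj C \<Longrightarrow> b \<in> sec B c \<Longrightarrow> locally c (\<lambda>f. in_image K (Dom C f) (res B f b))"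
  shows "epimorphic_family E B K"
  unfolding epimorphic_family_def
proof (intro conjI ballI allI impI)
  fix Z f g assume f: "f \<in> hom E B Z" and g: "g \<in> hom E B Z" and e: "\<forall>k\<in>K. f \<cdot>\<^bsub>E\<^esub> k = g \<cdot>\<^bsub>E\<^esub> k"
  show "f = g"
  proof (rule faithful[OF f g])
    fix c b assume c: "c \<in> Obj C" and b: "b \<in> sec B c"
    show "act f c b = act g c b"
    proof (rule separated[OF objE(2)[OF f] c l[OF c b] act_in[OF f c b] act_in[OF g c b]])
      fix d h assume h: "h \<in> hom C d c" and "in_image K (Dom C h) (res B h b)"
      then obtain k v where k: "k \<in> K" "v \<in> sec (Dom E k) d" "act k d v = res B h b"
        by (auto simp: in_image_def homD(2))
      have kh: "k \<in> hom E (Dom E k) B" using K[OF k(1)] by (simp add: hom_def)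
      note d = objC(1)[OF h]
      have "act f d (res B h b) = act g d (res B h b)"
        using act_comp[OF kh f d k(2)] act_comp[OF kh g d k(2)] k(1,3) e by simp
      then show "res Z h (act f c b) = res Z h (act g c b)" using act_nat[OF f h b] act_nat[OF g h b] by simp
    qed
  qed
qed (use K in auto)

end

section \<open>Constant objects and components of families\<close>

lemma set_cat_terminal_iff:
  assumes u: "universe el"
  shows "is_terminal (set_cat el) T \<longleftrightarrow> (\<exists>x. el T = {x})"
proof
  assume T: "is_terminal (set_cat el) T"
  obtain b s where s: "el s = {b}" using el_pair[OF u, of b b] by (auto simp: image_iff)
  have e: "\<exists>!f. f \<in> hom (set_cat el) s T" using T by (simp add: is_terminal_def)
  then obtain f where f: "f \<in> hom (set_cat el) s T" by blast
  have x: "app f b \<in> el T" using app_in[OF f] s by simp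
  have "y = app f b" if y: "y \<in> el T" for y
  proof -
    have "(s, (\<lambda>_\<in>el s. y), T) \<in> hom (set_cat el) s T" using y by (intro hom_set_catI) auto
    then have "f = (s, (\<lambda>_\<in>el s. y), T)" using e f by blast
    then show ?thesis using s by (simp add: app_def)
  qed
  then show "\<exists>x. el T = {x}" using x by blast
next
  assume "\<exists>x. el T = {x}"
  then obtain x where x: "el T = {x}" by blast
  have "\<exists>!f. f \<in> hom (set_cat el) A T" for A
  proof (rule ex1I[of _ "(A, (\<lambda>_\<in>el A. x), T)"])
    show h: "(A, (\<lambda>_\<in>el A. x), T) \<in> hom (set_cat el) A T" using x by (intro hom_set_catI) auto
    show "f = (A, (\<lambda>_\<in>el A. x), T)" if "f \<in> hom (set_cat el) A T" for f
      by (rule set_cat_ext[OF that h]) (use app_in[OF that] x in \<open>auto simp: app_def\<close>)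
  qed
  then show "is_terminal (set_cat el) T" by (simp add: is_terminal_def)
qed

lemma set_cat_one:
  assumes u: "universe el"
  shows "is_terminal (set_cat el) (one (set_cat el))" "\<exists>x. el (one (set_cat el)) = {x}"
proof -
  obtain b s where "el s = {b}" using el_pair[OF u, of b b] by (auto simp: image_iff)
  then have "is_terminal (set_cat el) s" by (auto simp: set_cat_terminal_iff[OF u])
  then show 1: "is_terminal (set_cat el) (one (set_cat el))" unfolding one_def by (rule someI)
  then show "\<exists>x. el (one (set_cat el)) = {x}" by (simp add: set_cat_terminal_iff[OF u])
qed

lemma point_hom: "a \<in> el A \<Longrightarrow> point el A a \<in> hom (set_cat el) (one (set_cat el)) A"
  unfolding point_def by (intro hom_set_catI) auto

lemma app_point: "x \<in> el (one (set_cat el)) \<Longrightarrow> app (point el A a) x = a"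
  by (simp add: point_def app_def)

lemma point_comp:
  assumes s: "s \<in> hom (set_cat el) A B" and a: "a \<in> el A"
  shows "s \<cdot>\<^bsub>set_cat el\<^esub> point el A a = point el B (app s a)"
proof -
  note p = point_hom[where el = el and A = A, OF a] and q = point_hom[where el = el and A = B, OF app_in[OF s a]]
  show ?thesis
    by (rule set_cat_ext[OF set_cat_comp[OF p s] q]) (simp add: app_comp_apply[OF p] app_point)
qed

text \<open>A topos of sheaves with its geometric morphism to the category of sets.\<close>

locale topos_over_sets = sheaf_topos el C J E sec res act
  for el :: "'v \<Rightarrow> 'v set" and C :: "('v, 'v) cat" and J and E :: "('o, 'a) cat" and sec res act +
  fixes gs :: "('v, 'v sarr, 'o, 'a) fctr" and gl :: "('o, 'a, 'v, 'v sarr) fctr"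
  assumes gm: "geometric_morphism E (set_cat el) gs gl"
begin

lemmas pointh = point_hom[where el = el]

lemma gs_functor: "is_functor (set_cat el) E gs"
  using gm by (simp add: geometric_morphism_def left_adjoint_def)

lemma gs_obj: "FO gs A \<in> Obj E"
  by (rule functor_obj[OF gs_functor]) simp

lemmas gs_arr = functor_arr[OF gs_functor] and gs_comp = functor_comp[OF gs_functor]

lemma gs_id: "FA gs (Id (set_cat el) A) = Id E (FO gs A)"
  by (rule functor_id[OF gs_functor]) simp

lemma gs_one: "is_terminal E (FO gs (one (set_cat el)))"
  using gm set_cat_one(1)[OF univ] by (simp add: geometric_morphism_def left_exact_def)

lemma gs_pullback: "is_pullback (set_cat el) p q f g \<Longrightarrow> is_pullback E (FA gs p) (FA gs q) (FA gs f) (FA gs g)"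
  by (rule conjunct2[OF conjunct2[OF conjunct2[OF gm[unfolded geometric_morphism_def left_exact_def]]], rule_format])

text \<open>The unique section of the terminal object \<open>\<gamma>\<^sup>* 1\<close>.\<close>

definition star :: "'v \<Rightarrow> 'v" where
  "star c = (THE z. z \<in> sec (FO gs (one (set_cat el))) c)"

lemma star: "c \<in> Obj C \<Longrightarrow> star c \<in> sec (FO gs (one (set_cat el))) c"
  and star_eq: "c \<in> Obj C \<Longrightarrow> z \<in> sec (FO gs (one (set_cat el))) c \<Longrightarrow> z = star c"
  using terminal_sec[OF gs_one] theI'[OF terminal_sec[OF gs_one]] unfolding star_def by blast+

text \<open>The constant section of \<open>\<gamma>\<^sup>* A\<close> at an element \<open>a\<close> of the set \<open>A\<close>.\<close>

definition const :: "'v \<Rightarrow> 'v \<Rightarrow> 'v \<Rightarrow> 'v" where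
  "const A a c = act (FA gs (point el A a)) c (star c)"

lemma const_res:
  assumes "a \<in> el A" "f \<in> hom C d c"
  shows "res (FO gs A) f (const A a c) = const A a d"
  using act_nat[OF gs_arr[OF pointh[OF assms(1)]] assms(2) star[OF objC(2)[OF assms(2)]]]
    star_eq[OF objC(1)[OF assms(2)] res_in[OF gs_obj assms(2) star[OF objC(2)[OF assms(2)]]]]
  by (simp add: const_def)

lemma const_map:
  assumes "s \<in> hom (set_cat el) A B" "a \<in> el A" "c \<in> Obj C"
  shows "act (FA gs s) c (const A a c) = const B (app s a) c"
  using act_comp[OF gs_arr[OF pointh[OF assms(2)]] gs_arr[OF assms(1)] assms(3) star[OF assms(3)]]
    gs_comp[OF pointh[OF assms(2)] assms(1)] point_comp[OF assms(1,2)]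
  by (simp add: const_def)

text \<open>A left adjoint preserves epimorphic families, in particular that of the points of a set.\<close>

lemma points_epi: "epimorphic_family E (FO gs A) {FA gs (point el A a) | a. a \<in> el A}"
  unfolding epimorphic_family_def
proof (intro conjI ballI allI impI)
  fix k assume "k \<in> {FA gs (point el A a) | a. a \<in> el A}"
  then obtain a where "a \<in> el A" "k = FA gs (point el A a)" by blast
  then have "k \<in> hom E (FO gs (one (set_cat el))) (FO gs A)" using gs_arr[OF pointh] by blast
  then show "k \<in> Arr E" "Cod E k = FO gs A" by (auto simp: hom_def)
next
  fix Z f g assume f: "f \<in> hom E (FO gs A) Z" and g: "g \<in> hom E (FO gs A) Z"
    and e: "\<forall>k\<in>{FA gs (point el A a) | a. a \<in> el A}. f \<cdot>\<^bsub>E\<^esub> k = g \<cdot>\<^bsub>E\<^esub> k"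
  note Z = objE(2)[OF f]
  have adj: "left_adjoint (set_cat el) E gs gl" using gm by (simp add: geometric_morphism_def)
  have glF: "is_functor E (set_cat el) gl"
    using conjunct1[OF conjunct2[OF adj[unfolded left_adjoint_def]]] .
  obtain \<phi> where b: "\<forall>A\<in>Obj (set_cat el). \<forall>X\<in>Obj E. bij_betw (\<phi> A X) (hom E (FO gs A) X) (hom (set_cat el) A (FO gl X))"
    and n: "\<forall>a\<in>Arr (set_cat el). \<forall>b\<in>Arr E. \<forall>f\<in>hom E (FO gs (Cod (set_cat el) a)) (Dom E b).
       \<phi> (Dom (set_cat el) a) (Cod E b) (b \<cdot>\<^bsub>E\<^esub> (f \<cdot>\<^bsub>E\<^esub> FA gs a)) =
       FA gl b \<cdot>\<^bsub>set_cat el\<^esub> (\<phi> (Cod (set_cat el) a) (Dom E b) f \<cdot>\<^bsub>set_cat el\<^esub> a)"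
    using conjunct2[OF conjunct2[OF adj[unfolded left_adjoint_def]]] by blast
  have bA: "bij_betw (\<phi> A Z) (hom E (FO gs A) Z) (hom (set_cat el) A (FO gl Z))" using b Z by simp
  have fh: "\<phi> A Z f' \<in> hom (set_cat el) A (FO gl Z)" if "f' \<in> hom E (FO gs A) Z" for f'
    using bA that by (auto simp: bij_betw_def)
  have nat: "\<phi> (one (set_cat el)) Z (f' \<cdot>\<^bsub>E\<^esub> FA gs (point el A a)) = \<phi> A Z f' \<cdot>\<^bsub>set_cat el\<^esub> point el A a"
    if f': "f' \<in> hom E (FO gs A) Z" and a: "a \<in> el A" for f' a
  proof -
    note p = pointh[OF a]
    note fp = compE[OF gs_arr[OF p] f']
    have i: "Id E Z \<in> hom E Z Z" by (rule idE[OF Z])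
    have "\<phi> (one (set_cat el)) Z (Id E Z \<cdot>\<^bsub>E\<^esub> (f' \<cdot>\<^bsub>E\<^esub> FA gs (point el A a))) =
       FA gl (Id E Z) \<cdot>\<^bsub>set_cat el\<^esub> (\<phi> A Z f' \<cdot>\<^bsub>set_cat el\<^esub> point el A a)"
      using n[rule_format, of "point el A a" "Id E Z" f'] p i f' by (simp add: hom_def)
    then show ?thesis
      using unitE(2)[OF fp] functor_id[OF glF Z] cat_unit(2)[OF category_set_cat set_cat_comp[OF p fh[OF f']]] by simp
  qed
  have "\<phi> A Z f = \<phi> A Z g"
  proof (rule set_cat_ext[OF fh[OF f] fh[OF g]])
    fix a assume a: "a \<in> el A"
    have "f \<cdot>\<^bsub>E\<^esub> FA gs (point el A a) = g \<cdot>\<^bsub>E\<^esub> FA gs (point el A a)" using e a by blast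
    then have e2: "\<phi> A Z f \<cdot>\<^bsub>set_cat el\<^esub> point el A a = \<phi> A Z g \<cdot>\<^bsub>set_cat el\<^esub> point el A a"
      using nat[OF f a] nat[OF g a] by simp
    obtain x where x: "x \<in> el (one (set_cat el))" using set_cat_one(2)[OF univ] by blast
    show "app (\<phi> A Z f) a = app (\<phi> A Z g) a"
      using app_comp_apply[OF pointh[OF a] x, of "\<phi> A Z f"] app_comp_apply[OF pointh[OF a] x, of "\<phi> A Z g"] e2
      by (simp add: app_point[where el = el, OF x])
  qed
  then show "f = g" using bA f g by (auto simp: bij_betw_def inj_on_def)
qed

text \<open>Every section of \<open>\<gamma>\<^sup>* A\<close> is locally constant.\<close>

lemma const_locally:
  assumes c: "c \<in> Obj C" and b: "b \<in> sec (FO gs A) c"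
  shows "locally c (\<lambda>f. \<exists>a\<in>el A. res (FO gs A) f b = const A a (Dom C f))"
proof (rule iffD1[OF locally_cong epi_locally[OF points_epi gs_obj c b]])
  fix d f assume f: "f \<in> hom C d c"
  note d = objC(1)[OF f] homD(2)[OF f]
  have D: "Dom E (FA gs (point el A a)) = FO gs (one (set_cat el))" if "a \<in> el A" for a
    using gs_arr[OF pointh[OF that]] by (simp add: hom_def)
  show "in_image {FA gs (point el A a) |a. a \<in> el A} (Dom C f) (res (FO gs A) f b) =
         (\<exists>a\<in>el A. res (FO gs A) f b = const A a (Dom C f))" (is "?l = ?r")
  proof
    assume ?l
    then obtain a v where a: "a \<in> el A" "v \<in> sec (Dom E (FA gs (point el A a))) d"
      "act (FA gs (point el A a)) d v = res (FO gs A) f b"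
      by (auto simp: in_image_def d(2))
    have "v = star d" by (rule star_eq[OF d(1)]) (use a(2) in \<open>simp only: D[OF a(1)]\<close>)
    then show ?r using a(3) by (intro bexI[OF _ a(1)]) (simp add: const_def d(2))
  next
    assume ?r
    then obtain a where a: "a \<in> el A" "res (FO gs A) f b = const A a d" by (auto simp: d(2))
    have "star d \<in> sec (Dom E (FA gs (point el A a))) d" using star[OF d(1)] by (simp only: D[OF a(1)])
    then show ?l
      using a unfolding in_image_def d(2) const_def
      by (intro bexI[of _ "FA gs (point el A a)"] bexI[of _ "star d"]) auto
  qed
qed

text \<open>Distinct constants agree only where the empty sieve covers: their pullback is \<open>\<gamma>\<^sup>*\<close> of the empty
  set.\<close>

lemma const_disjoint:
  assumes c: "c \<in> Obj C" and a: "a \<in> el A" and b: "b \<in> el A" and ab: "a \<noteq> b" and e: "const A a c = const A b c"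
  shows "{} \<in> J c"
proof -
  let ?o = "one (set_cat el)"
  obtain Q where Q: "el Q = {}" using el_sub[OF univ, of "{}"] by (metis empty_subsetI imageE)
  define p where "p = (Q, \<lambda>x::'v. undefined :: 'v, ?o)"
  have p: "p \<in> hom (set_cat el) Q ?o" by (simp add: p_def hom_set_cat app_def Q)
  note pa = pointh[OF a] and pb = pointh[OF b]
  obtain x where x: "el ?o = {x}" using set_cat_one(2)[OF univ] by blast
  have "is_pullback (set_cat el) p p (point el A a) (point el A b)"
    unfolding is_pullback_def
  proof (intro conjI allI ballI impI)
    show "point el A a \<in> Arr (set_cat el)" "point el A b \<in> Arr (set_cat el)"
      "Cod (set_cat el) (point el A a) = Cod (set_cat el) (point el A b)"
      "p \<in> hom (set_cat el) (Dom (set_cat el) p) (Dom (set_cat el) (point el A a))"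
      "p \<in> hom (set_cat el) (Dom (set_cat el) p) (Dom (set_cat el) (point el A b))"
      using p pa pb by (simp_all add: hom_def)
    show "point el A a \<cdot>\<^bsub>set_cat el\<^esub> p = point el A b \<cdot>\<^bsub>set_cat el\<^esub> p"
      by (rule set_cat_ext[OF set_cat_comp[OF p pa] set_cat_comp[OF p pb]]) (simp add: Q)
    fix T u v assume "u \<in> hom (set_cat el) T (Dom (set_cat el) (point el A a))"
      "v \<in> hom (set_cat el) T (Dom (set_cat el) (point el A b))"
      and uv: "point el A a \<cdot>\<^bsub>set_cat el\<^esub> u = point el A b \<cdot>\<^bsub>set_cat el\<^esub> v"
    then have u: "u \<in> hom (set_cat el) T ?o" and v: "v \<in> hom (set_cat el) T ?o"
      using pa pb by (simp_all add: hom_def)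
    have T: "el T = {}"
    proof (rule ccontr)
      assume "el T \<noteq> {}"
      then obtain t where t: "t \<in> el T" by blast
      have "app (point el A a \<cdot>\<^bsub>set_cat el\<^esub> u) t = a" "app (point el A b \<cdot>\<^bsub>set_cat el\<^esub> v) t = b"
        by (simp_all add: app_comp_apply[OF u t] app_comp_apply[OF v t] app_point app_in[OF u t] app_in[OF v t])
      then show False using uv ab by simp
    qed
    have h: "(T, \<lambda>x::'v. undefined :: 'v, Q) \<in> hom (set_cat el) T Q" by (simp add: hom_set_cat app_def T)
    have DQ: "Dom (set_cat el) p = Q" using p by (simp add: hom_def)
    show "\<exists>!h. h \<in> hom (set_cat el) T (Dom (set_cat el) p) \<and> p \<cdot>\<^bsub>set_cat el\<^esub> h = u \<and> p \<cdot>\<^bsub>set_cat el\<^esub> h = v"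
      unfolding DQ
    proof (rule ex1I[of _ "(T, \<lambda>x::'v. undefined :: 'v, Q)"], intro conjI h)
      show "p \<cdot>\<^bsub>set_cat el\<^esub> (T, \<lambda>x::'v. undefined :: 'v, Q) = u" "p \<cdot>\<^bsub>set_cat el\<^esub> (T, \<lambda>x::'v. undefined :: 'v, Q) = v"
        by (rule set_cat_ext[OF set_cat_comp[OF h p] u], simp add: T)
          (rule set_cat_ext[OF set_cat_comp[OF h p] v], simp add: T)
      fix k assume "k \<in> hom (set_cat el) T Q \<and> p \<cdot>\<^bsub>set_cat el\<^esub> k = u \<and> p \<cdot>\<^bsub>set_cat el\<^esub> k = v"
      then have k: "k \<in> hom (set_cat el) T Q" by simp
      show "k = (T, \<lambda>x::'v. undefined :: 'v, Q)" by (rule set_cat_ext[OF k h]) (simp add: T)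
    qed
  qed
  note pb' = gs_pullback[OF this]
  have "\<exists>z. z \<in> sec (Dom E (FA gs p)) c"
    using pullback_sec[OF gs_arr[OF pa] gs_arr[OF pb] pb' c star[OF c] star[OF c]] e by (auto simp: const_def)
  moreover have "Dom E (FA gs p) = FO gs Q" using gs_arr[OF p] by (simp add: hom_def)
  ultimately obtain z where "z \<in> sec (FO gs Q) c" by auto
  from const_locally[OF c this] show ?thesis by (simp add: Q locally_False)
qed

subsection \<open>Components\<close>

context
  fixes I U \<zeta> i
  assumes z: "\<zeta> \<in> hom E U (FO gs I)" and i: "i \<in> el I"
begin

text \<open>A component is the pullback of the structure map along a point, so its sections are the sections
  of the total object with that constant value.\<close>

lemma comp_in_pullback: "\<exists>q. is_pullback E (comp_in el E gs I \<zeta> i) q \<zeta> (FA gs (point el I i))"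
proof -
  obtain p q where "is_pullback E p q \<zeta> (FA gs (point el I i))"
    using pullback_exists[OF z gs_arr[OF pointh[OF i]]] by metis
  then have "\<exists>q. is_pullback E p q \<zeta> (FA gs (point el I i))" by blast
  then show ?thesis unfolding comp_in_def by (rule someI)
qed

lemma comp_in_hom: "comp_in el E gs I \<zeta> i \<in> hom E (component el E gs I \<zeta> i) U"
  using comp_in_pullback homD(2)[OF z] by (auto simp: is_pullback_def component_def)

lemma comp_in_str:
  assumes c: "c \<in> Obj C" and v: "v \<in> sec (component el E gs I \<zeta> i) c"
  shows "act \<zeta> c (act (comp_in el E gs I \<zeta> i) c v) = const I i c"
proof -
  note p = gs_arr[OF pointh[OF i]]
  obtain q where q: "is_pullback E (comp_in el E gs I \<zeta> i) q \<zeta> (FA gs (point el I i))"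
    using comp_in_pullback by blast
  have qh: "q \<in> hom E (component el E gs I \<zeta> i) (FO gs (one (set_cat el)))"
    and eq: "\<zeta> \<cdot>\<^bsub>E\<^esub> comp_in el E gs I \<zeta> i = FA gs (point el I i) \<cdot>\<^bsub>E\<^esub> q"
    using q homD(2)[OF p] by (auto simp: is_pullback_def component_def)
  show ?thesis
    using act_comp[OF comp_in_hom z c v] act_comp[OF qh p c v] eq star_eq[OF c act_in[OF qh c v]]
    by (simp add: const_def)
qed

lemma comp_in_ex1:
  assumes c: "c \<in> Obj C" and u: "u \<in> sec U c" and e: "act \<zeta> c u = const I i c"
  shows "\<exists>!v. v \<in> sec (component el E gs I \<zeta> i) c \<and> act (comp_in el E gs I \<zeta> i) c v = u"
proof -
  note p = gs_arr[OF pointh[OF i]]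
  obtain q where q: "is_pullback E (comp_in el E gs I \<zeta> i) q \<zeta> (FA gs (point el I i))"
    using comp_in_pullback by blast
  have qh: "q \<in> hom E (component el E gs I \<zeta> i) (FO gs (one (set_cat el)))"
    using q homD(2)[OF p] by (auto simp: is_pullback_def component_def)
  have "\<exists>!v. v \<in> sec (component el E gs I \<zeta> i) c \<and> act (comp_in el E gs I \<zeta> i) c v = u \<and> act q c v = star c"
    using pullback_sec[OF z p q c u star[OF c]] e by (simp add: const_def component_def)
  moreover have "act q c v = star c" if "v \<in> sec (component el E gs I \<zeta> i) c" for v
    using star_eq[OF c act_in[OF qh c that]] .
  ultimately show ?thesis by metis
qed

lemma comp_in_inj:
  assumes "c \<in> Obj C" "v \<in> sec (component el E gs I \<zeta> i) c" "v' \<in> sec (component el E gs I \<zeta> i) c"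
    "act (comp_in el E gs I \<zeta> i) c v = act (comp_in el E gs I \<zeta> i) c v'"
  shows "v = v'"
  using comp_in_ex1[OF assms(1) act_in[OF comp_in_hom assms(1,2)] comp_in_str[OF assms(1,2)]] assms by metis

end

lemma comp_map_prop:
  assumes z: "\<zeta> \<in> hom E U (FO gs I)" and i: "i \<in> el I" and x: "\<xi> \<in> hom E V (FO gs K)"
    and f: "f \<in> hom E U V" and s: "s \<in> hom (set_cat el) I K" and e: "\<xi> \<cdot>\<^bsub>E\<^esub> f = FA gs s \<cdot>\<^bsub>E\<^esub> \<zeta>"
  shows "comp_map el E gs I \<zeta> i K \<xi> (app s i) f \<in> hom E (component el E gs I \<zeta> i) (component el E gs K \<xi> (app s i))"
    and "c \<in> Obj C \<Longrightarrow> v \<in> sec (component el E gs I \<zeta> i) c \<Longrightarrow>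
      act (comp_in el E gs K \<xi> (app s i)) c (act (comp_map el E gs I \<zeta> i K \<xi> (app s i) f) c v) =
      act f c (act (comp_in el E gs I \<zeta> i) c v)"
proof -
  let ?A = "component el E gs I \<zeta> i" and ?B = "component el E gs K \<xi> (app s i)"
    and ?p = "comp_in el E gs I \<zeta> i" and ?q = "comp_in el E gs K \<xi> (app s i)"
  note j = app_in[OF s i]
  note p = comp_in_hom[OF z i] and q = comp_in_hom[OF x j]
  note fp = compE[OF p f]
  have st: "act \<xi> c (act f c (act ?p c v)) = const K (app s i) c" if c: "c \<in> Obj C" and v: "v \<in> sec ?A c" for c v
    using act_comp[OF f x c act_in[OF p c v]] act_comp[OF z gs_arr[OF s] c act_in[OF p c v]] e
      comp_in_str[OF z i c v] const_map[OF s i c] by simp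
  define \<phi> where "\<phi> c v = (THE w. w \<in> sec ?B c \<and> act ?q c w = act f c (act ?p c v))" for c v
  have \<phi>: "\<phi> c v \<in> sec ?B c \<and> act ?q c (\<phi> c v) = act f c (act ?p c v)" if c: "c \<in> Obj C" and v: "v \<in> sec ?A c" for c v
    unfolding \<phi>_def by (rule theI'[OF comp_in_ex1[OF x j c act_in[OF f c act_in[OF p c v]] st[OF c v]]])
  have "\<exists>g\<in>hom E ?A ?B. \<forall>c\<in>Obj C. \<forall>v\<in>sec ?A c. act g c v = \<phi> c v"
  proof (rule full[OF objE(1)[OF p] objE(1)[OF q]])
    fix h d c v assume h: "h \<in> hom C d c" and v: "v \<in> sec ?A c"
    note oc = objC[OF h]
    note r = res_in[OF objE(1)[OF p] h v]
    note fv = \<phi>[OF oc(2) v, THEN conjunct1]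
    have "act ?q d (\<phi> d (res ?A h v)) = act ?q d (res ?B h (\<phi> c v))"
      using \<phi>[OF oc(1) r] \<phi>[OF oc(2) v] act_nat[OF q h fv] act_nat[OF p h v] act_nat[OF f h act_in[OF p oc(2) v]] by simp
    then show "\<phi> d (res ?A h v) = res ?B h (\<phi> c v)"
      by (rule comp_in_inj[OF x j oc(1) conjunct1[OF \<phi>[OF oc(1) r]] res_in[OF objE(1)[OF q] h fv]])
  qed (rule conjunct1[OF \<phi>])
  then obtain g where g: "g \<in> hom E ?A ?B" and ga: "\<And>c v. c \<in> Obj C \<Longrightarrow> v \<in> sec ?A c \<Longrightarrow> act g c v = \<phi> c v" by blast
  have qg: "?q \<cdot>\<^bsub>E\<^esub> g = f \<cdot>\<^bsub>E\<^esub> ?p"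
  proof (rule faithful[OF compE[OF g q] fp])
    fix c v assume cv: "c \<in> Obj C" "v \<in> sec ?A c"
    show "act (?q \<cdot>\<^bsub>E\<^esub> g) c v = act (f \<cdot>\<^bsub>E\<^esub> ?p) c v"
      using act_comp[OF g q cv] act_comp[OF p f cv] ga[OF cv] conjunct2[OF \<phi>[OF cv]] by simp
  qed
  have un: "g' = g" if g': "g' \<in> hom E ?A ?B" "?q \<cdot>\<^bsub>E\<^esub> g' = f \<cdot>\<^bsub>E\<^esub> ?p" for g'
  proof (rule faithful[OF g'(1) g])
    fix c v assume c: "c \<in> Obj C" and v: "v \<in> sec ?A c"
    show "act g' c v = act g c v"
      by (rule comp_in_inj[OF x j c act_in[OF g'(1) c v] act_in[OF g c v]])
        (use act_comp[OF g'(1) q c v] act_comp[OF g q c v] g'(2) qg in simp)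
  qed
  have eq: "comp_map el E gs I \<zeta> i K \<xi> (app s i) f = g"
    unfolding comp_map_def
    by (rule the_equality, rule conjI[OF g qg]) (rule un, erule conjunct1, erule conjunct2)
  show "comp_map el E gs I \<zeta> i K \<xi> (app s i) f \<in> hom E ?A ?B" using g eq by simp
  show "act ?q c (act (comp_map el E gs I \<zeta> i K \<xi> (app s i) f) c v) = act f c (act ?p c v)"
    if "c \<in> Obj C" "v \<in> sec ?A c" using \<phi>[OF that] ga[OF that] eq by simp
qed

end

section \<open>Simplices of a hypercover\<close>

lemma simplicial_objectD:
  assumes "simplicial_object D X"
  shows simp_Ob: "Ob X n \<in> Obj D"
    and simp_dd: "i \<le> n + 1 \<Longrightarrow> dd X n i \<in> hom D (Ob X (n + 1)) (Ob X n)"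
    and simp_ss: "i \<le> n \<Longrightarrow> ss X n i \<in> hom D (Ob X n) (Ob X (n + 1))"
    and simp_dd_dd: "i < j \<Longrightarrow> j \<le> n + 2 \<Longrightarrow> dd X n i \<cdot>\<^bsub>D\<^esub> dd X (n + 1) j = dd X n (j - 1) \<cdot>\<^bsub>D\<^esub> dd X (n + 1) i"
    and simp_dd_ss_lt: "i < j \<Longrightarrow> j \<le> n + 1 \<Longrightarrow> dd X (n + 1) i \<cdot>\<^bsub>D\<^esub> ss X (n + 1) j = ss X n (j - 1) \<cdot>\<^bsub>D\<^esub> dd X n i"
    and simp_dd_ss_id: "j \<le> n \<Longrightarrow> i = j \<or> i = j + 1 \<Longrightarrow> dd X n i \<cdot>\<^bsub>D\<^esub> ss X n j = Id D (Ob X n)"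
    and simp_dd_ss_gt: "j + 1 < i \<Longrightarrow> i \<le> n + 2 \<Longrightarrow> dd X (n + 1) i \<cdot>\<^bsub>D\<^esub> ss X (n + 1) j = ss X n j \<cdot>\<^bsub>D\<^esub> dd X n (i - 1)"
  using assms unfolding simplicial_object_def by simp_all

lemma strict_dualityD:
  assumes "strict_duality D X \<tau>"
  shows dual_hom: "\<tau> n \<in> hom D (Ob X n) (Ob X n)"
    and dual_0: "\<tau> 0 = Id D (Ob X 0)"
    and dual_dd: "i \<le> n + 1 \<Longrightarrow> dd X n i \<cdot>\<^bsub>D\<^esub> \<tau> (n + 1) = \<tau> n \<cdot>\<^bsub>D\<^esub> dd X n (n + 1 - i)"
  using assms unfolding strict_duality_def by simp_all

text \<open>The fixed self-dual hypercover. The index set \<open>S\<^sub>n\<close> is \<open>simplices el F n\<close>; \<open>sr\<close> and \<open>tg\<close> are the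
  source and the target of an edge, \<open>dg\<close> its degenerate edge at a vertex.\<close>

locale sd_hypercover = topos_over_sets el C J E sec res act gs gl
  for el :: "'v \<Rightarrow> 'v set" and C :: "('v, 'v) cat" and J and E :: "('o, 'a) cat" and sec res act gs gl +
  fixes F :: "('v, 'o, 'a) sd_family" and I U \<zeta>
  assumes hr: "hypercover_refinement el E gs F I U \<zeta>" and sd: "self_dual el E gs F"
begin

abbreviation "S1 \<equiv> simplices el F 1"
abbreviation "S0 \<equiv> simplices el F 0"
abbreviation "S2 \<equiv> simplices el F 2"
abbreviation "sr \<equiv> bd F 0 1"
abbreviation "tg \<equiv> bd F 0 0"
abbreviation dg :: "'v \<Rightarrow> 'v" where "dg \<equiv> app (ss (idx F) 0 0)"

lemma sf: "simplicial_family el E gs F"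
  using hr by (simp add: hypercover_refinement_def)

lemma simp_tot: "simplicial_object E (tot F)"
  and simp_idx: "simplicial_object (set_cat el) (idx F)"
  and map_str: "simplicial_map E (tot F) (map_simp gs (idx F)) (str F)"
  and fam: "family el E gs (Ob (idx F) n) (Ob (tot F) n) (str F n)"
  using sf by (simp_all add: simplicial_family_def)

lemma dual_tot: "strict_duality E (tot F) (tot_dual F)"
  and dual_idx: "strict_duality (set_cat el) (idx F) (idx_dual F)"
  and dual_str: "str F n \<cdot>\<^bsub>E\<^esub> tot_dual F n = FA gs (idx_dual F n) \<cdot>\<^bsub>E\<^esub> str F n"
  using sd by (simp_all add: self_dual_def)

lemma str_hom: "str F n \<in> hom E (Ob (tot F) n) (FO gs (Ob (idx F) n))"
  using fam by (simp add: family_def)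

lemma str_dd: "i \<le> n + 1 \<Longrightarrow> str F n \<cdot>\<^bsub>E\<^esub> dd (tot F) n i = FA gs (dd (idx F) n i) \<cdot>\<^bsub>E\<^esub> str F (n + 1)"
  and str_ss: "i \<le> n \<Longrightarrow> str F (n + 1) \<cdot>\<^bsub>E\<^esub> ss (tot F) n i = FA gs (ss (idx F) n i) \<cdot>\<^bsub>E\<^esub> str F n"
  using map_str by (simp_all add: simplicial_map_def map_simp_def)

lemmas idx_dd = simp_dd[OF simp_idx] and idx_ss = simp_ss[OF simp_idx]
  and tot_dd = simp_dd[OF simp_tot] and tot_ss = simp_ss[OF simp_tot] and tot_obj = simp_Ob[OF simp_tot]

lemma tot_d: "dd (tot F) 0 0 \<in> hom E (Ob (tot F) 1) (Ob (tot F) 0)" "dd (tot F) 0 1 \<in> hom E (Ob (tot F) 1) (Ob (tot F) 0)"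
  using tot_dd[of 0 0] tot_dd[of 1 0] by simp_all

subsection \<open>Faces, degeneracies and opposites in the index set\<close>

lemma bd_in: "w \<in> simplices el F (n + 1) \<Longrightarrow> i \<le> n + 1 \<Longrightarrow> bd F n i w \<in> simplices el F n"
  unfolding simplices_def bd_def by (rule app_in[OF idx_dd])

lemma bd_0: "l \<in> S1 \<Longrightarrow> i \<le> 1 \<Longrightarrow> bd F 0 i l \<in> S0"
  using bd_in[of l 0 i] by simp

lemma bd_1: "w \<in> S2 \<Longrightarrow> i \<le> 2 \<Longrightarrow> bd F 1 i w \<in> S1"
  using bd_in[of w 1 i] by (simp add: numeral_2_eq_2)

lemma bd_bd:
  assumes w: "w \<in> S2"
  shows "bd F 0 0 (bd F 1 1 w) = bd F 0 0 (bd F 1 0 w)" "bd F 0 0 (bd F 1 2 w) = bd F 0 1 (bd F 1 0 w)"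
    "bd F 0 1 (bd F 1 2 w) = bd F 0 1 (bd F 1 1 w)"
proof -
  have *: "bd F 0 i (bd F 1 j w) = bd F 0 (j - 1) (bd F 1 i w)" if "i < j" "j \<le> 2" for i j
  proof -
    have w': "w \<in> el (Ob (idx F) (1 + 1))" using w by (simp add: simplices_def numeral_2_eq_2)
    have a: "app (dd (idx F) 0 i \<cdot>\<^bsub>set_cat el\<^esub> dd (idx F) 1 j) w = app (dd (idx F) 0 i) (app (dd (idx F) 1 j) w)"
      by (rule app_comp_apply[OF idx_dd w']) (use that in simp)
    have b: "app (dd (idx F) 0 (j - 1) \<cdot>\<^bsub>set_cat el\<^esub> dd (idx F) 1 i) w = app (dd (idx F) 0 (j - 1)) (app (dd (idx F) 1 i) w)"
      by (rule app_comp_apply[OF idx_dd w']) (use that in simp)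
    show ?thesis using simp_dd_dd[OF simp_idx, of i j 0] a b that by (simp add: bd_def)
  qed
  show "bd F 0 0 (bd F 1 1 w) = bd F 0 0 (bd F 1 0 w)" "bd F 0 0 (bd F 1 2 w) = bd F 0 1 (bd F 1 0 w)"
    "bd F 0 1 (bd F 1 2 w) = bd F 0 1 (bd F 1 1 w)"
    using *[of 0 1] *[of 0 2] *[of 1 2] by simp_all
qed

lemma dg_in: "i \<in> S0 \<Longrightarrow> dg i \<in> S1"
  using app_in[OF idx_ss[of 0 0]] by (simp add: simplices_def)

lemma bd_dg: "i \<in> S0 \<Longrightarrow> bd F 0 0 (dg i) = i" "i \<in> S0 \<Longrightarrow> bd F 0 1 (dg i) = i"
  using app_comp_apply[OF idx_ss[of 0 0], of i "dd (idx F) 0 0"] app_comp_apply[OF idx_ss[of 0 0], of i "dd (idx F) 0 1"]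
    simp_dd_ss_id[OF simp_idx, of 0 0 0] simp_dd_ss_id[OF simp_idx, of 0 0 1]
  by (simp_all add: bd_def simplices_def app_Id)

text \<open>The degenerate triangles on an edge, which give the unit laws of the groupoid.\<close>

lemma degenerate_right:
  assumes l: "l \<in> S1"
  obtains w where "w \<in> S2" "bd F 1 1 w = l" "bd F 1 0 w = l" "bd F 1 2 w = dg (bd F 0 1 l)"
proof
  have l': "l \<in> el (Ob (idx F) 1)" using l by (simp add: simplices_def)
  have h: "ss (idx F) 1 0 \<in> hom (set_cat el) (Ob (idx F) 1) (Ob (idx F) 2)"
    using idx_ss[of 0 1] by (simp add: numeral_2_eq_2)
  let ?w = "app (ss (idx F) 1 0) l"
  show "?w \<in> S2" using app_in[OF h l'] by (simp add: simplices_def numeral_2_eq_2)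
  show "bd F 1 1 ?w = l" "bd F 1 0 ?w = l"
    using app_comp_apply[OF h l', of "dd (idx F) 1 1"] app_comp_apply[OF h l', of "dd (idx F) 1 0"] l'
      simp_dd_ss_id[OF simp_idx, of 0 1 1] simp_dd_ss_id[OF simp_idx, of 0 1 0] by (simp_all add: bd_def app_Id)
  show "bd F 1 2 ?w = dg (bd F 0 1 l)"
    using app_comp_apply[OF h l', of "dd (idx F) 1 2"] simp_dd_ss_gt[OF simp_idx, of 0 2 0]
      app_comp_apply[OF idx_dd[of 1 0], of l "ss (idx F) 0 0"] l' by (simp add: bd_def)
qed

lemma degenerate_left:
  assumes l: "l \<in> S1"
  obtains w where "w \<in> S2" "bd F 1 1 w = l" "bd F 1 0 w = dg (bd F 0 0 l)" "bd F 1 2 w = l"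
proof
  have l': "l \<in> el (Ob (idx F) 1)" using l by (simp add: simplices_def)
  have h: "ss (idx F) 1 1 \<in> hom (set_cat el) (Ob (idx F) 1) (Ob (idx F) 2)"
    using idx_ss[of 1 1] by (simp add: numeral_2_eq_2)
  let ?w = "app (ss (idx F) 1 1) l"
  show "?w \<in> S2" using app_in[OF h] l' by (simp add: simplices_def numeral_2_eq_2)
  show "bd F 1 1 ?w = l" "bd F 1 2 ?w = l"
    using app_comp_apply[OF h, of l "dd (idx F) 1 1"] app_comp_apply[OF h, of l "dd (idx F) 1 2"] l'
      simp_dd_ss_id[OF simp_idx, of 1 1 1] simp_dd_ss_id[OF simp_idx, of 1 1 2]
    by (simp_all add: bd_def app_Id numeral_2_eq_2)
  show "bd F 1 0 ?w = dg (bd F 0 0 l)"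
    using app_comp_apply[OF h, of l "dd (idx F) 1 0"] simp_dd_ss_lt[OF simp_idx, of 0 1 0]
      app_comp_apply[OF idx_dd[of 0 0], of l "ss (idx F) 0 0"] l' by (simp add: bd_def)
qed

lemma opp_in: "l \<in> S1 \<Longrightarrow> opp F 1 l \<in> S1"
  using app_in[OF dual_hom[OF dual_idx]] by (simp add: simplices_def opp_def)

lemma bd_opp:
  assumes l: "l \<in> S1"
  shows "bd F 0 1 (opp F 1 l) = bd F 0 0 l" "bd F 0 0 (opp F 1 l) = bd F 0 1 l"
proof -
  have l': "l \<in> el (Ob (idx F) 1)" using l by (simp add: simplices_def)
  have *: "bd F 0 i (opp F 1 l) = bd F 0 (1 - i) l" if i: "i \<le> 1" for i
  proof -
    have "app (dd (idx F) 0 i \<cdot>\<^bsub>set_cat el\<^esub> idx_dual F 1) l = bd F 0 i (opp F 1 l)"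
      using app_comp_apply[OF dual_hom[OF dual_idx] l', of "dd (idx F) 0 i"] by (simp add: bd_def opp_def)
    moreover have "app (idx_dual F 0 \<cdot>\<^bsub>set_cat el\<^esub> dd (idx F) 0 (1 - i)) l = bd F 0 (1 - i) l"
      using app_comp_apply[OF idx_dd[of "1 - i" 0], of l "idx_dual F 0"] l' app_in[OF idx_dd[of "1 - i" 0], of l]
      by (simp add: dual_0[OF dual_idx] app_Id bd_def)
    ultimately show ?thesis using dual_dd[OF dual_idx, of i 0] i by simp
  qed
  show "bd F 0 1 (opp F 1 l) = bd F 0 0 l" "bd F 0 0 (opp F 1 l) = bd F 0 1 l" using *[of 1] *[of 0] by simp_all
qed

subsection \<open>Sections over a simplex\<close>

text \<open>The sections of \<open>H\<^sub>n\<close> lying in the component of \<open>w\<close>.\<close>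

definition part :: "nat \<Rightarrow> 'v \<Rightarrow> 'v \<Rightarrow> 'v set" where
  "part n w c = {h \<in> sec (Ob (tot F) n) c. act (str F n) c h = const (Ob (idx F) n) w c}"

abbreviation face :: "nat \<Rightarrow> nat \<Rightarrow> 'v \<Rightarrow> 'v \<Rightarrow> 'v" where
  "face n i \<equiv> act (dd (tot F) n i)"

lemma part_sec: "h \<in> part n w c \<Longrightarrow> h \<in> sec (Ob (tot F) n) c"
  by (simp add: part_def)

lemma part_res:
  assumes "w \<in> simplices el F n" "f \<in> hom C d c" "h \<in> part n w c"
  shows "res (Ob (tot F) n) f h \<in> part n w d"
  using assms act_nat[OF str_hom assms(2), of h n] const_res[of w "Ob (idx F) n" f d c] res_in[OF tot_obj assms(2)]
  by (auto simp: part_def simplices_def)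

lemma part_map:
  assumes f: "f \<in> hom E (Ob (tot F) n) (Ob (tot F) m)" and s: "s \<in> hom (set_cat el) (Ob (idx F) n) (Ob (idx F) m)"
    and e: "str F m \<cdot>\<^bsub>E\<^esub> f = FA gs s \<cdot>\<^bsub>E\<^esub> str F n"
    and w: "w \<in> simplices el F n" and c: "c \<in> Obj C" and h: "h \<in> part n w c"
  shows "act f c h \<in> part m (app s w) c"
proof -
  have hs: "h \<in> sec (Ob (tot F) n) c" "act (str F n) c h = const (Ob (idx F) n) w c" using h by (auto simp: part_def)
  have "act (str F m) c (act f c h) = act (FA gs s) c (act (str F n) c h)"
    using act_comp[OF f str_hom c hs(1)] act_comp[OF str_hom gs_arr[OF s] c hs(1)] e by simp
  also have "\<dots> = const (Ob (idx F) m) (app s w) c"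
    using const_map[OF s _ c, of w] w hs(2) by (simp add: simplices_def)
  finally show ?thesis using act_in[OF f c hs(1)] by (simp add: part_def)
qed

lemma part_face:
  assumes "w \<in> simplices el F (n + 1)" "i \<le> n + 1" "c \<in> Obj C" "h \<in> part (n + 1) w c"
  shows "face n i c h \<in> part n (bd F n i w) c"
  unfolding bd_def by (rule part_map[OF tot_dd[OF assms(2)] idx_dd[OF assms(2)] str_dd[OF assms(2)] assms(1,3,4)])

lemma part_face0: "l \<in> S1 \<Longrightarrow> i \<le> 1 \<Longrightarrow> c \<in> Obj C \<Longrightarrow> h \<in> part 1 l c \<Longrightarrow> face 0 i c h \<in> part 0 (bd F 0 i l) c"
  using part_face[of l 0 i c h] by simp

lemma part_unique:
  assumes "w \<in> simplices el F n" "w' \<in> simplices el F n" "c \<in> Obj C" "h \<in> part n w c" "h \<in> part n w' c" "w \<noteq> w'"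
  shows "{} \<in> J c"
  by (rule const_disjoint[OF assms(3), of w "Ob (idx F) n" w']) (use assms in \<open>auto simp: part_def simplices_def\<close>)

lemma part_locally:
  assumes c: "c \<in> Obj C" and h: "h \<in> sec (Ob (tot F) n) c"
  shows "locally c (\<lambda>f. \<exists>w\<in>simplices el F n. res (Ob (tot F) n) f h \<in> part n w (Dom C f))"
proof (rule iffD1[OF locally_cong const_locally[OF c act_in[OF str_hom c h]]])
  fix d f assume f: "f \<in> hom C d c"
  show "(\<exists>a\<in>el (Ob (idx F) n). res (FO gs (Ob (idx F) n)) f (act (str F n) c h) = const (Ob (idx F) n) a (Dom C f)) =
     (\<exists>w\<in>simplices el F n. res (Ob (tot F) n) f h \<in> part n w (Dom C f))"
    using act_nat[OF str_hom f h] res_in[OF tot_obj f h] homD(2)[OF f] by (simp add: part_def simplices_def)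
qed

lemma part_degenerate:
  assumes i: "i \<in> S0" and c: "c \<in> Obj C" and u: "u \<in> part 0 i c"
  shows "act (ss (tot F) 0 0) c u \<in> part 1 (dg i) c" "j \<le> 1 \<Longrightarrow> face 0 j c (act (ss (tot F) 0 0) c u) = u"
proof -
  note us = part_sec[OF u]
  have h: "ss (tot F) 0 0 \<in> hom E (Ob (tot F) 0) (Ob (tot F) 1)" using tot_ss[of 0 0] by simp
  show "act (ss (tot F) 0 0) c u \<in> part 1 (dg i) c"
    by (rule part_map[OF h _ _ i c u]) (use idx_ss[of 0 0] str_ss[of 0 0] in simp_all)
  show "face 0 j c (act (ss (tot F) 0 0) c u) = u" if "j \<le> 1"
  proof -
    have dj: "dd (tot F) 0 j \<in> hom E (Ob (tot F) 1) (Ob (tot F) 0)" using tot_dd[of j 0] that by simp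
    have "j = 0 \<or> j = 0 + 1" using that by auto
    from simp_dd_ss_id[OF simp_tot _ this] show ?thesis
      using act_comp[OF h dj c us] act_id[OF tot_obj c us] by simp
  qed
qed

lemma part_dual:
  assumes l: "l \<in> S1" and c: "c \<in> Obj C" and h: "h \<in> part 1 l c"
  shows "act (tot_dual F 1) c h \<in> part 1 (opp F 1 l) c"
    "face 0 1 c (act (tot_dual F 1) c h) = face 0 0 c h" "face 0 0 c (act (tot_dual F 1) c h) = face 0 1 c h"
proof -
  note hs = part_sec[OF h]
  note t = dual_hom[OF dual_tot]
  show "act (tot_dual F 1) c h \<in> part 1 (opp F 1 l) c"
    unfolding opp_def by (rule part_map[OF t dual_hom[OF dual_idx] dual_str l c h])
  have *: "face 0 i c (act (tot_dual F 1) c h) = face 0 (1 - i) c h" if i: "i \<le> 1" for i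
  proof -
    have di: "dd (tot F) 0 i \<in> hom E (Ob (tot F) 1) (Ob (tot F) 0)" "dd (tot F) 0 (1 - i) \<in> hom E (Ob (tot F) 1) (Ob (tot F) 0)"
      using tot_dd[of i 0] tot_dd[of "1 - i" 0] i by simp_all
    show ?thesis
      using act_comp[OF t di(1) c hs] unitE(2)[OF di(2)] dual_dd[OF dual_tot, of i 0] i by (simp add: dual_0[OF dual_tot])
  qed
  show "face 0 1 c (act (tot_dual F 1) c h) = face 0 0 c h" "face 0 0 c (act (tot_dual F 1) c h) = face 0 1 c h"
    using *[of 1] *[of 0] by simp_all
qed

subsection \<open>Local existence of edges and triangles\<close>

text \<open>The hypercover conditions in degrees one and two, with the coskeleton written as a finite limit.\<close>

lemma cover_0: "\<exists>p e. is_lim (Dom E (p 0)) p {0, 1} (\<lambda>_. Ob (tot F) 0) {} \<and>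
    e \<in> hom E (Ob (tot F) 1) (Dom E (p 0)) \<and> p 0 \<cdot>\<^bsub>E\<^esub> e = dd (tot F) 0 0 \<and> p 1 \<cdot>\<^bsub>E\<^esub> e = dd (tot F) 0 1 \<and> is_epi E e"
proof -
  have "\<forall>k. \<exists>M p e. is_cosk E (tot F) k M p \<and> e \<in> hom E (Ob (tot F) (k + 1)) M \<and>
        (\<forall>i\<le>k + 1. p i \<cdot>\<^bsub>E\<^esub> e = dd (tot F) k i) \<and> is_epi E e"
    using hr by (simp add: hypercover_refinement_def)
  then obtain M p e where M: "is_cosk E (tot F) 0 M p" and e: "e \<in> hom E (Ob (tot F) (0 + 1)) M"
    "\<forall>i\<le>0 + 1. p i \<cdot>\<^bsub>E\<^esub> e = dd (tot F) 0 i" "is_epi E e" by blast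
  have A: "(\<forall>i\<le>0 + 1. P i) \<longleftrightarrow> (\<forall>i\<in>{0, 1::nat}. P i)" for P by (auto simp: le_Suc_eq)
  have L: "is_lim M p {0, 1} (\<lambda>_. Ob (tot F) 0) {}"
    using M unfolding is_cosk_def Let_def A is_lim_def cone_def by simp
  then have "Dom E (p 0) = M" by (auto simp: is_lim_def cone_def hom_def)
  then show ?thesis using L e by (intro exI[of _ p] exI[of _ e]) auto
qed

lemma cover_1: "\<exists>p e. is_lim (Dom E (p 0)) p {0, 1, 2} (\<lambda>_. Ob (tot F) 1)
      {(1, dd (tot F) 0 0, 0, dd (tot F) 0 0), (2, dd (tot F) 0 0, 0, dd (tot F) 0 1), (2, dd (tot F) 0 1, 1, dd (tot F) 0 1)} \<and>
    e \<in> hom E (Ob (tot F) 2) (Dom E (p 0)) \<and> (\<forall>i\<in>{0, 1, 2}. p i \<cdot>\<^bsub>E\<^esub> e = dd (tot F) 1 i) \<and> is_epi E e"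
proof -
  let ?Q = "{(1::nat, dd (tot F) 0 0, 0::nat, dd (tot F) 0 0), (2, dd (tot F) 0 0, 0, dd (tot F) 0 1), (2, dd (tot F) 0 1, 1, dd (tot F) 0 1)}"
  have "\<forall>k. \<exists>M p e. is_cosk E (tot F) k M p \<and> e \<in> hom E (Ob (tot F) (k + 1)) M \<and>
        (\<forall>i\<le>k + 1. p i \<cdot>\<^bsub>E\<^esub> e = dd (tot F) k i) \<and> is_epi E e"
    using hr by (simp add: hypercover_refinement_def)
  then obtain M p e where M: "is_cosk E (tot F) 1 M p" and e: "e \<in> hom E (Ob (tot F) (1 + 1)) M"
    "\<forall>i\<le>1 + 1. p i \<cdot>\<^bsub>E\<^esub> e = dd (tot F) 1 i" "is_epi E e" by blast
  have A: "(\<forall>i\<le>1 + 1. P i) \<longleftrightarrow> (\<forall>i\<in>{0, 1, 2::nat}. P i)" for P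
    by (auto simp: le_Suc_eq numeral_2_eq_2)
  have c: "((\<forall>i\<le>1 + 1. q i \<in> hom E T (Ob (tot F) 1)) \<and>
       (\<forall>m i j. 1 = m + 1 \<and> i < j \<and> j \<le> 1 + 1 \<longrightarrow>
          dd (tot F) m i \<cdot>\<^bsub>E\<^esub> q j = dd (tot F) m (j - 1) \<cdot>\<^bsub>E\<^esub> q i)) \<longleftrightarrow> cone T q {0, 1, 2} (\<lambda>_. Ob (tot F) 1) ?Q" for T q
  proof -
    have X: "(\<forall>m i j. 1 = m + 1 \<and> i < j \<and> j \<le> 1 + 1 \<longrightarrow> P m i j) \<longleftrightarrow> P 0 0 1 \<and> P 0 0 2 \<and> P 0 1 2"
      for P :: "nat \<Rightarrow> nat \<Rightarrow> nat \<Rightarrow> bool"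
    proof
      assume a: "P 0 0 1 \<and> P 0 0 2 \<and> P 0 1 2"
      show "\<forall>m i j. 1 = m + 1 \<and> i < j \<and> j \<le> 1 + 1 \<longrightarrow> P m i j"
      proof (intro allI impI)
        fix m i j :: nat assume "1 = m + 1 \<and> i < j \<and> j \<le> 1 + 1"
        then have "m = 0" "(i = 0 \<and> j = 1) \<or> (i = 0 \<and> j = 2) \<or> (i = 1 \<and> j = 2)" by auto
        then show "P m i j" using a by auto
      qed
    qed auto
    show ?thesis unfolding A cone_def X by simp
  qed
  have L: "is_lim M p {0, 1, 2} (\<lambda>_. Ob (tot F) 1) ?Q"
    using M unfolding is_cosk_def Let_def c unfolding is_lim_def A .
  then have "Dom E (p 0) = M" by (auto simp: is_lim_def cone_def hom_def)
  then show ?thesis using L e(1,3) e(2)[unfolded A]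
    by (intro exI[of _ p] exI[of _ e]) (simp add: numeral_2_eq_2)
qed

lemma epi_surj:
  assumes e: "e \<in> hom E X Y" "is_epi E e" and c: "c \<in> Obj C" and y: "y \<in> sec Y c"
  shows "locally c (\<lambda>f. \<exists>x\<in>sec X (Dom C f). act e (Dom C f) x = res Y f y)"
proof -
  have "epimorphic_family E Y {e}"
    using e by (simp add: is_epi_def epimorphic_family_def hom_def)
  from epi_locally[OF this objE(2)[OF e(1)] c y] show ?thesis using e(1) by (simp add: in_image_def hom_def)
qed

text \<open>Over \<open>c\<close>, the section \<open>h\<close> of \<open>(H\<^sub>1)\<^sub>l\<close> is an edge from \<open>u\<close> to \<open>v\<close>.\<close>

definition joins :: "'v \<Rightarrow> 'v \<Rightarrow> 'v \<Rightarrow> 'v \<Rightarrow> 'v \<Rightarrow> bool" where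
  "joins c l h u v \<longleftrightarrow> l \<in> S1 \<and> h \<in> part 1 l c \<and> face 0 1 c h = u \<and> face 0 0 c h = v"

lemma joins_res:
  assumes "joins c l h u v" "f \<in> hom C d c"
  shows "joins d l (res (Ob (tot F) 1) f h) (res (Ob (tot F) 0) f u) (res (Ob (tot F) 0) f v)"
  using assms part_res[of l 1 f d c h] act_nat[OF tot_d(1) assms(2), of h] act_nat[OF tot_d(2) assms(2), of h] part_sec[of h 1 l c]
  by (auto simp: joins_def)

text \<open>From the first hypercover condition: \<open>H\<^sub>1 \<rightarrow> U \<times> U\<close> is locally surjective, and an edge found in this way
  has the prescribed endpoints except where the empty sieve covers.\<close>

lemma edges:
  assumes i: "i \<in> S0" and j: "j \<in> S0" and c: "c \<in> Obj C" and u: "u \<in> part 0 i c" and v: "v \<in> part 0 j c"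
  shows "locally c (\<lambda>f. \<exists>l h. bd F 0 1 l = i \<and> bd F 0 0 l = j \<and>
      joins (Dom C f) l h (res (Ob (tot F) 0) f u) (res (Ob (tot F) 0) f v))"
proof -
  let ?H = "Ob (tot F)"
  define P where "P f \<longleftrightarrow> (\<exists>l h. bd F 0 1 l = i \<and> bd F 0 0 l = j \<and>
    joins (Dom C f) l h (res (?H 0) f u) (res (?H 0) f v))" for f
  note us = part_sec[OF u] and vs = part_sec[OF v]
  have st: "stable c P"
  proof (rule stableI)
    fix f g d e assume f: "f \<in> hom C d c" "P f" and g: "g \<in> hom C e d"
    then obtain l h where l: "bd F 0 1 l = i" "bd F 0 0 l = j" "joins d l h (res (?H 0) f u) (res (?H 0) f v)"
      using homD(2)[OF f(1)] by (auto simp: P_def)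
    show "P (f \<cdot>\<^bsub>C\<^esub> g)"
      using joins_res[OF l(3) g] l(1,2) res_comp[OF tot_obj g f(1) us] res_comp[OF tot_obj g f(1) vs] homD(2)[OF compC[OF g f(1)]]
      by (auto simp: P_def)
  qed
  obtain p e where L: "is_lim (Dom E (p 0)) p {0, 1} (\<lambda>_. ?H 0) {}"
    and e: "e \<in> hom E (?H 1) (Dom E (p 0))" "p 0 \<cdot>\<^bsub>E\<^esub> e = dd (tot F) 0 0" "p 1 \<cdot>\<^bsub>E\<^esub> e = dd (tot F) 0 1" "is_epi E e"
    using cover_0 by blast
  have p: "p 0 \<in> hom E (Dom E (p 0)) (?H 0)" "p 1 \<in> hom E (Dom E (p 0)) (?H 0)"
    using L by (auto simp: is_lim_def cone_def)
  have "\<exists>!z. z \<in> sec (Dom E (p 0)) c \<and> (\<forall>k\<in>{0, 1}. act (p k) c z = two v u k)"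
    by (rule lim_sec[OF _ L c]) (use us vs tot_obj in \<open>auto simp: diagram_def sec_cone_def\<close>)
  then obtain m where m: "m \<in> sec (Dom E (p 0)) c" "act (p 0) c m = v" "act (p 1) c m = u" by auto
  have "locally c P"
  proof (rule locally_bind[OF c epi_surj[OF e(1,4) c m(1)] st])
    fix d f assume f: "f \<in> hom C d c" and "\<exists>x\<in>sec (?H 1) (Dom C f). act e (Dom C f) x = res (Dom E (p 0)) f m"
    then obtain h where h: "h \<in> sec (?H 1) d" "act e d h = res (Dom E (p 0)) f m" using homD(2)[OF f] by auto
    note d = objC(1)[OF f]
    have h0: "face 0 0 d h = res (?H 0) f v" "face 0 1 d h = res (?H 0) f u"
      using act_comp[OF e(1) p(1) d h(1)] act_comp[OF e(1) p(2) d h(1)] e(2,3) h(2) act_nat[OF p(1) f m(1)]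
        act_nat[OF p(2) f m(1)] m by simp_all
    show "locally d (\<lambda>g. P (f \<cdot>\<^bsub>C\<^esub> g))"
    proof (rule locally_bind[OF d part_locally[OF d h(1)]])
      show "stable d (\<lambda>g. P (f \<cdot>\<^bsub>C\<^esub> g))"
      proof (rule stableI)
        fix g k a b assume g: "g \<in> hom C a d" "P (f \<cdot>\<^bsub>C\<^esub> g)" and k: "k \<in> hom C b a"
        have "P ((f \<cdot>\<^bsub>C\<^esub> g) \<cdot>\<^bsub>C\<^esub> k)" by (rule stableD[OF st compC[OF g(1) f] g(2) k])
        then show "P (f \<cdot>\<^bsub>C\<^esub> (g \<cdot>\<^bsub>C\<^esub> k))" unfolding assocC[OF k g(1) f] .
      qed
      fix b g assume g: "g \<in> hom C b d" and "\<exists>w\<in>S1. res (?H 1) g h \<in> part 1 w (Dom C g)"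
      then obtain l where l: "l \<in> S1" "res (?H 1) g h \<in> part 1 l b" using homD(2)[OF g] by auto
      note b = objC(1)[OF g]
      note fg = compC[OF g f]
      have jn: "joins b l (res (?H 1) g h) (res (?H 0) (f \<cdot>\<^bsub>C\<^esub> g) u) (res (?H 0) (f \<cdot>\<^bsub>C\<^esub> g) v)"
        using l h0 act_nat[OF tot_d(1) g h(1)] act_nat[OF tot_d(2) g h(1)]
          res_comp[OF tot_obj g f us] res_comp[OF tot_obj g f vs] by (simp add: joins_def)
      have st': "stable b (\<lambda>k. P (f \<cdot>\<^bsub>C\<^esub> (g \<cdot>\<^bsub>C\<^esub> k)))"
      proof (rule stableI)
        fix k k' a a' assume k: "k \<in> hom C a b" "P (f \<cdot>\<^bsub>C\<^esub> (g \<cdot>\<^bsub>C\<^esub> k))" and k': "k' \<in> hom C a' a"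
        have "P ((f \<cdot>\<^bsub>C\<^esub> (g \<cdot>\<^bsub>C\<^esub> k)) \<cdot>\<^bsub>C\<^esub> k')"
          by (rule stableD[OF st compC[OF compC[OF k(1) g] f] k(2) k'])
        then show "P (f \<cdot>\<^bsub>C\<^esub> (g \<cdot>\<^bsub>C\<^esub> (k \<cdot>\<^bsub>C\<^esub> k')))"
          unfolding assocC[OF k' compC[OF k(1) g] f, symmetric] assocC[OF k' k(1) g, symmetric] .
      qed
      show "locally b (\<lambda>k. P (f \<cdot>\<^bsub>C\<^esub> (g \<cdot>\<^bsub>C\<^esub> k)))"
      proof (cases "bd F 0 1 l = i \<and> bd F 0 0 l = j")
        case True
        have P0: "P (f \<cdot>\<^bsub>C\<^esub> g)" using True jn homD(2)[OF fg] by (auto simp: P_def)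
        show ?thesis
        proof (rule locally_always[OF b])
          fix k a assume k: "k \<in> hom C a b"
          have "P ((f \<cdot>\<^bsub>C\<^esub> g) \<cdot>\<^bsub>C\<^esub> k)" by (rule stableD[OF st fg P0 k])
          then show "P (f \<cdot>\<^bsub>C\<^esub> (g \<cdot>\<^bsub>C\<^esub> k))" unfolding assocC[OF k g f] .
        qed
      next
        case False
        have "res (?H 0) (f \<cdot>\<^bsub>C\<^esub> g) u \<in> part 0 (bd F 0 1 l) b" "res (?H 0) (f \<cdot>\<^bsub>C\<^esub> g) v \<in> part 0 (bd F 0 0 l) b"
          using part_face0[OF l(1) _ b l(2), of 1] part_face0[OF l(1) _ b l(2), of 0] jn by (simp_all add: joins_def)
        then have "{} \<in> J b"
          using part_unique[OF bd_0[OF l(1), of 1] i b _ part_res[OF i fg u]]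
            part_unique[OF bd_0[OF l(1), of 0] j b _ part_res[OF j fg v]] False by auto
        then show ?thesis by (rule locally_empty[OF b _ st'])
      qed
    qed
  qed
  then show ?thesis by (simp add: P_def[abs_def])
qed

text \<open>From the second hypercover condition, applied to the boundary formed by the three edges.\<close>

lemma triangles:
  assumes c: "c \<in> Obj C" and nd: "{} \<notin> J c"
    and a: "joins c l h u v" and b: "joins c m h' v w" and n: "joins c n h'' u w"
  obtains x where "x \<in> S2" "bd F 1 2 x = l" "bd F 1 0 x = m" "bd F 1 1 x = n"
proof -
  let ?H = "Ob (tot F)"
  let ?hh = "\<lambda>k::nat. if k = 0 then h' else if k = 1 then h'' else h"
  let ?ll = "\<lambda>k::nat. if k = 0 then m else if k = 1 then n else l"
  let ?Q = "{(1::nat, dd (tot F) 0 0, 0::nat, dd (tot F) 0 0), (2, dd (tot F) 0 0, 0, dd (tot F) 0 1), (2, dd (tot F) 0 1, 1, dd (tot F) 0 1)}"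
  have hh: "?hh k \<in> part 1 (?ll k) c" "?ll k \<in> S1" for k using a b n by (auto simp: joins_def)
  obtain p e where L: "is_lim (Dom E (p 0)) p {0, 1, 2} (\<lambda>_. ?H 1) ?Q"
    and e: "e \<in> hom E (?H 2) (Dom E (p 0))" "\<And>i. i \<in> {0, 1, 2} \<Longrightarrow> p i \<cdot>\<^bsub>E\<^esub> e = dd (tot F) 1 i" "is_epi E e"
    using cover_1 by blast
  have p: "p k \<in> hom E (Dom E (p 0)) (?H 1)" if "k \<in> {0, 1, 2}" for k
    using L that by (simp only: is_lim_def cone_def)
  have D: "diagram {0, 1, 2} (\<lambda>_. ?H 1) ?Q"
    using tot_obj tot_dd[of 0 0] tot_dd[of 1 0] by (auto simp: diagram_def)
  have "sec_cone c ?hh {0, 1, 2} (\<lambda>_. ?H 1) ?Q"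
    using a b n part_sec by (auto simp: sec_cone_def joins_def)
  from lim_sec[OF D L c this] obtain z where z: "z \<in> sec (Dom E (p 0)) c"
    "\<And>k. k \<in> {0, 1, 2} \<Longrightarrow> act (p k) c z = ?hh k" by blast
  show thesis
  proof (rule ccontr)
    assume no: "\<not> thesis"
    \<comment> \<open>a filling exists locally, over some simplex \<open>x\<close>; as the faces of \<open>x\<close> are not the three given
      edges, sections with two different constant values coincide and the empty sieve covers\<close>
    have "locally c (\<lambda>f. False)"
    proof (rule locally_bind[OF c epi_surj[OF e(1,3) c z(1)]])
      fix d f assume f: "f \<in> hom C d c" and "\<exists>x\<in>sec (?H 2) (Dom C f). act e (Dom C f) x = res (Dom E (p 0)) f z"
      then obtain y where y: "y \<in> sec (?H 2) d" "act e d y = res (Dom E (p 0)) f z" using homD(2)[OF f] by auto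
      note d = objC(1)[OF f]
      have fy: "face 1 k d y = res (?H 1) f (?hh k)" if k: "k \<in> {0, 1, 2}" for k
        using act_comp[OF e(1) p[OF k] d y(1)] e(2)[OF k] y(2) act_nat[OF p[OF k] f z(1)] z(2)[OF k] by simp
      show "locally d (\<lambda>g. False)"
      proof (rule locally_bind[OF d part_locally[OF d y(1)]])
        fix b g assume g: "g \<in> hom C b d" and "\<exists>w\<in>S2. res (?H 2) g y \<in> part 2 w (Dom C g)"
        then obtain x where x: "x \<in> S2" "res (?H 2) g y \<in> part 2 x b" using homD(2)[OF g] by auto
        note b = objC(1)[OF g]
        note fg = compC[OF g f]
        have x': "x \<in> simplices el F (1 + 1)" "res (?H 2) g y \<in> part (1 + 1) x b" using x by (simp_all add: numeral_2_eq_2)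
        have "\<exists>k\<in>{0, 1, 2}. bd F 1 k x \<noteq> ?ll k"
          using no that[OF x(1)] by auto
        then obtain k where k: "k \<in> {0, 1, 2}" "bd F 1 k x \<noteq> ?ll k" by blast
        have k2: "k \<le> 1 + 1" using k(1) by auto
        have dk: "dd (tot F) 1 k \<in> hom E (?H 2) (?H 1)" using tot_dd[OF k2] by (simp add: numeral_2_eq_2)
        have q1: "face 1 k b (res (?H 2) g y) \<in> part 1 (bd F 1 k x) b" by (rule part_face[OF x'(1) k2 b x'(2)])
        have "face 1 k b (res (?H 2) g y) = res (?H 1) (f \<cdot>\<^bsub>C\<^esub> g) (?hh k)"
          using act_nat[OF dk g y(1)] fy[OF k(1)] res_comp[OF tot_obj g f part_sec[OF hh(1)]] by simp
        then have q2: "face 1 k b (res (?H 2) g y) \<in> part 1 (?ll k) b" using part_res[OF hh(2) fg hh(1)] by simp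
        have "{} \<in> J b"
          by (rule part_unique[OF _ hh(2) b q1 q2 k(2)]) (rule bd_1[OF x(1)], use k2 in simp)
        then show "locally b (\<lambda>k. False)" by (simp add: locally_False)
      qed (simp add: stable_def)
    qed (simp add: stable_def)
    then show False using nd by (simp add: locally_False)
  qed
qed

subsection \<open>Components of the family\<close>

abbreviation Hw :: "nat \<Rightarrow> 'v \<Rightarrow> 'o" where "Hw \<equiv> Hc el E gs F"

text \<open>The inclusion of the component \<open>(H\<^sub>n)\<^sub>w\<close> into \<open>H\<^sub>n\<close>.\<close>

definition inc :: "nat \<Rightarrow> 'v \<Rightarrow> 'a" where
  "inc n w = comp_in el E gs (Ob (idx F) n) (str F n) w"

lemma inc_hom: "w \<in> simplices el F n \<Longrightarrow> inc n w \<in> hom E (Hw n w) (Ob (tot F) n)"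
  unfolding inc_def Hc_def by (rule comp_in_hom[OF str_hom]) (simp add: simplices_def)

lemma Hw_obj: "w \<in> simplices el F n \<Longrightarrow> Hw n w \<in> Obj E"
  using objE(1)[OF inc_hom] .

lemma inc_part:
  assumes "w \<in> simplices el F n" "c \<in> Obj C" "v \<in> sec (Hw n w) c"
  shows "act (inc n w) c v \<in> part n w c"
  using comp_in_str[OF str_hom _ assms(2), of w n v] act_in[OF inc_hom[OF assms(1)] assms(2,3)] assms
  by (simp add: part_def inc_def Hc_def simplices_def)

lemma inc_ex1:
  assumes w: "w \<in> simplices el F n" and c: "c \<in> Obj C" and h: "h \<in> part n w c"
  shows "\<exists>!v. v \<in> sec (Hw n w) c \<and> act (inc n w) c v = h"
  using comp_in_ex1[OF str_hom _ c, of w n h] assms by (simp add: part_def inc_def Hc_def simplices_def)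

lemma inc_inj:
  assumes "w \<in> simplices el F n" "c \<in> Obj C" "v \<in> sec (Hw n w) c" "v' \<in> sec (Hw n w) c"
    "act (inc n w) c v = act (inc n w) c v'"
  shows "v = v'"
  using inc_ex1[OF assms(1,2) inc_part[OF assms(1-3)]] assms by metis

lemma dc_prop:
  assumes l: "l \<in> S1" and i: "i \<le> 1"
  shows "dc el E gs F 0 i l \<in> hom E (Hw 1 l) (Hw 0 (bd F 0 i l))"
    and "c \<in> Obj C \<Longrightarrow> v \<in> sec (Hw 1 l) c \<Longrightarrow>
      act (inc 0 (bd F 0 i l)) c (act (dc el E gs F 0 i l) c v) = face 0 i c (act (inc 1 l) c v)"
proof -
  have l': "l \<in> el (Ob (idx F) (0 + 1))" and i': "i \<le> 0 + 1" using l i by (simp_all add: simplices_def)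
  note p = comp_map_prop[OF str_hom l' str_hom tot_dd[OF i'] idx_dd[OF i'] str_dd[OF i']]
  show "dc el E gs F 0 i l \<in> hom E (Hw 1 l) (Hw 0 (bd F 0 i l))"
    using p(1) by (simp add: dc_def Hc_def bd_def)
  show "act (inc 0 (bd F 0 i l)) c (act (dc el E gs F 0 i l) c v) = face 0 i c (act (inc 1 l) c v)"
    if "c \<in> Obj C" "v \<in> sec (Hw 1 l) c"
    using p(2)[OF that(1), of v] that(2) by (simp add: dc_def Hc_def bd_def inc_def)
qed

lemma tauc_prop:
  assumes l: "l \<in> S1"
  shows "tauc el E gs F 1 l \<in> hom E (Hw 1 l) (Hw 1 (opp F 1 l))"
    and "c \<in> Obj C \<Longrightarrow> v \<in> sec (Hw 1 l) c \<Longrightarrow>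
      act (inc 1 (opp F 1 l)) c (act (tauc el E gs F 1 l) c v) = act (tot_dual F 1) c (act (inc 1 l) c v)"
proof -
  have l': "l \<in> el (Ob (idx F) 1)" using l by (simp add: simplices_def)
  note p = comp_map_prop[OF str_hom l' str_hom dual_hom[OF dual_tot] dual_hom[OF dual_idx] dual_str]
  show "tauc el E gs F 1 l \<in> hom E (Hw 1 l) (Hw 1 (opp F 1 l))"
    using p(1) by (simp add: tauc_def Hc_def opp_def)
  show "act (inc 1 (opp F 1 l)) c (act (tauc el E gs F 1 l) c v) = act (tot_dual F 1) c (act (inc 1 l) c v)"
    if "c \<in> Obj C" "v \<in> sec (Hw 1 l) c"
    using p(2)[OF that(1), of v] that(2) by (simp add: tauc_def Hc_def opp_def inc_def)
qed

lemma Hw_nonempty: "w \<in> simplices el F n \<Longrightarrow> \<not> is_initial E (Hw n w)"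
  using fam[of n] by (simp add: family_def Hc_def simplices_def)

end

section \<open>The covering projection of a descent datum\<close>

lemma (in sheaf_topos) sec_degenerate:
  assumes "c \<in> Obj C" "{} \<in> J c" "X \<in> Obj E" "x \<in> sec X c" "y \<in> sec X c"
  shows "x = y"
  by (rule separated[OF assms(3,1) _ assms(4,5), of "\<lambda>_. False"]) (use assms(2) in \<open>simp_all add: locally_False\<close>)

text \<open>A descent datum on the hypercover. Below, \<open>G i\<close> is \<open>\<gamma>\<^sup>* R\<^sub>i\<close>, \<open>sa l\<close> is \<open>\<gamma>\<^sup>* s\<^sub>l\<close>, and \<open>rs\<close> restricts
  sections of the cover.\<close>

locale descent = sd_hypercover el C J E sec res act gs gl F I U \<zeta>
  for el :: "'v \<Rightarrow> 'v set" and C :: "('v, 'v) cat" and J and E :: "('o, 'a) cat" and sec res act gs gl F I U \<zeta> +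
  fixes R :: "'v \<Rightarrow> 'v" and s :: "'v \<Rightarrow> 'v sarr"
  assumes D: "descent_datum el F (R, s)"
begin

abbreviation "G i \<equiv> FO gs (R i)"
abbreviation "sa l \<equiv> FA gs (s l)"
abbreviation "H0 \<equiv> Ob (tot F) 0"
abbreviation "rs \<equiv> res H0"

lemma s_hom: "l \<in> S1 \<Longrightarrow> s l \<in> hom (set_cat el) (R (sr l)) (R (tg l))"
  and s_bij: "l \<in> S1 \<Longrightarrow> bij_betw (app (s l)) (el (R (sr l))) (el (R (tg l)))"
  and s_dg: "i \<in> S0 \<Longrightarrow> s (dg i) = Id (set_cat el) (R i)"
  and s_tri: "w \<in> S2 \<Longrightarrow> s (bd F 1 1 w) = s (bd F 1 0 w) \<cdot>\<^bsub>set_cat el\<^esub> s (bd F 1 2 w)"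
  using D by (simp_all add: descent_datum_def)

lemma sa_hom: "l \<in> S1 \<Longrightarrow> sr l = i \<Longrightarrow> tg l = j \<Longrightarrow> sa l \<in> hom E (G i) (G j)"
proof -
  assume l: "l \<in> S1" and e: "sr l = i" "tg l = j"
  show "sa l \<in> hom E (G i) (G j)" using gs_arr[OF s_hom[OF l]] unfolding e .
qed

lemma joinsD:
  assumes "joins c l h u v" "c \<in> Obj C"
  shows "l \<in> S1" "u \<in> part 0 (sr l) c" "v \<in> part 0 (tg l) c" "h \<in> part 1 l c" "sr l \<in> S0" "tg l \<in> S0"
  using assms part_face0[of l 1 c h] part_face0[of l 0 c h] bd_0[of l] by (auto simp: joins_def)

lemma joins_dg:
  assumes "i \<in> S0" "c \<in> Obj C" "u \<in> part 0 i c"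
  shows "joins c (dg i) (act (ss (tot F) 0 0) c u) u u"
  using part_degenerate[OF assms] dg_in[OF assms(1)] by (simp add: joins_def)

text \<open>The cocycle condition on sections: it holds trivially where the empty sieve covers, and comes from a
  triangle elsewhere.\<close>

lemma tri_act:
  assumes c: "c \<in> Obj C" and l: "joins c l h u v" and m: "joins c m h' v w" and n: "joins c n h'' u w"
    and e: "sr l = i" "tg l = j" "sr m = j" "tg m = k" "sr n = i" "tg n = k" and r: "r \<in> sec (G i) c"
  shows "act (sa n) c r = act (sa m) c (act (sa l) c r)"
proof -
  note ln = joinsD(1)[OF l c] joinsD(1)[OF m c] joinsD(1)[OF n c]
  note hl = sa_hom[OF ln(1) e(1,2)] and hm = sa_hom[OF ln(2) e(3,4)] and hn = sa_hom[OF ln(3) e(5,6)]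
  show ?thesis
  proof (cases "{} \<in> J c")
    case True
    show ?thesis
      by (rule sec_degenerate[OF c True gs_obj act_in[OF hn c r] act_in[OF hm c act_in[OF hl c r]]])
  next
    case False
    obtain x where x: "x \<in> S2" "bd F 1 2 x = l" "bd F 1 0 x = m" "bd F 1 1 x = n"
      using triangles[OF c False l m n] by metis
    have "s l \<in> hom (set_cat el) (R i) (R j)" "s m \<in> hom (set_cat el) (R j) (R k)"
      using s_hom[OF ln(1)] s_hom[OF ln(2)] e by simp_all
    then have "sa n = sa m \<cdot>\<^bsub>E\<^esub> sa l" using s_tri[OF x(1)] gs_comp x by simp
    then show ?thesis using act_comp[OF hl hm c r] by simp
  qed
qed

text \<open>Edges with the same ends act alike, by a triangle with a degenerate side.\<close>

lemma same_act:
  assumes c: "c \<in> Obj C" and l: "joins c l h u v" and n: "joins c n h'' u v"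
    and e: "sr l = i" "tg l = j" "sr n = i" "tg n = j" and r: "r \<in> sec (G i) c"
  shows "act (sa n) c r = act (sa l) c r"
proof -
  have j: "j \<in> S0" "v \<in> part 0 j c" using joinsD[OF l c] e by simp_all
  have "act (sa n) c r = act (sa (dg j)) c (act (sa l) c r)"
    by (rule tri_act[OF c l joins_dg[OF j(1) c j(2)] n e(1,2) _ _ e(3,4) r]) (use bd_dg[OF j(1)] in simp_all)
  also have "\<dots> = act (sa l) c r"
    using s_dg[OF j(1)] gs_id act_id[OF gs_obj c act_in[OF sa_hom[OF joinsD(1)[OF l c] e(1,2)] c r]] by simp
  finally show ?thesis .
qed

subsection \<open>Transport of constant sections along edges\<close>

text \<open>\<open>y\<close> is the transport of the section \<open>r\<close> of \<open>\<gamma>\<^sup>* R\<^sub>i\<close> from \<open>u\<close> in \<open>U\<^sub>i\<close> to \<open>v\<close> in \<open>U\<^sub>j\<close>: along any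
  edge joining \<open>u\<close> to \<open>v\<close> it is given by the datum. The function \<open>transport\<close> below picks the unique
  such \<open>y\<close>.\<close>

definition transported :: "'v \<Rightarrow> 'v \<Rightarrow> 'v \<Rightarrow> 'v \<Rightarrow> 'v \<Rightarrow> 'v \<Rightarrow> 'v \<Rightarrow> bool" where
  "transported i j c r u v y \<longleftrightarrow> y \<in> sec (G j) c \<and>
    (\<forall>f d l h. f \<in> hom C d c \<longrightarrow> sr l = i \<longrightarrow> tg l = j \<longrightarrow> joins d l h (rs f u) (rs f v) \<longrightarrow>
      res (G j) f y = act (sa l) d (res (G i) f r))"

definition transport :: "'v \<Rightarrow> 'v \<Rightarrow> 'v \<Rightarrow> 'v \<Rightarrow> 'v \<Rightarrow> 'v \<Rightarrow> 'v" where
  "transport i j c r u v = (THE y. transported i j c r u v y)"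

lemma transportedD:
  assumes "transported i j c r u v y"
  shows "y \<in> sec (G j) c"
    and "f \<in> hom C d c \<Longrightarrow> sr l = i \<Longrightarrow> tg l = j \<Longrightarrow> joins d l h (rs f u) (rs f v) \<Longrightarrow>
      res (G j) f y = act (sa l) d (res (G i) f r)"
  using assms unfolding transported_def by blast+

lemma locally_joined:
  assumes "i \<in> S0" "j \<in> S0" "c \<in> Obj C" "u \<in> part 0 i c" "v \<in> part 0 j c"
  obtains P where "locally c P"
    "\<And>f d. f \<in> hom C d c \<Longrightarrow> P f \<longleftrightarrow> (\<exists>l h. sr l = i \<and> tg l = j \<and> joins d l h (rs f u) (rs f v))"
proof
  show "locally c (\<lambda>f. \<exists>l h. sr l = i \<and> tg l = j \<and> joins (Dom C f) l h (rs f u) (rs f v))"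
    by (rule edges[OF assms])
  show "(\<exists>l h. sr l = i \<and> tg l = j \<and> joins (Dom C f) l h (rs f u) (rs f v)) \<longleftrightarrow>
     (\<exists>l h. sr l = i \<and> tg l = j \<and> joins d l h (rs f u) (rs f v))" if "f \<in> hom C d c" for f d
    using that by (simp add: hom_def)
qed

context
  fixes i j c r u v
  assumes i: "i \<in> S0" and j: "j \<in> S0" and c: "c \<in> Obj C" and r: "r \<in> sec (G i) c"
    and u: "u \<in> part 0 i c" and v: "v \<in> part 0 j c"
begin

lemma transported_unique:
  assumes "transported i j c r u v y" "transported i j c r u v y'"
  shows "y = y'"
proof -
  obtain P where P: "locally c P"
    "\<And>f d. f \<in> hom C d c \<Longrightarrow> P f \<longleftrightarrow> (\<exists>l h. sr l = i \<and> tg l = j \<and> joins d l h (rs f u) (rs f v))"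
    using locally_joined[OF i j c u v] by metis
  show ?thesis
  proof (rule separated[OF gs_obj c P(1)])
    show "y \<in> sec (G j) c" "y' \<in> sec (G j) c" using transportedD(1) assms by blast+
    fix d f assume f: "f \<in> hom C d c" and "P f"
    then obtain l h where l: "sr l = i" "tg l = j" "joins d l h (rs f u) (rs f v)" using P(2) by blast
    show "res (G j) f y = res (G j) f y'"
      using transportedD(2)[OF assms(1) f l] transportedD(2)[OF assms(2) f l] by simp
  qed
qed

lemma transported_exists: "\<exists>y. transported i j c r u v y"
proof -
  obtain P where P: "locally c P"
    "\<And>f d. f \<in> hom C d c \<Longrightarrow> P f \<longleftrightarrow> (\<exists>l h. sr l = i \<and> tg l = j \<and> joins d l h (rs f u) (rs f v))"
    using locally_joined[OF i j c u v] by metis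
  define lf where "lf f = (SOME l. \<exists>h. sr l = i \<and> tg l = j \<and> joins (Dom C f) l h (rs f u) (rs f v))" for f
  define x where "x f = act (sa (lf f)) (Dom C f) (res (G i) f r)" for f
  have x: "x f = act (sa l) d (res (G i) f r)"
    if f: "f \<in> hom C d c" and l: "sr l = i" "tg l = j" "joins d l h (rs f u) (rs f v)" for f d l h
  proof -
    have "\<exists>h. sr (lf f) = i \<and> tg (lf f) = j \<and> joins d (lf f) h (rs f u) (rs f v)"
      unfolding lf_def homD(2)[OF f] by (rule someI[of _ l]) (use l in blast)
    then obtain h' where h': "sr (lf f) = i" "tg (lf f) = j" "joins d (lf f) h' (rs f u) (rs f v)" by blast
    show ?thesis unfolding x_def homD(2)[OF f]
      by (rule same_act[OF objC(1)[OF f] l(3) h'(3) l(1,2) h'(1,2) res_in[OF gs_obj f r]])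
  qed
  have "\<exists>y\<in>sec (G j) c. \<forall>d f. f \<in> hom C d c \<longrightarrow> P f \<longrightarrow> res (G j) f y = x f"
  proof (rule glue[OF gs_obj c P(1)])
    fix d f assume f: "f \<in> hom C d c" and "P f"
    then obtain l h where l: "sr l = i" "tg l = j" "joins d l h (rs f u) (rs f v)" using P(2) by blast
    note d = objC(1)[OF f]
    note sl = sa_hom[OF joinsD(1)[OF l(3) d] l(1,2)]
    note fr = res_in[OF gs_obj f r]
    show "x f \<in> sec (G j) d" using act_in[OF sl d fr] x[OF f l] by simp
    fix e g assume g: "g \<in> hom C e d"
    note fg = compC[OF g f]
    have l': "joins e l (res (Ob (tot F) 1) g h) (rs (f \<cdot>\<^bsub>C\<^esub> g) u) (rs (f \<cdot>\<^bsub>C\<^esub> g) v)"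
      using joins_res[OF l(3) g] res_comp[OF tot_obj g f part_sec[OF u]] res_comp[OF tot_obj g f part_sec[OF v]] by simp
    show "res (G j) g (x f) = x (f \<cdot>\<^bsub>C\<^esub> g)"
      using x[OF f l] x[OF fg l(1,2) l'] act_nat[OF sl g fr] res_comp[OF gs_obj g f r] by simp
  qed
  then obtain y where y: "y \<in> sec (G j) c" "\<And>d f. f \<in> hom C d c \<Longrightarrow> P f \<Longrightarrow> res (G j) f y = x f" by blast
  have "transported i j c r u v y"
    unfolding transported_def
  proof (intro conjI y(1) allI impI)
    fix f d l h assume f: "f \<in> hom C d c" and l: "sr l = i" "tg l = j" "joins d l h (rs f u) (rs f v)"
    have "P f" using P(2)[OF f] l by blast
    then show "res (G j) f y = act (sa l) d (res (G i) f r)" using y(2)[OF f] x[OF f l] by simp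
  qed
  then show ?thesis by blast
qed

lemma transport_transported: "transported i j c r u v (transport i j c r u v)"
proof -
  have "\<exists>!y. transported i j c r u v y" using transported_exists transported_unique by blast
  then show ?thesis unfolding transport_def by (rule theI')
qed

lemma transport_in: "transport i j c r u v \<in> sec (G j) c"
  by (rule transportedD(1)[OF transport_transported])

lemma transport_joins:
  "f \<in> hom C d c \<Longrightarrow> sr l = i \<Longrightarrow> tg l = j \<Longrightarrow> joins d l h (rs f u) (rs f v) \<Longrightarrow>
    res (G j) f (transport i j c r u v) = act (sa l) d (res (G i) f r)"
  by (rule transportedD(2)[OF transport_transported])

lemma transport_at:
  assumes "sr l = i" "tg l = j" "joins c l h u v"
  shows "transport i j c r u v = act (sa l) c r"
  using transport_joins[OF idC[OF c] assms(1,2), of h] assms(3) res_id[OF tot_obj c part_sec[OF u]]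
    res_id[OF tot_obj c part_sec[OF v]] res_id[OF gs_obj c r] res_id[OF gs_obj c transport_in] by simp

lemma transport_eqI: "transported i j c r u v y \<Longrightarrow> transport i j c r u v = y"
  using transported_unique transport_transported by blast

end

lemma transport_res:
  assumes i: "i \<in> S0" and j: "j \<in> S0" and r: "r \<in> sec (G i) c"
    and u: "u \<in> part 0 i c" and v: "v \<in> part 0 j c" and f: "f \<in> hom C d c"
  shows "res (G j) f (transport i j c r u v) = transport i j d (res (G i) f r) (rs f u) (rs f v)"
proof -
  note o = objC[OF f]
  note a = i j o(2) r u v
  show ?thesis
  proof (rule HOL.sym, rule transport_eqI[OF i j o(1) res_in[OF gs_obj f r] part_res[OF i f u] part_res[OF j f v]])
    show "transported i j d (res (G i) f r) (rs f u) (rs f v) (res (G j) f (transport i j c r u v))"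
      unfolding transported_def
    proof (intro conjI allI impI)
      show "res (G j) f (transport i j c r u v) \<in> sec (G j) d" by (rule res_in[OF gs_obj f transport_in[OF a]])
      fix g e l h assume g: "g \<in> hom C e d" and l: "sr l = i" "tg l = j" "joins e l h (rs g (rs f u)) (rs g (rs f v))"
      have "joins e l h (rs (f \<cdot>\<^bsub>C\<^esub> g) u) (rs (f \<cdot>\<^bsub>C\<^esub> g) v)"
        using l(3) res_comp[OF tot_obj g f part_sec[OF u]] res_comp[OF tot_obj g f part_sec[OF v]] by simp
      from transport_joins[OF a compC[OF g f] l(1,2) this]
      show "res (G j) g (res (G j) f (transport i j c r u v)) = act (sa l) e (res (G i) g (res (G i) f r))"
        using res_comp[OF gs_obj g f transport_in[OF a]] res_comp[OF gs_obj g f r] by simp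
    qed
  qed
qed

lemma transport_refl:
  assumes i: "i \<in> S0" and c: "c \<in> Obj C" and r: "r \<in> sec (G i) c" and u: "u \<in> part 0 i c"
  shows "transport i i c r u u = r"
  using transport_at[OF i i c r u u _ _ joins_dg[OF i c u]] bd_dg[OF i] s_dg[OF i] gs_id act_id[OF gs_obj c r] by simp

text \<open>Transport commutes with the action of an edge on the starting point and on the end point.\<close>

lemma transport_left:
  assumes j: "j \<in> S0" and c: "c \<in> Obj C" and m: "joins c m k u u'" and w: "w \<in> part 0 j c"
    and r: "r \<in> sec (G (sr m)) c"
  shows "transport (sr m) j c r u w = transport (tg m) j c (act (sa m) c r) u' w"
proof -
  note md = joinsD[OF m c]
  note sm = sa_hom[OF md(1) HOL.refl HOL.refl]
  note r' = act_in[OF sm c r]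
  note a = md(5) j c r md(2) w and b = md(6) j c r' md(3) w
  obtain P where P: "locally c P"
    "\<And>f d. f \<in> hom C d c \<Longrightarrow> P f \<longleftrightarrow> (\<exists>l h. sr l = sr m \<and> tg l = j \<and> joins d l h (rs f u) (rs f w))"
    using locally_joined[OF md(5) j c md(2) w] by metis
  obtain P' where P': "locally c P'"
    "\<And>f d. f \<in> hom C d c \<Longrightarrow> P' f \<longleftrightarrow> (\<exists>l h. sr l = tg m \<and> tg l = j \<and> joins d l h (rs f u') (rs f w))"
    using locally_joined[OF md(6) j c md(3) w] by metis
  show ?thesis
  proof (rule separated[OF gs_obj c locally_conj[OF c P(1) P'(1)] transport_in[OF a] transport_in[OF b]])
    fix d f assume f: "f \<in> hom C d c" and PP: "P f \<and> P' f"
    obtain l h where l: "sr l = sr m" "tg l = j" "joins d l h (rs f u) (rs f w)" using PP P(2)[OF f] by blast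
    obtain l' h' where l': "sr l' = tg m" "tg l' = j" "joins d l' h' (rs f u') (rs f w)" using PP P'(2)[OF f] by blast
    show "res (G j) f (transport (sr m) j c r u w) = res (G j) f (transport (tg m) j c (act (sa m) c r) u' w)"
      using transport_joins[OF a f l] transport_joins[OF b f l'] act_nat[OF sm f r]
        tri_act[OF objC(1)[OF f] joins_res[OF m f] l'(3) l(3) HOL.refl HOL.refl l'(1,2) l(1,2) res_in[OF gs_obj f r]]
      by simp
  qed
qed

lemma transport_right:
  assumes i: "i \<in> S0" and c: "c \<in> Obj C" and m: "joins c m k v v'" and u: "u \<in> part 0 i c"
    and r: "r \<in> sec (G i) c"
  shows "transport i (tg m) c r u v' = act (sa m) c (transport i (sr m) c r u v)"
proof -
  note md = joinsD[OF m c]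
  note sm = sa_hom[OF md(1) HOL.refl HOL.refl]
  note a = i md(5) c r u md(2) and b = i md(6) c r u md(3)
  obtain P where P: "locally c P"
    "\<And>f d. f \<in> hom C d c \<Longrightarrow> P f \<longleftrightarrow> (\<exists>l h. sr l = i \<and> tg l = sr m \<and> joins d l h (rs f u) (rs f v))"
    using locally_joined[OF i md(5) c u md(2)] by metis
  obtain P' where P': "locally c P'"
    "\<And>f d. f \<in> hom C d c \<Longrightarrow> P' f \<longleftrightarrow> (\<exists>l h. sr l = i \<and> tg l = tg m \<and> joins d l h (rs f u) (rs f v'))"
    using locally_joined[OF i md(6) c u md(3)] by metis
  show ?thesis
  proof (rule separated[OF gs_obj c locally_conj[OF c P(1) P'(1)] transport_in[OF b] act_in[OF sm c transport_in[OF a]]])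
    fix d f assume f: "f \<in> hom C d c" and PP: "P f \<and> P' f"
    obtain l h where l: "sr l = i" "tg l = sr m" "joins d l h (rs f u) (rs f v)" using PP P(2)[OF f] by blast
    obtain l' h' where l': "sr l' = i" "tg l' = tg m" "joins d l' h' (rs f u) (rs f v')" using PP P'(2)[OF f] by blast
    show "res (G (tg m)) f (transport i (tg m) c r u v') = res (G (tg m)) f (act (sa m) c (transport i (sr m) c r u v))"
      using transport_joins[OF a f l] transport_joins[OF b f l'] act_nat[OF sm f transport_in[OF a]]
        tri_act[OF objC(1)[OF f] l(3) joins_res[OF m f] l'(3) l(1,2) HOL.refl HOL.refl l'(1,2) res_in[OF gs_obj f r]]
      by simp
  qed
qed

subsection \<open>The glued object\<close>

text \<open>A section over \<open>c\<close> assigns to every \<open>u\<close> in \<open>U\<^sub>k\<close> over \<open>f : d \<rightarrow> c\<close> a section of \<open>\<gamma>\<^sup>* R\<^sub>k\<close>,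
  naturally and compatibly with the descent datum.\<close>

definition ix :: "'v \<Rightarrow> ('v \<times> 'v \<times> 'v) set" where
  "ix c = {(k, f, u). k \<in> S0 \<and> f \<in> Arr C \<and> Cod C f = c \<and> u \<in> part 0 k (Dom C f)}"

definition glued :: "'v \<Rightarrow> ('v \<times> 'v \<times> 'v \<Rightarrow> 'v) set" where
  "glued c = {x \<in> PiE (ix c) (\<lambda>(k, f, u). sec (G k) (Dom C f)).
     (\<forall>k f u d g e. k \<in> S0 \<longrightarrow> f \<in> hom C d c \<longrightarrow> u \<in> part 0 k d \<longrightarrow> g \<in> hom C e d \<longrightarrow>
        x (k, f \<cdot>\<^bsub>C\<^esub> g, rs g u) = res (G k) g (x (k, f, u))) \<and>
     (\<forall>f d l h. f \<in> hom C d c \<longrightarrow> l \<in> S1 \<longrightarrow> h \<in> part 1 l d \<longrightarrow>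
        x (tg l, f, face 0 0 d h) = act (sa l) d (x (sr l, f, face 0 1 d h)))}"

text \<open>Restriction of such a section along \<open>g\<close>.\<close>

definition gres :: "'v \<Rightarrow> ('v \<times> 'v \<times> 'v \<Rightarrow> 'v) \<Rightarrow> ('v \<times> 'v \<times> 'v \<Rightarrow> 'v)" where
  "gres g x = (\<lambda>(k, f, u)\<in>ix (Dom C g). x (k, g \<cdot>\<^bsub>C\<^esub> f, u))"

lemma ix_iff: "f \<in> hom C d c \<Longrightarrow> (k, f, u) \<in> ix c \<longleftrightarrow> k \<in> S0 \<and> u \<in> part 0 k d"
  by (auto simp: ix_def hom_def)

lemma ixE:
  assumes "p \<in> ix c"
  obtains k f u d where "p = (k, f, u)" "f \<in> hom C d c" "k \<in> S0" "u \<in> part 0 k d"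
  using assms by (cases p) (auto simp: ix_def hom_def)

lemma gluedI:
  assumes "x \<in> extensional (ix c)"
    and "\<And>k f u d. f \<in> hom C d c \<Longrightarrow> k \<in> S0 \<Longrightarrow> u \<in> part 0 k d \<Longrightarrow> x (k, f, u) \<in> sec (G k) d"
    and "\<And>k f u d g e. k \<in> S0 \<Longrightarrow> f \<in> hom C d c \<Longrightarrow> u \<in> part 0 k d \<Longrightarrow> g \<in> hom C e d \<Longrightarrow>
        x (k, f \<cdot>\<^bsub>C\<^esub> g, rs g u) = res (G k) g (x (k, f, u))"
    and "\<And>f d l h. f \<in> hom C d c \<Longrightarrow> l \<in> S1 \<Longrightarrow> h \<in> part 1 l d \<Longrightarrow>
        x (tg l, f, face 0 0 d h) = act (sa l) d (x (sr l, f, face 0 1 d h))"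
  shows "x \<in> glued c"
proof -
  have "x \<in> PiE (ix c) (\<lambda>(k, f, u). sec (G k) (Dom C f))"
  proof (rule PiE_I)
    fix p assume "p \<in> ix c"
    then obtain k f u d where "p = (k, f, u)" "f \<in> hom C d c" "k \<in> S0" "u \<in> part 0 k d" by (rule ixE)
    then show "x p \<in> (case p of (k, f, u) \<Rightarrow> sec (G k) (Dom C f))" using assms(2) homD(2) by fastforce
  qed (use assms(1) in \<open>auto simp: extensional_def\<close>)
  then show ?thesis unfolding glued_def using assms(3,4) by blast
qed

lemma gluedD:
  assumes "x \<in> glued c"
  shows "x \<in> extensional (ix c)"
    and "f \<in> hom C d c \<Longrightarrow> k \<in> S0 \<Longrightarrow> u \<in> part 0 k d \<Longrightarrow> x (k, f, u) \<in> sec (G k) d"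
    and "k \<in> S0 \<Longrightarrow> f \<in> hom C d c \<Longrightarrow> u \<in> part 0 k d \<Longrightarrow> g \<in> hom C e d \<Longrightarrow>
        x (k, f \<cdot>\<^bsub>C\<^esub> g, rs g u) = res (G k) g (x (k, f, u))"
    and "f \<in> hom C d c \<Longrightarrow> l \<in> S1 \<Longrightarrow> h \<in> part 1 l d \<Longrightarrow>
        x (tg l, f, face 0 0 d h) = act (sa l) d (x (sr l, f, face 0 1 d h))"
proof -
  note a = assms[unfolded glued_def mem_Collect_eq]
  show "x \<in> extensional (ix c)" using conjunct1[OF a] by (simp add: PiE_def)
  show "x (k, f, u) \<in> sec (G k) d" if "f \<in> hom C d c" "k \<in> S0" "u \<in> part 0 k d"
    using PiE_mem[OF conjunct1[OF a], of "(k, f, u)"] ix_iff[OF that(1)] that by (simp add: homD(2)[OF that(1)])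
  show "k \<in> S0 \<Longrightarrow> f \<in> hom C d c \<Longrightarrow> u \<in> part 0 k d \<Longrightarrow> g \<in> hom C e d \<Longrightarrow>
        x (k, f \<cdot>\<^bsub>C\<^esub> g, rs g u) = res (G k) g (x (k, f, u))"
    using conjunct1[OF conjunct2[OF a]] by blast
  show "f \<in> hom C d c \<Longrightarrow> l \<in> S1 \<Longrightarrow> h \<in> part 1 l d \<Longrightarrow>
        x (tg l, f, face 0 0 d h) = act (sa l) d (x (sr l, f, face 0 1 d h))"
    using conjunct2[OF conjunct2[OF a]] by blast
qed

lemma glued_ext:
  assumes "x \<in> glued c" "y \<in> glued c"
    and "\<And>k f u d. f \<in> hom C d c \<Longrightarrow> k \<in> S0 \<Longrightarrow> u \<in> part 0 k d \<Longrightarrow> x (k, f, u) = y (k, f, u)"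
  shows "x = y"
proof (rule extensionalityI[OF gluedD(1)[OF assms(1)] gluedD(1)[OF assms(2)]])
  fix p assume "p \<in> ix c"
  then show "x p = y p" by (rule ixE) (use assms(3) in blast)
qed

lemma gres_apply:
  assumes "g \<in> hom C d c" "f \<in> hom C e d" "k \<in> S0" "u \<in> part 0 k e"
  shows "gres g x (k, f, u) = x (k, g \<cdot>\<^bsub>C\<^esub> f, u)"
proof -
  have "(k, f, u) \<in> ix (Dom C g)" using assms ix_iff by (simp add: homD(2)[OF assms(1)])
  then show ?thesis by (simp add: gres_def)
qed

lemma gres_in:
  assumes g: "g \<in> hom C d c" and x: "x \<in> glued c"
  shows "gres g x \<in> glued d"
proof (rule gluedI)
  show "gres g x \<in> extensional (ix d)" by (simp add: gres_def homD(2)[OF g])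
  fix k f u e assume f: "f \<in> hom C e d" and k: "k \<in> S0" and u: "u \<in> part 0 k e"
  show "gres g x (k, f, u) \<in> sec (G k) e"
    unfolding gres_apply[OF g f k u] by (rule gluedD(2)[OF x compC[OF f g] k u])
next
  fix k f u e h a assume k: "k \<in> S0" and f: "f \<in> hom C e d" and u: "u \<in> part 0 k e" and h: "h \<in> hom C a e"
  show "gres g x (k, f \<cdot>\<^bsub>C\<^esub> h, rs h u) = res (G k) h (gres g x (k, f, u))"
    unfolding gres_apply[OF g f k u] gres_apply[OF g compC[OF h f] k part_res[OF k h u]] assocC[OF h f g]
    by (rule gluedD(3)[OF x k compC[OF f g] u h])
next
  fix f e l h assume f: "f \<in> hom C e d" and l: "l \<in> S1" and h: "h \<in> part 1 l e"
  have S: "sr l \<in> S0" "tg l \<in> S0" using bd_0[OF l] by simp_all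
  have p: "face 0 0 e h \<in> part 0 (tg l) e" "face 0 1 e h \<in> part 0 (sr l) e"
    using part_face0[OF l _ objC(1)[OF f] h] by simp_all
  show "gres g x (tg l, f, face 0 0 e h) = act (sa l) e (gres g x (sr l, f, face 0 1 e h))"
    unfolding gres_apply[OF g f S(1) p(2)] gres_apply[OF g f S(2) p(1)]
    by (rule gluedD(4)[OF x compC[OF f g] l h])
qed

lemma glued_sheaf: "set_sheaf C J glued gres"
proof (rule set_sheaf_localI)
  fix f d c x assume "f \<in> hom C d c" "x \<in> glued c"
  then show "gres f x \<in> glued d" by (rule gres_in)
next
  fix c x assume c: "c \<in> Obj C" and x: "x \<in> glued c"
  show "gres (Id C c) x = x"
    by (rule glued_ext[OF gres_in[OF idC[OF c] x] x]) (simp add: gres_apply[OF idC[OF c]] unitC(2))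
next
  fix f g b c d x assume f: "f \<in> hom C b c" and g: "g \<in> hom C c d" and x: "x \<in> glued d"
  note fg = compC[OF f g]
  show "gres (g \<cdot>\<^bsub>C\<^esub> f) x = gres f (gres g x)"
  proof (rule glued_ext[OF gres_in[OF fg x] gres_in[OF f gres_in[OF g x]]])
    fix k h u e assume h: "h \<in> hom C e b" and k: "k \<in> S0" and u: "u \<in> part 0 k e"
    show "gres (g \<cdot>\<^bsub>C\<^esub> f) x (k, h, u) = gres f (gres g x) (k, h, u)"
      unfolding gres_apply[OF fg h k u] gres_apply[OF f h k u] gres_apply[OF g compC[OF h f] k u] assocC[OF h f g] ..
  qed
next
  fix c P x y assume c: "c \<in> Obj C" and P: "locally c P" and x: "x \<in> glued c" and y: "y \<in> glued c"
    and e: "\<And>d f. f \<in> hom C d c \<Longrightarrow> P f \<Longrightarrow> gres f x = gres f y"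
  show "x = y"
  proof (rule glued_ext[OF x y])
    fix k f u d assume f: "f \<in> hom C d c" and k: "k \<in> S0" and u: "u \<in> part 0 k d"
    note d = objC(1)[OF f]
    show "x (k, f, u) = y (k, f, u)"
    proof (rule separated[OF gs_obj d locally_pull[OF f P] gluedD(2)[OF x f k u] gluedD(2)[OF y f k u]])
      fix b g assume g: "g \<in> hom C b d" and Pg: "P (f \<cdot>\<^bsub>C\<^esub> g)"
      note fg = compC[OF g f]
      note i = idC[OF objC(1)[OF g]]
      note gu = part_res[OF k g u]
      show "res (G k) g (x (k, f, u)) = res (G k) g (y (k, f, u))"
        using fun_cong[OF e[OF fg Pg], of "(k, Id C b, rs g u)"] gluedD(3)[OF x k f u g] gluedD(3)[OF y k f u g]
        unfolding gres_apply[OF fg i k gu] unitC(1)[OF fg] by simp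
    qed
  qed
next
  fix c P x assume c: "c \<in> Obj C" and P: "locally c P" and x: "\<And>d f. f \<in> hom C d c \<Longrightarrow> P f \<Longrightarrow> x f \<in> glued d"
    and m: "\<And>d e f g. f \<in> hom C d c \<Longrightarrow> P f \<Longrightarrow> g \<in> hom C e d \<Longrightarrow> gres g (x f) = x (f \<cdot>\<^bsub>C\<^esub> g)"
  note st = stableD[OF locally_stable[OF c P]]
  have shift: "x (f \<cdot>\<^bsub>C\<^esub> g) (k, h, u) = x f (k, g \<cdot>\<^bsub>C\<^esub> h, u)"
    if "f \<in> hom C d c" "P f" "g \<in> hom C e d" "h \<in> hom C a e" "k \<in> S0" "u \<in> part 0 k a" for f d g e h a k u
    using m[OF that(1-3)] gres_apply[OF that(3-6), of "x f"] by simp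
  \<comment> \<open>the value at \<open>u\<close> is glued from the values at its restrictions along arrows into the cover\<close>
  define val where "val = (\<lambda>(k, f, u). SOME y. y \<in> sec (G k) (Dom C f) \<and> (\<forall>e g. g \<in> hom C e (Dom C f) \<longrightarrow> P (f \<cdot>\<^bsub>C\<^esub> g) \<longrightarrow>
     res (G k) g y = x (f \<cdot>\<^bsub>C\<^esub> g) (k, Id C e, rs g u)))"
  have val: "val (k, f, u) \<in> sec (G k) d \<and> (\<forall>e g. g \<in> hom C e d \<longrightarrow> P (f \<cdot>\<^bsub>C\<^esub> g) \<longrightarrow>
     res (G k) g (val (k, f, u)) = x (f \<cdot>\<^bsub>C\<^esub> g) (k, Id C e, rs g u))"
    if f: "f \<in> hom C d c" and k: "k \<in> S0" and u: "u \<in> part 0 k d" for k f u d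
  proof -
    note d = objC(1)[OF f]
    have "\<exists>y\<in>sec (G k) d. \<forall>e g. g \<in> hom C e d \<longrightarrow> P (f \<cdot>\<^bsub>C\<^esub> g) \<longrightarrow>
        res (G k) g y = x (f \<cdot>\<^bsub>C\<^esub> g) (k, Id C (Dom C g), rs g u)"
    proof (rule glue[OF gs_obj d locally_pull[OF f P]])
      fix e g assume g: "g \<in> hom C e d" and Pg: "P (f \<cdot>\<^bsub>C\<^esub> g)"
      note fg = compC[OF g f]
      note i = idC[OF objC(1)[OF g]]
      note gu = part_res[OF k g u]
      show "x (f \<cdot>\<^bsub>C\<^esub> g) (k, Id C (Dom C g), rs g u) \<in> sec (G k) e"
        unfolding homD(2)[OF g] by (rule gluedD(2)[OF x[OF fg Pg] i k gu])
      fix a h assume h: "h \<in> hom C a e"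
      note gh = compC[OF h g]
      have "x (f \<cdot>\<^bsub>C\<^esub> (g \<cdot>\<^bsub>C\<^esub> h)) (k, Id C a, rs (g \<cdot>\<^bsub>C\<^esub> h) u) = x (f \<cdot>\<^bsub>C\<^esub> g) (k, h \<cdot>\<^bsub>C\<^esub> Id C a, rs h (rs g u))"
        unfolding assocC[OF h g f] res_comp[OF tot_obj h g part_sec[OF u]]
        by (rule shift[OF fg Pg h idC[OF objC(1)[OF h]] k part_res[OF k h gu]])
      also have "\<dots> = res (G k) h (x (f \<cdot>\<^bsub>C\<^esub> g) (k, Id C e, rs g u))"
        using gluedD(3)[OF x[OF fg Pg] k i gu h] unfolding unitC(1)[OF h] unitC(2)[OF h] .
      finally show "res (G k) h (x (f \<cdot>\<^bsub>C\<^esub> g) (k, Id C (Dom C g), rs g u)) =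
          x (f \<cdot>\<^bsub>C\<^esub> (g \<cdot>\<^bsub>C\<^esub> h)) (k, Id C (Dom C (g \<cdot>\<^bsub>C\<^esub> h)), rs (g \<cdot>\<^bsub>C\<^esub> h) u)"
        unfolding homD(2)[OF g] homD(2)[OF gh] ..
    qed
    then have ex: "\<exists>y. y \<in> sec (G k) d \<and> (\<forall>e g. g \<in> hom C e d \<longrightarrow> P (f \<cdot>\<^bsub>C\<^esub> g) \<longrightarrow>
        res (G k) g y = x (f \<cdot>\<^bsub>C\<^esub> g) (k, Id C e, rs g u))" by (metis homD(2))
    show ?thesis unfolding val_def split_conv homD(2)[OF f] by (rule someI_ex[OF ex])
  qed
  define y where "y = restrict val (ix c)"
  have yv: "y (k, f, u) = val (k, f, u)" if "f \<in> hom C d c" "k \<in> S0" "u \<in> part 0 k d" for f d k u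
    using that ix_iff[OF that(1)] by (simp add: y_def)
  have y1: "y (k, f, u) \<in> sec (G k) d" if "f \<in> hom C d c" "k \<in> S0" "u \<in> part 0 k d" for f d k u
    using val[OF that] yv[OF that] by simp
  have y2: "res (G k) g (y (k, f, u)) = x (f \<cdot>\<^bsub>C\<^esub> g) (k, Id C e, rs g u)"
    if "f \<in> hom C d c" "k \<in> S0" "u \<in> part 0 k d" "g \<in> hom C e d" "P (f \<cdot>\<^bsub>C\<^esub> g)" for f d k u e g
    using val[OF that(1-3)] yv[OF that(1-3)] that(4,5) by simp
  have yg: "y \<in> glued c"
  proof (rule gluedI)
    show "y \<in> extensional (ix c)" by (simp add: y_def)
    show "y (k, f, u) \<in> sec (G k) d" if "f \<in> hom C d c" "k \<in> S0" "u \<in> part 0 k d" for k f u d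
      by (rule y1[OF that])
  next
    fix k f u d g e assume k: "k \<in> S0" and f: "f \<in> hom C d c" and u: "u \<in> part 0 k d" and g: "g \<in> hom C e d"
    note fg = compC[OF g f] and gu = part_res[OF k g u]
    show "y (k, f \<cdot>\<^bsub>C\<^esub> g, rs g u) = res (G k) g (y (k, f, u))"
    proof (rule separated[OF gs_obj objC(1)[OF g] locally_pull[OF fg P] y1[OF fg k gu] res_in[OF gs_obj g y1[OF f k u]]])
      fix a h assume h: "h \<in> hom C a e" and Ph: "P ((f \<cdot>\<^bsub>C\<^esub> g) \<cdot>\<^bsub>C\<^esub> h)"
      note gh = compC[OF h g]
      have Ph': "P (f \<cdot>\<^bsub>C\<^esub> (g \<cdot>\<^bsub>C\<^esub> h))" using Ph unfolding assocC[OF h g f] .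
      show "res (G k) h (y (k, f \<cdot>\<^bsub>C\<^esub> g, rs g u)) = res (G k) h (res (G k) g (y (k, f, u)))"
        using y2[OF fg k gu h Ph] y2[OF f k u gh Ph'] res_comp[OF gs_obj h g y1[OF f k u]]
          res_comp[OF tot_obj h g part_sec[OF u]] assocC[OF h g f] by simp
    qed
  next
    fix f d l h assume f: "f \<in> hom C d c" and l: "l \<in> S1" and h: "h \<in> part 1 l d"
    note d = objC(1)[OF f]
    have S: "sr l \<in> S0" "tg l \<in> S0" using bd_0[OF l] by simp_all
    have p: "face 0 0 d h \<in> part 0 (tg l) d" "face 0 1 d h \<in> part 0 (sr l) d"
      using part_face0[OF l _ d h] by simp_all
    note sl = sa_hom[OF l HOL.refl HOL.refl]
    show "y (tg l, f, face 0 0 d h) = act (sa l) d (y (sr l, f, face 0 1 d h))"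
    proof (rule separated[OF gs_obj d locally_pull[OF f P] y1[OF f S(2) p(1)] act_in[OF sl d y1[OF f S(1) p(2)]]])
      fix e g assume g: "g \<in> hom C e d" and Pg: "P (f \<cdot>\<^bsub>C\<^esub> g)"
      note fg = compC[OF g f]
      have "x (f \<cdot>\<^bsub>C\<^esub> g) (tg l, Id C e, rs g (face 0 0 d h)) = act (sa l) e (x (f \<cdot>\<^bsub>C\<^esub> g) (sr l, Id C e, rs g (face 0 1 d h)))"
        using gluedD(4)[OF x[OF fg Pg] idC[OF objC(1)[OF g]] l part_res[OF l g h]]
          act_nat[OF tot_d(1) g part_sec[OF h]] act_nat[OF tot_d(2) g part_sec[OF h]] by simp
      then show "res (G (tg l)) g (y (tg l, f, face 0 0 d h)) = res (G (tg l)) g (act (sa l) d (y (sr l, f, face 0 1 d h)))"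
        using y2[OF f S(2) p(1) g Pg] y2[OF f S(1) p(2) g Pg] act_nat[OF sl g y1[OF f S(1) p(2)]] by simp
    qed
  qed
  have "gres f y = x f" if f: "f \<in> hom C d c" and Pf: "P f" for d f
  proof (rule glued_ext[OF gres_in[OF f yg] x[OF f Pf]])
    fix k g u e assume g: "g \<in> hom C e d" and k: "k \<in> S0" and u: "u \<in> part 0 k e"
    note fg = compC[OF g f]
    note e = objC(1)[OF g]
    note Pg = st[OF f Pf g]
    have Pg': "P ((f \<cdot>\<^bsub>C\<^esub> g) \<cdot>\<^bsub>C\<^esub> Id C e)" using Pg unfolding unitC(1)[OF fg] .
    have "y (k, f \<cdot>\<^bsub>C\<^esub> g, u) = x (f \<cdot>\<^bsub>C\<^esub> g) (k, Id C e, u)"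
      using y2[OF fg k u idC[OF e] Pg'] unfolding res_id[OF gs_obj e y1[OF fg k u]] unitC(1)[OF fg]
        res_id[OF tot_obj e part_sec[OF u]] .
    also have "\<dots> = x f (k, g, u)" using shift[OF f Pf g idC[OF e] k u] unfolding unitC(1)[OF g] .
    finally show "gres f y (k, g, u) = x f (k, g, u)" unfolding gres_apply[OF f g k u] .
  qed
  then show "\<exists>y\<in>glued c. \<forall>d f. f \<in> hom C d c \<longrightarrow> P f \<longrightarrow> gres f y = x f" using yg by blast
qed

lemma glued_small:
  assumes c: "c \<in> Obj C"
  shows "small el (glued c)"
proof -
  let ?B = "Sigma S0 (\<lambda>k. Sigma {f \<in> Arr C. Cod C f = c} (\<lambda>f. sec H0 (Dom C f)))"
  have d: "Dom C f \<in> Obj C" if "f \<in> Arr C" for f using cat_dom_obj[OF catC that] .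
  have sB: "small el ?B"
  proof (intro small_Sigma[OF univ])
    show "small el S0" using small_el[OF univ] by (simp add: simplices_def)
    show "small el {f \<in> Arr C. Cod C f = c}"
      by (rule small_sub[OF univ small_range[OF univ small_Arr]]) auto
    show "small el (sec H0 (Dom C f))" if "f \<in> {f \<in> Arr C. Cod C f = c}" for f
      using that by (intro small_range[OF univ sec_range[OF tot_obj d]]) auto
  qed
  have "ix c \<subseteq> ?B" using part_sec by (auto simp: ix_def)
  then have "small el (ix c)" by (rule small_sub[OF univ sB])
  then have "small el (PiE (ix c) (\<lambda>(k, f, u). sec (G k) (Dom C f)))"
  proof (rule small_PiE[OF univ])
    fix p assume "p \<in> ix c"
    then show "small el (case p of (k, f, u) \<Rightarrow> sec (G k) (Dom C f))"
      using small_range[OF univ sec_range[OF gs_obj d]] by (auto simp: ix_def)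
  qed
  then show ?thesis by (rule small_sub[OF univ]) (auto simp: glued_def)
qed

text \<open>All values of a section of the glued object are transports of any one of them.\<close>

lemma glued_transport:
  assumes x: "x \<in> glued c" and i: "i \<in> S0" and u: "u \<in> part 0 i c" and f: "f \<in> hom C d c"
    and k: "k \<in> S0" and v: "v \<in> part 0 k d"
  shows "x (k, f, v) = transport i k d (res (G i) f (x (i, Id C c, u))) (rs f u) v"
proof -
  note o = objC[OF f]
  note fu = part_res[OF i f u]
  have xi: "x (i, f, rs f u) = res (G i) f (x (i, Id C c, u))"
    using gluedD(3)[OF x i idC[OF o(2)] u f] unfolding unitC(2)[OF f] .
  note xr = gluedD(2)[OF x f i fu]
  have "transport i k d (x (i, f, rs f u)) (rs f u) v = x (k, f, v)"
  proof (rule transport_eqI[OF i k o(1) xr fu v])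
    show "transported i k d (x (i, f, rs f u)) (rs f u) v (x (k, f, v))"
      unfolding transported_def
    proof (intro conjI allI impI)
      show "x (k, f, v) \<in> sec (G k) d" by (rule gluedD(2)[OF x f k v])
      fix g e l h assume g: "g \<in> hom C e d" and l: "sr l = i" "tg l = k" "joins e l h (rs g (rs f u)) (rs g v)"
      have h: "l \<in> S1" "h \<in> part 1 l e" "face 0 1 e h = rs g (rs f u)" "face 0 0 e h = rs g v"
        using l(3) by (auto simp: joins_def)
      show "res (G k) g (x (k, f, v)) = act (sa l) e (res (G i) g (x (i, f, rs f u)))"
        using gluedD(4)[OF x compC[OF g f] h(1,2)] gluedD(3)[OF x k f v g] gluedD(3)[OF x i f fu g] h(3,4) l(1,2) by simp
    qed
  qed
  then show ?thesis using xi by simp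
qed

end

context sheaf_topos
begin

lemma iso_solve:
  assumes i: "is_iso E a" and a: "a \<in> hom E X Y" and b: "b \<in> hom E W Y"
  shows "\<exists>!g. g \<in> hom E W X \<and> a \<cdot>\<^bsub>E\<^esub> g = b"
proof -
  obtain k where k: "k \<in> hom E Y X" "k \<cdot>\<^bsub>E\<^esub> a = Id E X" "a \<cdot>\<^bsub>E\<^esub> k = Id E Y"
    using i homD(2,3)[OF a] by (auto simp: is_iso_def)
  show ?thesis
  proof (rule ex1I[of _ "k \<cdot>\<^bsub>E\<^esub> b"])
    show "k \<cdot>\<^bsub>E\<^esub> b \<in> hom E W X \<and> a \<cdot>\<^bsub>E\<^esub> (k \<cdot>\<^bsub>E\<^esub> b) = b"
      using compE[OF b k(1)] assocE[OF b k(1) a] unitE(2)[OF b] k(3) by simp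
    fix g assume g: "g \<in> hom E W X \<and> a \<cdot>\<^bsub>E\<^esub> g = b"
    then have "k \<cdot>\<^bsub>E\<^esub> b = (k \<cdot>\<^bsub>E\<^esub> a) \<cdot>\<^bsub>E\<^esub> g" using assocE[OF conjunct1[OF g] a k(1)] by simp
    then show "g = k \<cdot>\<^bsub>E\<^esub> b" using unitE(2)[OF conjunct1[OF g]] k(2) by simp
  qed
qed

lemma symm_hom: "A \<in> Obj E \<Longrightarrow> B \<in> Obj E \<Longrightarrow> symm E A B \<in> hom E (Prod E A B) (Prod E B A)"
  unfolding symm_def by (rule pairing_hom[OF pr_hom(2) pr_hom(1)])

lemma symm_act:
  assumes AB: "A \<in> Obj E" "B \<in> Obj E" and c: "c \<in> Obj C" "z \<in> sec (Prod E A B) c"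
  shows "act (pr1 E B A) c (act (symm E A B) c z) = act (pr2 E A B) c z"
    "act (pr2 E B A) c (act (symm E A B) c z) = act (pr1 E A B) c z"
  unfolding symm_def by (rule pairing_act[OF pr_hom(2)[OF AB] pr_hom(1)[OF AB] c])+

lemma assoc_right_prop:
  assumes A: "A \<in> Obj E" and B: "B \<in> Obj E" and D: "D \<in> Obj E"
  shows "assoc_right E A B D \<in> hom E (Prod E (Prod E A B) D) (Prod E A (Prod E B D))"
    and "c \<in> Obj C \<Longrightarrow> z \<in> sec (Prod E (Prod E A B) D) c \<Longrightarrow>
      act (pr1 E A (Prod E B D)) c (act (assoc_right E A B D) c z) = act (pr1 E A B) c (act (pr1 E (Prod E A B) D) c z) \<and>
      act (pr1 E B D) c (act (pr2 E A (Prod E B D)) c (act (assoc_right E A B D) c z)) =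
        act (pr2 E A B) c (act (pr1 E (Prod E A B) D) c z) \<and>
      act (pr2 E B D) c (act (pr2 E A (Prod E B D)) c (act (assoc_right E A B D) c z)) = act (pr2 E (Prod E A B) D) c z"
proof -
  note p = pr_hom[OF A B] and q = pr_hom[OF Prod_obj[OF A B] D]
  note f = compE[OF q(1) p(1)] and g = compE[OF q(1) p(2)]
  note gq = pairing_hom[OF g q(2)]
  show "assoc_right E A B D \<in> hom E (Prod E (Prod E A B) D) (Prod E A (Prod E B D))"
    unfolding assoc_right_def by (rule pairing_hom[OF f gq])
  assume c: "c \<in> Obj C" "z \<in> sec (Prod E (Prod E A B) D) c"
  show "act (pr1 E A (Prod E B D)) c (act (assoc_right E A B D) c z) = act (pr1 E A B) c (act (pr1 E (Prod E A B) D) c z) \<and>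
      act (pr1 E B D) c (act (pr2 E A (Prod E B D)) c (act (assoc_right E A B D) c z)) =
        act (pr2 E A B) c (act (pr1 E (Prod E A B) D) c z) \<and>
      act (pr2 E B D) c (act (pr2 E A (Prod E B D)) c (act (assoc_right E A B D) c z)) = act (pr2 E (Prod E A B) D) c z"
    unfolding assoc_right_def pairing_act[OF f gq c] pairing_act[OF g q(2) c]
    using act_comp[OF q(1) p(1) c] act_comp[OF q(1) p(2) c] by simp
qed

lemma assoc_left_prop:
  assumes A: "A \<in> Obj E" and B: "B \<in> Obj E" and D: "D \<in> Obj E"
  shows "assoc_left E A B D \<in> hom E (Prod E A (Prod E B D)) (Prod E (Prod E A B) D)"
    and "c \<in> Obj C \<Longrightarrow> z \<in> sec (Prod E A (Prod E B D)) c \<Longrightarrow>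
      act (pr1 E A B) c (act (pr1 E (Prod E A B) D) c (act (assoc_left E A B D) c z)) = act (pr1 E A (Prod E B D)) c z \<and>
      act (pr2 E A B) c (act (pr1 E (Prod E A B) D) c (act (assoc_left E A B D) c z)) =
        act (pr1 E B D) c (act (pr2 E A (Prod E B D)) c z) \<and>
      act (pr2 E (Prod E A B) D) c (act (assoc_left E A B D) c z) = act (pr2 E B D) c (act (pr2 E A (Prod E B D)) c z)"
proof -
  note p = pr_hom[OF B D] and q = pr_hom[OF A Prod_obj[OF B D]]
  note f = compE[OF q(2) p(1)] and g = compE[OF q(2) p(2)]
  note qf = pairing_hom[OF q(1) f]
  show "assoc_left E A B D \<in> hom E (Prod E A (Prod E B D)) (Prod E (Prod E A B) D)"
    unfolding assoc_left_def by (rule pairing_hom[OF qf g])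
  assume c: "c \<in> Obj C" "z \<in> sec (Prod E A (Prod E B D)) c"
  show "act (pr1 E A B) c (act (pr1 E (Prod E A B) D) c (act (assoc_left E A B D) c z)) = act (pr1 E A (Prod E B D)) c z \<and>
      act (pr2 E A B) c (act (pr1 E (Prod E A B) D) c (act (assoc_left E A B D) c z)) =
        act (pr1 E B D) c (act (pr2 E A (Prod E B D)) c z) \<and>
      act (pr2 E (Prod E A B) D) c (act (assoc_left E A B D) c z) = act (pr2 E B D) c (act (pr2 E A (Prod E B D)) c z)"
    unfolding assoc_left_def pairing_act[OF qf g c] pairing_act[OF q(1) f c]
    using act_comp[OF q(2) p(1) c] act_comp[OF q(2) p(2) c] by simp
qed

lemma in_image_stable:
  assumes K: "\<And>k. k \<in> K \<Longrightarrow> k \<in> Arr E \<and> Cod E k = B" and B: "B \<in> Obj E" and b: "b \<in> sec B c"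
  shows "stable c (\<lambda>f. in_image K (Dom C f) (res B f b))"
proof (rule stableI)
  fix f g d e assume f: "f \<in> hom C d c" "in_image K (Dom C f) (res B f b)" and g: "g \<in> hom C e d"
  have "in_image K d (res B f b)" using f(2) unfolding homD(2)[OF f(1)] .
  then have "in_image K e (res B g (res B f b))" by (intro in_image_res[OF K g])
  then show "in_image K (Dom C (f \<cdot>\<^bsub>C\<^esub> g)) (res B (f \<cdot>\<^bsub>C\<^esub> g) b)"
    unfolding res_comp[OF B g f(1) b] homD(2)[OF compC[OF g f(1)]] .
qed

end

context descent
begin

text \<open>The section of the glued object through \<open>r\<close> over \<open>u\<close>.\<close>

definition through :: "'v \<Rightarrow> 'v \<Rightarrow> 'v \<Rightarrow> 'v \<Rightarrow> ('v \<times> 'v \<times> 'v \<Rightarrow> 'v)" where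
  "through i c r u = (\<lambda>(k, f, v)\<in>ix c. transport i k (Dom C f) (res (G i) f r) (rs f u) v)"

lemma through_apply:
  "f \<in> hom C d c \<Longrightarrow> k \<in> S0 \<Longrightarrow> v \<in> part 0 k d \<Longrightarrow>
    through i c r u (k, f, v) = transport i k d (res (G i) f r) (rs f u) v"
  by (simp add: through_def ix_iff homD(2))

lemma through_glued:
  assumes i: "i \<in> S0" and r: "r \<in> sec (G i) c" and u: "u \<in> part 0 i c"
  shows "through i c r u \<in> glued c"
proof (rule gluedI)
  show "through i c r u \<in> extensional (ix c)" by (simp add: through_def)
  fix k f v d assume f: "f \<in> hom C d c" and k: "k \<in> S0" and v: "v \<in> part 0 k d"
  note fr = res_in[OF gs_obj f r] and fu = part_res[OF i f u]
  show "through i c r u (k, f, v) \<in> sec (G k) d"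
    unfolding through_apply[OF f k v] by (rule transport_in[OF i k objC(1)[OF f] fr fu v])
  fix g e assume g: "g \<in> hom C e d"
  show "through i c r u (k, f \<cdot>\<^bsub>C\<^esub> g, rs g v) = res (G k) g (through i c r u (k, f, v))"
    unfolding through_apply[OF f k v] through_apply[OF compC[OF g f] k part_res[OF k g v]]
      transport_res[OF i k fr fu v g] res_comp[OF gs_obj g f r] res_comp[OF tot_obj g f part_sec[OF u]] ..
next
  fix f d l h assume f: "f \<in> hom C d c" and l: "l \<in> S1" and h: "h \<in> part 1 l d"
  note d = objC(1)[OF f]
  have j: "joins d l h (face 0 1 d h) (face 0 0 d h)" using l h by (simp add: joins_def)
  note jd = joinsD[OF j d]
  show "through i c r u (tg l, f, face 0 0 d h) = act (sa l) d (through i c r u (sr l, f, face 0 1 d h))"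
    unfolding through_apply[OF f jd(5) jd(2)] through_apply[OF f jd(6) jd(3)]
    by (rule transport_right[OF i d j part_res[OF i f u] res_in[OF gs_obj f r]])
qed

lemma through_res:
  assumes i: "i \<in> S0" and r: "r \<in> sec (G i) c" and u: "u \<in> part 0 i c" and f: "f \<in> hom C d c"
  shows "gres f (through i c r u) = through i d (res (G i) f r) (rs f u)"
proof (rule glued_ext[OF gres_in[OF f through_glued[OF i r u]] through_glued[OF i res_in[OF gs_obj f r] part_res[OF i f u]]])
  fix k g v e assume g: "g \<in> hom C e d" and k: "k \<in> S0" and v: "v \<in> part 0 k e"
  show "gres f (through i c r u) (k, g, v) = through i d (res (G i) f r) (rs f u) (k, g, v)"
    unfolding gres_apply[OF f g k v] through_apply[OF g k v] through_apply[OF compC[OF g f] k v]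
      res_comp[OF gs_obj g f r] res_comp[OF tot_obj g f part_sec[OF u]] ..
qed

lemma through_joins:
  assumes c: "c \<in> Obj C" and m: "joins c m h u u'" and r: "r \<in> sec (G (sr m)) c"
  shows "through (sr m) c r u = through (tg m) c (act (sa m) c r) u'"
proof -
  note md = joinsD[OF m c]
  note sm = sa_hom[OF md(1) HOL.refl HOL.refl]
  show ?thesis
  proof (rule glued_ext[OF through_glued[OF md(5) r md(2)] through_glued[OF md(6) act_in[OF sm c r] md(3)]])
    fix k f v d assume f: "f \<in> hom C d c" and k: "k \<in> S0" and v: "v \<in> part 0 k d"
    show "through (sr m) c r u (k, f, v) = through (tg m) c (act (sa m) c r) u' (k, f, v)"
      unfolding through_apply[OF f k v] act_nat[OF sm f r, symmetric]
      by (rule transport_left[OF k objC(1)[OF f] joins_res[OF m f] v res_in[OF gs_obj f r]])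
  qed
qed

lemma through_value:
  assumes i: "i \<in> S0" and c: "c \<in> Obj C" and r: "r \<in> sec (G i) c" and u: "u \<in> part 0 i c"
  shows "through i c r u (i, Id C c, u) = r"
  unfolding through_apply[OF idC[OF c] i u] res_id[OF gs_obj c r] res_id[OF tot_obj c part_sec[OF u]]
  by (rule transport_refl[OF i c r u])

lemma through_glued_value:
  assumes i: "i \<in> S0" and c: "c \<in> Obj C" and x: "x \<in> glued c" and u: "u \<in> part 0 i c"
  shows "through i c (x (i, Id C c, u)) u = x"
proof (rule glued_ext[OF through_glued[OF i gluedD(2)[OF x idC[OF c] i u] u] x])
  fix k f v d assume f: "f \<in> hom C d c" and k: "k \<in> S0" and v: "v \<in> part 0 k d"
  show "through i c (x (i, Id C c, u)) u (k, f, v) = x (k, f, v)"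
    unfolding through_apply[OF f k v] by (rule glued_transport[OF x i u f k v, symmetric])
qed

text \<open>The object \<open>X\<close> with the sections \<open>pt i c r u\<close> through \<open>r\<close> over \<open>u\<close>. Only these properties are used
  below.\<close>

lemma glued_object:
  obtains X pt where "X \<in> Obj E"
    "\<And>i c r u. i \<in> S0 \<Longrightarrow> c \<in> Obj C \<Longrightarrow> r \<in> sec (G i) c \<Longrightarrow> u \<in> part 0 i c \<Longrightarrow> pt i c r u \<in> sec X c"
    "\<And>i c r u f d. i \<in> S0 \<Longrightarrow> r \<in> sec (G i) c \<Longrightarrow> u \<in> part 0 i c \<Longrightarrow> f \<in> hom C d c \<Longrightarrow>
       res X f (pt i c r u) = pt i d (res (G i) f r) (rs f u)"
    "\<And>c m h u u' r. c \<in> Obj C \<Longrightarrow> joins c m h u u' \<Longrightarrow> r \<in> sec (G (sr m)) c \<Longrightarrow>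
       pt (sr m) c r u = pt (tg m) c (act (sa m) c r) u'"
    "\<And>i c r r' u. i \<in> S0 \<Longrightarrow> c \<in> Obj C \<Longrightarrow> r \<in> sec (G i) c \<Longrightarrow> r' \<in> sec (G i) c \<Longrightarrow> u \<in> part 0 i c \<Longrightarrow>
       pt i c r u = pt i c r' u \<Longrightarrow> r = r'"
    "\<And>i c x u. i \<in> S0 \<Longrightarrow> c \<in> Obj C \<Longrightarrow> x \<in> sec X c \<Longrightarrow> u \<in> part 0 i c \<Longrightarrow> \<exists>r\<in>sec (G i) c. pt i c r u = x"
proof -
  obtain X \<beta> where X: "X \<in> Obj E" and b: "\<And>c. c \<in> Obj C \<Longrightarrow> bij_betw (\<beta> c) (sec X c) (glued c)"
    and bn: "\<And>f d c x. f \<in> hom C d c \<Longrightarrow> x \<in> sec X c \<Longrightarrow> \<beta> d (res X f x) = gres f (\<beta> c x)"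
    using represent_small[OF glued_sheaf glued_small] by metis
  define pt where "pt i c r u = inv_into (sec X c) (\<beta> c) (through i c r u)" for i c r u
  have p: "pt i c r u \<in> sec X c \<and> \<beta> c (pt i c r u) = through i c r u"
    if a: "i \<in> S0" "c \<in> Obj C" "r \<in> sec (G i) c" "u \<in> part 0 i c" for i c r u
  proof -
    have "through i c r u \<in> \<beta> c ` sec X c"
      using bij_betw_imp_surj_on[OF b[OF a(2)]] through_glued[OF a(1,3,4)] by simp
    then show ?thesis by (simp add: pt_def inv_into_into f_inv_into_f)
  qed
  have inj: "x = y" if "c \<in> Obj C" "x \<in> sec X c" "y \<in> sec X c" "\<beta> c x = \<beta> c y" for c x y
    using b[OF that(1)] that(2-4) by (auto simp: bij_betw_def inj_on_def)
  show thesis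
  proof (rule that[OF X])
    show "pt i c r u \<in> sec X c" if "i \<in> S0" "c \<in> Obj C" "r \<in> sec (G i) c" "u \<in> part 0 i c" for i c r u
      using p[OF that] ..
    show "res X f (pt i c r u) = pt i d (res (G i) f r) (rs f u)"
      if i: "i \<in> S0" and r: "r \<in> sec (G i) c" and u: "u \<in> part 0 i c" and f: "f \<in> hom C d c" for i c r u f d
    proof -
      note o = objC[OF f]
      note p1 = p[OF i o(2) r u] and p2 = p[OF i o(1) res_in[OF gs_obj f r] part_res[OF i f u]]
      show ?thesis
        by (rule inj[OF o(1) res_in[OF X f conjunct1[OF p1]] conjunct1[OF p2]])
          (use bn[OF f conjunct1[OF p1]] p1 p2 through_res[OF i r u f] in simp)
    qed
    show "pt (sr m) c r u = pt (tg m) c (act (sa m) c r) u'"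
      if "c \<in> Obj C" "joins c m h u u'" "r \<in> sec (G (sr m)) c" for c m h u u' r
      unfolding pt_def through_joins[OF that] ..
    show "r = r'" if a: "i \<in> S0" "c \<in> Obj C" "r \<in> sec (G i) c" "r' \<in> sec (G i) c" "u \<in> part 0 i c"
       and e: "pt i c r u = pt i c r' u" for i c r r' u
    proof -
      have "through i c r u = through i c r' u" using p[OF a(1,2,3,5)] p[OF a(1,2,4,5)] e by simp
      from fun_cong[OF this, of "(i, Id C c, u)"]
      show ?thesis unfolding through_value[OF a(1,2,3,5)] through_value[OF a(1,2,4,5)] .
    qed
    show "\<exists>r\<in>sec (G i) c. pt i c r u = x" if i: "i \<in> S0" and c: "c \<in> Obj C" and x: "x \<in> sec X c" and u: "u \<in> part 0 i c" for i c x u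
    proof -
      have g: "\<beta> c x \<in> glued c" using b[OF c] x by (auto simp: bij_betw_def)
      have r: "\<beta> c x (i, Id C c, u) \<in> sec (G i) c" by (rule gluedD(2)[OF g idC[OF c] i u])
      have "pt i c (\<beta> c x (i, Id C c, u)) u = x"
        by (rule inj[OF c conjunct1[OF p[OF i c r u]] x]) (use p[OF i c r u] through_glued_value[OF i c g u] in simp)
      then show ?thesis using r by blast
    qed
  qed
qed

subsection \<open>The covering projection\<close>

abbreviation "U0 \<equiv> Hw 0"

context
  fixes X pt
  assumes X: "X \<in> Obj E"
    and pt_in: "\<And>i c r u. i \<in> S0 \<Longrightarrow> c \<in> Obj C \<Longrightarrow> r \<in> sec (G i) c \<Longrightarrow> u \<in> part 0 i c \<Longrightarrow> pt i c r u \<in> sec X c"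
    and pt_res: "\<And>i c r u f d. i \<in> S0 \<Longrightarrow> r \<in> sec (G i) c \<Longrightarrow> u \<in> part 0 i c \<Longrightarrow> f \<in> hom C d c \<Longrightarrow>
       res X f (pt i c r u) = pt i d (res (G i) f r) (rs f u)"
    and pt_joins: "\<And>c m h u u' r. c \<in> Obj C \<Longrightarrow> joins c m h u u' \<Longrightarrow> r \<in> sec (G (sr m)) c \<Longrightarrow>
       pt (sr m) c r u = pt (tg m) c (act (sa m) c r) u'"
    and pt_inj: "\<And>i c r r' u. i \<in> S0 \<Longrightarrow> c \<in> Obj C \<Longrightarrow> r \<in> sec (G i) c \<Longrightarrow> r' \<in> sec (G i) c \<Longrightarrow> u \<in> part 0 i c \<Longrightarrow>
       pt i c r u = pt i c r' u \<Longrightarrow> r = r'"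
    and pt_surj: "\<And>i c x u. i \<in> S0 \<Longrightarrow> c \<in> Obj C \<Longrightarrow> x \<in> sec X c \<Longrightarrow> u \<in> part 0 i c \<Longrightarrow> \<exists>r\<in>sec (G i) c. pt i c r u = x"
begin

text \<open>The arrow \<open>\<gamma>\<^sup>* R\<^sub>i \<times> U\<^sub>i \<rightarrow> X\<close> taking \<open>(r, u)\<close> to the section through \<open>r\<close> over \<open>u\<close>.\<close>

definition tm :: "'v \<Rightarrow> 'a" where
  "tm i = (SOME t. t \<in> hom E (Prod E (G i) (U0 i)) X \<and> (\<forall>c\<in>Obj C. \<forall>z\<in>sec (Prod E (G i) (U0 i)) c.
     act t c z = pt i c (act (pr1 E (G i) (U0 i)) c z) (act (inc 0 i) c (act (pr2 E (G i) (U0 i)) c z))))"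

lemma tm_prop:
  assumes i: "i \<in> S0"
  shows "tm i \<in> hom E (Prod E (G i) (U0 i)) X"
    and "c \<in> Obj C \<Longrightarrow> z \<in> sec (Prod E (G i) (U0 i)) c \<Longrightarrow>
      act (tm i) c z = pt i c (act (pr1 E (G i) (U0 i)) c z) (act (inc 0 i) c (act (pr2 E (G i) (U0 i)) c z))"
proof -
  note p = pr_hom[OF gs_obj[of "R i"] Hw_obj[OF i]]
  note n = inc_hom[OF i]
  have "\<exists>t\<in>hom E (Prod E (G i) (U0 i)) X. \<forall>c\<in>Obj C. \<forall>z\<in>sec (Prod E (G i) (U0 i)) c.
     act t c z = pt i c (act (pr1 E (G i) (U0 i)) c z) (act (inc 0 i) c (act (pr2 E (G i) (U0 i)) c z))"
  proof (rule full[OF objE(1)[OF p(1)] X])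
    fix c z assume c: "c \<in> Obj C" and z: "z \<in> sec (Prod E (G i) (U0 i)) c"
    show "pt i c (act (pr1 E (G i) (U0 i)) c z) (act (inc 0 i) c (act (pr2 E (G i) (U0 i)) c z)) \<in> sec X c"
      by (rule pt_in[OF i c act_in[OF p(1) c z] inc_part[OF i c act_in[OF p(2) c z]]])
  next
    fix f d c z assume f: "f \<in> hom C d c" and z: "z \<in> sec (Prod E (G i) (U0 i)) c"
    note c = objC(2)[OF f]
    show "pt i d (act (pr1 E (G i) (U0 i)) d (res (Prod E (G i) (U0 i)) f z)) (act (inc 0 i) d (act (pr2 E (G i) (U0 i)) d (res (Prod E (G i) (U0 i)) f z))) =
       res X f (pt i c (act (pr1 E (G i) (U0 i)) c z) (act (inc 0 i) c (act (pr2 E (G i) (U0 i)) c z)))"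
      unfolding act_nat[OF p(1) f z] act_nat[OF p(2) f z] act_nat[OF n f act_in[OF p(2) c z]]
      by (rule pt_res[OF i act_in[OF p(1) c z] inc_part[OF i c act_in[OF p(2) c z]] f, symmetric])
  qed
  then have "\<exists>t. t \<in> hom E (Prod E (G i) (U0 i)) X \<and> (\<forall>c\<in>Obj C. \<forall>z\<in>sec (Prod E (G i) (U0 i)) c.
     act t c z = pt i c (act (pr1 E (G i) (U0 i)) c z) (act (inc 0 i) c (act (pr2 E (G i) (U0 i)) c z)))" by blast
  note t = someI_ex[OF this, folded tm_def]
  show "tm i \<in> hom E (Prod E (G i) (U0 i)) X" using conjunct1[OF t] .
  show "act (tm i) c z = pt i c (act (pr1 E (G i) (U0 i)) c z) (act (inc 0 i) c (act (pr2 E (G i) (U0 i)) c z))"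
    if "c \<in> Obj C" "z \<in> sec (Prod E (G i) (U0 i)) c" using conjunct2[OF t] that by blast
qed

text \<open>The trivializations \<open>\<theta>\<^sub>i : \<gamma>\<^sup>* R\<^sub>i \<times> U\<^sub>i \<rightarrow> X \<times> U\<^sub>i\<close>.\<close>

definition th :: "'v \<Rightarrow> 'a" where
  "th = (\<lambda>i\<in>S0. pairing E (tm i) (pr2 E (G i) (U0 i)))"

lemma th_hom:
  assumes i: "i \<in> S0"
  shows "th i \<in> hom E (Prod E (G i) (U0 i)) (Prod E X (U0 i))"
  using pairing_hom[OF tm_prop(1)[OF i] pr_hom(2)[OF gs_obj Hw_obj[OF i]]] i by (simp add: th_def)

lemma th_act:
  assumes i: "i \<in> S0" and c: "c \<in> Obj C" and z: "z \<in> sec (Prod E (G i) (U0 i)) c"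
  shows "act (pr1 E X (U0 i)) c (act (th i) c z) =
      pt i c (act (pr1 E (G i) (U0 i)) c z) (act (inc 0 i) c (act (pr2 E (G i) (U0 i)) c z))"
    "act (pr2 E X (U0 i)) c (act (th i) c z) = act (pr2 E (G i) (U0 i)) c z"
  using pairing_act[OF tm_prop(1)[OF i] pr_hom(2)[OF gs_obj Hw_obj[OF i]] c z] tm_prop(2)[OF i c z] i
  by (simp_all add: th_def)

lemma th_iso:
  assumes i: "i \<in> S0"
  shows "is_iso E (th i)"
proof (rule iso_of_bij[OF th_hom[OF i]])
  fix c assume c: "c \<in> Obj C"
  note GU = gs_obj[of "R i"] Hw_obj[OF i] and XU = X Hw_obj[OF i]
  note p = pr_hom[OF GU] and q = pr_hom[OF XU]
  show "bij_betw (act (th i) c) (sec (Prod E (G i) (U0 i)) c) (sec (Prod E X (U0 i)) c)"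
    unfolding bij_betw_def
  proof (intro conjI subset_antisym)
    show "inj_on (act (th i) c) (sec (Prod E (G i) (U0 i)) c)"
    proof (rule inj_onI)
      fix z z' assume z: "z \<in> sec (Prod E (G i) (U0 i)) c" and z': "z' \<in> sec (Prod E (G i) (U0 i)) c"
        and e: "act (th i) c z = act (th i) c z'"
      have e2: "act (pr2 E (G i) (U0 i)) c z = act (pr2 E (G i) (U0 i)) c z'"
        using th_act(2)[OF i c z] th_act(2)[OF i c z'] e by simp
      have "act (pr1 E (G i) (U0 i)) c z = act (pr1 E (G i) (U0 i)) c z'"
        by (rule pt_inj[OF i c act_in[OF p(1) c z] act_in[OF p(1) c z'] inc_part[OF i c act_in[OF p(2) c z]]])
          (use th_act(1)[OF i c z] th_act(1)[OF i c z'] e e2 in simp)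
      then show "z = z'" by (rule Prod_ext[OF GU c z z' _ e2])
    qed
    show "act (th i) c ` sec (Prod E (G i) (U0 i)) c \<subseteq> sec (Prod E X (U0 i)) c"
      using act_in[OF th_hom[OF i] c] by blast
    show "sec (Prod E X (U0 i)) c \<subseteq> act (th i) c ` sec (Prod E (G i) (U0 i)) c"
    proof
      fix w assume w: "w \<in> sec (Prod E X (U0 i)) c"
      note v = act_in[OF q(2) c w]
      obtain r where r: "r \<in> sec (G i) c" "pt i c r (act (inc 0 i) c (act (pr2 E X (U0 i)) c w)) = act (pr1 E X (U0 i)) c w"
        using pt_surj[OF i c act_in[OF q(1) c w] inc_part[OF i c v]] by blast
      obtain z where z: "z \<in> sec (Prod E (G i) (U0 i)) c" "act (pr1 E (G i) (U0 i)) c z = r"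
        "act (pr2 E (G i) (U0 i)) c z = act (pr2 E X (U0 i)) c w"
        by (rule Prod_sec[OF GU c r(1) v])
      have "act (th i) c z = w"
        by (rule Prod_ext[OF XU c act_in[OF th_hom[OF i] c z(1)] w]) (use th_act[OF i c z(1)] z r in simp_all)
      then show "w \<in> act (th i) c ` sec (Prod E (G i) (U0 i)) c" using z(1) by blast
    qed
  qed
qed

lemma th_locally_constant: "locally_constant el E gs F R (X, th)"
  unfolding locally_constant_def split_conv
proof (intro conjI X ballI)
  show "th \<in> extensional S0" by (simp add: th_def)
  fix i assume i: "i \<in> S0"
  show "th i \<in> hom E (Prod E (G i) (U0 i)) (Prod E X (U0 i))" by (rule th_hom[OF i])
  show "is_iso E (th i)" by (rule th_iso[OF i])
  show "pr2 E X (U0 i) \<cdot>\<^bsub>E\<^esub> th i = pr2 E (G i) (U0 i)"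
    using pairing_prop(3)[OF tm_prop(1)[OF i] pr_hom(2)[OF gs_obj Hw_obj[OF i]]] i by (simp add: th_def)
qed

text \<open>\<open>UU i j\<close> is \<open>U\<^sub>i \<times> U\<^sub>j\<close>, \<open>tt i j\<close> is \<open>\<theta>\<^sub>i \<times> U\<^sub>j\<close>, and \<open>tn j i\<close> is the transition map
  \<open>\<sigma>\<^sub>j\<^sub>,\<^sub>i\<close>.\<close>

abbreviation "UU i j \<equiv> Prod E (U0 i) (U0 j)"
abbreviation "tt \<equiv> theta_times el E gs F R (X, th)"
abbreviation "tn \<equiv> transition el E gs F R (X, th)"

context
  fixes i j
  assumes i: "i \<in> S0" and j: "j \<in> S0"
begin

lemma UU_obj: "UU i j \<in> Obj E"
  by (rule Prod_obj[OF Hw_obj[OF i] Hw_obj[OF j]])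

lemma tt_hom: "tt i j \<in> hom E (Prod E (G i) (UU i j)) (Prod E X (UU i j))"
  unfolding theta_times_def split_conv
  by (rule compE[OF compE[OF assoc_left_prop(1)[OF gs_obj Hw_obj[OF i] Hw_obj[OF j]]
      prod_map_hom[OF th_hom[OF i] idE[OF Hw_obj[OF j]]]] assoc_right_prop(1)[OF X Hw_obj[OF i] Hw_obj[OF j]]])

lemma tt_act:
  assumes c: "c \<in> Obj C" and z: "z \<in> sec (Prod E (G i) (UU i j)) c"
  shows "act (pr1 E X (UU i j)) c (act (tt i j) c z) = pt i c (act (pr1 E (G i) (UU i j)) c z)
      (act (inc 0 i) c (act (pr1 E (U0 i) (U0 j)) c (act (pr2 E (G i) (UU i j)) c z)))"
    "act (pr2 E X (UU i j)) c (act (tt i j) c z) = act (pr2 E (G i) (UU i j)) c z"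
proof -
  note Gi = gs_obj[of "R i"] and Ui = Hw_obj[OF i] and Uj = Hw_obj[OF j]
  note al = assoc_left_prop[OF Gi Ui Uj] and ar = assoc_right_prop[OF X Ui Uj]
  note m = prod_map_hom[OF th_hom[OF i] idE[OF Uj]]
  note z1 = act_in[OF al(1) c z]
  note z2 = act_in[OF m c z1]
  have e: "act (tt i j) c z = act (assoc_right E X (U0 i) (U0 j)) c (act (prod_map E (th i) (Id E (U0 j))) c
      (act (assoc_left E (G i) (U0 i) (U0 j)) c z))"
    unfolding theta_times_def split_conv
    using act_comp[OF compE[OF al(1) m] ar(1) c z] act_comp[OF al(1) m c z] by simp
  note a = al(2)[OF c z] and b = ar(2)[OF c z2]
    and d = prod_map_act[OF th_hom[OF i] idE[OF Uj] c z1]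
  note w = act_in[OF pr_hom(1)[OF Prod_obj[OF Gi Ui] Uj] c z1] and w2 = act_in[OF pr_hom(2)[OF Prod_obj[OF Gi Ui] Uj] c z1]
  note t = th_act[OF i c w]
  show "act (pr1 E X (UU i j)) c (act (tt i j) c z) = pt i c (act (pr1 E (G i) (UU i j)) c z)
      (act (inc 0 i) c (act (pr1 E (U0 i) (U0 j)) c (act (pr2 E (G i) (UU i j)) c z)))"
    unfolding e using a b d t by simp
  note q = pr_hom(2)[OF X UU_obj] and q' = pr_hom(2)[OF Gi UU_obj]
  show "act (pr2 E X (UU i j)) c (act (tt i j) c z) = act (pr2 E (G i) (UU i j)) c z"
  proof (rule Prod_ext[OF Ui Uj c act_in[OF q c act_in[OF tt_hom c z]] act_in[OF q' c z]])
    show "act (pr1 E (U0 i) (U0 j)) c (act (pr2 E X (UU i j)) c (act (tt i j) c z)) =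
        act (pr1 E (U0 i) (U0 j)) c (act (pr2 E (G i) (UU i j)) c z)"
      unfolding e using a b d t by simp
    show "act (pr2 E (U0 i) (U0 j)) c (act (pr2 E X (UU i j)) c (act (tt i j) c z)) =
        act (pr2 E (U0 i) (U0 j)) c (act (pr2 E (G i) (UU i j)) c z)"
      unfolding e using a b d act_id[OF Uj c w2] by simp
  qed
qed

lemma tt_inj:
  assumes c: "c \<in> Obj C" and z: "z \<in> sec (Prod E (G i) (UU i j)) c" and z': "z' \<in> sec (Prod E (G i) (UU i j)) c"
    and e: "act (tt i j) c z = act (tt i j) c z'"
  shows "z = z'"
proof -
  note Gi = gs_obj[of "R i"] and p = pr_hom[OF gs_obj[of "R i"] UU_obj]
  note q = pr_hom[OF Hw_obj[OF i] Hw_obj[OF j]]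
  have e2: "act (pr2 E (G i) (UU i j)) c z = act (pr2 E (G i) (UU i j)) c z'"
    using tt_act(2)[OF c z] tt_act(2)[OF c z'] e by simp
  have "act (pr1 E (G i) (UU i j)) c z = act (pr1 E (G i) (UU i j)) c z'"
    by (rule pt_inj[OF i c act_in[OF p(1) c z] act_in[OF p(1) c z'] inc_part[OF i c act_in[OF q(1) c act_in[OF p(2) c z]]]])
      (use tt_act(1)[OF c z] tt_act(1)[OF c z'] e e2 in simp)
  then show ?thesis by (rule Prod_ext[OF Gi UU_obj c z z' _ e2])
qed

lemma tt_iso: "is_iso E (tt i j)"
proof (rule iso_of_bij[OF tt_hom])
  fix c assume c: "c \<in> Obj C"
  note Gi = gs_obj[of "R i"] and p = pr_hom[OF X UU_obj]
  note q = pr_hom[OF Hw_obj[OF i] Hw_obj[OF j]]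
  show "bij_betw (act (tt i j) c) (sec (Prod E (G i) (UU i j)) c) (sec (Prod E X (UU i j)) c)"
    unfolding bij_betw_def
  proof (intro conjI subset_antisym)
    show "inj_on (act (tt i j) c) (sec (Prod E (G i) (UU i j)) c)"
      by (rule inj_onI) (rule tt_inj[OF c])
    show "act (tt i j) c ` sec (Prod E (G i) (UU i j)) c \<subseteq> sec (Prod E X (UU i j)) c"
      using act_in[OF tt_hom c] by blast
    show "sec (Prod E X (UU i j)) c \<subseteq> act (tt i j) c ` sec (Prod E (G i) (UU i j)) c"
    proof
      fix w assume w: "w \<in> sec (Prod E X (UU i j)) c"
      note v = act_in[OF p(2) c w]
      obtain r where r: "r \<in> sec (G i) c"
        "pt i c r (act (inc 0 i) c (act (pr1 E (U0 i) (U0 j)) c (act (pr2 E X (UU i j)) c w))) = act (pr1 E X (UU i j)) c w"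
        using pt_surj[OF i c act_in[OF p(1) c w] inc_part[OF i c act_in[OF q(1) c v]]] by blast
      obtain z where z: "z \<in> sec (Prod E (G i) (UU i j)) c" "act (pr1 E (G i) (UU i j)) c z = r"
        "act (pr2 E (G i) (UU i j)) c z = act (pr2 E X (UU i j)) c w"
        by (rule Prod_sec[OF Gi UU_obj c r(1) v])
      have "act (tt i j) c z = w"
        by (rule Prod_ext[OF X UU_obj c act_in[OF tt_hom c z(1)] w]) (use tt_act[OF c z(1)] z r in simp_all)
      then show "w \<in> act (tt i j) c ` sec (Prod E (G i) (UU i j)) c" using z(1) by blast
    qed
  qed
qed

end

context
  fixes i j
  assumes i: "i \<in> S0" and j: "j \<in> S0"
begin

lemma tn_prop:
  "tn j i \<in> hom E (Prod E (G i) (UU i j)) (Prod E (G j) (UU j i))"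
  "tt j i \<cdot>\<^bsub>E\<^esub> tn j i = prod_map E (Id E X) (symm E (U0 i) (U0 j)) \<cdot>\<^bsub>E\<^esub> tt i j"
proof -
  have h: "prod_map E (Id E X) (symm E (U0 i) (U0 j)) \<cdot>\<^bsub>E\<^esub> tt i j \<in> hom E (Prod E (G i) (UU i j)) (Prod E X (UU j i))"
    by (rule compE[OF tt_hom[OF i j] prod_map_hom[OF idE[OF X] symm_hom[OF Hw_obj[OF i] Hw_obj[OF j]]]])
  note t = theI'[OF iso_solve[OF tt_iso[OF j i] tt_hom[OF j i] h]]
  show "tn j i \<in> hom E (Prod E (G i) (UU i j)) (Prod E (G j) (UU j i))"
    "tt j i \<cdot>\<^bsub>E\<^esub> tn j i = prod_map E (Id E X) (symm E (U0 i) (U0 j)) \<cdot>\<^bsub>E\<^esub> tt i j"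
    using t by (simp_all add: transition_def)
qed

text \<open>Recognizing the value of the transition map at \<open>z\<close>: it is the section with the same image in \<open>X\<close> and
  with the two coordinates in the cover exchanged.\<close>

lemma tn_eqI:
  assumes c: "c \<in> Obj C" and z: "z \<in> sec (Prod E (G i) (UU i j)) c" and y: "y \<in> sec (Prod E (G j) (UU j i)) c"
    and e: "pt j c (act (pr1 E (G j) (UU j i)) c y) (act (inc 0 j) c (act (pr1 E (U0 j) (U0 i)) c (act (pr2 E (G j) (UU j i)) c y))) =
      pt i c (act (pr1 E (G i) (UU i j)) c z) (act (inc 0 i) c (act (pr1 E (U0 i) (U0 j)) c (act (pr2 E (G i) (UU i j)) c z)))"
    and e1: "act (pr1 E (U0 j) (U0 i)) c (act (pr2 E (G j) (UU j i)) c y) = act (pr2 E (U0 i) (U0 j)) c (act (pr2 E (G i) (UU i j)) c z)"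
    and e2: "act (pr2 E (U0 j) (U0 i)) c (act (pr2 E (G j) (UU j i)) c y) = act (pr1 E (U0 i) (U0 j)) c (act (pr2 E (G i) (UU i j)) c z)"
  shows "act (tn j i) c z = y"
proof (rule tt_inj[OF j i c act_in[OF tn_prop(1) c z] y])
  note Ui = Hw_obj[OF i] and Uj = Hw_obj[OF j]
  note sy = symm_hom[OF Ui Uj]
  note m = prod_map_hom[OF idE[OF X] sy]
  note tz = act_in[OF tt_hom[OF i j] c z]
  note xu = pr_hom[OF X UU_obj[OF i j]]
  have "act (tt j i) c (act (tn j i) c z) = act (prod_map E (Id E X) (symm E (U0 i) (U0 j))) c (act (tt i j) c z)"
    using act_comp[OF tn_prop(1) tt_hom[OF j i] c z] act_comp[OF tt_hom[OF i j] m c z] tn_prop(2) by simp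
  also have "\<dots> = act (tt j i) c y"
  proof (rule Prod_ext[OF X UU_obj[OF j i] c act_in[OF m c tz] act_in[OF tt_hom[OF j i] c y]])
    note a = prod_map_act[OF idE[OF X] sy c tz]
    show "act (pr1 E X (UU j i)) c (act (prod_map E (Id E X) (symm E (U0 i) (U0 j))) c (act (tt i j) c z)) =
       act (pr1 E X (UU j i)) c (act (tt j i) c y)"
      using a(1) act_id[OF X c act_in[OF xu(1) c tz]] tt_act(1)[OF i j c z] tt_act(1)[OF j i c y] e by simp
    show "act (pr2 E X (UU j i)) c (act (prod_map E (Id E X) (symm E (U0 i) (U0 j))) c (act (tt i j) c z)) =
       act (pr2 E X (UU j i)) c (act (tt j i) c y)"
    proof (rule Prod_ext[OF Uj Ui c])
      show "act (pr2 E X (UU j i)) c (act (prod_map E (Id E X) (symm E (U0 i) (U0 j))) c (act (tt i j) c z)) \<in> sec (UU j i) c"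
        by (rule act_in[OF pr_hom(2)[OF X UU_obj[OF j i]] c act_in[OF m c tz]])
      show "act (pr2 E X (UU j i)) c (act (tt j i) c y) \<in> sec (UU j i) c"
        by (rule act_in[OF pr_hom(2)[OF X UU_obj[OF j i]] c act_in[OF tt_hom[OF j i] c y]])
    qed (use a(2) symm_act[OF Ui Uj c act_in[OF xu(2) c tz]] tt_act(2)[OF i j c z] tt_act(2)[OF j i c y] e1 e2 in simp_all)
  qed
  finally show "act (tt j i) c (act (tn j i) c z) = act (tt j i) c y" .
qed

end

text \<open>The transition map along an edge. Taking for \<open>b\<close> the exchanged pair of faces and for \<open>a\<close> the
  identity shows that edges are action spans; taking the faces of the opposite edge and the duality
  gives the equation that determines \<open>X\<close> by its datum.\<close>

lemma tn_edge:
  assumes l: "l \<in> S1" and b: "b \<in> hom E W (UU (tg l) (sr l))" and a: "a \<in> hom E (Hw 1 l) W"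
    and b1: "\<And>c h. c \<in> Obj C \<Longrightarrow> h \<in> sec (Hw 1 l) c \<Longrightarrow>
       act (pr1 E (U0 (tg l)) (U0 (sr l))) c (act b c (act a c h)) = act (dc el E gs F 0 0 l) c h"
    and b2: "\<And>c h. c \<in> Obj C \<Longrightarrow> h \<in> sec (Hw 1 l) c \<Longrightarrow>
       act (pr2 E (U0 (tg l)) (U0 (sr l))) c (act b c (act a c h)) = act (dc el E gs F 0 1 l) c h"
  shows "tn (tg l) (sr l) \<cdot>\<^bsub>E\<^esub> prod_map E (Id E (G (sr l))) (h1c el E gs F l) =
    prod_map E (Id E (G (tg l))) b \<cdot>\<^bsub>E\<^esub> prod_map E (sa l) a"
proof -
  have S: "sr l \<in> S0" "tg l \<in> S0" using bd_0[OF l] by simp_all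
  note d1 = dc_prop[OF l, of 1, simplified One_nat_def[symmetric]] and d0 = dc_prop[OF l, of 0]
  have d1h: "dc el E gs F 0 1 l \<in> hom E (Hw 1 l) (U0 (sr l))" and d0h: "dc el E gs F 0 0 l \<in> hom E (Hw 1 l) (U0 (tg l))"
    using dc_prop(1)[OF l] by simp_all
  have h1: "h1c el E gs F l \<in> hom E (Hw 1 l) (UU (sr l) (tg l))"
    unfolding h1c_def by (rule pairing_hom[OF d1h d0h])
  note sl = sa_hom[OF l HOL.refl HOL.refl]
  note G1 = gs_obj[of "R (sr l)"] and G2 = gs_obj[of "R (tg l)"]
  note V = Hw_obj[OF l]
  note m1 = prod_map_hom[OF idE[OF G1] h1] and m2 = prod_map_hom[OF idE[OF G2] b] and m3 = prod_map_hom[OF sl a]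
  note t = tn_prop[OF S]
  show ?thesis
  proof (rule faithful[OF compE[OF m1 t(1)] compE[OF m3 m2]])
    fix c z assume c: "c \<in> Obj C" and z: "z \<in> sec (Prod E (G (sr l)) (Hw 1 l)) c"
    note r = act_in[OF pr_hom(1)[OF G1 V] c z] and h = act_in[OF pr_hom(2)[OF G1 V] c z]
    note z1 = act_in[OF m1 c z] and z2 = act_in[OF m2 c act_in[OF m3 c z]]
    note p1 = prod_map_act[OF idE[OF G1] h1 c z] and p3 = prod_map_act[OF sl a c z]
      and p2 = prod_map_act[OF idE[OF G2] b c act_in[OF m3 c z]]
    note hp = pairing_act[OF d1h d0h c h, folded h1c_def]
    let ?h = "act (inc 1 l) c (act (pr2 E (G (sr l)) (Hw 1 l)) c z)"
    let ?r = "act (pr1 E (G (sr l)) (Hw 1 l)) c z"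
    have jn: "joins c l ?h (face 0 1 c ?h) (face 0 0 c ?h)"
      using l inc_part[OF l c h] by (simp add: joins_def)
    have f: "act (inc 0 (sr l)) c (act (dc el E gs F 0 1 l) c (act (pr2 E (G (sr l)) (Hw 1 l)) c z)) = face 0 1 c ?h"
      "act (inc 0 (tg l)) c (act (dc el E gs F 0 0 l) c (act (pr2 E (G (sr l)) (Hw 1 l)) c z)) = face 0 0 c ?h"
      using dc_prop(2)[OF l _ c h] by simp_all
    have q1: "act (pr1 E (G (sr l)) (UU (sr l) (tg l))) c (act (prod_map E (Id E (G (sr l))) (h1c el E gs F l)) c z) = ?r"
      using p1(1) act_id[OF G1 c r] by simp
    have q2: "act (pr1 E (G (tg l)) (UU (tg l) (sr l))) c (act (prod_map E (Id E (G (tg l))) b) c (act (prod_map E (sa l) a) c z)) =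
        act (sa l) c ?r"
      using p2(1) p3(1) act_id[OF G2 c act_in[OF sl c r]] by simp
    have "act (tn (tg l) (sr l)) c (act (prod_map E (Id E (G (sr l))) (h1c el E gs F l)) c z) =
       act (prod_map E (Id E (G (tg l))) b) c (act (prod_map E (sa l) a) c z)"
    proof (rule tn_eqI[OF S c z1 z2])
      show "pt (tg l) c (act (pr1 E (G (tg l)) (UU (tg l) (sr l))) c (act (prod_map E (Id E (G (tg l))) b) c (act (prod_map E (sa l) a) c z)))
         (act (inc 0 (tg l)) c (act (pr1 E (U0 (tg l)) (U0 (sr l))) c (act (pr2 E (G (tg l)) (UU (tg l) (sr l))) c
            (act (prod_map E (Id E (G (tg l))) b) c (act (prod_map E (sa l) a) c z))))) =
        pt (sr l) c (act (pr1 E (G (sr l)) (UU (sr l) (tg l))) c (act (prod_map E (Id E (G (sr l))) (h1c el E gs F l)) c z))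
         (act (inc 0 (sr l)) c (act (pr1 E (U0 (sr l)) (U0 (tg l))) c (act (pr2 E (G (sr l)) (UU (sr l) (tg l))) c
            (act (prod_map E (Id E (G (sr l))) (h1c el E gs F l)) c z))))"
        unfolding q1 q2 p1(2) p2(2) p3(2) b1[OF c h] hp(1) f by (rule pt_joins[OF c jn r, symmetric])
    qed (simp_all only: p1(2) p2(2) p3(2) b1[OF c h] b2[OF c h] hp)
    then show "act (tn (tg l) (sr l) \<cdot>\<^bsub>E\<^esub> prod_map E (Id E (G (sr l))) (h1c el E gs F l)) c z =
       act (prod_map E (Id E (G (tg l))) b \<cdot>\<^bsub>E\<^esub> prod_map E (sa l) a) c z"
      using act_comp[OF m1 t(1) c z] act_comp[OF m3 m2 c z] by simp
  qed
qed

lemma dc_hom: "l \<in> S1 \<Longrightarrow> dc el E gs F 0 1 l \<in> hom E (Hw 1 l) (U0 (sr l))"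
  "l \<in> S1 \<Longrightarrow> dc el E gs F 0 0 l \<in> hom E (Hw 1 l) (U0 (tg l))"
  using dc_prop(1) by simp_all

lemma edge_action_span:
  assumes l: "l \<in> S1"
  shows "action_span el E gs F R (X, th) (sr l) (tg l) (Hw 1 l) (dc el E gs F 0 1 l) (dc el E gs F 0 0 l)"
  unfolding action_span_def
proof (intro conjI bexI)
  note d = dc_hom[OF l]
  note V = Hw_obj[OF l]
  show "dc el E gs F 0 1 l \<in> hom E (Hw 1 l) (U0 (sr l))" "dc el E gs F 0 0 l \<in> hom E (Hw 1 l) (U0 (tg l))"
    by (rule d)+
  show "s l \<in> hom (set_cat el) (R (sr l)) (R (tg l))" by (rule s_hom[OF l])
  show "bij_betw (app (s l)) (el (R (sr l))) (el (R (tg l)))" by (rule s_bij[OF l])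
  show "tn (tg l) (sr l) \<cdot>\<^bsub>E\<^esub> prod_map E (Id E (G (sr l))) (pairing E (dc el E gs F 0 1 l) (dc el E gs F 0 0 l)) =
    prod_map E (Id E (G (tg l))) (pairing E (dc el E gs F 0 0 l) (dc el E gs F 0 1 l)) \<cdot>\<^bsub>E\<^esub> prod_map E (sa l) (Id E (Hw 1 l))"
    unfolding h1c_def[symmetric]
  proof (rule tn_edge[OF l pairing_hom[OF d(2,1)] idE[OF V]])
    fix c h assume c: "c \<in> Obj C" and h: "h \<in> sec (Hw 1 l) c"
    show "act (pr1 E (U0 (tg l)) (U0 (sr l))) c (act (pairing E (dc el E gs F 0 0 l) (dc el E gs F 0 1 l)) c (act (Id E (Hw 1 l)) c h)) =
        act (dc el E gs F 0 0 l) c h"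
      "act (pr2 E (U0 (tg l)) (U0 (sr l))) c (act (pairing E (dc el E gs F 0 0 l) (dc el E gs F 0 1 l)) c (act (Id E (Hw 1 l)) c h)) =
        act (dc el E gs F 0 1 l) c h"
      unfolding act_id[OF V c h] by (rule pairing_act[OF d(2,1) c h])+
  qed
qed

lemma th_covering_projection: "covering_projection el E gs F R (X, th)"
  unfolding covering_projection_def
proof (intro conjI th_locally_constant ballI, unfold split_paired_all split_conv)
  fix i j assume "(i, j) \<in> cech1 el E gs F"
  then have i: "i \<in> S0" and j: "j \<in> S0" by (simp_all add: cech1_def)
  note Ui = Hw_obj[OF i] and Uj = Hw_obj[OF j]
  note q = pr_hom[OF Ui Uj]
  let ?K = "{pairing E u v | V u v. V \<in> Obj E \<and> \<not> is_initial E V \<and> action_span el E gs F R (X, th) i j V u v}"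
  have K: "k \<in> Arr E \<and> Cod E k = UU i j" if kK: "k \<in> ?K" for k
  proof -
    obtain V u v where "k = pairing E u v" "action_span el E gs F R (X, th) i j V u v" using kK by blast
    then have "k \<in> hom E V (UU i j)" using pairing_hom[of u V "U0 i" v "U0 j"] by (simp add: action_span_def)
    then show ?thesis by (simp add: hom_def)
  qed
  show "epimorphic_family E (UU i j) ?K"
  proof (rule epi_of_locally[OF K])
    fix c w assume c: "c \<in> Obj C" and w: "w \<in> sec (UU i j) c"
    let ?a = "act (inc 0 i) c (act (pr1 E (U0 i) (U0 j)) c w)" and ?b = "act (inc 0 j) c (act (pr2 E (U0 i) (U0 j)) c w)"
    note a = inc_part[OF i c act_in[OF q(1) c w]] and b = inc_part[OF j c act_in[OF q(2) c w]]
    show "locally c (\<lambda>f. in_image ?K (Dom C f) (res (UU i j) f w))"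
    proof (rule locally_mono[OF c edges[OF i j c a b] in_image_stable[OF K UU_obj[OF i j] w]])
      fix d f assume f: "f \<in> hom C d c"
        and "\<exists>l h. sr l = i \<and> tg l = j \<and> joins (Dom C f) l h (rs f ?a) (rs f ?b)"
      then obtain l h where e: "i = sr l" "j = tg l" and jn: "joins d l h (rs f ?a) (rs f ?b)"
        using homD(2)[OF f] by auto
      note d = objC(1)[OF f]
      note l = joinsD(1)[OF jn d]
      obtain v where v: "v \<in> sec (Hw 1 l) d" "act (inc 1 l) d v = h" using inc_ex1[OF l d joinsD(4)[OF jn d]] by blast
      note dh = dc_hom[OF l]
      note fw = res_in[OF UU_obj[OF i j] f w]
      let ?k = "pairing E (dc el E gs F 0 1 l) (dc el E gs F 0 0 l)"
      have kh: "?k \<in> hom E (Hw 1 l) (UU i j)" unfolding e by (rule pairing_hom[OF dh])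
      note pa = pairing_act[OF dh d v(1), folded e]
      have "act ?k d v = res (UU i j) f w"
      proof (rule Prod_ext[OF Ui Uj d act_in[OF kh d v(1)] fw])
        show "act (pr1 E (U0 i) (U0 j)) d (act ?k d v) = act (pr1 E (U0 i) (U0 j)) d (res (UU i j) f w)"
        proof (rule inc_inj[OF i d act_in[OF q(1) d act_in[OF kh d v(1)]] act_in[OF q(1) d fw]])
          have "act (inc 0 i) d (act (dc el E gs F 0 1 l) d v) = rs f ?a"
            using dc_prop(2)[OF l _ d v(1), of 1] v(2) jn by (simp add: joins_def e)
          then show "act (inc 0 i) d (act (pr1 E (U0 i) (U0 j)) d (act ?k d v)) = act (inc 0 i) d (act (pr1 E (U0 i) (U0 j)) d (res (UU i j) f w))"
            using pa(1) act_nat[OF q(1) f w] act_nat[OF inc_hom[OF i] f act_in[OF q(1) c w]] by simp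
        qed
        show "act (pr2 E (U0 i) (U0 j)) d (act ?k d v) = act (pr2 E (U0 i) (U0 j)) d (res (UU i j) f w)"
        proof (rule inc_inj[OF j d act_in[OF q(2) d act_in[OF kh d v(1)]] act_in[OF q(2) d fw]])
          have "act (inc 0 j) d (act (dc el E gs F 0 0 l) d v) = rs f ?b"
            using dc_prop(2)[OF l _ d v(1), of 0] v(2) jn by (simp add: joins_def e)
          then show "act (inc 0 j) d (act (pr2 E (U0 i) (U0 j)) d (act ?k d v)) = act (inc 0 j) d (act (pr2 E (U0 i) (U0 j)) d (res (UU i j) f w))"
            using pa(2) act_nat[OF q(2) f w] act_nat[OF inc_hom[OF j] f act_in[OF q(2) c w]] by simp
        qed
      qed
      moreover have "?k \<in> ?K"
        using edge_action_span[OF l] Hw_obj[OF l] Hw_nonempty[OF l] unfolding e by blast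
      moreover have "Dom E ?k = Hw 1 l" using kh by (simp add: hom_def)
      ultimately show "in_image ?K (Dom C f) (res (UU i j) f w)"
        unfolding in_image_def homD(2)[OF f] using v(1) by (intro bexI[of _ ?k] bexI[of _ v]) simp_all
    qed
  qed
qed

lemma th_determined: "determined_by el E gs F (R, s) (X, th)"
  unfolding determined_by_def split_conv
proof (intro conjI th_covering_projection ballI)
  fix l assume l: "l \<in> S1"
  note o = opp_in[OF l]
  note bo = bd_opp[OF l]
  have dh: "dc el E gs F 0 1 (opp F 1 l) \<in> hom E (Hw 1 (opp F 1 l)) (U0 (tg l))"
    "dc el E gs F 0 0 (opp F 1 l) \<in> hom E (Hw 1 (opp F 1 l)) (U0 (sr l))"
    using dc_hom[OF o] unfolding bo .
  have S: "sr l \<in> S0" "tg l \<in> S0" using bd_0[OF l] by simp_all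
  have b: "h1c el E gs F (opp F 1 l) \<in> hom E (Hw 1 (opp F 1 l)) (UU (tg l) (sr l))"
    unfolding h1c_def by (rule pairing_hom[OF dh])
  note t = tauc_prop[OF l]
  show "tn (tg l) (sr l) \<cdot>\<^bsub>E\<^esub> prod_map E (Id E (G (sr l))) (h1c el E gs F l) =
     prod_map E (Id E (G (tg l))) (h1c el E gs F (opp F 1 l)) \<cdot>\<^bsub>E\<^esub> prod_map E (sa l) (tauc el E gs F 1 l)"
  proof (rule tn_edge[OF l b t(1)])
    fix c h assume c: "c \<in> Obj C" and h: "h \<in> sec (Hw 1 l) c"
    note th = act_in[OF t(1) c h]
    note p = pairing_act[OF dh c th, folded h1c_def]
    note du = part_dual[OF l c inc_part[OF l c h]]
    have f: "act (inc 0 (tg l)) c (act (dc el E gs F 0 1 (opp F 1 l)) c (act (tauc el E gs F 1 l) c h)) = face 0 0 c (act (inc 1 l) c h)"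
      "act (inc 0 (sr l)) c (act (dc el E gs F 0 0 (opp F 1 l)) c (act (tauc el E gs F 1 l) c h)) = face 0 1 c (act (inc 1 l) c h)"
      using dc_prop(2)[OF o _ c th, of 1] dc_prop(2)[OF o _ c th, of 0] t(2)[OF c h] du(2,3) bo by simp_all
    have g: "act (inc 0 (tg l)) c (act (dc el E gs F 0 0 l) c h) = face 0 0 c (act (inc 1 l) c h)"
      "act (inc 0 (sr l)) c (act (dc el E gs F 0 1 l) c h) = face 0 1 c (act (inc 1 l) c h)"
      using dc_prop(2)[OF l _ c h] by simp_all
    show "act (pr1 E (U0 (tg l)) (U0 (sr l))) c (act (h1c el E gs F (opp F 1 l)) c (act (tauc el E gs F 1 l) c h)) = act (dc el E gs F 0 0 l) c h"
      unfolding p(1)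
      by (rule inc_inj[OF S(2) c act_in[OF dh(1) c th] act_in[OF dc_hom(2)[OF l] c h]]) (simp only: f g)
    show "act (pr2 E (U0 (tg l)) (U0 (sr l))) c (act (h1c el E gs F (opp F 1 l)) c (act (tauc el E gs F 1 l) c h)) = act (dc el E gs F 0 1 l) c h"
      unfolding p(2)
      by (rule inc_inj[OF S(1) c act_in[OF dh(2) c th] act_in[OF dc_hom(1)[OF l] c h]]) (simp only: f g)
  qed
qed

end

theorem covering_projection_exists: "\<exists>X\<theta>. determined_by el E gs F (R, s) X\<theta>"
  apply (rule glued_object)
  subgoal premises p for X pt by (rule exI, rule th_determined[OF p])
  done

end

section \<open>The fundamental groupoid\<close>

lemma premorphism_single:
  "premorphism el F i [l] j \<longleftrightarrow> l \<in> simplices el F 1 \<and> bd F 0 1 l = i \<and> bd F 0 0 l = j"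
  by (auto simp: premorphism_def)

text \<open>Decomposition of a path at its last edge.\<close>

lemma premorphism_Cons:
  assumes p: "p \<noteq> []"
  shows "premorphism el F i (l # p) j \<longleftrightarrow> l \<in> simplices el F 1 \<and> bd F 0 0 l = j \<and> premorphism el F i p (bd F 0 1 l)"
proof -
  have "(\<forall>k. Suc k < length (l # p) \<longrightarrow> bd F 0 1 ((l # p) ! k) = bd F 0 0 ((l # p) ! Suc k)) \<longleftrightarrow>
     bd F 0 1 l = bd F 0 0 (hd p) \<and> (\<forall>k. Suc k < length p \<longrightarrow> bd F 0 1 (p ! k) = bd F 0 0 (p ! Suc k))" (is "?l \<longleftrightarrow> ?r")
  proof
    assume a: ?l
    have "bd F 0 1 l = bd F 0 0 (hd p)" using a[rule_format, of 0] p by (simp add: hd_conv_nth)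
    moreover have "bd F 0 1 (p ! k) = bd F 0 0 (p ! Suc k)" if "Suc k < length p" for k
      using a[rule_format, of "Suc k"] that by simp
    ultimately show ?r by blast
  next
    assume a: ?r
    show ?l
    proof (intro allI impI)
      fix k assume k: "Suc k < length (l # p)"
      show "bd F 0 1 ((l # p) ! k) = bd F 0 0 ((l # p) ! Suc k)"
        using a k p by (cases k) (simp_all add: hd_conv_nth)
    qed
  qed
  then show ?thesis using p by (auto simp: premorphism_def)
qed

lemma premorphism_append:
  "premorphism el F i p j \<Longrightarrow> premorphism el F j q k \<Longrightarrow> premorphism el F i (q @ p) k"
proof (induction q arbitrary: k)
  case Nil
  then show ?case by (simp add: premorphism_def)
next
  case (Cons l q)
  have p: "p \<noteq> []" using Cons.prems(1) by (simp add: premorphism_def)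
  show ?case
  proof (cases "q = []")
    case True
    then show ?thesis using Cons.prems p by (auto simp: premorphism_Cons premorphism_single)
  next
    case False
    then show ?thesis using Cons.IH[of "bd F 0 1 l"] Cons.prems by (simp add: premorphism_Cons)
  qed
qed

lemma premorphism_unique: "premorphism el F i p j \<Longrightarrow> premorphism el F i' p j' \<Longrightarrow> i = i' \<and> j = j'"
  by (simp add: premorphism_def)

text \<open>The composite of the maps of a datum along a path; the path is written with its last edge at the
  head. The empty path is not a premorphism.\<close>

fun path_map :: "('v \<Rightarrow> 'v set) \<Rightarrow> ('v \<Rightarrow> 'v sarr) \<Rightarrow> 'v list \<Rightarrow> 'v sarr" where
  "path_map el s [] = undefined"
| "path_map el s [l] = s l"
| "path_map el s (l # l' # p) = s l \<cdot>\<^bsub>set_cat el\<^esub> path_map el s (l' # p)"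

lemma path_map_Cons: "p \<noteq> [] \<Longrightarrow> path_map el s (l # p) = s l \<cdot>\<^bsub>set_cat el\<^esub> path_map el s p"
  by (cases p) auto

context sd_hypercover
begin

text \<open>\<open>pm i p j\<close>: \<open>p\<close> is a premorphism from \<open>i\<close> to \<open>j\<close>; \<open>eqv\<close> is the congruence on premorphisms, \<open>pc\<close>
  the class of a premorphism, and \<open>FG\<close> the groupoid.\<close>

abbreviation "pm \<equiv> premorphism el F"
abbreviation "eqv \<equiv> equiv_pre el E gs F"
abbreviation "pc \<equiv> pclass el E gs F"
abbreviation "FG \<equiv> fundamental_groupoid el E gs F"
abbreviation "SC \<equiv> set_cat el"

lemma pm_objects:
  assumes "pm i p j"
  shows "i \<in> S0" "j \<in> S0"
proof -
  have p: "p \<noteq> []" "set p \<subseteq> S1" "sr (last p) = i" "tg (hd p) = j" using assms by (simp_all add: premorphism_def)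
  have "last p \<in> S1" "hd p \<in> S1" using p(1,2) by auto
  then show "i \<in> S0" "j \<in> S0" using bd_0[of "last p" 1] bd_0[of "hd p" 0] p(3,4) by simp_all
qed

lemma eqv_pm: "eqv p q \<Longrightarrow> \<exists>i j. pm i p j \<and> pm i q j"
proof (induction rule: equiv_pre.induct)
  case (refl i p j)
  then show ?case by blast
next
  case (trans p q r)
  then show ?case using premorphism_unique by metis
next
  case (comp i p j p' k q q')
  have "pm i q j" "pm j q' k" using comp.IH comp.hyps(1,2) premorphism_unique by metis+
  then have "pm i (p' @ p) k" "pm i (q' @ q) k" using premorphism_append[of el F] comp.hyps(1,2) by metis+
  then show ?case by blast
next
  case (triangle w)
  have "pm (sr (bd F 1 1 w)) [bd F 1 1 w] (tg (bd F 1 1 w))"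
    using bd_1[OF triangle, of 1] by (simp add: premorphism_single)
  moreover have "pm (sr (bd F 1 1 w)) [bd F 1 0 w, bd F 1 2 w] (tg (bd F 1 1 w))"
    using bd_1[OF triangle, of 0] bd_1[OF triangle, of 2] bd_bd[OF triangle]
    by (simp add: premorphism_single premorphism_Cons)
  ultimately show ?case by blast
next
  case (spans l t f)
  then have "pm (sr l) [l] (tg l)" "pm (sr l) [t] (tg l)" by (simp_all add: span_morphism_def premorphism_single)
  then show ?case by blast
qed blast

lemma eqv_pm_iff: "eqv p q \<Longrightarrow> pm i p j \<longleftrightarrow> pm i q j"
  using eqv_pm premorphism_unique by metis

lemma pc_eq:
  assumes "pm i p j"
  shows "pc p = pc q \<longleftrightarrow> eqv p q"
proof
  have "p \<in> pc p" using equiv_pre.refl[OF assms] by (simp add: pclass_def)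
  then show "eqv p q" if "pc p = pc q" using that by (auto simp: pclass_def intro: equiv_pre.sym)
  show "pc p = pc q" if "eqv p q"
    using that equiv_pre.trans equiv_pre.sym by (auto simp: pclass_def) blast+
qed

lemma pc_cong: "pm i p j \<Longrightarrow> eqv p q \<Longrightarrow> pc q = pc p"
  using pc_eq by metis

lemma pc_mem: "q \<in> pc p \<longleftrightarrow> eqv p q"
  by (simp add: pclass_def)

lemma pc_self: "pm i p j \<Longrightarrow> p \<in> pc p"
  using equiv_pre.refl by (simp add: pclass_def)

lemma pc_comp:
  assumes p: "pm i p j" and q: "pm j q k"
  shows "(\<Union>q'\<in>pc q. \<Union>p'\<in>pc p. pc (q' @ p')) = pc (q @ p)"
proof -
  have "pc (q' @ p') = pc (q @ p)" if "q' \<in> pc q" "p' \<in> pc p" for q' p'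
    by (rule pc_cong[OF premorphism_append[OF p q] equiv_pre.comp[OF p q]]) (use that in \<open>simp_all add: pc_mem\<close>)
  then have "(\<Union>q'\<in>pc q. \<Union>p'\<in>pc p. pc (q' @ p')) = (\<Union>q'\<in>pc q. \<Union>p'\<in>pc p. pc (q @ p))"
    by (intro SUP_cong HOL.refl)
  also have "\<dots> = pc (q @ p)" using pc_self[OF p] pc_self[OF q] by blast
  finally show ?thesis .
qed

lemma FG_simps:
  "Obj FG = S0" "(i, A, j) \<in> Arr FG \<longleftrightarrow> (\<exists>p. A = pc p \<and> pm i p j)"
  "Dom FG (i, A, j) = i" "Cod FG (i, A, j) = j" "Id FG i = (i, pc [dg i], i)"
  "(j, B, k) \<cdot>\<^bsub>FG\<^esub> (i, A, j') = (i, (\<Union>q\<in>B. \<Union>p\<in>A. pc (q @ p)), k)"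
  using pm_objects by (auto simp: fundamental_groupoid_def)

lemma FG_comp: "pm i p j \<Longrightarrow> pm j q k \<Longrightarrow> (j, pc q, k) \<cdot>\<^bsub>FG\<^esub> (i, pc p, j) = (i, pc (q @ p), k)"
  by (simp add: FG_simps pc_comp)

lemma FG_hom: "a \<in> hom FG i j \<longleftrightarrow> (\<exists>p. a = (i, pc p, j) \<and> pm i p j)"
  by (cases a) (auto simp: hom_def FG_simps)

lemma pm_dg: "i \<in> S0 \<Longrightarrow> pm i [dg i] i"
  using dg_in bd_dg by (simp add: premorphism_single)

lemma eqv_unit_right:
  assumes p: "pm i p j"
  shows "eqv p (p @ [dg i])"
proof -
  have ne: "p \<noteq> []" using p by (simp add: premorphism_def)
  then obtain p' l where pl: "p = p' @ [l]" by (metis rev_exhaust)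
  have l: "l \<in> S1" "sr l = i" using p pl by (auto simp: premorphism_def)
  obtain w where "w \<in> S2" "bd F 1 1 w = l" "bd F 1 0 w = l" "bd F 1 2 w = dg i"
    using degenerate_right[OF l(1)] l(2) by metis
  then have e: "eqv [l] [l, dg i]" using equiv_pre.triangle[of w] by metis
  show ?thesis
  proof (cases "p' = []")
    case False
    have "pm (tg l) p' j" if "pm i (p' @ [l]) j" "p' \<noteq> []" for p'
      using that
    proof (induction p' arbitrary: j)
      case (Cons m p')
      then show ?case by (cases "p' = []") (auto simp: premorphism_Cons premorphism_single)
    qed simp
    then have p': "pm (tg l) p' j" using p pl False by simp
    have "pm i [l] (tg l)" using l by (simp add: premorphism_single)
    from equiv_pre.comp[OF this p' e equiv_pre.refl[OF p']] show ?thesis by (simp add: pl)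
  qed (use e pl in simp)
qed

lemma eqv_unit_left:
  assumes p: "pm i p j"
  shows "eqv p ([dg j] @ p)"
proof -
  obtain l p' where pl: "p = l # p'" using p by (cases p) (auto simp: premorphism_def)
  have l: "l \<in> S1" "tg l = j" using p pl by (auto simp: premorphism_def)
  obtain w where "w \<in> S2" "bd F 1 1 w = l" "bd F 1 0 w = dg j" "bd F 1 2 w = l"
    using degenerate_left[OF l(1)] l(2) by metis
  then have e: "eqv [l] [dg j, l]" using equiv_pre.triangle[of w] by metis
  show ?thesis
  proof (cases "p' = []")
    case False
    then have p': "pm i p' (sr l)" using p pl by (simp add: premorphism_Cons)
    have "pm (sr l) [l] j" using l by (simp add: premorphism_single)
    from equiv_pre.comp[OF p' this equiv_pre.refl[OF p'] e] show ?thesis by (simp add: pl)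
  qed (use e pl in simp)
qed

lemma category_FG: "category FG"
proof (rule categoryI)
  fix f assume f: "f \<in> Arr FG"
  obtain i A j where f': "f = (i, A, j)" by (cases f)
  then obtain p where p: "A = pc p" "pm i p j" using f by (auto simp: FG_simps)
  note o = pm_objects[OF p(2)]
  show "Dom FG f \<in> Obj FG \<and> Cod FG f \<in> Obj FG" using o by (simp add: f' FG_simps(1,3,4))
  have "f \<cdot>\<^bsub>FG\<^esub> Id FG i = (i, pc (p @ [dg i]), j)"
    unfolding f' p(1) FG_simps(5) by (rule FG_comp[OF pm_dg[OF o(1)] p(2)])
  then show "f \<cdot>\<^bsub>FG\<^esub> Id FG (Dom FG f) = f"
    using pc_cong[OF p(2) eqv_unit_right[OF p(2)]] by (simp add: f' FG_simps(3) p(1))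
  have "Id FG j \<cdot>\<^bsub>FG\<^esub> f = (i, pc ([dg j] @ p), j)"
    unfolding f' p(1) FG_simps(5) by (rule FG_comp[OF p(2) pm_dg[OF o(2)]])
  then show "Id FG (Cod FG f) \<cdot>\<^bsub>FG\<^esub> f = f"
    using pc_cong[OF p(2) eqv_unit_left[OF p(2)]] by (simp add: f' FG_simps(4) p(1))
next
  fix i assume "i \<in> Obj FG"
  then show "Id FG i \<in> hom FG i i" using pm_dg by (auto simp: FG_hom FG_simps(1,5))
next
  fix f g assume "f \<in> Arr FG" "g \<in> Arr FG" "Dom FG g = Cod FG f"
  then obtain i p j q k where fg: "f = (i, pc p, j)" "g = (j, pc q, k)" and p: "pm i p j" and q: "pm j q k"
    by (cases f; cases g) (auto simp: FG_simps)
  show "g \<cdot>\<^bsub>FG\<^esub> f \<in> hom FG (Dom FG f) (Cod FG g)"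
    unfolding fg FG_comp[OF p q] FG_simps(3,4) FG_hom using premorphism_append[OF p q] by blast
next
  fix f g h assume "f \<in> Arr FG" "g \<in> Arr FG" "h \<in> Arr FG" "Dom FG g = Cod FG f" "Dom FG h = Cod FG g"
  then obtain i p j q k r m where fgh: "f = (i, pc p, j)" "g = (j, pc q, k)" "h = (k, pc r, m)"
    and p: "pm i p j" and q: "pm j q k" and r: "pm k r m"
    by (cases f; cases g; cases h) (auto simp: FG_simps)
  show "h \<cdot>\<^bsub>FG\<^esub> (g \<cdot>\<^bsub>FG\<^esub> f) = (h \<cdot>\<^bsub>FG\<^esub> g) \<cdot>\<^bsub>FG\<^esub> f"
    unfolding fgh FG_comp[OF p q] FG_comp[OF q r] FG_comp[OF premorphism_append[OF p q] r]
      FG_comp[OF p premorphism_append[OF q r]] by simp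
qed

subsection \<open>Inverses from condition G\<close>

text \<open>Condition G gives a triangle with sides \<open>l\<close> and its opposite whose third side is a loop with equal
  faces. Such a loop maps, as a span, to the degenerate edge by the common face followed by the
  degeneracy, so it is an identity of the groupoid.\<close>

lemma inverse_edge:
  assumes G: "condition_G el E gs F" and l: "l \<in> S1"
  shows "eqv [dg (sr l)] [opp F 1 l, l]"
proof -
  obtain w where w: "w \<in> S2" "bd F 1 2 w = l" "bd F 1 0 w = opp F 1 l"
    and e: "dc el E gs F 0 1 (bd F 1 1 w) = dc el E gs F 0 0 (bd F 1 1 w)"
    using G l by (auto simp: condition_G_def)
  let ?t = "bd F 1 1 w" and ?i = "sr l"
  have t: "?t \<in> S1" using bd_1[OF w(1), of 1] by simp
  have i: "?i \<in> S0" using bd_0[OF l, of 1] by simp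
  have st: "sr ?t = ?i" "tg ?t = ?i" using bd_bd[OF w(1)] w(2,3) bd_opp[OF l] by simp_all
  note di = dg_in[OF i]
  have i': "?i \<in> el (Ob (idx F) 0)" using i by (simp add: simplices_def)
  have hs: "ss (tot F) 0 0 \<in> hom E (Ob (tot F) 0) (Ob (tot F) 1)" using tot_ss[of 0 0] by simp
  have hi: "ss (idx F) 0 0 \<in> hom SC (Ob (idx F) 0) (Ob (idx F) 1)" using idx_ss[of 0 0] by simp
  have e0: "str F 1 \<cdot>\<^bsub>E\<^esub> ss (tot F) 0 0 = FA gs (ss (idx F) 0 0) \<cdot>\<^bsub>E\<^esub> str F 0" using str_ss[of 0 0] by simp
  note cm = comp_map_prop[OF str_hom i' str_hom hs hi e0]
  define k where "k = comp_map el E gs (Ob (idx F) 0) (str F 0) ?i (Ob (idx F) 1) (str F 1) (dg ?i) (ss (tot F) 0 0)"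
  have k: "k \<in> hom E (Hw 0 ?i) (Hw 1 (dg ?i))" using cm(1) by (simp add: k_def Hc_def)
  have ka: "act (inc 1 (dg ?i)) c (act k c v) = act (ss (tot F) 0 0) c (act (inc 0 ?i) c v)"
    if "c \<in> Obj C" "v \<in> sec (Hw 0 ?i) c" for c v
    using cm(2)[OF that(1), of v] that(2) by (simp add: k_def Hc_def inc_def)
  have d1: "dc el E gs F 0 n (dg ?i) \<in> hom E (Hw 1 (dg ?i)) (Hw 0 ?i)" if "n \<le> 1" for n
  proof -
    have "bd F 0 n (dg ?i) = ?i" using bd_dg[OF i] that by (cases n) simp_all
    then show ?thesis using dc_prop(1)[OF di that] by simp
  qed
  have kd: "dc el E gs F 0 n (dg ?i) \<cdot>\<^bsub>E\<^esub> k = Id E (Hw 0 ?i)" if n: "n \<le> 1" for n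
  proof (rule faithful[OF compE[OF k d1[OF n]] idE[OF Hw_obj[OF i]]])
    fix c v assume c: "c \<in> Obj C" and v: "v \<in> sec (Hw 0 ?i) c"
    have b: "bd F 0 n (dg ?i) = ?i" using bd_dg[OF i] n by (cases n) simp_all
    note kv = act_in[OF k c v]
    have "act (dc el E gs F 0 n (dg ?i)) c (act k c v) = v"
    proof (rule inc_inj[OF i c act_in[OF d1[OF n] c kv] v])
      show "act (inc 0 ?i) c (act (dc el E gs F 0 n (dg ?i)) c (act k c v)) = act (inc 0 ?i) c v"
        using dc_prop(2)[OF di n c kv] ka[OF c v] part_degenerate(2)[OF i c inc_part[OF i c v] n] b by simp
    qed
    then show "act (dc el E gs F 0 n (dg ?i) \<cdot>\<^bsub>E\<^esub> k) c v = act (Id E (Hw 0 ?i)) c v"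
      using act_comp[OF k d1[OF n] c v] act_id[OF Hw_obj[OF i] c v] by simp
  qed
  have dt: "dc el E gs F 0 1 ?t \<in> hom E (Hw 1 ?t) (Hw 0 ?i)" using dc_prop(1)[OF t, of 1] st by simp
  have "dc el E gs F 0 n (dg ?i) \<cdot>\<^bsub>E\<^esub> (k \<cdot>\<^bsub>E\<^esub> dc el E gs F 0 1 ?t) = dc el E gs F 0 1 ?t" if "n \<le> 1" for n
    using assocE[OF dt k d1[OF that]] kd[OF that] unitE(2)[OF dt] by simp
  from this[of 1] this[of 0] have "span_morphism el E gs F ?t (dg ?i) (k \<cdot>\<^bsub>E\<^esub> dc el E gs F 0 1 ?t)"
    unfolding span_morphism_def using t di st bd_dg[OF i] compE[OF dt k] e by simp
  then have "eqv [?t] [dg ?i]" by (rule equiv_pre.spans)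
  then show ?thesis
    using equiv_pre.triangle[OF w(1)] w(2,3) equiv_pre.sym equiv_pre.trans by metis
qed

section \<open>Descent data are actions of the fundamental groupoid\<close>

text \<open>Consistent descent data.\<close>

definition datum :: "'v descent_datum \<Rightarrow> bool" where
  "datum Rs \<longleftrightarrow> descent_datum el F Rs \<and> consistent el E gs F Rs"

context
  fixes R s
  assumes D: "datum (R, s)"
begin

lemma datum_hom: "l \<in> S1 \<Longrightarrow> s l \<in> hom SC (R (sr l)) (R (tg l))"
  and datum_dg: "i \<in> S0 \<Longrightarrow> s (dg i) = Id SC (R i)"
  and datum_tri: "w \<in> S2 \<Longrightarrow> s (bd F 1 1 w) = s (bd F 1 0 w) \<cdot>\<^bsub>SC\<^esub> s (bd F 1 2 w)"
  and datum_ext: "R \<in> extensional S0" "s \<in> extensional S1"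
  using D by (simp_all add: datum_def descent_datum_def)

lemma datum_consistent: "span_morphism el E gs F l t f \<Longrightarrow> s l = s t"
  using D by (auto simp: datum_def consistent_def)

lemma path_map_hom: "pm i p j \<Longrightarrow> path_map el s p \<in> hom SC (R i) (R j)"
proof (induction p arbitrary: j)
  case Nil
  then show ?case by (simp add: premorphism_def)
next
  case (Cons l p)
  show ?case
  proof (cases "p = []")
    case True
    then show ?thesis using Cons.prems datum_hom[of l] by (auto simp: premorphism_single)
  next
    case False
    then have l: "l \<in> S1" "tg l = j" "pm i p (sr l)" using Cons.prems by (simp_all add: premorphism_Cons)
    have "s l \<in> hom SC (R (sr l)) (R j)" using datum_hom[OF l(1)] unfolding l(2) .
    then show ?thesis unfolding path_map_Cons[OF False] by (rule set_cat_comp[OF Cons.IH[OF l(3)]])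
  qed
qed

lemma path_map_append:
  assumes p: "pm i p j"
  shows "pm j q k \<Longrightarrow> path_map el s (q @ p) = path_map el s q \<cdot>\<^bsub>SC\<^esub> path_map el s p"
proof (induction q arbitrary: k)
  case Nil
  then show ?case by (simp add: premorphism_def)
next
  case (Cons l q)
  have pn: "p \<noteq> []" using p by (simp add: premorphism_def)
  show ?case
  proof (cases "q = []")
    case True
    then show ?thesis using path_map_Cons[OF pn] by simp
  next
    case False
    then have l: "l \<in> S1" "tg l = k" "pm j q (sr l)" using Cons.prems by (simp_all add: premorphism_Cons)
    have "path_map el s ((l # q) @ p) = s l \<cdot>\<^bsub>SC\<^esub> (path_map el s q \<cdot>\<^bsub>SC\<^esub> path_map el s p)"
      using path_map_Cons[of "q @ p" el s l] Cons.IH[OF l(3)] pn by simp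
    also have "\<dots> = (s l \<cdot>\<^bsub>SC\<^esub> path_map el s q) \<cdot>\<^bsub>SC\<^esub> path_map el s p"
      by (rule cat_assoc[OF category_set_cat path_map_hom[OF p] path_map_hom[OF l(3)] datum_hom[OF l(1)]])
    finally show ?thesis unfolding path_map_Cons[OF False] .
  qed
qed

lemma path_map_eqv: "eqv p q \<Longrightarrow> path_map el s p = path_map el s q"
proof (induction rule: equiv_pre.induct)
  case (comp i p j p' k q q')
  have "pm i q j" "pm j q' k" using eqv_pm_iff[OF comp.hyps(3)] eqv_pm_iff[OF comp.hyps(4)] comp.hyps(1,2) by blast+
  then show ?case using path_map_append comp.hyps(1,2) comp.IH by metis
next
  case (triangle w)
  then show ?case using datum_tri by simp
next
  case (spans l t f)
  then show ?case using datum_consistent by simp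
qed simp_all

end

text \<open>The functor on the fundamental groupoid given by a datum; on a class of paths it is computed on any
  representative.\<close>

definition act_of :: "'v descent_datum \<Rightarrow> ('v, 'v \<times> 'v list set \<times> 'v, 'v, 'v sarr) fctr" where
  "act_of Rs = \<lparr>FO = fst Rs, FA = (\<lambda>a\<in>Arr FG. path_map el (snd Rs) (SOME p. p \<in> fst (snd a)))\<rparr>"

lemma act_of_FO: "FO (act_of (R, s)) = R"
  by (simp add: act_of_def)

lemma act_of_FA:
  assumes D: "datum (R, s)" and p: "pm i p j"
  shows "FA (act_of (R, s)) (i, pc p, j) = path_map el s p"
proof -
  have "(SOME q. q \<in> pc p) \<in> pc p" by (rule someI[of _ p]) (rule pc_self[OF p])
  then have "eqv p (SOME q. q \<in> pc p)" by (simp only: pc_mem)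
  then have "path_map el s (SOME q. q \<in> pc p) = path_map el s p" using path_map_eqv[OF D] by metis
  moreover have "(i, pc p, j) \<in> Arr FG" using p by (auto simp: FG_simps)
  ultimately show ?thesis by (simp add: act_of_def)
qed

lemma act_of_functor:
  assumes D: "datum (R, s)"
  shows "act_of (R, s) \<in> functors FG SC"
proof -
  have "is_functor FG SC (act_of (R, s))"
    unfolding is_functor_def
  proof (intro conjI ballI impI category_FG category_set_cat)
    fix i assume i: "i \<in> Obj FG"
    show "FO (act_of (R, s)) i \<in> Obj SC" by simp
    have "i \<in> S0" using i by (simp add: FG_simps)
    then show "FA (act_of (R, s)) (Id FG i) = Id SC (FO (act_of (R, s)) i)"
      using act_of_FA[OF D pm_dg] datum_dg[OF D] by (simp add: FG_simps(5) act_of_FO)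
  next
    fix f assume "f \<in> Arr FG"
    then obtain i p j where "f = (i, pc p, j)" "pm i p j" by (cases f) (auto simp: FG_simps)
    then show "FA (act_of (R, s)) f \<in> hom SC (FO (act_of (R, s)) (Dom FG f)) (FO (act_of (R, s)) (Cod FG f))"
      using act_of_FA[OF D] path_map_hom[OF D] by (simp add: FG_simps(3,4) act_of_FO)
  next
    fix f g assume "f \<in> Arr FG" "g \<in> Arr FG" "Dom FG g = Cod FG f"
    then obtain i p j q k where fg: "f = (i, pc p, j)" "g = (j, pc q, k)" and p: "pm i p j" and q: "pm j q k"
      by (cases f; cases g) (auto simp: FG_simps)
    show "FA (act_of (R, s)) (g \<cdot>\<^bsub>FG\<^esub> f) = FA (act_of (R, s)) g \<cdot>\<^bsub>SC\<^esub> FA (act_of (R, s)) f"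
      unfolding fg FG_comp[OF p q] act_of_FA[OF D premorphism_append[OF p q]] act_of_FA[OF D p] act_of_FA[OF D q]
      by (rule path_map_append[OF D p q])
  qed
  moreover have "FO (act_of (R, s)) \<in> extensional (Obj FG)"
    using datum_ext(1)[OF D] by (simp add: act_of_FO FG_simps)
  moreover have "FA (act_of (R, s)) \<in> extensional (Arr FG)" by (simp add: act_of_def)
  ultimately show ?thesis by (simp add: functors_def)
qed

lemma act_of_inj:
  assumes D: "datum Rs" and D': "datum Rs'" and e: "act_of Rs = act_of Rs'"
  shows "Rs = Rs'"
proof -
  obtain R s R' s' where r: "Rs = (R, s)" "Rs' = (R', s')" by (cases Rs; cases Rs')
  note D = D[unfolded r] and D' = D'[unfolded r] and e = e[unfolded r]
  have "R = R'" using e act_of_FO by metis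
  moreover have "s = s'"
  proof (rule extensionalityI[OF datum_ext(2)[OF D] datum_ext(2)[OF D']])
    fix l assume "l \<in> S1"
    then have "pm (sr l) [l] (tg l)" by (simp add: premorphism_single)
    from act_of_FA[OF D this] act_of_FA[OF D' this] e show "s l = s' l" by simp
  qed
  ultimately show ?thesis by (simp add: r)
qed

text \<open>Every functor comes from a datum. The opposite of an edge is a left inverse of it, and has a left
  inverse itself, namely its own opposite, which is not assumed to be the original edge; so the edge
  acts by a bijection.\<close>

lemma act_of_surj:
  assumes G: "condition_G el E gs F" and P: "P \<in> functors FG SC"
  obtains R s where "datum (R, s)" "act_of (R, s) = P"
proof -
  have F: "is_functor FG SC P" and ext: "FO P \<in> extensional (Obj FG)" "FA P \<in> extensional (Arr FG)"
    using P by (auto simp: functors_def)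
  define s where "s = (\<lambda>l\<in>S1. FA P (sr l, pc [l], tg l))"
  have sl: "s l = FA P (sr l, pc [l], tg l)" if "l \<in> S1" for l using that by (simp add: s_def)
  have FAh: "FA P (i, pc p, j) \<in> hom SC (FO P i) (FO P j)" if "pm i p j" for i p j
    by (rule functor_arr[OF F]) (use that in \<open>auto simp: FG_hom\<close>)
  have FAc: "FA P (i, pc (q @ p), k) = FA P (j, pc q, k) \<cdot>\<^bsub>SC\<^esub> FA P (i, pc p, j)"
    if p: "pm i p j" and q: "pm j q k" for i p j q k
    using functor_comp[OF F, of "(i, pc p, j)" i j "(j, pc q, k)" k] p q FG_comp[OF p q] by (simp add: FG_hom) blast
  have one: "pm (sr l) [l] (tg l)" if "l \<in> S1" for l using that by (simp add: premorphism_single)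
  have sh: "s l \<in> hom SC (FO P (sr l)) (FO P (tg l))" if "l \<in> S1" for l
    using FAh[OF one[OF that]] sl[OF that] by simp
  have sd: "s (dg i) = Id SC (FO P i)" if i: "i \<in> S0" for i
    using functor_id[OF F, of i] i sl[OF dg_in[OF i]] bd_dg[OF i] by (simp add: FG_simps(1,5))
  have two: "FA P (sr m, pc [l, m], tg l) = s l \<cdot>\<^bsub>SC\<^esub> s m" if "l \<in> S1" "m \<in> S1" "sr l = tg m" for l m
    using FAc[OF one[OF that(2)], of "[l]" "tg l"] that sl one[OF that(1)] by simp
  have st: "s (bd F 1 1 w) = s (bd F 1 0 w) \<cdot>\<^bsub>SC\<^esub> s (bd F 1 2 w)" if w: "w \<in> S2" for w
  proof -
    have b: "bd F 1 0 w \<in> S1" "bd F 1 1 w \<in> S1" "bd F 1 2 w \<in> S1" using bd_1[OF w] by simp_all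
    have "pc [bd F 1 1 w] = pc [bd F 1 0 w, bd F 1 2 w]"
      using pc_eq[OF one[OF b(2)]] equiv_pre.triangle[OF w] by blast
    then show ?thesis
      using two[OF b(1,3)] bd_bd[OF w] sl[OF b(2)] by simp
  qed
  have inv: "app (s (opp F 1 l)) (app (s l) x) = x" if l: "l \<in> S1" and x: "x \<in> el (FO P (sr l))" for l x
  proof -
    have i: "sr l \<in> S0" using bd_0[OF l, of 1] by simp
    have "pc [dg (sr l)] = pc [opp F 1 l, l]" using pc_eq[OF pm_dg[OF i]] inverse_edge[OF G l] by blast
    then have "s (dg (sr l)) = s (opp F 1 l) \<cdot>\<^bsub>SC\<^esub> s l"
      using two[OF opp_in[OF l] l] bd_opp[OF l] sl[OF dg_in[OF i]] bd_dg[OF i] by simp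
    then have "app (s (opp F 1 l) \<cdot>\<^bsub>SC\<^esub> s l) x = x" using sd[OF i] x by (simp add: app_Id)
    then show ?thesis using app_comp_apply[OF sh[OF l] x] by simp
  qed
  have sb: "bij_betw (app (s l)) (el (FO P (sr l))) (el (FO P (tg l)))" if l: "l \<in> S1" for l
  proof (rule bij_betwI[where g = "app (s (opp F 1 l))"])
    note o = opp_in[OF l]
    have ho: "s (opp F 1 l) \<in> hom SC (FO P (tg l)) (FO P (sr l))" using sh[OF o] bd_opp[OF l] by simp
    show "app (s l) \<in> el (FO P (sr l)) \<rightarrow> el (FO P (tg l))" using app_in[OF sh[OF l]] by blast
    show "app (s (opp F 1 l)) \<in> el (FO P (tg l)) \<rightarrow> el (FO P (sr l))" using app_in[OF ho] by blast
    show "app (s (opp F 1 l)) (app (s l) x) = x" if "x \<in> el (FO P (sr l))" for x by (rule inv[OF l that])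
    show "app (s l) (app (s (opp F 1 l)) y) = y" if y: "y \<in> el (FO P (tg l))" for y
    proof -
      have y': "app (s (opp F 1 l)) y \<in> el (FO P (sr l))" by (rule app_in[OF ho y])
      have z: "app (s l) (app (s (opp F 1 l)) y) \<in> el (FO P (tg l))" by (rule app_in[OF sh[OF l] y'])
      have i: "app (s (opp F 1 (opp F 1 l))) (app (s (opp F 1 l)) x) = x" if "x \<in> el (FO P (tg l))" for x
        using inv[OF o, of x] that bd_opp[OF l] by simp
      show ?thesis using i[OF z] i[OF y] inv[OF l y'] by simp
    qed
  qed
  have "descent_datum el F (FO P, s)"
    unfolding descent_datum_def split_conv using ext(1) sh sb sd st by (simp add: s_def FG_simps(1))
  moreover have "consistent el E gs F (FO P, s)"
    unfolding consistent_def split_conv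
  proof (intro allI impI)
    fix l t f assume a: "span_morphism el E gs F l t f"
    then have lt: "l \<in> S1" "t \<in> S1" "sr l = sr t" "tg l = tg t" by (simp_all add: span_morphism_def)
    have "pc [l] = pc [t]" using pc_eq[OF one[OF lt(1)]] equiv_pre.spans[OF a] by blast
    then show "s l = s t" using sl lt by simp
  qed
  ultimately have D: "datum (FO P, s)" by (simp add: datum_def)
  have pmap: "path_map el s p = FA P (i, pc p, j)" if "pm i p j" for i p j
    using that
  proof (induction p arbitrary: j)
    case Nil
    then show ?case by (simp add: premorphism_def)
  next
    case (Cons l p)
    show ?case
    proof (cases "p = []")
      case True
      then show ?thesis using Cons.prems sl by (auto simp: premorphism_single)
    next
      case False
      then have l: "l \<in> S1" "tg l = j" "pm i p (sr l)" using Cons.prems by (simp_all add: premorphism_Cons)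
      show ?thesis
        unfolding path_map_Cons[OF False] Cons.IH[OF l(3)]
        using FAc[OF l(3) one[OF l(1)]] sl[OF l(1)] l(2) by simp
    qed
  qed
  have "FA (act_of (FO P, s)) = FA P"
  proof (rule extensionalityI[OF _ ext(2)])
    show "FA (act_of (FO P, s)) \<in> extensional (Arr FG)" by (simp add: act_of_def)
    fix a assume "a \<in> Arr FG"
    then obtain i p j where "a = (i, pc p, j)" "pm i p j" by (cases a) (auto simp: FG_simps)
    then show "FA (act_of (FO P, s)) a = FA P a" using act_of_FA[OF D] pmap by simp
  qed
  moreover have "FO (act_of (FO P, s)) = FO P" by (simp add: act_of_FO)
  ultimately have "act_of (FO P, s) = P" by simp
  then show thesis using that D by blast
qed

text \<open>A family commuting with the edges commutes with all paths.\<close>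

lemma natural_iff:
  assumes D: "datum (R, s)" and D': "datum (R', s')" and t: "\<And>i. i \<in> S0 \<Longrightarrow> t i \<in> hom SC (R i) (R' i)"
  shows "(\<forall>l\<in>S1. t (tg l) \<cdot>\<^bsub>SC\<^esub> s l = s' l \<cdot>\<^bsub>SC\<^esub> t (sr l)) \<longleftrightarrow>
    (\<forall>a\<in>Arr FG. t (Cod FG a) \<cdot>\<^bsub>SC\<^esub> FA (act_of (R, s)) a = FA (act_of (R', s')) a \<cdot>\<^bsub>SC\<^esub> t (Dom FG a))"
proof
  assume n: "\<forall>l\<in>S1. t (tg l) \<cdot>\<^bsub>SC\<^esub> s l = s' l \<cdot>\<^bsub>SC\<^esub> t (sr l)"
  have pn: "t j \<cdot>\<^bsub>SC\<^esub> path_map el s p = path_map el s' p \<cdot>\<^bsub>SC\<^esub> t i" if "pm i p j" for i p j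
    using that
  proof (induction p arbitrary: j)
    case Nil
    then show ?case by (simp add: premorphism_def)
  next
    case (Cons l p)
    show ?case
    proof (cases "p = []")
      case True
      then show ?thesis using Cons.prems n by (auto simp: premorphism_single)
    next
      case False
      then have l: "l \<in> S1" "tg l = j" "pm i p (sr l)" using Cons.prems by (simp_all add: premorphism_Cons)
      note o = pm_objects[OF Cons.prems] and o' = pm_objects[OF l(3)]
      note h = path_map_hom[OF D l(3)] and h' = path_map_hom[OF D' l(3)]
      note sl = datum_hom[OF D l(1), unfolded l(2)] and sl' = datum_hom[OF D' l(1), unfolded l(2)]
      note assoc = cat_assoc[OF category_set_cat]
      have "t j \<cdot>\<^bsub>SC\<^esub> (s l \<cdot>\<^bsub>SC\<^esub> path_map el s p) = (s' l \<cdot>\<^bsub>SC\<^esub> t (sr l)) \<cdot>\<^bsub>SC\<^esub> path_map el s p"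
        using assoc[OF h sl t[OF o(2)]] n l(1,2) by auto
      also have "\<dots> = s' l \<cdot>\<^bsub>SC\<^esub> (path_map el s' p \<cdot>\<^bsub>SC\<^esub> t i)"
        using assoc[OF h t[OF o'(2)] sl'] Cons.IH[OF l(3)] by simp
      also have "\<dots> = (s' l \<cdot>\<^bsub>SC\<^esub> path_map el s' p) \<cdot>\<^bsub>SC\<^esub> t i"
        by (rule assoc[OF t[OF o(1)] h' sl'])
      finally show ?thesis unfolding path_map_Cons[OF False] .
    qed
  qed
  show "\<forall>a\<in>Arr FG. t (Cod FG a) \<cdot>\<^bsub>SC\<^esub> FA (act_of (R, s)) a = FA (act_of (R', s')) a \<cdot>\<^bsub>SC\<^esub> t (Dom FG a)"
  proof
    fix a assume "a \<in> Arr FG"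
    then obtain i p j where "a = (i, pc p, j)" "pm i p j" by (cases a) (auto simp: FG_simps)
    then show "t (Cod FG a) \<cdot>\<^bsub>SC\<^esub> FA (act_of (R, s)) a = FA (act_of (R', s')) a \<cdot>\<^bsub>SC\<^esub> t (Dom FG a)"
      using act_of_FA[OF D] act_of_FA[OF D'] pn by (simp add: FG_simps(3,4))
  qed
next
  assume n: "\<forall>a\<in>Arr FG. t (Cod FG a) \<cdot>\<^bsub>SC\<^esub> FA (act_of (R, s)) a = FA (act_of (R', s')) a \<cdot>\<^bsub>SC\<^esub> t (Dom FG a)"
  show "\<forall>l\<in>S1. t (tg l) \<cdot>\<^bsub>SC\<^esub> s l = s' l \<cdot>\<^bsub>SC\<^esub> t (sr l)"
  proof
    fix l assume "l \<in> S1"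
    then have p: "pm (sr l) [l] (tg l)" by (simp add: premorphism_single)
    then have "(sr l, pc [l], tg l) \<in> Arr FG" by (auto simp: FG_simps)
    from n[rule_format, OF this] show "t (tg l) \<cdot>\<^bsub>SC\<^esub> s l = s' l \<cdot>\<^bsub>SC\<^esub> t (sr l)"
      using act_of_FA[OF D p] act_of_FA[OF D' p] by (simp add: FG_simps(3,4))
  qed
qed

abbreviation "CC \<equiv> covering_cat el E gs F"
abbreviation "CO \<equiv> covering_objects el E gs F"
abbreviation "FC \<equiv> functor_cat FG SC"

lemma covering_objects_iff:
  "(X\<theta>, Rs) \<in> CO \<longleftrightarrow> datum Rs \<and> X\<theta> = the_covering_projection el E gs F Rs"
proof -
  have "determined_by el E gs F Rs (the_covering_projection el E gs F Rs)" if D: "datum Rs"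
  proof -
    obtain R s where Rs: "Rs = (R, s)" by (cases Rs)
    interpret descent el C J E sec res act gs gl F I U \<zeta> R s
      by unfold_locales (use D in \<open>simp add: datum_def Rs\<close>)
    show ?thesis unfolding the_covering_projection_def Rs by (rule someI_ex[OF covering_projection_exists])
  qed
  then show ?thesis by (auto simp: covering_objects_def datum_def)
qed

lemma CC_simps:
  "Obj CC = CO"
  "(P, f, P') \<in> Arr CC \<longleftrightarrow> P \<in> CO \<and> P' \<in> CO \<and> f \<in> extensional S0 \<and>
     (\<forall>i\<in>S0. f i \<in> hom SC (fst (snd P) i) (fst (snd P') i)) \<and>
     (\<forall>l\<in>S1. f (tg l) \<cdot>\<^bsub>SC\<^esub> snd (snd P) l = snd (snd P') l \<cdot>\<^bsub>SC\<^esub> f (sr l))"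
  "Dom CC (P, f, P') = P" "Cod CC (P, f, P') = P'"
  "Id CC P = (P, (\<lambda>i\<in>S0. Id SC (fst (snd P) i)), P)"
  "(P', g, P'') \<cdot>\<^bsub>CC\<^esub> (P, f, Q) = (P, (\<lambda>i\<in>S0. g i \<cdot>\<^bsub>SC\<^esub> f i), P'')"
  by (simp_all add: covering_cat_def)

text \<open>The comparison functor forgets the chosen covering projection, which is a function of the datum, and
  turns the datum into an action.\<close>

definition comparison ::
  "(('v, 'o, 'a) cov_obj, ('v, 'o, 'a) cov_obj \<times> ('v \<Rightarrow> 'v sarr) \<times> ('v, 'o, 'a) cov_obj,
    ('v, 'v \<times> 'v list set \<times> 'v, 'v, 'v sarr) fctr,
    ('v, 'v \<times> 'v list set \<times> 'v, 'v, 'v sarr) fctr \<times> ('v \<Rightarrow> 'v sarr) \<times>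
      ('v, 'v \<times> 'v list set \<times> 'v, 'v, 'v sarr) fctr) fctr" where
  "comparison = \<lparr>FO = (\<lambda>P. act_of (snd P)), FA = (\<lambda>(P, f, P'). (act_of (snd P), f, act_of (snd P')))\<rparr>"

lemma comparison_arr:
  assumes P: "P \<in> CO" and P': "P' \<in> CO"
  shows "(P, f, P') \<in> Arr CC \<longleftrightarrow> (act_of (snd P), f, act_of (snd P')) \<in> Arr FC"
proof -
  obtain X R s X' R' s' where e: "P = (X, (R, s))" "P' = (X', (R', s'))" by (metis surj_pair)
  have D: "datum (R, s)" and D': "datum (R', s')" using P P' by (simp_all add: e covering_objects_iff)
  have "(P, f, P') \<in> Arr CC \<longleftrightarrow> f \<in> extensional S0 \<and> (\<forall>i\<in>S0. f i \<in> hom SC (R i) (R' i)) \<and>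
     (\<forall>l\<in>S1. f (tg l) \<cdot>\<^bsub>SC\<^esub> s l = s' l \<cdot>\<^bsub>SC\<^esub> f (sr l))"
    using P P' by (simp add: CC_simps(2) e)
  also have "\<dots> \<longleftrightarrow> f \<in> extensional S0 \<and> (\<forall>i\<in>S0. f i \<in> hom SC (R i) (R' i)) \<and>
     (\<forall>a\<in>Arr FG. f (Cod FG a) \<cdot>\<^bsub>SC\<^esub> FA (act_of (R, s)) a = FA (act_of (R', s')) a \<cdot>\<^bsub>SC\<^esub> f (Dom FG a))"
    using natural_iff[OF D D', of f] by blast
  also have "\<dots> \<longleftrightarrow> (act_of (R, s), f, act_of (R', s')) \<in> Arr FC"
    using act_of_functor[OF D] act_of_functor[OF D'] by (simp add: functor_cat_simps(2) FG_simps(1) act_of_FO)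
  finally show ?thesis by (simp add: e)
qed

lemma covering_objects_act:
  assumes "P \<in> CO"
  shows "act_of (snd P) \<in> functors FG SC" "FO (act_of (snd P)) = fst (snd P)"
  using assms act_of_functor act_of_FO by (cases P; cases "snd P"; simp add: covering_objects_iff)+

lemma covering_objects_inj:
  assumes "P \<in> CO" "P' \<in> CO" "act_of (snd P) = act_of (snd P')"
  shows "P = P'"
proof -
  have "datum (snd P)" "datum (snd P')" "fst P = the_covering_projection el E gs F (snd P)"
    "fst P' = the_covering_projection el E gs F (snd P')"
    using assms(1,2) by (cases P; cases P'; simp add: covering_objects_iff)+
  then show ?thesis using act_of_inj[OF _ _ assms(3)] by (metis prod.collapse)
qed

lemma comparison_simps:
  "FO comparison P = act_of (snd P)"
  "FA comparison (P, f, P') = (act_of (snd P), f, act_of (snd P'))"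
  by (simp_all add: comparison_def)

lemma CC_arrE:
  assumes "a \<in> Arr CC"
  obtains P f P' where "a = (P, f, P')" "P \<in> CO" "P' \<in> CO"
  using assms by (cases a) (auto simp: CC_simps(2))

lemma comparison_Id: "P \<in> CO \<Longrightarrow> FA comparison (Id CC P) = Id FC (FO comparison P)"
  using covering_objects_act(2) by (simp add: comparison_simps CC_simps(5) functor_cat_simps(5) FG_simps(1))

lemma comparison_comp: "FA comparison ((P', g, P'') \<cdot>\<^bsub>CC\<^esub> (P, f, P')) =
    FA comparison (P', g, P'') \<cdot>\<^bsub>FC\<^esub> FA comparison (P, f, P')"
  by (simp add: comparison_simps CC_simps(6) functor_cat_simps(6) FG_simps(1))

lemma category_FC: "category FC"
  by (rule category_functor_cat[OF category_FG category_set_cat])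

text \<open>The comparison is injective on arrows, so the category of covering projections inherits its laws from
  the functor category.\<close>

lemma comparison_inj_arr:
  assumes "a \<in> Arr CC" "b \<in> Arr CC" "FA comparison a = FA comparison b"
  shows "a = b"
proof -
  obtain P f P' where a: "a = (P, f, P')" "P \<in> CO" "P' \<in> CO" by (rule CC_arrE[OF assms(1)])
  obtain Q g Q' where b: "b = (Q, g, Q')" "Q \<in> CO" "Q' \<in> CO" by (rule CC_arrE[OF assms(2)])
  show ?thesis
    using assms(3) covering_objects_inj[OF a(2) b(2)] covering_objects_inj[OF a(3) b(3)]
    by (simp add: a(1) b(1) comparison_simps)
qed

lemma comparison_hom:
  assumes "a \<in> Arr CC"
  shows "FA comparison a \<in> hom FC (FO comparison (Dom CC a)) (FO comparison (Cod CC a))"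
proof -
  obtain P f P' where a: "a = (P, f, P')" "P \<in> CO" "P' \<in> CO" by (rule CC_arrE[OF assms])
  then have "FA comparison a \<in> Arr FC" using assms comparison_arr by (simp add: comparison_simps)
  then show ?thesis by (simp add: a(1) hom_def comparison_simps functor_cat_simps(3,4) CC_simps(3,4))
qed

lemma CC_Id:
  assumes P: "P \<in> CO"
  shows "Id CC P \<in> hom CC P P"
proof -
  have "FA comparison (Id CC P) \<in> Arr FC"
    using comparison_Id[OF P] cat_id[OF category_FC, of "FO comparison P"] covering_objects_act(1)[OF P]
    by (simp add: hom_def functor_cat_simps(1) comparison_simps)
  then have "Id CC P \<in> Arr CC"
    using comparison_arr[OF P P] by (simp add: CC_simps(5) comparison_simps)
  then show ?thesis by (simp add: hom_def CC_simps(3,4,5))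
qed

lemma CC_comp:
  assumes f: "f \<in> Arr CC" and g: "g \<in> Arr CC" and e: "Dom CC g = Cod CC f"
  shows "g \<cdot>\<^bsub>CC\<^esub> f \<in> hom CC (Dom CC f) (Cod CC g)" "FA comparison (g \<cdot>\<^bsub>CC\<^esub> f) = FA comparison g \<cdot>\<^bsub>FC\<^esub> FA comparison f"
proof -
  obtain P t P' where f': "f = (P, t, P')" "P \<in> CO" "P' \<in> CO" by (rule CC_arrE[OF f])
  obtain Q u P'' where g': "g = (Q, u, P'')" "Q \<in> CO" "P'' \<in> CO" by (rule CC_arrE[OF g])
  have Q: "Q = P'" using e by (simp add: f' g' CC_simps(3,4))
  show c: "FA comparison (g \<cdot>\<^bsub>CC\<^esub> f) = FA comparison g \<cdot>\<^bsub>FC\<^esub> FA comparison f"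
    unfolding f'(1) g'(1) Q by (rule comparison_comp)
  have "FA comparison g \<cdot>\<^bsub>FC\<^esub> FA comparison f \<in> hom FC (FO comparison (Dom CC f)) (FO comparison (Cod CC g))"
    by (rule cat_comp[OF category_FC comparison_hom[OF f]]) (use comparison_hom[OF g] e in simp)
  then have "FA comparison (g \<cdot>\<^bsub>CC\<^esub> f) \<in> Arr FC" unfolding c by (simp add: hom_def)
  then have "g \<cdot>\<^bsub>CC\<^esub> f \<in> Arr CC"
    using comparison_arr[OF f'(2) g'(3)] by (simp add: f'(1) g'(1) CC_simps(6) comparison_simps)
  then show "g \<cdot>\<^bsub>CC\<^esub> f \<in> hom CC (Dom CC f) (Cod CC g)"
    by (simp add: hom_def f'(1) g'(1) CC_simps(3,4,6))
qed

lemma category_CC: "category CC"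
proof (rule categoryI)
  fix f assume f: "f \<in> Arr CC"
  obtain P t P' where f': "f = (P, t, P')" "P \<in> CO" "P' \<in> CO" by (rule CC_arrE[OF f])
  show "Dom CC f \<in> Obj CC \<and> Cod CC f \<in> Obj CC" using f' by (simp add: CC_simps(1,3,4))
  have d: "Dom CC f = P" "Cod CC f = P'" by (simp_all add: f' CC_simps(3,4))
  note i = CC_Id[OF f'(2)] and j = CC_Id[OF f'(3)]
  note h = comparison_hom[OF f, unfolded d]
  note c1 = CC_comp[OF homD(1)[OF i] f] and c2 = CC_comp[OF f homD(1)[OF j]]
  have e1: "Dom CC f = Cod CC (Id CC P)" "Dom CC (Id CC P') = Cod CC f" using i j d by (simp_all add: hom_def)
  show "f \<cdot>\<^bsub>CC\<^esub> Id CC (Dom CC f) = f"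
    unfolding d by (rule comparison_inj_arr[OF homD(1)[OF c1(1)[OF e1(1)]] f])
      (use c1(2)[OF e1(1)] comparison_Id[OF f'(2)] cat_unit(1)[OF category_FC h] in simp)
  show "Id CC (Cod CC f) \<cdot>\<^bsub>CC\<^esub> f = f"
    unfolding d by (rule comparison_inj_arr[OF homD(1)[OF c2(1)[OF e1(2)]] f])
      (use c2(2)[OF e1(2)] comparison_Id[OF f'(3)] cat_unit(2)[OF category_FC h] in simp)
next
  show "Id CC P \<in> hom CC P P" if "P \<in> Obj CC" for P using CC_Id that by (simp add: CC_simps(1))
next
  show "g \<cdot>\<^bsub>CC\<^esub> f \<in> hom CC (Dom CC f) (Cod CC g)" if "f \<in> Arr CC" "g \<in> Arr CC" "Dom CC g = Cod CC f" for f g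
    by (rule CC_comp(1)[OF that])
next
  fix f g h assume f: "f \<in> Arr CC" and g: "g \<in> Arr CC" and h: "h \<in> Arr CC"
    and e: "Dom CC g = Cod CC f" "Dom CC h = Cod CC g"
  note gf = CC_comp[OF f g e(1)] and hg = CC_comp[OF g h e(2)]
  have e': "Dom CC h = Cod CC (g \<cdot>\<^bsub>CC\<^esub> f)" "Dom CC (h \<cdot>\<^bsub>CC\<^esub> g) = Cod CC f"
    using gf(1) hg(1) e by (simp_all add: hom_def)
  note l = CC_comp[OF homD(1)[OF gf(1)] h e'(1)] and r = CC_comp[OF f homD(1)[OF hg(1)] e'(2)]
  show "h \<cdot>\<^bsub>CC\<^esub> (g \<cdot>\<^bsub>CC\<^esub> f) = (h \<cdot>\<^bsub>CC\<^esub> g) \<cdot>\<^bsub>CC\<^esub> f"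
    by (rule comparison_inj_arr[OF homD(1)[OF l(1)] homD(1)[OF r(1)]])
      (use l(2) r(2) gf(2) hg(2) cat_assoc[OF category_FC comparison_hom[OF f] comparison_hom[OF g, unfolded e(1)]
        comparison_hom[OF h, unfolded e(2)]] in simp)
qed

theorem comparison_isomorphism:
  assumes G: "condition_G el E gs F"
  shows "isomorphic_categories CC FC"
  unfolding isomorphic_categories_def
proof (intro exI[of _ comparison] conjI)
  have surj: "\<exists>P\<in>CO. act_of (snd P) = T" if T: "T \<in> functors FG SC" for T
  proof -
    obtain R s where "datum (R, s)" "act_of (R, s) = T" by (rule act_of_surj[OF G T])
    then show ?thesis
      by (intro bexI[of _ "(the_covering_projection el E gs F (R, s), (R, s))"]) (simp_all add: covering_objects_iff)
  qed
  show "is_functor CC FC comparison"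
    unfolding is_functor_def
  proof (intro conjI ballI impI category_CC category_FC)
    show "FO comparison P \<in> Obj FC" if "P \<in> Obj CC" for P
      using that covering_objects_act(1) by (simp add: CC_simps(1) functor_cat_simps(1) comparison_simps)
    show "FA comparison (Id CC P) = Id FC (FO comparison P)" if "P \<in> Obj CC" for P
      using that comparison_Id by (simp add: CC_simps(1))
    show "FA comparison f \<in> hom FC (FO comparison (Dom CC f)) (FO comparison (Cod CC f))" if "f \<in> Arr CC" for f
      by (rule comparison_hom[OF that])
    show "FA comparison (g \<cdot>\<^bsub>CC\<^esub> f) = FA comparison g \<cdot>\<^bsub>FC\<^esub> FA comparison f"
      if "f \<in> Arr CC" "g \<in> Arr CC" "Dom CC g = Cod CC f" for f g
      by (rule CC_comp(2)[OF that])
  qed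
  show "bij_betw (FO comparison) (Obj CC) (Obj FC)"
    unfolding bij_betw_def
  proof (intro conjI subset_antisym)
    show "inj_on (FO comparison) (Obj CC)"
      using covering_objects_inj by (auto simp: inj_on_def CC_simps(1) comparison_simps)
    show "FO comparison ` Obj CC \<subseteq> Obj FC"
      using covering_objects_act(1) by (auto simp: CC_simps(1) functor_cat_simps(1) comparison_simps)
    show "Obj FC \<subseteq> FO comparison ` Obj CC"
      using surj by (auto simp: CC_simps(1) functor_cat_simps(1) comparison_simps image_iff)
  qed
  show "bij_betw (FA comparison) (Arr CC) (Arr FC)"
    unfolding bij_betw_def
  proof (intro conjI subset_antisym)
    show "inj_on (FA comparison) (Arr CC)" using comparison_inj_arr by (auto simp: inj_on_def)
    show "FA comparison ` Arr CC \<subseteq> Arr FC" using comparison_hom by (auto simp: hom_def)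
    show "Arr FC \<subseteq> FA comparison ` Arr CC"
    proof
      fix a assume a: "a \<in> Arr FC"
      obtain T f T' where a': "a = (T, f, T')" by (cases a)
      then have "T \<in> functors FG SC" "T' \<in> functors FG SC" using a by (simp_all add: functor_cat_simps(2))
      then obtain P P' where P: "P \<in> CO" "P' \<in> CO" "act_of (snd P) = T" "act_of (snd P') = T'" using surj by metis
      then have "(P, f, P') \<in> Arr CC" using comparison_arr[OF P(1,2)] a a' by simp
      moreover have "FA comparison (P, f, P') = a" using P a' by (simp add: comparison_simps)
      ultimately show "a \<in> FA comparison ` Arr CC" by blast
    qed
  qed
qed

end

theorem theorem7p8:
  fixes el :: "'v \<Rightarrow> 'v set"
    and E :: "('o, 'a) cat"
    and gs :: "('v, 'v sarr, 'o, 'a) fctr"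
    and gl :: "('o, 'a, 'v, 'v sarr) fctr"
    and I :: 'v and U :: 'o and \<zeta> :: 'a
    and F :: "('v, 'o, 'a) sd_family"
  assumes "universe el"
    and "grothendieck_topos el E"
    and "geometric_morphism E (set_cat el) gs gl"
    and "cover el E gs I U \<zeta>"
    and "hypercover_refinement el E gs F I U \<zeta>"
    and "self_dual el E gs F"
    and "condition_G el E gs F"
  shows "isomorphic_categories (covering_cat el E gs F)
           (functor_cat (fundamental_groupoid el E gs F) (set_cat el))"
proof -
  obtain C J sec res act where "sheaf_topos el C J E sec res act"
    by (rule sheaf_topos_of_grothendieck_topos[OF assms(1,2)])
  then interpret sheaf_topos el C J E sec res act .
  interpret sd_hypercover el C J E sec res act gs gl F I U \<zeta>
    by unfold_locales (rule assms(3,5,6))+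
  show ?thesis by (rule comparison_isomorphism[OF assms(7)])
qed

end
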